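(* Let $t>0$ and $x\in\mathbb{R}$. Let $\beta^x=\{\beta^x_s\}_{0\le s\le t}$ be a one-dimensional Brownian bridge from $0$ to $x$ over $[0,t]$, and let $M^x=\{M^x_s\}_{0\le s\le t}$ be a process identical in law with $$\sqrt{(\beta^x_s)^2+(B^2_s)^2+(B^3_s)^2},\quad 0\le s\le t,$$ where $(B^2,B^3)$ is a standard two-dimensional Brownian motion started at the origin, independent of $\beta^x$. Then $$\bigl\{\bigl(\mathcal{P}(\beta^x)(s),\ \beta^x_s\bigr)\bigr\}_{0\le s\le t}\ \overset{(d)}{=}\ \bigl\{\bigl(M^x_s,\ \mathcal{L}_x(M^x)(s)\bigr)\bigr\}_{0\le s\le t}.$$
   Context: For $\phi\in C([0,t];\mathbb{R})$, $y\in\mathbb{R}$ and $0\le s\le t$, define $$\mathcal{P}(\phi)(s)=2\max_{0\le u\le s}\phi_u-\phi_s,\qquad \mathcal{L}_y(\phi)(s)=-\phi_s+\min\Bigl\{2\min_{s\le u\le t}\phi_u,\ \phi_t+y\Bigr\}.$$ The Brownian bridge from $0$ to $x$ over $[0,t]$ is the continuous Gaussian process with mean $\frac{x}{t}s$ and covariance function $\frac{s_1(t-s_2)}{t}$ for $0\le s_1\le s_2\le t$. The symbol $\overset{(d)}{=}$ means equality of laws as continuous processes, i.e. as random elements of $C([0,t];\mathbb{R}^2)$. *)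

theory Defs
  imports "HOL-Probability.Probability"
begin

section \<open>The path space \<open>C([0,t]; E)\<close> and laws of continuous processes\<close>

text \<open>
  The space of continuous functions on \<open>[0,t]\<close> with the uniform metric, equipped with its
  Borel \<open>\<sigma>\<close>-algebra.  Its points are functions on \<open>\<real>\<close> that take the
  value \<^const>\<open>undefined\<close> off \<open>[0,t]\<close>.
\<close>

definition path_space :: "real \<Rightarrow> (real \<Rightarrow> 'e::metric_space) measure" where
  "path_space t =
     (let C = cfunspace (top_of_set {0..t}) euclidean_metric
      in sigma (mspace C) {U. openin (mtopology_of C) U})"

definition sample_path :: "real \<Rightarrow> (real \<Rightarrow> 'a \<Rightarrow> 'e) \<Rightarrow> 'a \<Rightarrow> (real \<Rightarrow> 'e)" where
  "sample_path t X \<omega> = (\<lambda>s\<in>{0..t}. X s \<omega>)"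

text \<open>
  The measurability conditions say that both processes are random elements of the path space
  (in particular all their paths are continuous on \<open>[0,t]\<close>); without them
  \<^const>\<open>distr\<close> is not a meaningful law.
\<close>

definition equal_in_law ::
  "real \<Rightarrow> 'a measure \<Rightarrow> (real \<Rightarrow> 'a \<Rightarrow> 'e::metric_space) \<Rightarrow>
   'b measure \<Rightarrow> (real \<Rightarrow> 'b \<Rightarrow> 'e) \<Rightarrow> bool" where
  "equal_in_law t P X Q Y \<longleftrightarrow>
     sample_path t X \<in> measurable P (path_space t) \<and>
     sample_path t Y \<in> measurable Q (path_space t) \<and>
     distr P (path_space t) (sample_path t X) = distr Q (path_space t) (sample_path t Y)"

definition continuous_process ::
  "real \<Rightarrow> 'a measure \<Rightarrow> (real \<Rightarrow> 'a \<Rightarrow> 'e::metric_space) \<Rightarrow> bool" where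
  "continuous_process t P X \<longleftrightarrow>
     (\<forall>s\<in>{0..t}. X s \<in> borel_measurable P) \<and>
     (\<forall>\<omega>\<in>space P. continuous_on {0..t} (\<lambda>s. X s \<omega>))"

text \<open>
  Independence of the generated \<open>\<sigma>\<close>-algebras, allowing different state spaces
  (the library's \<open>indep_var\<close> requires both variables to have the same type).
\<close>

definition indep_processes ::
  "real \<Rightarrow> 'a measure \<Rightarrow> (real \<Rightarrow> 'a \<Rightarrow> 'e::metric_space) \<Rightarrow>
   (real \<Rightarrow> 'a \<Rightarrow> 'f::metric_space) \<Rightarrow> bool" where
  "indep_processes t P X Y \<longleftrightarrow>
     sample_path t X \<in> measurable P (path_space t) \<and>
     sample_path t Y \<in> measurable P (path_space t) \<and>
     prob_space.indep_set P
       (sets (vimage_algebra (space P) (sample_path t X) (path_space t)))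
       (sets (vimage_algebra (space P) (sample_path t Y) (path_space t)))"

section \<open>Brownian bridge and Brownian motion\<close>

text \<open>Point masses count as (degenerate) Gaussian laws.\<close>

definition gaussian_rv :: "'a measure \<Rightarrow> ('a \<Rightarrow> real) \<Rightarrow> bool" where
  "gaussian_rv P Z \<longleftrightarrow>
     Z \<in> borel_measurable P \<and>
     ((\<exists>m. distr P borel Z = return borel m) \<or>
      (\<exists>m \<sigma>. \<sigma> > 0 \<and> distributed P lborel Z (\<lambda>z. ennreal (normal_density m \<sigma> z))))"

definition gaussian_process :: "real \<Rightarrow> 'a measure \<Rightarrow> (real \<Rightarrow> 'a \<Rightarrow> real) \<Rightarrow> bool" where
  "gaussian_process t P X \<longleftrightarrow>
     (\<forall>F c. finite F \<and> F \<subseteq> {0..t} \<longrightarrow> gaussian_rv P (\<lambda>\<omega>. \<Sum>s\<in>F. c s * X s \<omega>))"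

definition brownian_bridge ::
  "real \<Rightarrow> real \<Rightarrow> 'a measure \<Rightarrow> (real \<Rightarrow> 'a \<Rightarrow> real) \<Rightarrow> bool" where
  "brownian_bridge t x P X \<longleftrightarrow>
     continuous_process t P X \<and>
     gaussian_process t P X \<and>
     (\<forall>s\<in>{0..t}. integral\<^sup>L P (X s) = x / t * s) \<and>
     (\<forall>s1 s2. 0 \<le> s1 \<and> s1 \<le> s2 \<and> s2 \<le> t \<longrightarrow>
        integral\<^sup>L P (\<lambda>\<omega>. (X s1 \<omega> - integral\<^sup>L P (X s1)) * (X s2 \<omega> - integral\<^sup>L P (X s2)))
          = s1 * (t - s2) / t)"

text \<open>
  Standard Brownian motion from the origin up to time \<open>t\<close>, in a Euclidean space of
  dimension \<open>d\<close>: an increment over a time step \<open>h\<close> is centred Gaussian with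
  covariance \<open>h\<close> times the identity, i.e. its density is the product over the
  coordinates of one-dimensional normal densities.
\<close>

definition standard_brownian_motion ::
  "real \<Rightarrow> 'a measure \<Rightarrow> (real \<Rightarrow> 'a \<Rightarrow> 'e::euclidean_space) \<Rightarrow> bool" where
  "standard_brownian_motion t P B \<longleftrightarrow>
     continuous_process t P B \<and>
     (AE \<omega> in P. B 0 \<omega> = 0) \<and>
     (\<forall>(n::nat) \<tau>. 0 \<le> \<tau> 0 \<and> (\<forall>i<n. \<tau> i < \<tau> (Suc i)) \<and> \<tau> n \<le> t \<longrightarrow>
        prob_space.indep_vars P (\<lambda>_. borel) (\<lambda>i \<omega>. B (\<tau> (Suc i)) \<omega> - B (\<tau> i) \<omega>) {..<n}) \<and>
     (\<forall>r s. 0 \<le> r \<and> r < s \<and> s \<le> t \<longrightarrow>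
        distributed P lborel (\<lambda>\<omega>. B s \<omega> - B r \<omega>)
          (\<lambda>z. ennreal (\<Prod>b\<in>Basis. normal_density 0 (sqrt (s - r)) (z \<bullet> b))))"

section \<open>The path transformations\<close>

text \<open>For a continuous path the suprema and infima below are attained.\<close>

definition pitman_P :: "(real \<Rightarrow> real) \<Rightarrow> real \<Rightarrow> real" where
  "pitman_P \<phi> s = 2 * (SUP u\<in>{0..s}. \<phi> u) - \<phi> s"

definition pitman_L :: "real \<Rightarrow> real \<Rightarrow> (real \<Rightarrow> real) \<Rightarrow> real \<Rightarrow> real" where
  "pitman_L t y \<phi> s = - \<phi> s + min (2 * (INF u\<in>{s..t}. \<phi> u)) (\<phi> t + y)"

end

theory Submission
  imports Defs
begin

text \<open>
  Let \<open>\<P>\<close> and \<open>\<L>\<close> stand for the two path transformations.  A continuous path that ends in \<open>x\<close>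
  can be read off its transform: \<open>\<L>\<^sub>x (\<P> \<beta>) = \<beta>\<close> (\<open>pitman_L_pitman_P\<close>).  So the pair
  \<open>(\<P> \<beta>, \<beta>)\<close> is almost surely the image of \<open>\<P> \<beta>\<close> under the measurable map
  \<open>f \<mapsto> (f, \<L>\<^sub>x f)\<close>, and \<open>(M, \<L>\<^sub>x M)\<close> is the image of \<open>M\<close> under the same map
  (\<open>equal_in_law_recovered\<close>).  It remains to show that \<open>\<P> \<beta>\<close> has the law of
  \<open>\<bar>(\<beta>, B2, B3)\<bar>\<close>, a version of Pitman's theorem for the bridge.  A law on the path space is
  determined by the finite-dimensional distributions (\<open>path_space_eqI\<close>), so this concerns
  finitely many times only.

  The bridge has no independent increments, and therefore its endpoint is made random: if \<open>z\<close> is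
  a centred normal variable with variance \<open>t\<close> and independent of everything else, then
  \<open>W s = \<beta> s + (z - x) * s / t\<close> is a Brownian motion with \<open>W t = z\<close>, because the added drift
  contributes to the characteristic function of the increments the very factor that distinguishes
  the bridge from Brownian motion (\<open>shifted_bridge_brownian_motion\<close>).  One proves that
  \<open>(\<P> W, W t)\<close> and \<open>(\<bar>(W, B2, B3)\<bar>, W t)\<close> agree in law along any finite partition, where the
  first components are taken at the partition times (\<open>pitman_theorem_extended\<close>), and then
  disintegrates with respect to \<open>z\<close>.  This gives the identity for almost every value of \<open>z\<close>; both
  sides depend continuously on \<open>z\<close>, so it holds for \<open>z = x\<close>, where \<open>W\<close> is the bridge
  (\<open>pitman_theorem_bridge\<close>).

  For the Brownian identity, compare two Markov chains.  Over an interval of length \<open>v\<close> let \<open>D\<close> be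
  the increment of \<open>W\<close> and \<open>N\<close> the maximum of the increments from the left end.  By the
  reflection principle \<open>(2 * N - D, D)\<close> has the density \<open>z / v * p\<^sub>v z\<close> on \<open>\<bar>d\<bar> < z\<close>, with \<open>p\<^sub>v\<close>
  the normal density (\<open>increment_max_law\<close>), and these pairs drive the chain formed by
  \<open>(\<P> W, W)\<close> at the partition times.  If the position is spread uniformly over \<open>(-r, r)\<close>, then
  one step of this chain leads to a mixture of uniform distributions over \<open>(-\<rho>, \<rho>)\<close>, with the
  kernel \<open>p\<^sub>v (\<rho> - r) - p\<^sub>v (\<rho> + r)\<close> (\<open>pitman_one_step\<close>).  The other chain is Brownian motion in
  space.  By rotation invariance its position stays uniform on spheres, the radius is
  governed by the same kernel (\<open>brownian_chain_expectation\<close>), and by Archimedes the first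
  coordinate of a uniform point on the sphere of radius \<open>\<rho>\<close> is uniform on \<open>(-\<rho>, \<rho>)\<close>.  So both
  chains give the same joint law to the radii and the final coordinate
  (\<open>pitman_brownian_chain_expectation\<close>).
\<close>

section \<open>Paths in the uniform topology\<close>

lemma rational_dense_le:
  fixes h :: "real \<Rightarrow> real"
  assumes "0 < t" "continuous_on {0..t} h" "\<And>s. s \<in> \<rat> \<inter> {0..t} \<Longrightarrow> h s \<le> c" "s \<in> {0..t}"
  shows "h s \<le> c"
proof -
  have *: "closure (\<rat> \<inter> {0..t}) = {0..t}"
  proof
    show "closure (\<rat> \<inter> {0..t}) \<subseteq> {0..t}"
      by (meson Int_lower2 closed_atLeastAtMost closure_minimal)
    have "{0<..<t} \<subseteq> closure (\<rat> \<inter> {0<..<t})"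
    proof
      fix s assume s: "s \<in> {0<..<t}"
      show "s \<in> closure (\<rat> \<inter> {0<..<t})"
        unfolding closure_approachable
      proof (intro allI impI)
        fix e :: real assume "e > 0"
        then obtain r where "r \<in> \<rat>" "s < r" "r < min (s + e) t"
          using Rats_dense_in_real[of s "min (s + e) t"] s by auto
        then show "\<exists>y\<in>\<rat> \<inter> {0<..<t}. dist y s < e"
          using s by (intro bexI[of _ r]) (auto simp: dist_real_def)
      qed
    qed
    also have "\<dots> \<subseteq> closure (\<rat> \<inter> {0..t})"
      by (intro closure_mono) auto
    finally have "closure {0<..<t} \<subseteq> closure (\<rat> \<inter> {0..t})"
      by (simp add: closure_minimal)
    then show "{0..t} \<subseteq> closure (\<rat> \<inter> {0..t})" using assms(1) by simp
  qed
  show ?thesis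
    by (rule continuous_le_on_closure[where S = "\<rat> \<inter> {0..t}"]) (use assms * in auto)
qed

lemma mspace_path_metric:
  fixes t :: real
  shows "mspace (cfunspace (top_of_set {0..t}) (euclidean_metric :: 'e::metric_space metric))
         = {f \<in> extensional {0..t}. continuous_on {0..t} f}"
  by (subst compactin_mspace_cfunspace) (auto simp: compactin_subtopology)

lemma space_path_space:
  "space (path_space t) = {f \<in> extensional {0..t}. continuous_on {0..t} f}"
  by (simp add: path_space_def Let_def space_measure_of_conv mspace_path_metric del: mspace_cfunspace)

lemma open_sets_path_space:
  fixes t :: real
  defines "C \<equiv> cfunspace (top_of_set {0..t}) (euclidean_metric :: 'e::metric_space metric)"
  shows "sets (path_space t) = sigma_sets (mspace C) {U. openin (mtopology_of C) U}"
proof -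
  have "{U. openin (mtopology_of C) U} \<subseteq> Pow (mspace C)"
    using openin_subset[of "mtopology_of C"] by auto
  then show ?thesis
    unfolding path_space_def Let_def C_def[symmetric] by (rule sets_measure_of)
qed

lemma open_path_setI:
  fixes t :: real and U :: "(real \<Rightarrow> 'e::metric_space) set"
  defines "C \<equiv> cfunspace (top_of_set {0..t}) (euclidean_metric :: 'e metric)"
  assumes "0 < t" "U \<subseteq> space (path_space t)"
    and "\<And>f. f \<in> U \<Longrightarrow> \<exists>r>0. \<forall>g\<in>space (path_space t). (\<forall>s\<in>{0..t}. dist (f s) (g s) < r) \<longrightarrow> g \<in> U"
  shows "openin (mtopology_of C) U"
proof -
  have sp: "space (path_space t :: (real \<Rightarrow> 'e) measure) = mspace C"
    by (simp add: space_path_space C_def mspace_path_metric del: mspace_cfunspace)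
  have "\<exists>r>0. Metric_space.mball (mspace C) (mdist C) f r \<subseteq> U" if f: "f \<in> U" for f
  proof -
    obtain r where r: "r > 0"
      "\<And>g. g\<in>space (path_space t) \<Longrightarrow> (\<forall>s\<in>{0..t}. dist (f s) (g s) < r) \<Longrightarrow> g \<in> U"
      using assms(4)[OF f] by metis
    have "Metric_space.mball (mspace C) (mdist C) f r \<subseteq> U"
    proof
      fix g assume "g \<in> Metric_space.mball (mspace C) (mdist C) f r"
      then have g: "f \<in> mspace C" "g \<in> mspace C" "mdist C f g < r"
        using Metric_space.in_mball[OF Metric_space_mspace_mdist] by metis+
      have "\<forall>s\<in>{0..t}. dist (f s) (g s) < r"
      proof
        fix s assume "s \<in> {0..t}"
        then have "mdist euclidean_metric (f s) (g s) < r"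
          using g unfolding C_def
          by (intro cfunspace_mdist_lt[where X="top_of_set {0..t}" and f=f and g=g and a=r])
             (auto simp: compactin_subtopology simp del: mspace_cfunspace)
        then show "dist (f s) (g s) < r" by simp
      qed
      then show "g \<in> U" using r(2)[of g] g sp by auto
    qed
    then show ?thesis using r(1) by blast
  qed
  then show ?thesis
    unfolding mtopology_of_def Metric_space.openin_mtopology[OF Metric_space_mspace_mdist]
    using assms(3) sp by auto
qed

text \<open>
  The tube is closed because weak inequalities, unlike strict ones, can be tested at rational
  times; hence the radius is half that of a ball.
\<close>

lemma open_path_setD:
  fixes t :: real and U :: "(real \<Rightarrow> 'e::metric_space) set"
  defines "C \<equiv> cfunspace (top_of_set {0..t}) (euclidean_metric :: 'e metric)"
  assumes "0 < t" "openin (mtopology_of C) U" "f \<in> U"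
  shows "\<exists>r>0. \<forall>g\<in>space (path_space t). (\<forall>s\<in>{0..t}. dist (f s) (g s) \<le> r) \<longrightarrow> g \<in> U"
proof -
  have sp: "space (path_space t :: (real \<Rightarrow> 'e) measure) = mspace C"
    by (simp add: space_path_space C_def mspace_path_metric del: mspace_cfunspace)
  obtain r where r: "r > 0" "Metric_space.mball (mspace C) (mdist C) f r \<subseteq> U"
    using assms(3,4) unfolding mtopology_of_def Metric_space.openin_mtopology[OF Metric_space_mspace_mdist]
    by blast
  have fC: "f \<in> mspace C"
    using assms(3,4) openin_subset[OF assms(3)] by auto
  have "g \<in> U" if g: "g\<in>space (path_space t)" "\<forall>s\<in>{0..t}. dist (f s) (g s) \<le> r/2" for g
  proof -
    have "mdist C f g \<le> r/2"
      unfolding C_def using r(1) g by (intro mdist_cfunspace_le) auto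
    then have "g \<in> Metric_space.mball (mspace C) (mdist C) f r"
      using fC g(1) sp r(1) Metric_space.in_mball[OF Metric_space_mspace_mdist, of g C f r] by auto
    then show ?thesis using r by blast
  qed
  then show ?thesis using r(1) by (intro exI[of _ "r/2"]) auto
qed

lemma path_evaluation_measurable:
  assumes "0 < t" "s \<in> {0..t}"
  shows "(\<lambda>f. f s :: 'e::metric_space) \<in> borel_measurable (path_space t)"
proof (rule borel_measurableI)
  fix V :: "'e set" assume V: "open V"
  let ?U = "(\<lambda>f. f s) -` V \<inter> space (path_space t)"
  have "openin (mtopology_of (cfunspace (top_of_set {0..t}) euclidean_metric)) ?U"
  proof (rule open_path_setI[OF assms(1)])
    fix f assume f: "f \<in> ?U"
    obtain r where "r > 0" "\<And>y. dist y (f s) < r \<Longrightarrow> y \<in> V"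
      using V f unfolding open_dist by blast
    then show "\<exists>r>0. \<forall>g\<in>space (path_space t). (\<forall>s\<in>{0..t}. dist (f s) (g s) < r) \<longrightarrow> g \<in> ?U"
      using assms(2) by (intro exI[of _ r]) (auto simp: dist_commute)
  qed auto
  then show "?U \<in> sets (path_space t)"
    unfolding open_sets_path_space by (intro sigma_sets.Basic) auto
qed

text \<open>
  Every open set is a countable union of closed tubes around step functions with values in a
  countable dense set, and whether a continuous path lies in a tube is decided at the rational
  times, which makes it an event.  Step functions serve as centres, instead of continuous paths,
  because countably many of them suffice in any second countable state space, with no linear
  structure to interpolate between their values.
\<close>

lemma sample_path_measurable:
  fixes X :: "real \<Rightarrow> 'a \<Rightarrow> 'e::{metric_space, second_countable_topology}"
  assumes t: "0 < t" and X: "continuous_process t P X"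
  shows "sample_path t X \<in> measurable P (path_space t)"
proof -
  have in_sp: "sample_path t X \<omega> \<in> space (path_space t)" if "\<omega> \<in> space P" for \<omega>
  proof -
    have "continuous_on {0..t} (\<lambda>s. X s \<omega>)"
      using X that by (simp add: continuous_process_def)
    then have "continuous_on {0..t} (\<lambda>s\<in>{0..t}. X s \<omega>)"
      by (rule continuous_on_eq) simp
    then show ?thesis by (simp add: space_path_space sample_path_def)
  qed
  obtain D :: "'e set" where D: "countable D" "\<And>V. open V \<Longrightarrow> V \<noteq> {} \<Longrightarrow> \<exists>d\<in>D. d \<in> V"
    using countable_dense_setE by metis
  \<comment> \<open>The step function that takes the value \<open>l ! j\<close> on \<open>[j / n, (j + 1) / n)\<close>.\<close>
  define q where "q n l s = (l :: 'e list) ! nat \<lfloor>s * real n\<rfloor>" for n l s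
  define T where "T = (\<lambda>(n, l, k). {g \<in> space (path_space t).
      \<forall>s\<in>\<rat> \<inter> {0..t}. dist (g s) (q n l s) \<le> 1 / real (Suc k)})"
  define I where "I = (UNIV :: nat set) \<times> lists D \<times> (UNIV :: nat set)"
  have cI: "countable I" unfolding I_def using D(1) by auto
  have T_meas: "sample_path t X -` T i \<inter> space P \<in> sets P" for i
  proof -
    obtain n l k where i: "i = (n, l, k)" by (cases i) auto
    have "sample_path t X -` T i \<inter> space P
      = {\<omega>\<in>space P. \<forall>s\<in>\<rat> \<inter> {0..t}. dist (X s \<omega>) (q n l s) \<le> 1 / real (Suc k)}"
      using in_sp by (auto simp: T_def i sample_path_def)
    also have "\<dots> \<in> sets P"
    proof (rule sets.sets_Collect_countable_All')
      show "countable (\<rat> \<inter> {0..t})" by (simp add: countable_rat countable_Int1)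
      fix s assume "s \<in> \<rat> \<inter> {0..t}"
      then have [measurable]: "X s \<in> borel_measurable P"
        using X by (auto simp: continuous_process_def)
      show "{\<omega> \<in> space P. dist (X s \<omega>) (q n l s) \<le> 1 / real (Suc k)} \<in> sets P"
        by measurable
    qed
    finally show ?thesis .
  qed
  have cover: "U = (\<Union>i\<in>{i\<in>I. T i \<subseteq> U}. T i)"
    if U: "openin (mtopology_of (cfunspace (top_of_set {0..t}) euclidean_metric)) U" for U
  proof (intro equalityI subsetI)
    fix f assume f: "f \<in> U"
    have fsp: "f \<in> space (path_space t)"
      using openin_subset[OF U] f by (auto simp: space_path_space mspace_path_metric simp del: mspace_cfunspace)
    obtain r where r: "r > 0"
      "\<And>g. g \<in> space (path_space t) \<Longrightarrow> (\<forall>s\<in>{0..t}. dist (f s) (g s) \<le> r) \<Longrightarrow> g \<in> U"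
      using open_path_setD[OF t U f] by metis
    obtain k where k: "2 / real (Suc k) < r"
      using reals_Archimedean[of "r/2"] r(1) by (auto simp: field_simps)
    define e where "e = 1 / real (Suc k)"
    have e: "e > 0" "2 * e < r" using k by (auto simp: e_def)
    have "uniformly_continuous_on {0..t} f"
      using fsp by (intro compact_uniformly_continuous) (auto simp: space_path_space)
    then obtain d where d: "d > 0"
      "\<And>x y. x \<in> {0..t} \<Longrightarrow> y \<in> {0..t} \<Longrightarrow> dist y x < d \<Longrightarrow> dist (f y) (f x) < e/2"
      unfolding uniformly_continuous_on_def using e(1) by (metis half_gt_zero)
    obtain n where n: "1 / real (Suc n) < d"
      using reals_Archimedean[OF d(1)] by (auto simp: field_simps)
    have "\<forall>j. \<exists>c\<in>D. dist c (f (min t (real j / real (Suc n)))) < e/2"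
      using D(2)[of "ball (f (min t (real _ / real (Suc n)))) (e/2)"] e(1)
      by (auto simp: dist_commute)
    then obtain c where c: "\<And>j. c j \<in> D" "\<And>j. dist (c j) (f (min t (real j / real (Suc n)))) < e/2"
      by metis
    define N where "N = Suc (nat \<lfloor>t * real (Suc n)\<rfloor>)"
    define l where "l = map c [0..<N]"
    have iI: "(Suc n, l, k) \<in> I" unfolding I_def l_def using c(1) by auto
    have near: "dist (f s) (q (Suc n) l s) \<le> e" if s: "s \<in> {0..t}" for s
    proof -
      define j where "j = nat \<lfloor>s * real (Suc n)\<rfloor>"
      have j: "real j \<le> s * real (Suc n)" "s * real (Suc n) < real j + 1"
      proof -
        have "0 \<le> s * real (Suc n)" using s by simp
        then have "real j = of_int \<lfloor>s * real (Suc n)\<rfloor>" unfolding j_def by simp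
        then show "real j \<le> s * real (Suc n)" "s * real (Suc n) < real j + 1" by linarith+
      qed
      have jN: "j < N" unfolding N_def j_def less_Suc_eq_le using s by (intro nat_mono floor_mono mult_right_mono) auto
      have le: "real j / real (Suc n) \<le> s" using j(1) by (simp add: pos_divide_le_eq)
      have "s < (real j + 1) / real (Suc n)" using j(2) by (simp add: pos_less_divide_eq)
      then have "dist (real j / real (Suc n)) s < d"
        using le n by (simp add: dist_real_def add_divide_distrib)
      then have "dist (f (real j / real (Suc n))) (f s) < e/2"
        using le s by (intro d(2)) auto
      moreover have "min t (real j / real (Suc n)) = real j / real (Suc n)" using le s by auto
      then have "dist (c j) (f (real j / real (Suc n))) < e/2" using c(2)[of j] by auto
      ultimately have "dist (f s) (c j) < e/2 + e/2"
        by (metis dist_commute dist_triangle_less_add)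
      then show ?thesis using jN unfolding q_def j_def[symmetric] l_def by simp
    qed
    have "T (Suc n, l, k) \<subseteq> U"
    proof
      fix g assume "g \<in> T (Suc n, l, k)"
      then have g: "g \<in> space (path_space t)" "\<And>s. s\<in>\<rat> \<inter> {0..t} \<Longrightarrow> dist (g s) (q (Suc n) l s) \<le> e"
        by (auto simp: T_def e_def)
      have "dist (f s) (g s) \<le> 2 * e" if "s \<in> {0..t}" for s
      proof (rule rational_dense_le[OF t _ _ that])
        show "continuous_on {0..t} (\<lambda>s. dist (f s) (g s))"
          using g(1) fsp by (intro continuous_on_dist) (auto simp: space_path_space)
        fix s assume s: "s \<in> \<rat> \<inter> {0..t}"
        have "dist (f s) (g s) \<le> dist (f s) (q (Suc n) l s) + dist (g s) (q (Suc n) l s)"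
          by (rule dist_triangle2)
        then show "dist (f s) (g s) \<le> 2 * e" using near[of s] g(2)[OF s] s by auto
      qed
      then show "g \<in> U" using e(2) r(2)[OF g(1)] by force
    qed
    moreover have "f \<in> T (Suc n, l, k)" using near fsp by (auto simp: T_def e_def)
    ultimately show "f \<in> (\<Union>i\<in>{i\<in>I. T i \<subseteq> U}. T i)" using iI by blast
  qed auto
  show ?thesis
    unfolding measurable_def
  proof (safe intro!: in_sp)
    have "sample_path t X \<in> measurable P (measure_of (mspace (cfunspace (top_of_set {0..t}) euclidean_metric))
      {U. openin (mtopology_of (cfunspace (top_of_set {0..t}) euclidean_metric)) U} (\<lambda>_. 0))"
    proof (rule measurable_measure_of)
      show "{U. openin (mtopology_of (cfunspace (top_of_set {0..t}) euclidean_metric)) U}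
        \<subseteq> Pow (mspace (cfunspace (top_of_set {0..t}) (euclidean_metric :: 'e metric)))"
        using openin_subset by fastforce
      show "sample_path t X \<in> space P \<rightarrow> mspace (cfunspace (top_of_set {0..t}) euclidean_metric)"
        using in_sp by (auto simp: space_path_space mspace_path_metric simp del: mspace_cfunspace)
      fix U assume "U \<in> {U. openin (mtopology_of (cfunspace (top_of_set {0..t}) (euclidean_metric :: 'e metric))) U}"
      then have "U = (\<Union>i\<in>{i\<in>I. T i \<subseteq> U}. T i)" using cover by blast
      then have "sample_path t X -` U \<inter> space P
          = (\<Union>i\<in>{i\<in>I. T i \<subseteq> U}. sample_path t X -` T i \<inter> space P)" by blast
      also have "\<dots> \<in> sets P"
        using cI T_meas by (intro sets.countable_UN'') (auto intro: countable_subset)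
      finally show "sample_path t X -` U \<inter> space P \<in> sets P" .
    qed
    then have "sample_path t X \<in> measurable P (path_space t)"
      by (simp add: path_space_def Let_def)
    then show "sample_path t X -` A \<inter> space P \<in> sets P" if "A \<in> sets (path_space t)" for A
      using that by (rule measurable_sets)
  qed
qed

text \<open>
  The cylinder events are stable under intersection.  They generate the Borel sets: the coordinate
  process is continuous and measurable for the \<open>\<sigma>\<close>-algebra of the cylinders, so
  \<open>sample_path_measurable\<close> makes the identity measurable from that \<open>\<sigma>\<close>-algebra to the Borel sets.
\<close>

lemma path_space_eqI:
  fixes M N :: "(real \<Rightarrow> real) measure"
  assumes t: "0 < t" and M: "prob_space M" "sets M = sets (path_space t)"
    and N: "prob_space N" "sets N = sets (path_space t)"
    and eq: "\<And>F a. finite F \<Longrightarrow> F \<subseteq> {0..t} \<Longrightarrow>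
      emeasure M {f \<in> space (path_space t). \<forall>s\<in>F. f s \<le> a s}
      = emeasure N {f \<in> space (path_space t). \<forall>s\<in>F. f s \<le> a s}"
  shows "M = N"
proof -
  define \<Omega> where "\<Omega> = space (path_space t :: (real \<Rightarrow> real) measure)"
  define E where "E = {{f \<in> \<Omega>. \<forall>s\<in>F. f s \<le> a s} | F a. finite F \<and> F \<subseteq> {0..t}}"
  have E_sub: "E \<subseteq> Pow \<Omega>" by (auto simp: E_def)
  have E_sets: "E \<subseteq> sets (path_space t)"
  proof
    fix A assume "A \<in> E"
    then obtain F a where A: "A = {f \<in> space (path_space t). \<forall>s\<in>F. f s \<le> a s}" "finite F" "F \<subseteq> {0..t}"
      by (auto simp: E_def \<Omega>_def)
    show "A \<in> sets (path_space t)"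
      unfolding A(1)
    proof (rule sets.sets_Collect_finite_All[OF _ A(2)])
      fix s assume "s \<in> F"
      then have [measurable]: "(\<lambda>f. f s) \<in> borel_measurable (path_space t :: (real \<Rightarrow> real) measure)"
        using A(3) t by (intro path_evaluation_measurable) auto
      show "{f \<in> space (path_space t). f s \<le> a s} \<in> sets (path_space t)" by measurable
    qed
  qed
  have sE: "sets (path_space t) = sigma_sets \<Omega> E"
  proof
    show "sigma_sets \<Omega> E \<subseteq> sets (path_space t)"
      using E_sets unfolding \<Omega>_def by (intro sets.sigma_sets_subset)
    define S where "S = sigma \<Omega> E"
    have S: "sets S = sigma_sets \<Omega> E" "space S = \<Omega>" using E_sub by (auto simp: S_def)
    have "sample_path t (\<lambda>s f. f s) \<in> measurable S (path_space t)"
    proof (rule sample_path_measurable[OF t])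
      show "continuous_process t S (\<lambda>s f. f s :: real)"
        unfolding continuous_process_def
      proof (intro conjI ballI)
        fix s assume s: "s \<in> {0..t}"
        show "(\<lambda>f. f s) \<in> borel_measurable S"
        proof (rule borel_measurableI_le)
          fix c
          have "{f \<in> space S. f s \<le> c} = {f \<in> \<Omega>. \<forall>s\<in>{s}. f s \<le> (\<lambda>_. c) s}" using S by auto
          also have "\<dots> \<in> E" unfolding E_def using s by (intro CollectI exI[of _ "{s}"] exI[of _ "\<lambda>_. c"]) auto
          finally show "{f \<in> space S. f s \<le> c} \<in> sets S" using S by auto
        qed
      qed (auto simp: S \<Omega>_def space_path_space)
    qed
    then have id: "(\<lambda>f. f) \<in> measurable S (path_space t)"
      by (subst measurable_cong[of S "\<lambda>f. f" "sample_path t (\<lambda>s f. f s)"])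
        (simp_all add: S \<Omega>_def space_path_space sample_path_def extensional_restrict)
    show "sets (path_space t) \<subseteq> sigma_sets \<Omega> E"
    proof
      fix A assume A: "A \<in> sets (path_space t :: (real \<Rightarrow> real) measure)"
      then have "(\<lambda>f. f) -` A \<inter> space S \<in> sets S" using id by (rule measurable_sets[rotated])
      moreover have "(\<lambda>f. f) -` A \<inter> space S = A"
        using sets.sets_into_space[OF A] S by (auto simp: \<Omega>_def)
      ultimately show "A \<in> sigma_sets \<Omega> E" using S by simp
    qed
  qed
  have "\<Omega> = {f \<in> \<Omega>. \<forall>s\<in>{}. f s \<le> (\<lambda>_. 0) s}" by simp
  then have \<Omega>_E: "\<Omega> \<in> E" unfolding E_def by (intro CollectI exI[of _ "{}"] exI[of _ "\<lambda>_. 0"]) auto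
  show ?thesis
  proof (rule measure_eqI_generator_eq[where E=E and \<Omega>=\<Omega> and A="\<lambda>_. \<Omega>"])
    show "Int_stable E"
    proof (rule Int_stableI)
      fix A B assume "A \<in> E" "B \<in> E"
      then obtain F a G b where *: "A = {f \<in> \<Omega>. \<forall>s\<in>F. f s \<le> a s}" "finite F" "F \<subseteq> {0..t}"
        "B = {f \<in> \<Omega>. \<forall>s\<in>G. f s \<le> b s}" "finite G" "G \<subseteq> {0..t}"
        unfolding E_def by blast
      define c where "c s = (if s \<in> F \<and> s \<in> G then min (a s) (b s) else if s \<in> F then a s else b s)" for s
      have "A \<inter> B = {f \<in> \<Omega>. \<forall>s\<in>F \<union> G. f s \<le> c s}"
        unfolding * c_def by (auto split: if_splits)
      then show "A \<inter> B \<in> E" unfolding E_def using * by (intro CollectI exI[of _ "F \<union> G"] exI[of _ c]) auto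
    qed
    show "emeasure M A = emeasure N A" if AE: "A \<in> E" for A
    proof -
      obtain F a where "A = {f \<in> space (path_space t). \<forall>s\<in>F. f s \<le> a s}" "finite F" "F \<subseteq> {0..t}"
      proof -
        have "\<exists>F a. A = {f \<in> space (path_space t). \<forall>s\<in>F. f s \<le> a s} \<and> finite F \<and> F \<subseteq> {0..t}"
          using AE by (simp only: E_def \<Omega>_def mem_Collect_eq)
        then show thesis by (elim exE conjE) (rule that)
      qed
      then show ?thesis using eq[of F a] by simp
    qed
    show "emeasure M \<Omega> \<noteq> \<infinity>" 
      using finite_measure.emeasure_finite[OF prob_space.finite_measure[OF M(1)]] by simp
  qed (use E_sub sE M N \<Omega>_E in auto)
qed

section \<open>The path transformations\<close>

text \<open>
  By uniform continuity, nearby parameters change the function, and hence its supremum, by little.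
  The index set is a fixed interval; \<open>pitman_P_SUP_unit\<close> and \<open>pitman_L_SUP_unit\<close> bring the
  moving intervals of the two transforms into this form.
\<close>

lemma continuous_on_SUP_param:
  fixes g :: "real \<Rightarrow> real \<Rightarrow> real"
  assumes S: "compact S" and g: "continuous_on (S \<times> {0..1}) (\<lambda>(s, v). g s v)"
  shows "continuous_on S (\<lambda>s. SUP v\<in>{0..1}. g s v)"
proof -
  have "uniformly_continuous_on (S \<times> {0..1}) (\<lambda>(s, v). g s v)"
    using S g by (intro compact_uniformly_continuous compact_Times) auto
  note uc = this[unfolded uniformly_continuous_on_def, rule_format]
  have bdd: "bdd_above (g s ` {0..1})" if "s \<in> S" for s
  proof -
    have "continuous_on {0..1} (\<lambda>v. case (s, v) of (s, v) \<Rightarrow> g s v)"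
      by (rule continuous_on_compose2[OF g]) (use that in \<open>auto intro!: continuous_intros\<close>)
    then have "compact (g s ` {0..1})" by (intro compact_continuous_image) auto
    then show ?thesis by (simp add: bounded_imp_bdd_above compact_imp_bounded)
  qed
  show ?thesis
    unfolding continuous_on_iff
  proof (intro ballI allI impI)
    fix s e :: real assume s: "s \<in> S" and e: "0 < e"
    obtain d where d: "d > 0" "\<And>p q. p \<in> S \<times> {0..1} \<Longrightarrow> q \<in> S \<times> {0..1} \<Longrightarrow> dist q p < d \<Longrightarrow>
        dist (case q of (s, v) \<Rightarrow> g s v) (case p of (s, v) \<Rightarrow> g s v) < e/2"
      using uc[of "e/2"] e by (metis half_gt_zero)
    have le: "(SUP v\<in>{0..1}. g a v) \<le> (SUP v\<in>{0..1}. g b v) + e/2"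
      if ab: "a \<in> S" "b \<in> S" "dist a b < d" for a b
    proof (rule cSUP_least)
      fix v :: real assume v: "v \<in> {0..1}"
      have "dist (g a v) (g b v) < e/2"
        using d(2)[of "(b, v)" "(a, v)"] ab v by (simp add: dist_Pair_Pair)
      then have "g a v \<le> g b v + e/2" unfolding dist_real_def by linarith
      also have "g b v \<le> (SUP v\<in>{0..1}. g b v)" using bdd[OF ab(2)] v by (rule cSUP_upper[rotated])
      finally show "g a v \<le> (SUP v\<in>{0..1}. g b v) + e/2" by simp
    qed auto
    show "\<exists>d>0. \<forall>x'\<in>S. dist x' s < d \<longrightarrow> dist (SUP v\<in>{0..1}. g x' v) (SUP v\<in>{0..1}. g s v) < e"
    proof (intro exI[of _ d] conjI ballI impI d(1))
      fix b assume b: "b \<in> S" "dist b s < d"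
      show "dist (SUP v\<in>{0..1}. g b v) (SUP v\<in>{0..1}. g s v) < e"
      proof -
        have "dist s b < d" using b by (simp add: dist_commute)
        then show ?thesis using le[OF b(1) s b(2)] le[OF s b(1)] e unfolding dist_real_def by linarith
      qed
    qed
  qed
qed

lemma measurable_SUP_param:
  fixes g :: "'a \<Rightarrow> real \<Rightarrow> real"
  assumes c: "\<And>\<omega>. \<omega> \<in> space P \<Longrightarrow> continuous_on {0..1} (g \<omega>)"
    and m: "\<And>v. v \<in> {0..1} \<Longrightarrow> (\<lambda>\<omega>. g \<omega> v) \<in> borel_measurable P"
  shows "(\<lambda>\<omega>. SUP v\<in>{0..1}. g \<omega> v) \<in> borel_measurable P"
proof (rule borel_measurableI_le)
  fix a :: real
  have "((SUP v\<in>{0..1}. g \<omega> v) \<le> a) \<longleftrightarrow> (\<forall>v\<in>\<rat> \<inter> {0..1}. g \<omega> v \<le> a)" if "\<omega> \<in> space P" for \<omega>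
  proof -
    have "compact (g \<omega> ` {0..1})" by (intro compact_continuous_image c that) auto
    then have "bdd_above (g \<omega> ` {0..1})" by (simp add: bounded_imp_bdd_above compact_imp_bounded)
    then have "((SUP v\<in>{0..1}. g \<omega> v) \<le> a) \<longleftrightarrow> (\<forall>v\<in>{0..1}. g \<omega> v \<le> a)"
      by (intro cSUP_le_iff) auto
    also have "\<dots> \<longleftrightarrow> (\<forall>v\<in>\<rat> \<inter> {0..1}. g \<omega> v \<le> a)"
      using rational_dense_le[OF zero_less_one c[OF that]] by blast
    finally show ?thesis .
  qed
  then have "{\<omega> \<in> space P. (SUP v\<in>{0..1}. g \<omega> v) \<le> a} = {\<omega> \<in> space P. \<forall>v\<in>\<rat> \<inter> {0..1}. g \<omega> v \<le> a}"
    by blast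
  also have "\<dots> \<in> sets P"
  proof (rule sets.sets_Collect_countable_All')
    fix v :: real assume "v \<in> \<rat> \<inter> {0..1}"
    then have [measurable]: "(\<lambda>\<omega>. g \<omega> v) \<in> borel_measurable P" by (intro m) auto
    show "{\<omega> \<in> space P. g \<omega> v \<le> a} \<in> sets P" by measurable
  qed (simp add: countable_rat countable_Int1)
  finally show "{\<omega> \<in> space P. (SUP v\<in>{0..1}. g \<omega> v) \<le> a} \<in> sets P" .
qed

lemma pitman_P_SUP_unit:
  assumes "0 \<le> s"
  shows "pitman_P \<phi> s = 2 * (SUP v\<in>{0..1}. \<phi> (s * v)) - \<phi> s"
proof -
  have "{0..s} = (\<lambda>v. s * v) ` {0..1}"
    using assms image_mult_atLeastAtMost[of s 0 1] by (cases "s = 0") (auto simp: image_constant_conv)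
  then show ?thesis by (simp add: pitman_P_def image_image)
qed

lemma pitman_L_SUP_unit:
  assumes "s \<le> t"
  shows "pitman_L t y \<phi> s = - \<phi> s + min (- 2 * (SUP v\<in>{0..1}. - \<phi> (s + (t - s) * v))) (\<phi> t + y)"
proof -
  have "{s..t} = (\<lambda>u. s + u) ` (\<lambda>v. (t - s) * v) ` {0..1}"
    using assms image_mult_atLeastAtMost[of "t - s" 0 1]
    by (cases "s = t") (auto simp: image_constant_conv)
  then have "(INF u\<in>{s..t}. \<phi> u) = (INF v\<in>{0..1}. \<phi> (s + (t - s) * v))" by (simp add: image_image)
  also have "\<dots> = - (SUP v\<in>{0..1}. - \<phi> (s + (t - s) * v))"
    by (simp add: Inf_real_def image_image)
  finally show ?thesis by (simp add: pitman_L_def)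
qed

lemma continuous_on_pitman_P:
  assumes "continuous_on {0..t} \<phi>"
  shows "continuous_on {0..t} (pitman_P \<phi>)"
proof -
  have "continuous_on {0..t} (\<lambda>s. 2 * (SUP v\<in>{0..1}. \<phi> (s * v)) - \<phi> s)"
    by (intro continuous_intros assms continuous_on_SUP_param)
       (auto simp: case_prod_unfold intro!: continuous_on_compose2[OF assms] continuous_intros
         intro: order_trans[OF mult_left_le])
  then show ?thesis
    by (rule continuous_on_eq) (simp add: pitman_P_SUP_unit)
qed

lemma unit_interp_mem:
  fixes s t v :: real
  assumes "0 \<le> s" "s \<le> t" "0 \<le> v" "v \<le> 1"
  shows "0 \<le> s + (t - s) * v" "s + (t - s) * v \<le> t"
  using assms mult_left_le[of v "t - s"] by auto

lemma continuous_on_pitman_L: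
  assumes "continuous_on {0..t} \<phi>"
  shows "continuous_on {0..t} (pitman_L t y \<phi>)"
proof -
  have "continuous_on {0..t} (\<lambda>s. - \<phi> s + min (- 2 * (SUP v\<in>{0..1}. - \<phi> (s + (t - s) * v))) (\<phi> t + y))"
    by (intro continuous_intros assms continuous_on_SUP_param)
       (auto simp: case_prod_unfold unit_interp_mem
         intro!: continuous_on_compose2[OF assms] continuous_intros)
  then show ?thesis
    by (rule continuous_on_eq) (simp add: pitman_L_SUP_unit)
qed

lemma measurable_pitman_P:
  assumes X: "continuous_process t P X" and s: "s \<in> {0..t}"
  shows "(\<lambda>\<omega>. pitman_P (\<lambda>u. X u \<omega>) s) \<in> borel_measurable P"
proof -
  have mem: "s * v \<in> {0..t}" if "v \<in> {0..1}" for v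
    using s that by (auto intro: order_trans[OF mult_left_le])
  have c: "continuous_on {0..t} (\<lambda>u. X u \<omega>)" if "\<omega> \<in> space P" for \<omega>
    using X that by (simp add: continuous_process_def)
  have "(\<lambda>\<omega>. 2 * (SUP v\<in>{0..1}. X (s * v) \<omega>) - X s \<omega>) \<in> borel_measurable P"
    using X s mem
    by (intro borel_measurable_diff borel_measurable_times measurable_SUP_param)
       (auto simp: continuous_process_def intro!: continuous_on_compose2[OF c] continuous_intros)
  then show ?thesis using s by (simp add: pitman_P_SUP_unit)
qed

lemma measurable_pitman_L:
  assumes X: "continuous_process t P X" and s: "s \<in> {0..t}"
  shows "(\<lambda>\<omega>. pitman_L t y (\<lambda>u. X u \<omega>) s) \<in> borel_measurable P"
proof -
  have mem: "s + (t - s) * v \<in> {0..t}" if "v \<in> {0..1}" for v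
    using s that by (auto simp: unit_interp_mem)
  have c: "continuous_on {0..t} (\<lambda>u. X u \<omega>)" if "\<omega> \<in> space P" for \<omega>
    using X that by (simp add: continuous_process_def)
  have [measurable]: "X s \<in> borel_measurable P" "X t \<in> borel_measurable P"
    using X s by (auto simp: continuous_process_def)
  have [measurable]: "(\<lambda>\<omega>. SUP v\<in>{0..1}. - X (s + (t - s) * v) \<omega>) \<in> borel_measurable P"
    using X s mem
    by (intro measurable_SUP_param)
       (auto simp: continuous_process_def intro!: continuous_on_compose2[OF c] continuous_intros)
  have "(\<lambda>\<omega>. - X s \<omega> + min (- 2 * (SUP v\<in>{0..1}. - X (s + (t - s) * v) \<omega>)) (X t \<omega> + y))
    \<in> borel_measurable P" by measurable
  then show ?thesis using s by (simp add: pitman_L_SUP_unit)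
qed

text \<open>
  Let \<open>S\<close> be the running maximum.  For \<open>u \<ge> s\<close> the transform \<open>2 * S u - \<phi> u\<close> is at least
  \<open>S u \<ge> S s\<close>.  If the maximum is still to increase after \<open>s\<close>, equality holds at the first
  \<open>u \<ge> s\<close> with \<open>\<phi> u = S s\<close>; then the infimum is \<open>S s\<close>, and twice this is below
  \<open>pitman_P \<phi> t + x = 2 * S t\<close>.  If the maximum does not increase any more, the second term of the
  minimum is \<open>2 * S s\<close> itself.  In both cases the transform is \<open>2 * S s - (2 * S s - \<phi> s)\<close>.
\<close>

lemma pitman_L_pitman_P:
  assumes c: "continuous_on {0..t} \<phi>" and x: "\<phi> t = x" and s: "s \<in> {0..t}"
  shows "pitman_L t x (pitman_P \<phi>) s = \<phi> s"
proof -
  define S where "S u = (SUP v\<in>{0..u}. \<phi> v)" for u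
  have bdd: "bdd_above (\<phi> ` {0..u})" if "u \<in> {0..t}" for u
    using that by (intro bounded_imp_bdd_above compact_imp_bounded compact_continuous_image
        continuous_on_subset[OF c]) auto
  have S_upper: "\<phi> v \<le> S u" if "v \<in> {0..u}" "u \<in> {0..t}" for u v
    unfolding S_def using bdd[OF that(2)] that(1) by (rule cSUP_upper[rotated])
  have S_mono: "S u \<le> S w" if "0 \<le> u" "u \<le> w" "w \<le> t" for u w
    unfolding S_def by (intro cSUP_subset_mono bdd) (use that in auto)
  have PS: "pitman_P \<phi> u = 2 * S u - \<phi> u" for u by (simp add: pitman_P_def S_def)
  have ge: "S s \<le> pitman_P \<phi> u" if "u \<in> {s..t}" for u
    using S_mono[of s u] S_upper[of u u] that s by (auto simp: PS)
  have bb: "bdd_below (pitman_P \<phi> ` {s..t})" using ge by (intro bdd_belowI2) auto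
  have inf_ge: "S s \<le> (INF u\<in>{s..t}. pitman_P \<phi> u)"
    using s ge by (intro cINF_greatest) auto
  have "min (2 * (INF u\<in>{s..t}. pitman_P \<phi> u)) (pitman_P \<phi> t + x) = 2 * S s"
  proof (cases "S t = S s")
    case True
    then show ?thesis using inf_ge x by (simp add: PS min_def)
  next
    case False
    then have lt: "S s < S t" using S_mono[of s t] s by auto
    obtain w where w: "w \<in> {0..t}" "\<phi> w > S s"
      using lt less_cSUP_iff[OF _ bdd[of t], of "S s"] s unfolding S_def[of t] by fastforce
    have ws: "s < w" using w S_upper[of w s] s by force
    \<comment> \<open>At \<open>s\<close> the path is not above the level \<open>S s\<close>, and it exceeds it at \<open>w\<close>, so it hits the level in between.\<close>
    define K where "K = {u \<in> {s..w}. \<phi> u = S s}"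
    have cw: "continuous_on {s..w} \<phi>" using w s by (intro continuous_on_subset[OF c]) auto
    have "K = {s..w} \<inter> \<phi> -` {S s}" by (auto simp: K_def)
    then have "closed K" using continuous_closed_preimage[OF cw, of "{S s}"] by simp
    moreover have "bounded K" by (rule bounded_subset[of "{s..w}"]) (auto simp: K_def)
    ultimately have "compact K" by (simp add: compact_eq_bounded_closed)
    have "K \<noteq> {}"
      using IVT'[of \<phi> s "S s" w] S_upper[of s s] s w ws cw unfolding K_def by fastforce
    then obtain u where u: "u \<in> K" "\<And>v. v \<in> K \<Longrightarrow> u \<le> v"
      using compact_attains_inf[OF \<open>compact K\<close>] by blast
    \<comment> \<open>A value above \<open>S s\<close> before the first hitting time \<open>u\<close> would force an earlier hit.\<close>
    have "S u \<le> S s"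
      unfolding S_def[of u]
    proof (rule cSUP_least)
      fix v assume v: "v \<in> {0..u}"
      show "\<phi> v \<le> S s"
      proof (rule ccontr)
        assume "\<not> \<phi> v \<le> S s"
        moreover from this have "s < v" using S_upper[of v s] v s by force
        ultimately obtain v' where "s \<le> v'" "v' \<le> v" "\<phi> v' = S s"
          using IVT'[of \<phi> s "S s" v] S_upper[of s s] s v u w
            continuous_on_subset[OF cw, of "{s..v}"] unfolding K_def by fastforce
        then have "v' \<in> K" "v' < u" 
          using v u \<open>\<not> \<phi> v \<le> S s\<close> unfolding K_def by (auto simp: less_le)
        then show False using u(2) by force
      qed
    qed (use u s in \<open>auto simp: K_def\<close>)
    then have "pitman_P \<phi> u \<le> S s" using u by (auto simp: PS K_def)
    moreover have "u \<in> {s..t}" using u w by (auto simp: K_def)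
    ultimately have "(INF u\<in>{s..t}. pitman_P \<phi> u) \<le> S s"
      using cINF_lower2[OF bb] by blast
    moreover have "pitman_P \<phi> t + x = 2 * S t" by (simp add: PS x)
    ultimately show ?thesis using inf_ge lt by (simp add: min_def)
  qed
  then show ?thesis by (simp add: pitman_L_def PS)
qed

lemma sample_path_cong:
  "(\<And>s. s \<in> {0..t} \<Longrightarrow> X s \<omega> = Y s \<omega>') \<Longrightarrow> sample_path t X \<omega> = sample_path t Y \<omega>'"
  by (auto simp: sample_path_def)

text \<open>
  Both pairs are images of their first components under one measurable map \<open>G\<close> of path spaces: the
  right one by definition, the left one almost surely since \<open>\<beta>\<close> is recovered from its
  transform.
\<close>

lemma equal_in_law_recovered:
  fixes \<beta> :: "real \<Rightarrow> 'a \<Rightarrow> real" and M :: "real \<Rightarrow> 'b \<Rightarrow> real"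
  assumes t: "0 < t" and \<beta>: "continuous_process t P \<beta>" and x: "AE \<omega> in P. \<beta> t \<omega> = x"
    and M: "sample_path t M \<in> measurable Q (path_space t)"
    and eq: "distr P (path_space t) (sample_path t (\<lambda>s \<omega>. pitman_P (\<lambda>u. \<beta> u \<omega>) s))
      = distr Q (path_space t) (sample_path t M)"
  shows "equal_in_law t P (\<lambda>s \<omega>. (pitman_P (\<lambda>u. \<beta> u \<omega>) s, \<beta> s \<omega>))
           Q (\<lambda>s \<omega>. (M s \<omega>, pitman_L t x (\<lambda>u. M u \<omega>) s))"
proof -
  let ?S = "path_space t :: (real \<Rightarrow> real) measure"
  let ?R = "\<lambda>s \<omega>. pitman_P (\<lambda>u. \<beta> u \<omega>) s"
  define G where "G = sample_path t (\<lambda>s \<phi>. (\<phi> s, pitman_L t x (\<lambda>u. \<phi> u :: real) s))"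
  have id: "continuous_process t ?S (\<lambda>s \<phi>. \<phi> s)"
    unfolding continuous_process_def
    by (intro conjI ballI path_evaluation_measurable[OF t]) (auto simp: space_path_space)
  have G: "G \<in> measurable ?S (path_space t)"
    unfolding G_def
  proof (rule sample_path_measurable[OF t])
    show "continuous_process t ?S (\<lambda>s \<phi>. (\<phi> s, pitman_L t x (\<lambda>u. \<phi> u) s))"
      using id measurable_pitman_L[OF id] unfolding continuous_process_def
      by (auto intro!: continuous_intros continuous_on_pitman_L borel_measurable_Pair)
  qed
  have L_cong: "pitman_L t x f s = pitman_L t x g s" if "s \<in> {0..t}" "\<And>u. u \<in> {0..t} \<Longrightarrow> f u = g u"
    for f g :: "real \<Rightarrow> real" and s
    using that unfolding pitman_L_def by (auto intro!: arg_cong2[where f=min] SUP_cong INF_cong)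
  have GX: "G (sample_path t X \<omega>) = sample_path t (\<lambda>s \<omega>. (X s \<omega>, pitman_L t x (\<lambda>u. X u \<omega>) s)) \<omega>"
    for X :: "real \<Rightarrow> 'c \<Rightarrow> real" and \<omega>
    unfolding G_def by (intro sample_path_cong) (auto simp: sample_path_def intro!: L_cong)
  have R: "continuous_process t P ?R"
    using \<beta> measurable_pitman_P[OF \<beta>] unfolding continuous_process_def
    by (auto intro!: continuous_on_pitman_P)
  have Rm: "sample_path t ?R \<in> measurable P ?S" by (rule sample_path_measurable[OF t R])
  have R\<beta>: "sample_path t (\<lambda>s \<omega>. (?R s \<omega>, \<beta> s \<omega>)) \<in> measurable P (path_space t)"
    using \<beta> R unfolding continuous_process_def
    by (intro sample_path_measurable[OF t])
       (auto simp: continuous_process_def intro!: continuous_intros borel_measurable_Pair)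
  have MLm: "sample_path t (\<lambda>s \<omega>. (M s \<omega>, pitman_L t x (\<lambda>u. M u \<omega>) s)) \<in> measurable Q (path_space t)"
    using measurable_compose[OF M G] by (simp add: GX)
  have "distr P (path_space t) (sample_path t (\<lambda>s \<omega>. (?R s \<omega>, \<beta> s \<omega>)))
    = distr P (path_space t) (\<lambda>\<omega>. G (sample_path t ?R \<omega>))"
  proof (rule distr_cong_AE[OF refl refl])
    show "AE \<omega> in P. sample_path t (\<lambda>s \<omega>. (?R s \<omega>, \<beta> s \<omega>)) \<omega> = G (sample_path t ?R \<omega>)"
      using x AE_space
    proof eventually_elim
      case (elim \<omega>)
      then show ?case
        unfolding GX using \<beta>
        by (intro sample_path_cong) (auto simp: continuous_process_def pitman_L_pitman_P)
    qed
  qed (use R\<beta> measurable_compose[OF Rm G] in auto)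
  also have "\<dots> = distr (distr P ?S (sample_path t ?R)) (path_space t) G"
    using distr_distr[OF G Rm] by (simp add: comp_def)
  also have "\<dots> = distr (distr Q ?S (sample_path t M)) (path_space t) G" by (simp only: eq)
  also have "\<dots> = distr Q (path_space t) (\<lambda>\<omega>. G (sample_path t M \<omega>))"
    using distr_distr[OF G M] by (simp add: comp_def)
  finally show ?thesis
    unfolding equal_in_law_def using R\<beta> MLm by (simp add: GX)
qed

section \<open>Independence from characteristic functions\<close>

text \<open>
  Normalising the weight makes it a probability density, and Levy's uniqueness theorem identifies
  the law of \<open>X\<close> under the reweighted measure.
\<close>

lemma weighted_law_eq_of_fourier:
  fixes X w :: "'a \<Rightarrow> real"
  assumes Q: "finite_measure Q" and [measurable]: "X \<in> borel_measurable Q" "w \<in> borel_measurable Q"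
    and w0: "\<And>\<omega>. 0 \<le> w \<omega>" and wB: "\<And>\<omega>. w \<omega> \<le> B"
    and N: "real_distribution N"
    and fourier: "\<And>u. (CLINT \<omega>|Q. w \<omega> * iexp (u * X \<omega>)) = (LINT \<omega>|Q. w \<omega>) * char N u"
    and A: "A \<in> sets borel"
  shows "(LINT \<omega>|Q. w \<omega> * indicator A (X \<omega>)) = (LINT \<omega>|Q. w \<omega>) * measure N A"
proof -
  interpret Q: finite_measure Q by fact
  interpret N: real_distribution N by fact
  have [measurable]: "A \<in> sets borel" by fact
  have wint: "integrable Q w"
    by (rule Q.integrable_const_bound[of _ B]) (use w0 wB in auto)
  define c where "c = (LINT \<omega>|Q. w \<omega>)"
  have c0: "0 \<le> c" unfolding c_def using w0 by simp
  show ?thesis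
  proof (cases "c = 0")
    case True
    then have "AE \<omega> in Q. w \<omega> = 0"
      using integral_nonneg_eq_0_iff_AE[OF wint] w0 by (auto simp: c_def)
    then have "(LINT \<omega>|Q. w \<omega> * indicator A (X \<omega>)) = (LINT \<omega>|Q. 0)"
      by (intro integral_cong_AE) auto
    then show ?thesis using True by (simp add: c_def)
  next
    case False
    then have c: "0 < c" using c0 by simp
    define D where "D = density Q (\<lambda>\<omega>. ennreal (w \<omega> / c))"
    have emD: "emeasure D (space D) = 1"
    proof -
      have "emeasure D (space D) = (\<integral>\<^sup>+\<omega>. ennreal (w \<omega> / c) \<partial>Q)"
        unfolding D_def by (simp add: emeasure_density cong: nn_integral_cong)
      also have "\<dots> = ennreal (LINT \<omega>|Q. w \<omega> / c)"
        using wint w0 c by (intro nn_integral_eq_integral) auto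
      also have "\<dots> = 1" using c by (simp add: c_def[symmetric])
      finally show ?thesis .
    qed
    have pD: "prob_space D" by (rule prob_spaceI) (fact emD)
    have XD: "X \<in> borel_measurable D" unfolding D_def by simp
    interpret M: real_distribution "distr D borel X"
      using prob_space.real_distribution_distr[OF pD XD] .
    have "char (distr D borel X) = char N"
    proof
      fix u
      have "char (distr D borel X) u = (CLINT \<omega>|D. iexp (u * X \<omega>))"
        unfolding char_def using XD by (subst integral_distr) auto
      also have "\<dots> = (CLINT \<omega>|Q. (w \<omega> / c) *\<^sub>R iexp (u * X \<omega>))"
        unfolding D_def using w0 c by (subst integral_density) auto
      also have "\<dots> = (CLINT \<omega>|Q. (1 / c) * (w \<omega> * iexp (u * X \<omega>)))"
        by (intro Bochner_Integration.integral_cong) (auto simp: scaleR_conv_of_real)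
      also have "\<dots> = (1 / c) * (CLINT \<omega>|Q. w \<omega> * iexp (u * X \<omega>))"
        by (rule integral_mult_right_zero)
      also have "\<dots> = char N u" unfolding fourier c_def[symmetric] using c by simp
      finally show "char (distr D borel X) u = char N u" .
    qed
    then have eq: "distr D borel X = N"
      by (intro Levy_uniqueness) (unfold_locales)
    have "measure N A = measure D (X -` A \<inter> space D)"
      unfolding eq[symmetric] using XD by (subst measure_distr) auto
    also have "\<dots> = (LINT \<omega>|D. indicator A (X \<omega>))"
    proof -
      have "(LINT \<omega>|D. indicator A (X \<omega>)) = (LINT \<omega>|D. indicator (X -` A \<inter> space D) \<omega>)"
        by (intro Bochner_Integration.integral_cong) (auto simp: indicator_def)
      also have "\<dots> = measure D (X -` A \<inter> space D)" by simp
      finally show ?thesis by simp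
    qed
    also have "\<dots> = (LINT \<omega>|Q. (w \<omega> / c) *\<^sub>R indicator A (X \<omega>))"
      unfolding D_def using w0 c by (subst integral_density) auto
    also have "\<dots> = (LINT \<omega>|Q. (1 / c) * (w \<omega> * indicator A (X \<omega>)))"
      by (intro Bochner_Integration.integral_cong) auto
    also have "\<dots> = (1 / c) * (LINT \<omega>|Q. w \<omega> * indicator A (X \<omega>))"
      by (rule integral_mult_right_zero)
    finally show ?thesis using c by (simp add: c_def[symmetric])
  qed
qed

text \<open>
  Uniqueness of characteristic functions concerns positive measures, so it is applied under the
  weights \<open>1\<close>, \<open>1 + cos Y\<close> and \<open>1 + sin Y\<close>.  These are combinations of \<open>exp (\<i> k Y)\<close> with
  \<open>k = 0, 1, -1\<close>, to which the hypothesis applies; the real and imaginary parts of the claim are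
  differences of the results.
\<close>

lemma fourier_factor_indicator:
  fixes X Y :: "'a \<Rightarrow> real"
  assumes Q: "finite_measure Q" and [measurable]: "X \<in> borel_measurable Q" "Y \<in> borel_measurable Q"
    and N: "real_distribution N"
    and fourier: "\<And>k u. (CLINT \<omega>|Q. iexp (k * Y \<omega> + u * X \<omega>)) = (CLINT \<omega>|Q. iexp (k * Y \<omega>)) * char N u"
    and A: "A \<in> sets borel"
  shows "(CLINT \<omega>|Q. indicator A (X \<omega>) *\<^sub>R iexp (Y \<omega>)) = (CLINT \<omega>|Q. iexp (Y \<omega>)) * measure N A"
proof -
  interpret Q: finite_measure Q by fact
  have [measurable]: "A \<in> sets borel" by fact
  have int_iexp: "integrable Q (\<lambda>\<omega>. iexp (f \<omega>))" if [measurable]: "f \<in> borel_measurable Q" for f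
    by (rule Q.integrable_const_bound[of _ 1]) auto
  have key: "(LINT \<omega>|Q. w \<omega> * indicator A (X \<omega>)) = (LINT \<omega>|Q. w \<omega>) * measure N A"
    if w0: "\<And>\<omega>. 0 \<le> w \<omega>" and wB: "\<And>\<omega>. w \<omega> \<le> 2" and [measurable]: "w \<in> borel_measurable Q"
      and w: "\<And>\<omega>. complex_of_real (w \<omega>) = 1 + a * iexp (1 * Y \<omega>) + b * iexp ((-1) * Y \<omega>)"
    for w and a b :: complex
  proof (rule weighted_law_eq_of_fourier[OF Q _ _ w0 wB N _ A])
    fix u
    have "(CLINT \<omega>|Q. w \<omega> * iexp (u * X \<omega>)) =
      (CLINT \<omega>|Q. iexp (0 * Y \<omega> + u * X \<omega>) + a * iexp (1 * Y \<omega> + u * X \<omega>) + b * iexp ((-1) * Y \<omega> + u * X \<omega>))"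
    proof (intro Bochner_Integration.integral_cong refl)
      fix \<omega>
      have E: "iexp (k * Y \<omega> + u * X \<omega>) = iexp (k * Y \<omega>) * iexp (u * X \<omega>)" for k
        by (simp only: exp_add distrib_left of_real_add)
      have "iexp (0 * Y \<omega>) = 1" by simp
      then show "w \<omega> * iexp (u * X \<omega>) = iexp (0 * Y \<omega> + u * X \<omega>) + a * iexp (1 * Y \<omega> + u * X \<omega>)
          + b * iexp ((-1) * Y \<omega> + u * X \<omega>)"
        unfolding E w by (simp only: distrib_right mult.assoc)
    qed
    also have "\<dots> = (CLINT \<omega>|Q. iexp (0 * Y \<omega> + u * X \<omega>)) + a * (CLINT \<omega>|Q. iexp (1 * Y \<omega> + u * X \<omega>))
        + b * (CLINT \<omega>|Q. iexp ((-1) * Y \<omega> + u * X \<omega>))"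
      by (subst Bochner_Integration.integral_add, (intro Bochner_Integration.integrable_add integrable_mult_right int_iexp; measurable)+,
          subst Bochner_Integration.integral_add, (intro integrable_mult_right int_iexp; measurable)+, simp)
    also have "\<dots> = ((CLINT \<omega>|Q. iexp (0 * Y \<omega>)) + a * (CLINT \<omega>|Q. iexp (1 * Y \<omega>))
        + b * (CLINT \<omega>|Q. iexp ((-1) * Y \<omega>))) * char N u"
      unfolding fourier by (simp add: algebra_simps)
    also have "(CLINT \<omega>|Q. iexp (0 * Y \<omega>)) + a * (CLINT \<omega>|Q. iexp (1 * Y \<omega>)) + b * (CLINT \<omega>|Q. iexp ((-1) * Y \<omega>))
      = (CLINT \<omega>|Q. iexp (0 * Y \<omega>) + a * iexp (1 * Y \<omega>) + b * iexp ((-1) * Y \<omega>))"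
      by (subst Bochner_Integration.integral_add, (intro Bochner_Integration.integrable_add integrable_mult_right int_iexp; measurable)+,
          subst Bochner_Integration.integral_add, (intro integrable_mult_right int_iexp; measurable)+, simp)
    also have "\<dots> = (CLINT \<omega>|Q. complex_of_real (w \<omega>))"
      unfolding w by (intro Bochner_Integration.integral_cong) auto
    also have "\<dots> = complex_of_real (LINT \<omega>|Q. w \<omega>)" by simp
    finally show "(CLINT \<omega>|Q. w \<omega> * iexp (u * X \<omega>)) = (LINT \<omega>|Q. w \<omega>) * char N u" .
  qed measurable
  have bnd: "integrable Q f" if [measurable]: "f \<in> borel_measurable Q" and "\<And>\<omega>. \<bar>f \<omega>\<bar> \<le> 1" for f :: "'a \<Rightarrow> real"
    by (rule Q.integrable_const_bound[of _ 1]) (use that in auto)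
  have one: "(LINT \<omega>|Q. indicator A (X \<omega>)) = measure Q (space Q) * measure N A"
    using key[of "\<lambda>_. 1" 0 0] by simp
  have cosY: "complex_of_real (1 + cos (Y \<omega>)) = 1 + (1/2) * iexp (1 * Y \<omega>) + (1/2) * iexp ((-1) * Y \<omega>)" for \<omega>
    unfolding cis_conv_exp[symmetric] by (simp add: complex_eq_iff)
  have sinY: "complex_of_real (1 + sin (Y \<omega>)) = 1 + (-\<i>/2) * iexp (1 * Y \<omega>) + (\<i>/2) * iexp ((-1) * Y \<omega>)" for \<omega>
    unfolding cis_conv_exp[symmetric] by (simp add: complex_eq_iff)
  have shift: "(LINT \<omega>|Q. f \<omega> * indicator A (X \<omega>)) = (LINT \<omega>|Q. f \<omega>) * measure N A"
    if [measurable]: "f \<in> borel_measurable Q" and f1: "\<And>\<omega>. \<bar>f \<omega>\<bar> \<le> 1"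
      and *: "(LINT \<omega>|Q. (1 + f \<omega>) * indicator A (X \<omega>)) = (LINT \<omega>|Q. (1 + f \<omega>)) * measure N A" for f
  proof -
    have "(LINT \<omega>|Q. (1 + f \<omega>) * indicator A (X \<omega>)) = (LINT \<omega>|Q. indicator A (X \<omega>) + f \<omega> * indicator A (X \<omega>))"
      by (intro Bochner_Integration.integral_cong) (auto simp: algebra_simps)
    also have "\<dots> = (LINT \<omega>|Q. indicator A (X \<omega>)) + (LINT \<omega>|Q. f \<omega> * indicator A (X \<omega>))"
      by (rule Bochner_Integration.integral_add; rule bnd) (use f1 in \<open>auto simp: indicator_def\<close>)
    finally have 1: "(LINT \<omega>|Q. (1 + f \<omega>) * indicator A (X \<omega>)) = \<dots>" .
    have 2: "(LINT \<omega>|Q. (1 + f \<omega>)) = measure Q (space Q) + (LINT \<omega>|Q. f \<omega>)"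
      by (subst Bochner_Integration.integral_add) (simp_all add: bnd f1 that(1))
    show ?thesis using * unfolding 1 2 one by (simp add: algebra_simps)
  qed
  have c: "(LINT \<omega>|Q. cos (Y \<omega>) * indicator A (X \<omega>)) = (LINT \<omega>|Q. cos (Y \<omega>)) * measure N A"
  proof (rule shift)
    show "(LINT \<omega>|Q. (1 + cos (Y \<omega>)) * indicator A (X \<omega>)) = (LINT \<omega>|Q. (1 + cos (Y \<omega>))) * measure N A"
    proof (rule key[OF _ _ _ cosY])
      show "0 \<le> 1 + cos (Y \<omega>)" "1 + cos (Y \<omega>) \<le> 2" for \<omega>
        using cos_ge_minus_one[of "Y \<omega>"] cos_le_one[of "Y \<omega>"] by linarith+
    qed measurable
  qed simp_all
  have s: "(LINT \<omega>|Q. sin (Y \<omega>) * indicator A (X \<omega>)) = (LINT \<omega>|Q. sin (Y \<omega>)) * measure N A"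
  proof (rule shift)
    show "(LINT \<omega>|Q. (1 + sin (Y \<omega>)) * indicator A (X \<omega>)) = (LINT \<omega>|Q. (1 + sin (Y \<omega>))) * measure N A"
    proof (rule key[OF _ _ _ sinY])
      show "0 \<le> 1 + sin (Y \<omega>)" "1 + sin (Y \<omega>) \<le> 2" for \<omega>
        using sin_ge_minus_one[of "Y \<omega>"] sin_le_one[of "Y \<omega>"] by linarith+
    qed measurable
  qed simp_all
  have intA: "integrable Q (\<lambda>\<omega>. indicator A (X \<omega>) *\<^sub>R iexp (Y \<omega>))"
    by (rule Q.integrable_const_bound[of _ 1]) (auto simp: indicator_def)
  show ?thesis
  proof (rule complex_eqI)
    have "Re (CLINT \<omega>|Q. indicator A (X \<omega>) *\<^sub>R iexp (Y \<omega>)) = (LINT \<omega>|Q. cos (Y \<omega>) * indicator A (X \<omega>))"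
      by (subst integral_Re[OF intA, symmetric]) (auto simp: Re_exp mult.commute)
    moreover have "Re (CLINT \<omega>|Q. iexp (Y \<omega>)) = (LINT \<omega>|Q. cos (Y \<omega>))"
      by (subst integral_Re[OF int_iexp, symmetric]) (auto simp: Re_exp)
    ultimately show "Re (CLINT \<omega>|Q. indicator A (X \<omega>) *\<^sub>R iexp (Y \<omega>))
      = Re ((CLINT \<omega>|Q. iexp (Y \<omega>)) * measure N A)" using c by simp
    have "Im (CLINT \<omega>|Q. indicator A (X \<omega>) *\<^sub>R iexp (Y \<omega>)) = (LINT \<omega>|Q. sin (Y \<omega>) * indicator A (X \<omega>))"
      by (subst integral_Im[OF intA, symmetric]) (auto simp: Im_exp mult.commute)
    moreover have "Im (CLINT \<omega>|Q. iexp (Y \<omega>)) = (LINT \<omega>|Q. sin (Y \<omega>))"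
      by (subst integral_Im[OF int_iexp, symmetric]) (auto simp: Im_exp)
    ultimately show "Im (CLINT \<omega>|Q. indicator A (X \<omega>) *\<^sub>R iexp (Y \<omega>))
      = Im ((CLINT \<omega>|Q. iexp (Y \<omega>)) * measure N A)" using s by simp
  qed
qed

text \<open>
  Kac's criterion for independence.  In the induction the measure is restricted to
  \<open>X j \<in> A j\<close>, which by \<open>fourier_factor_indicator\<close> multiplies the characteristic function of the
  other variables by a constant.  The total mass \<open>c\<close> is arbitrary so that the restricted
  measure need not be normalised.
\<close>

lemma joint_fourier_factorizes:
  fixes X :: "'i \<Rightarrow> 'a \<Rightarrow> real"
  assumes "finite I" and "\<And>i. i \<in> I \<Longrightarrow> real_distribution (N i)" and "\<And>i. i \<in> I \<Longrightarrow> A i \<in> sets borel"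
    and "finite_measure Q" and "\<And>i. i \<in> I \<Longrightarrow> X i \<in> borel_measurable Q"
    and "\<And>l :: 'i \<Rightarrow> real. (CLINT \<omega>|Q. iexp (\<Sum>i\<in>I. l i * X i \<omega>)) = complex_of_real c * (\<Prod>i\<in>I. char (N i) (l i))"
  shows "measure Q {\<omega>\<in>space Q. \<forall>i\<in>I. X i \<omega> \<in> A i} = c * (\<Prod>i\<in>I. measure (N i) (A i))"
  using assms
proof (induction I arbitrary: Q c rule: finite_induct)
  case empty
  have "(CLINT \<omega>|Q. iexp (\<Sum>i\<in>{}. (\<lambda>_. 0) i * X i \<omega>)) = complex_of_real c * (\<Prod>i\<in>{}. char (N i) ((\<lambda>_. 0) i))"
    by (rule empty(5))
  then have "complex_of_real (measure Q (space Q)) = complex_of_real c" by (simp add: scaleR_conv_of_real)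
  then show ?case by simp
next
  case (insert j I)
  interpret Q: finite_measure Q by (rule insert.prems(3))
  have Xm[measurable]: "X i \<in> borel_measurable Q" if "i \<in> insert j I" for i using insert.prems(4) that .
  have Am[measurable]: "A i \<in> sets borel" if "i \<in> insert j I" for i using insert.prems(2) that .
  have Nj: "real_distribution (N j)" using insert.prems(1) by simp
  have [measurable]: "X j \<in> borel_measurable Q" "A j \<in> sets borel" using Xm Am by auto
  define S where "S = {\<omega>\<in>space Q. X j \<omega> \<in> A j}"
  have [measurable]: "S \<in> sets Q" unfolding S_def by measurable
  define Q' where "Q' = density Q (indicator S)"
  have fQ': "finite_measure Q'" unfolding Q'_def by (rule Q.finite_measure_restricted) measurable
  have split: "(\<Sum>i\<in>insert j I. l i * X i \<omega>) = (\<Sum>i\<in>I. l i * X i \<omega>) + l j * X j \<omega>" for l \<omega>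
    using insert.hyps by simp
  have "measure Q' {\<omega>\<in>space Q'. \<forall>i\<in>I. X i \<omega> \<in> A i} = (c * measure (N j) (A j)) * (\<Prod>i\<in>I. measure (N i) (A i))"
  proof (rule insert.IH[OF _ _ fQ'])
    fix l :: "'i \<Rightarrow> real"
    define Y where "Y \<omega> = (\<Sum>i\<in>I. l i * X i \<omega>)" for \<omega>
    have [measurable]: "Y \<in> borel_measurable Q" unfolding Y_def using Xm by auto
    have F: "(CLINT \<omega>|Q. iexp (k * Y \<omega> + u * X j \<omega>)) = complex_of_real c * (\<Prod>i\<in>I. char (N i) (k * l i)) * char (N j) u" for k u
    proof -
      define l' where "l' i = (if i = j then u else k * l i)" for i
      have "(\<Sum>i\<in>insert j I. l' i * X i \<omega>) = k * Y \<omega> + u * X j \<omega>" for \<omega>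
        unfolding split using insert.hyps(2)
        by (auto simp: l'_def Y_def sum_distrib_left algebra_simps intro!: sum.cong)
      moreover have "(\<Prod>i\<in>insert j I. char (N i) (l' i)) = (\<Prod>i\<in>I. char (N i) (k * l i)) * char (N j) u"
        using insert.hyps by (auto simp: l'_def intro!: prod.cong)
      ultimately show ?thesis using insert.prems(5)[of l'] by (simp add: mult.assoc)
    qed
    have "(CLINT \<omega>|Q'. iexp (\<Sum>i\<in>I. l i * X i \<omega>)) = (CLINT \<omega>|Q. indicator S \<omega> *\<^sub>R iexp (Y \<omega>))"
      unfolding Q'_def ennreal_indicator[symmetric] Y_def[symmetric]
      by (subst integral_density) auto
    also have "\<dots> = (CLINT \<omega>|Q. indicator (A j) (X j \<omega>) *\<^sub>R iexp (Y \<omega>))"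
      by (intro Bochner_Integration.integral_cong) (auto simp: S_def indicator_def)
    also have "\<dots> = (CLINT \<omega>|Q. iexp (Y \<omega>)) * measure (N j) (A j)"
    proof (rule fourier_factor_indicator[OF insert.prems(3) _ _ Nj])
      fix k u
      have "(CLINT \<omega>|Q. iexp (k * Y \<omega>)) = complex_of_real c * (\<Prod>i\<in>I. char (N i) (k * l i))"
        using F[of k 0] real_distribution.char_zero[OF Nj] by simp
      then show "(CLINT \<omega>|Q. iexp (k * Y \<omega> + u * X j \<omega>)) = (CLINT \<omega>|Q. iexp (k * Y \<omega>)) * char (N j) u"
        using F by simp
    qed auto
    also have "(CLINT \<omega>|Q. iexp (Y \<omega>)) = complex_of_real c * (\<Prod>i\<in>I. char (N i) (l i))"
      using F[of 1 0] real_distribution.char_zero[OF Nj] by simp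
    finally show "(CLINT \<omega>|Q'. iexp (\<Sum>i\<in>I. l i * X i \<omega>))
      = complex_of_real (c * measure (N j) (A j)) * (\<Prod>i\<in>I. char (N i) (l i))" by simp
  qed (use insert.prems Xm in \<open>auto simp: Q'_def\<close>)
  moreover have "measure Q' {\<omega>\<in>space Q'. \<forall>i\<in>I. X i \<omega> \<in> A i} = measure Q {\<omega>\<in>space Q. \<forall>i\<in>insert j I. X i \<omega> \<in> A i}"
  proof -
    have T: "{\<omega>\<in>space Q. \<forall>i\<in>I. X i \<omega> \<in> A i} \<in> sets Q"
    proof (rule sets.sets_Collect_finite_All[OF _ insert.hyps(1)])
      fix i assume "i \<in> I"
      then have [measurable]: "X i \<in> borel_measurable Q" "A i \<in> sets borel" using Xm Am by auto
      show "{\<omega>\<in>space Q. X i \<omega> \<in> A i} \<in> sets Q" by measurable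
    qed
    have "measure Q' {\<omega>\<in>space Q'. \<forall>i\<in>I. X i \<omega> \<in> A i} = measure Q (S \<inter> {\<omega>\<in>space Q. \<forall>i\<in>I. X i \<omega> \<in> A i})"
      unfolding Q'_def using measure_restricted[OF \<open>S \<in> sets Q\<close> T] by simp
    also have "S \<inter> {\<omega>\<in>space Q. \<forall>i\<in>I. X i \<omega> \<in> A i} = {\<omega>\<in>space Q. \<forall>i\<in>insert j I. X i \<omega> \<in> A i}"
      unfolding S_def by auto
    finally show ?thesis .
  qed
  ultimately show ?case using insert.hyps by (simp add: mult.assoc)
qed

text \<open>
  A point mass has no density and is treated separately; it satisfies the same formula with
  variance \<open>0\<close>.
\<close>

lemma gaussian_rv_moments:
  assumes P: "prob_space P" and Z: "gaussian_rv P Z"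
  shows "integrable P Z" "integrable P (\<lambda>\<omega>. (Z \<omega>)\<^sup>2)"
    and "(CLINT \<omega>|P. iexp (Z \<omega>))
      = iexp (LINT \<omega>|P. Z \<omega>) * exp (- (LINT \<omega>|P. (Z \<omega> - (LINT \<omega>|P. Z \<omega>))\<^sup>2) / 2)"
proof -
  interpret prob_space P by fact
  have Zm[measurable]: "Z \<in> borel_measurable P" using Z by (simp add: gaussian_rv_def)
  consider m where "distr P borel Z = return borel m"
    | m \<sigma> where "\<sigma> > 0" "distributed P lborel Z (\<lambda>z. ennreal (normal_density m \<sigma> z))"
    using Z by (auto simp: gaussian_rv_def)
  then have "integrable P Z \<and> integrable P (\<lambda>\<omega>. (Z \<omega>)\<^sup>2) \<and> (CLINT \<omega>|P. iexp (Z \<omega>))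
      = iexp (LINT \<omega>|P. Z \<omega>) * exp (- (LINT \<omega>|P. (Z \<omega> - (LINT \<omega>|P. Z \<omega>))\<^sup>2) / 2)"
  proof cases
    case (1 m)
    have "AE x in distr P borel Z. x = m" unfolding 1 by (simp add: AE_return)
    then have ae: "AE \<omega> in P. Z \<omega> = m" by (subst (asm) AE_distr_iff) auto
    have "integrable P Z \<longleftrightarrow> integrable P (\<lambda>\<omega>. m)"
      by (rule integrable_cong_AE) (use ae in auto)
    moreover have "integrable P (\<lambda>\<omega>. (Z \<omega>)\<^sup>2) \<longleftrightarrow> integrable P (\<lambda>\<omega>. m\<^sup>2)"
      by (rule integrable_cong_AE) (use ae in auto)
    moreover have m: "(LINT \<omega>|P. Z \<omega>) = (LINT \<omega>|P. m)"
      by (rule integral_cong_AE) (use ae in auto)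
    moreover have "(LINT \<omega>|P. (Z \<omega> - m)\<^sup>2) = (LINT \<omega>|P. 0)"
      by (rule integral_cong_AE) (use ae in auto)
    moreover have "(CLINT \<omega>|P. iexp (Z \<omega>)) = (CLINT \<omega>|P. iexp m)"
      by (rule integral_cong_AE) (use ae in auto)
    ultimately show ?thesis by (simp add: prob_space)
  next
    case (2 m \<sigma>)
    have d: "distributed P lborel Z (normal_density m \<sigma>)" using 2(2) .
    have E: "expectation Z = m" by (rule normal_distributed_expectation[OF 2(1) d])
    have V: "variance Z = \<sigma>\<^sup>2" by (rule normal_distributed_variance[OF 2(1) d])
    have "integrable lborel (\<lambda>x. normal_density m \<sigma> x * x)" 
      by (rule integrable_normal_moment_nz_1[OF 2(1)])
    then have i1: "integrable P Z"
      by (subst distributed_integrable[OF d, of "\<lambda>x. x", symmetric]) auto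
    have "integrable lborel (\<lambda>x. normal_density m \<sigma> x * (x - m)^2)"
      by (rule integrable_normal_moment[OF 2(1)])
    then have i2: "integrable P (\<lambda>\<omega>. (Z \<omega> - m)\<^sup>2)"
      by (subst distributed_integrable[OF d, of "\<lambda>x. (x - m)^2", symmetric]) auto
    have "integrable P (\<lambda>\<omega>. (Z \<omega> - m)\<^sup>2 + 2 * m * Z \<omega> - m\<^sup>2)" using i1 i2 by auto
    then have i3: "integrable P (\<lambda>\<omega>. (Z \<omega>)\<^sup>2)" by (simp add: power2_eq_square algebra_simps)
    have "distributed P lborel (\<lambda>\<omega>. (Z \<omega> - m) / \<sigma>) std_normal_density"
      using normal_standard_normal_convert[OF 2(1), of Z m] d by simp
    then have std: "distr P lborel (\<lambda>\<omega>. (Z \<omega> - m) / \<sigma>) = std_normal_distribution"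
      by (simp add: distributed_def)
    have "(CLINT \<omega>|P. iexp (Z \<omega>)) = (CLINT \<omega>|P. iexp m * iexp (\<sigma> * ((Z \<omega> - m) / \<sigma>)))"
    proof (intro Bochner_Integration.integral_cong refl)
      fix \<omega>
      have "iexp m * iexp (\<sigma> * ((Z \<omega> - m) / \<sigma>)) = iexp (m + \<sigma> * ((Z \<omega> - m) / \<sigma>))"
        by (simp only: exp_add distrib_left of_real_add)
      also have "m + \<sigma> * ((Z \<omega> - m) / \<sigma>) = Z \<omega>" using 2(1) by simp
      finally show "iexp (Z \<omega>) = iexp m * iexp (\<sigma> * ((Z \<omega> - m) / \<sigma>))" by simp
    qed
    also have "\<dots> = iexp m * (CLINT \<omega>|P. iexp (\<sigma> * ((Z \<omega> - m) / \<sigma>)))"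
      by (rule integral_mult_right_zero)
    also have "(CLINT \<omega>|P. iexp (\<sigma> * ((Z \<omega> - m) / \<sigma>))) = char std_normal_distribution \<sigma>"
      unfolding std[symmetric] char_def by (subst integral_distr) auto
    also have "\<dots> = exp (- (\<sigma>\<^sup>2) / 2)" by (simp add: char_std_normal_distribution)
    finally show ?thesis using i1 i3 E V by simp
  qed
  then show "integrable P Z" "integrable P (\<lambda>\<omega>. (Z \<omega>)\<^sup>2)"
    and "(CLINT \<omega>|P. iexp (Z \<omega>))
      = iexp (LINT \<omega>|P. Z \<omega>) * exp (- (LINT \<omega>|P. (Z \<omega> - (LINT \<omega>|P. Z \<omega>))\<^sup>2) / 2)" by auto
qed

lemma char_normal:
  assumes "0 < v"
  shows "char (density lborel (\<lambda>z. ennreal (normal_density 0 (sqrt v) z))) u = exp (- (u\<^sup>2 * v) / 2)"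
    and "real_distribution (density lborel (\<lambda>z. ennreal (normal_density 0 (sqrt v) z)))"
proof -
  let ?N = "density lborel (\<lambda>z. ennreal (normal_density 0 (sqrt v) z))"
  have p: "prob_space ?N" using assms by (intro prob_space_normal_density) auto
  show "real_distribution ?N"
    using p by (simp add: real_distribution_def real_distribution_axioms_def)
  interpret prob_space ?N by fact
  have d: "distributed ?N lborel (\<lambda>z. u * z + 0) (\<lambda>z. ennreal (normal_density 0 (\<bar>u\<bar> * sqrt v) z))" if "u \<noteq> 0"
  proof -
    have "distributed ?N lborel (\<lambda>z. z) (\<lambda>z. ennreal (normal_density 0 (sqrt v) z))"
      by (simp add: distributed_def distr_id2)
    then show ?thesis using normal_density_affine[of "\<lambda>z. z" 0 "sqrt v" u 0] assms that by simp
  qed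
  have g: "gaussian_rv ?N (\<lambda>z. u * z)"
  proof (cases "u = 0")
    case True
    then have "distr ?N borel (\<lambda>z. u * z) = return borel 0"
      using distr_const[of 0 borel] by simp
    then show ?thesis by (auto simp: gaussian_rv_def)
  next
    case False
    then have "0 < \<bar>u\<bar> * sqrt v \<and> distributed ?N lborel (\<lambda>z. u * z) (\<lambda>z. ennreal (normal_density 0 (\<bar>u\<bar> * sqrt v) z))"
      using d assms by simp
    then show ?thesis unfolding gaussian_rv_def by (intro conjI disjI2) (simp, blast)
  qed
  have EV: "(LINT z|?N. u * z) = 0 \<and> (LINT z|?N. (u * z)\<^sup>2) = u\<^sup>2 * v"
  proof (cases "u = 0")
    case False
    then have pos: "0 < \<bar>u\<bar> * sqrt v" using assms by simp
    have d': "distributed ?N lborel (\<lambda>z. u * z) (normal_density 0 (\<bar>u\<bar> * sqrt v))" using d[OF False] by simp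
    have E: "(LINT z|?N. u * z) = 0" by (rule normal_distributed_expectation[OF pos d'])
    have "(LINT z|?N. (u * z)\<^sup>2) = (\<bar>u\<bar> * sqrt v)\<^sup>2"
      using normal_distributed_variance[OF pos d'] unfolding E by simp
    then show ?thesis using E assms by (simp add: power_mult_distrib)
  qed simp
  then have E: "(LINT z|?N. u * z) = 0" and V: "(LINT z|?N. (u * z)\<^sup>2) = u\<^sup>2 * v" by auto
  show "char ?N u = exp (- (u\<^sup>2 * v) / 2)"
    using gaussian_rv_moments(3)[OF p g] unfolding char_def E diff_0_right V by simp
qed

section \<open>The reflection principle\<close>

text \<open>
  Both families of steps are independent with the same marginals, so they have the same joint
  law.
\<close>

lemma (in prob_space) flip_tail_prob:
  fixes \<xi> :: "nat \<Rightarrow> 'a \<Rightarrow> real"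
  assumes ind: "indep_vars (\<lambda>_. borel) \<xi> {..<m}" and m: "0 < m"
    and sym: "\<And>i. i < m \<Longrightarrow> distr M borel (\<lambda>\<omega>. - \<xi> i \<omega>) = distr M borel (\<xi> i)"
    and B: "B \<in> sets (PiM {..<m} (\<lambda>_. borel))"
  shows "prob {\<omega>\<in>space M. (\<lambda>i\<in>{..<m}. \<xi> i \<omega>) \<in> B}
    = prob {\<omega>\<in>space M. (\<lambda>i\<in>{..<m}. if i < j then \<xi> i \<omega> else - \<xi> i \<omega>) \<in> B}"
proof -
  let ?P = "PiM {..<m} (\<lambda>_. borel :: real measure)"
  define f :: "nat \<Rightarrow> real \<Rightarrow> real" where "f i x = (if i < j then x else - x)" for i x
  have [measurable]: "f i \<in> borel_measurable borel" for i unfolding f_def by measurable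
  have rv[measurable]: "\<xi> i \<in> borel_measurable M" if "i < m" for i
    using ind that by (auto simp: indep_vars_def)
  have ind': "indep_vars (\<lambda>_. borel) (\<lambda>i \<omega>. f i (\<xi> i \<omega>)) {..<m}"
    by (rule indep_vars_compose2[OF ind]) simp
  have law: "distr M borel (\<lambda>\<omega>. f i (\<xi> i \<omega>)) = distr M borel (\<xi> i)" if "i < m" for i
    using sym[OF that] by (cases "i < j") (auto simp: f_def)
  have ne: "{..<m} \<noteq> {}" using m by blast
  have "distr M ?P (\<lambda>\<omega>. \<lambda>i\<in>{..<m}. \<xi> i \<omega>) = PiM {..<m} (\<lambda>i. distr M borel (\<xi> i))"
    using indep_vars_iff_distr_eq_PiM'[where I = "{..<m}" and M' = "\<lambda>_. borel" and X = \<xi>] ind ne by auto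
  also have "\<dots> = PiM {..<m} (\<lambda>i. distr M borel (\<lambda>\<omega>. f i (\<xi> i \<omega>)))"
    by (intro PiM_cong) (auto simp: law)
  also have "\<dots> = distr M ?P (\<lambda>\<omega>. \<lambda>i\<in>{..<m}. f i (\<xi> i \<omega>))"
    using indep_vars_iff_distr_eq_PiM'[where I = "{..<m}" and M' = "\<lambda>_. borel" and X = "\<lambda>i \<omega>. f i (\<xi> i \<omega>)"] ind' ne by auto
  finally have eq: "distr M ?P (\<lambda>\<omega>. \<lambda>i\<in>{..<m}. \<xi> i \<omega>) = distr M ?P (\<lambda>\<omega>. \<lambda>i\<in>{..<m}. f i (\<xi> i \<omega>))" .
  have m1: "(\<lambda>\<omega>. \<lambda>i\<in>{..<m}. \<xi> i \<omega>) \<in> measurable M ?P" by (intro measurable_restrict) auto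
  have m2: "(\<lambda>\<omega>. \<lambda>i\<in>{..<m}. f i (\<xi> i \<omega>)) \<in> measurable M ?P"
    by (intro measurable_restrict) (auto intro: measurable_compose[OF rv])
  have "prob ((\<lambda>\<omega>. \<lambda>i\<in>{..<m}. \<xi> i \<omega>) -` B \<inter> space M) = prob ((\<lambda>\<omega>. \<lambda>i\<in>{..<m}. f i (\<xi> i \<omega>)) -` B \<inter> space M)"
    using arg_cong[OF eq, of "\<lambda>N. measure N B"] B m1 m2 by (simp add: measure_distr)
  moreover have "(\<lambda>i\<in>{..<m}. f i (\<xi> i \<omega>)) = (\<lambda>i\<in>{..<m}. if i < j then \<xi> i \<omega> else - \<xi> i \<omega>)" for \<omega>
    by (auto simp: f_def)
  ultimately show ?thesis by (simp add: vimage_def Int_def conj_commute)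
qed

text \<open>
  Split according to the first index \<open>j\<close> at which the walk exceeds \<open>k\<close> and reverse all later
  steps: this preserves probabilities and turns \<open>S m\<close> into \<open>2 * S j - S m\<close>.  A walk jumps over the
  level \<open>k\<close> instead of hitting it, so \<open>S j\<close> lies in \<open>(k, k + e]\<close> if the steps are bounded
  by \<open>e\<close>; the reflection identity therefore becomes two inequalities that differ by
  \<open>2 * e\<close>.
\<close>

lemma (in prob_space) discrete_reflection:
  fixes \<xi> :: "nat \<Rightarrow> 'a \<Rightarrow> real"
  assumes ind: "indep_vars (\<lambda>_. borel) \<xi> {..<m}" and m: "0 < m"
    and sym: "\<And>i. i < m \<Longrightarrow> distr M borel (\<lambda>\<omega>. - \<xi> i \<omega>) = distr M borel (\<xi> i)"
    and k: "0 \<le> k" "y \<le> k"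
  defines "S \<equiv> \<lambda>j \<omega>. \<Sum>i<j. \<xi> i \<omega>"
  shows "prob {\<omega>\<in>space M. (\<exists>j\<le>m. k < S j \<omega>) \<and> S m \<omega> \<le> y} \<le> prob {\<omega>\<in>space M. 2 * k - y \<le> S m \<omega>}"
    and "0 < e \<Longrightarrow> prob {\<omega>\<in>space M. 2 * k - y + 2 * e \<le> S m \<omega> \<and> (\<forall>i<m. \<bar>\<xi> i \<omega>\<bar> \<le> e)}
      \<le> prob {\<omega>\<in>space M. (\<exists>j\<le>m. k < S j \<omega>) \<and> S m \<omega> \<le> y}"
proof -
  let ?P = "PiM {..<m} (\<lambda>_. borel :: real measure)"
  have rv: "\<xi> i \<in> borel_measurable M" if "i < m" for i
    using ind that by (auto simp: indep_vars_def)
  have Sm: "S j \<in> borel_measurable M" if "j \<le> m" for j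
    unfolding S_def using that by (intro borel_measurable_sum rv) auto
  define E where "E j \<omega> \<longleftrightarrow> (\<forall>i<j. S i \<omega> \<le> k) \<and> k < S j \<omega>" for j \<omega>
  have E_ex: "(\<exists>j\<le>m. k < S j \<omega>) \<longleftrightarrow> (\<exists>j\<le>m. E j \<omega>)" for \<omega>
  proof
    assume "\<exists>j\<le>m. k < S j \<omega>"
    then obtain j where j: "j \<le> m" "k < S j \<omega>" by blast
    define l where "l = (LEAST j. k < S j \<omega>)"
    have "E l \<omega>" unfolding E_def l_def using j(2) by (metis LeastI not_less_Least not_le)
    moreover have "l \<le> m" using j unfolding l_def by (meson Least_le le_trans)
    ultimately show "\<exists>j\<le>m. E j \<omega>" by blast
  qed (auto simp: E_def)
  have E_uniq: "i = j" if "E i \<omega>" "E j \<omega>" for i j \<omega>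
    using that unfolding E_def by (metis linorder_neqE_nat not_le)
  have E_meas: "{\<omega>\<in>space M. E j \<omega> \<and> Q \<omega>} \<in> sets M" if "j \<le> m" "Measurable.pred M Q" for j Q
  proof -
    have "{\<omega>\<in>space M. E j \<omega>} \<in> sets M" unfolding E_def
    proof (intro sets.sets_Collect_conj sets.sets_Collect_countable_All)
      have [measurable]: "S j \<in> borel_measurable M" using Sm that by auto
      show "{\<omega> \<in> space M. k < S j \<omega>} \<in> sets M" by measurable
      fix i
      show "{\<omega> \<in> space M. i < j \<longrightarrow> S i \<omega> \<le> k} \<in> sets M"
      proof (cases "i < j")
        case True
        then have [measurable]: "S i \<in> borel_measurable M" using Sm that by auto
        show ?thesis by measurable
      qed simp
    qed
    then show ?thesis using that(2) by (auto simp: pred_def intro: sets.sets_Collect_conj)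
  qed
  have [measurable]: "S m \<in> borel_measurable M" using Sm by auto
  have flip: "prob {\<omega>\<in>space M. E j \<omega> \<and> S m \<omega> \<le> y} = prob {\<omega>\<in>space M. E j \<omega> \<and> 2 * S j \<omega> - S m \<omega> \<le> y}"
    if j: "j \<le> m" for j
  proof -
    define s where "s i x = (\<Sum>l<i. x l :: real)" for i and x :: "nat \<Rightarrow> real"
    have sm: "s i \<in> borel_measurable ?P" if "i \<le> m" for i
      unfolding s_def using that by (intro borel_measurable_sum measurable_component_singleton) auto
    define B where "B = {x\<in>space ?P. (\<forall>i. i < j \<longrightarrow> s i x \<le> k) \<and> k < s j x \<and> s m x \<le> y}"
    have "B \<in> sets ?P" unfolding B_def
    proof (intro sets.sets_Collect_conj sets.sets_Collect_countable_All)
      have [measurable]: "s j \<in> borel_measurable ?P" "s m \<in> borel_measurable ?P" using sm j by auto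
      show "{x \<in> space ?P. k < s j x} \<in> sets ?P" "{x \<in> space ?P. s m x \<le> y} \<in> sets ?P" by measurable
      fix i
      show "{x \<in> space ?P. i < j \<longrightarrow> s i x \<le> k} \<in> sets ?P"
      proof (cases "i < j")
        case True
        then have [measurable]: "s i \<in> borel_measurable ?P" using sm j by auto
        show ?thesis by measurable
      qed simp
    qed
    note fl = flip_tail_prob[OF ind m sym this, of j]
    have restr: "s i (\<lambda>l\<in>{..<m}. x l) = s i x" if "i \<le> m" for i x
      unfolding s_def using that by (intro sum.cong) auto
    have neg: "s i (\<lambda>l. if l < j then \<xi> l \<omega> else - \<xi> l \<omega>) = S i \<omega>" if "i \<le> j" for i \<omega>
      unfolding s_def S_def using that by (intro sum.cong) auto
    have negm: "s m (\<lambda>l. if l < j then \<xi> l \<omega> else - \<xi> l \<omega>) = 2 * S j \<omega> - S m \<omega>" for \<omega>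
    proof -
      have spl: "{..<m} = {..<j} \<union> {j..<m}" using j by auto
      have "s m (\<lambda>l. if l < j then \<xi> l \<omega> else - \<xi> l \<omega>) = S j \<omega> - (\<Sum>l\<in>{j..<m}. \<xi> l \<omega>)"
        unfolding s_def S_def spl by (subst sum.union_disjoint) (auto simp: sum_negf)
      moreover have "S m \<omega> = S j \<omega> + (\<Sum>l\<in>{j..<m}. \<xi> l \<omega>)"
        unfolding S_def spl by (subst sum.union_disjoint) auto
      ultimately show ?thesis by simp
    qed
    have "{\<omega>\<in>space M. (\<lambda>i\<in>{..<m}. \<xi> i \<omega>) \<in> B} = {\<omega>\<in>space M. E j \<omega> \<and> S m \<omega> \<le> y}"
      using j by (auto simp: B_def space_PiM E_def restr) (auto simp: s_def S_def)
    moreover have "{\<omega>\<in>space M. (\<lambda>i\<in>{..<m}. if i < j then \<xi> i \<omega> else - \<xi> i \<omega>) \<in> B}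
        = {\<omega>\<in>space M. E j \<omega> \<and> 2 * S j \<omega> - S m \<omega> \<le> y}"
      using j by (auto simp: B_def space_PiM E_def restr neg negm)
    ultimately show ?thesis using fl by simp
  qed
  have disj: "disjoint_family_on (\<lambda>j. {\<omega>\<in>space M. E j \<omega> \<and> Q j \<omega>}) {..m}" for Q
    unfolding disjoint_family_on_def using E_uniq by blast
  have "{\<omega>\<in>space M. (\<exists>j\<le>m. k < S j \<omega>) \<and> S m \<omega> \<le> y} = (\<Union>j\<in>{..m}. {\<omega>\<in>space M. E j \<omega> \<and> S m \<omega> \<le> y})"
    unfolding E_ex by auto
  then have "prob {\<omega>\<in>space M. (\<exists>j\<le>m. k < S j \<omega>) \<and> S m \<omega> \<le> y} = (\<Sum>j\<le>m. prob {\<omega>\<in>space M. E j \<omega> \<and> S m \<omega> \<le> y})"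
    by (simp only:) (intro finite_measure_finite_Union disj finite_atMost; auto intro!: E_meas)
  also have "\<dots> = (\<Sum>j\<le>m. prob {\<omega>\<in>space M. E j \<omega> \<and> 2 * S j \<omega> - S m \<omega> \<le> y})"
    by (intro sum.cong flip) auto
  also have "\<dots> = prob (\<Union>j\<in>{..m}. {\<omega>\<in>space M. E j \<omega> \<and> 2 * S j \<omega> - S m \<omega> \<le> y})"
  proof (intro finite_measure_finite_Union[symmetric] disj finite_atMost image_subsetI)
    fix j assume "j \<in> {..m}"
    then have [measurable]: "S j \<in> borel_measurable M" using Sm by auto
    show "{\<omega>\<in>space M. E j \<omega> \<and> 2 * S j \<omega> - S m \<omega> \<le> y} \<in> sets M"
      using \<open>j \<in> _\<close> by (intro E_meas) auto
  qed
  finally have main: "prob {\<omega>\<in>space M. (\<exists>j\<le>m. k < S j \<omega>) \<and> S m \<omega> \<le> y}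
    = prob (\<Union>j\<in>{..m}. {\<omega>\<in>space M. E j \<omega> \<and> 2 * S j \<omega> - S m \<omega> \<le> y})" .
  have U: "(\<Union>j\<in>{..m}. {\<omega>\<in>space M. E j \<omega> \<and> 2 * S j \<omega> - S m \<omega> \<le> y}) \<in> sets M"
  proof (intro sets.finite_UN finite_atMost)
    fix j assume "j \<in> {..m}"
    then have [measurable]: "S j \<in> borel_measurable M" using Sm by auto
    show "{\<omega>\<in>space M. E j \<omega> \<and> 2 * S j \<omega> - S m \<omega> \<le> y} \<in> sets M"
      using \<open>j \<in> _\<close> by (intro E_meas) auto
  qed
  show "prob {\<omega>\<in>space M. (\<exists>j\<le>m. k < S j \<omega>) \<and> S m \<omega> \<le> y} \<le> prob {\<omega>\<in>space M. 2 * k - y \<le> S m \<omega>}"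
    unfolding main by (intro finite_measure_mono) (auto simp: E_def)
  show "prob {\<omega>\<in>space M. 2 * k - y + 2 * e \<le> S m \<omega> \<and> (\<forall>i<m. \<bar>\<xi> i \<omega>\<bar> \<le> e)}
      \<le> prob {\<omega>\<in>space M. (\<exists>j\<le>m. k < S j \<omega>) \<and> S m \<omega> \<le> y}" if e: "0 < e"
    unfolding main
  proof (intro finite_measure_mono U subsetI)
    fix \<omega> assume "\<omega> \<in> {\<omega>\<in>space M. 2 * k - y + 2 * e \<le> S m \<omega> \<and> (\<forall>i<m. \<bar>\<xi> i \<omega>\<bar> \<le> e)}"
    then have w: "\<omega> \<in> space M" "2 * k - y + 2 * e \<le> S m \<omega>" "\<And>i. i < m \<Longrightarrow> \<bar>\<xi> i \<omega>\<bar> \<le> e" by auto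
    then have "k < S m \<omega>" using k e by linarith
    then obtain j where j: "j \<le> m" "E j \<omega>" using E_ex[of \<omega>] by blast
    have "S 0 \<omega> = 0" by (simp add: S_def)
    then have "j \<noteq> 0" using k j(2) unfolding E_def by (metis not_le)
    then obtain i where i: "j = Suc i" by (cases j) auto
    have "S j \<omega> = S i \<omega> + \<xi> i \<omega>" by (simp add: S_def i)
    moreover have "S i \<omega> \<le> k" using j(2) by (simp add: E_def i)
    ultimately have "S j \<omega> \<le> k + e" using w(3)[of i] j(1) i by auto
    then have "2 * S j \<omega> - S m \<omega> \<le> y" using w(2) by linarith
    then show "\<omega> \<in> (\<Union>j\<in>{..m}. {\<omega>\<in>space M. E j \<omega> \<and> 2 * S j \<omega> - S m \<omega> \<le> y})"
      using j w(1) by auto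
  qed
qed

definition dyadic_grid :: "real \<Rightarrow> real \<Rightarrow> nat \<Rightarrow> nat \<Rightarrow> real" where
  "dyadic_grid a b N j = a + (b - a) * real j / 2 ^ N"

lemma dyadic_grid_mem:
  assumes "a \<le> b" "j \<le> 2 ^ N"
  shows "dyadic_grid a b N j \<in> {a..b}"
proof -
  have "real j \<le> 2 ^ N" using assms(2) by simp
  then have "(b - a) * (real j / 2 ^ N) \<le> (b - a) * 1"
    using assms(1) by (intro mult_left_mono) auto
  moreover have "0 \<le> (b - a) * (real j / 2 ^ N)" using assms(1) by simp
  ultimately show ?thesis by (simp add: dyadic_grid_def)
qed

lemma dyadic_grid_refine: "dyadic_grid a b (Suc N) (2 * j) = dyadic_grid a b N j"
  by (simp add: dyadic_grid_def)

lemma dyadic_grid_ends [simp]: "dyadic_grid a b N 0 = a" "dyadic_grid a b N (2 ^ N) = b"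
  by (auto simp: dyadic_grid_def)

text \<open>
  Exceeding \<open>k\<close> strictly is an open condition, so points of a dense set detect it.
\<close>

lemma dyadic_grid_exceed:
  fixes f :: "real \<Rightarrow> real"
  assumes "a < b" and f: "continuous_on {a..b} f"
  shows "(\<exists>u\<in>{a..b}. k < f u) \<longleftrightarrow> (\<exists>N. \<exists>j\<le>2 ^ N. k < f (dyadic_grid a b N j))"
proof
  assume "\<exists>u\<in>{a..b}. k < f u"
  then obtain u where u: "u \<in> {a..b}" "k < f u" by blast
  obtain d where d: "d > 0" "\<And>v. v \<in> {a..b} \<Longrightarrow> dist v u < d \<Longrightarrow> dist (f v) (f u) < f u - k"
    using f u unfolding continuous_on_iff by (metis diff_gt_0_iff_gt)
  obtain N where N: "(b - a) / d < 2 ^ N" using real_arch_pow[of 2 "(b - a) / d"] by auto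
  define j where "j = nat \<lfloor>(u - a) / (b - a) * 2 ^ N\<rfloor>"
  have nn: "0 \<le> (u - a) / (b - a) * 2 ^ N" using u assms(1) by simp
  have jr: "real j = of_int \<lfloor>(u - a) / (b - a) * 2 ^ N\<rfloor>" unfolding j_def using nn by simp
  have j: "real j \<le> (u - a) / (b - a) * 2 ^ N" "(u - a) / (b - a) * 2 ^ N < real j + 1"
    unfolding jr by linarith+
  have "(u - a) / (b - a) * 2 ^ N \<le> 1 * 2 ^ N" using u assms(1) by (intro mult_right_mono) auto
  then have "real j \<le> 2 ^ N" using j(1) by linarith
  then have j_le: "j \<le> 2 ^ N" by simp
  have "dyadic_grid a b N j \<le> u"
    using j(1) assms(1) by (simp add: dyadic_grid_def field_simps)
  moreover have "u < dyadic_grid a b N j + (b - a) / 2 ^ N"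
  proof -
    have "(u - a) * 2 ^ N < (real j + 1) * (b - a)" using j(2) assms(1) by (simp add: field_simps)
    then have "u - a < (real j + 1) * (b - a) / 2 ^ N" by (simp add: pos_less_divide_eq)
    also have "\<dots> = (b - a) * real j / 2 ^ N + (b - a) / 2 ^ N"
      by (simp add: add_divide_distrib[symmetric] algebra_simps)
    finally show ?thesis by (simp add: dyadic_grid_def)
  qed
  moreover have "(b - a) / 2 ^ N < d" using N d(1) by (simp add: field_simps)
  ultimately have "dist (dyadic_grid a b N j) u < d" by (simp add: dist_real_def)
  then have "dist (f (dyadic_grid a b N j)) (f u) < f u - k"
    using assms(1) j_le by (intro d(2) dyadic_grid_mem) auto
  then have "k < f (dyadic_grid a b N j)" by (simp add: dist_real_def)
  then show "\<exists>N. \<exists>j\<le>2 ^ N. k < f (dyadic_grid a b N j)" using j_le by blast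
next
  assume "\<exists>N. \<exists>j\<le>2 ^ N. k < f (dyadic_grid a b N j)"
  then show "\<exists>u\<in>{a..b}. k < f u" using dyadic_grid_mem assms(1) by (metis less_imp_le)
qed

lemma dyadic_grid_small_steps:
  fixes f :: "real \<Rightarrow> real"
  assumes "a < b" and f: "continuous_on {a..b} f" and "0 < e"
  shows "\<exists>N0. \<forall>N\<ge>N0. \<forall>i<2 ^ N. \<bar>f (dyadic_grid a b N (Suc i)) - f (dyadic_grid a b N i)\<bar> \<le> e"
proof -
  have "uniformly_continuous_on {a..b} f" using f by (intro compact_uniformly_continuous) auto
  then obtain d where d: "d > 0" "\<And>x y. x \<in> {a..b} \<Longrightarrow> y \<in> {a..b} \<Longrightarrow> dist y x < d \<Longrightarrow> dist (f y) (f x) < e"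
    unfolding uniformly_continuous_on_def using assms(3) by metis
  obtain N0 where N0: "(b - a) / d < 2 ^ N0" using real_arch_pow[of 2 "(b - a) / d"] by auto
  show ?thesis
  proof (intro exI[of _ N0] allI impI)
    fix N i assume N: "N0 \<le> N" and i: "i < (2::nat) ^ N"
    have "(2::real) ^ N0 \<le> 2 ^ N" using N by simp
    then have "(b - a) / d < 2 ^ N" using N0 by linarith
    then have "(b - a) / 2 ^ N < d" using d(1) by (simp add: field_simps)
    moreover have "dyadic_grid a b N (Suc i) - dyadic_grid a b N i = (b - a) / 2 ^ N"
      by (simp add: dyadic_grid_def field_simps)
    ultimately have "dist (dyadic_grid a b N (Suc i)) (dyadic_grid a b N i) < d"
      using assms(1) by (simp add: dist_real_def)
    then have "dist (f (dyadic_grid a b N (Suc i))) (f (dyadic_grid a b N i)) < e"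
      using i assms(1) by (intro d(2) dyadic_grid_mem) auto
    then show "\<bar>f (dyadic_grid a b N (Suc i)) - f (dyadic_grid a b N i)\<bar> \<le> e"
      by (simp add: dist_real_def)
  qed
qed

definition increment_max :: "(real \<Rightarrow> 'a \<Rightarrow> real) \<Rightarrow> real \<Rightarrow> real \<Rightarrow> 'a \<Rightarrow> real" where
  "increment_max W a b \<omega> = (SUP u\<in>{a..b}. W u \<omega> - W a \<omega>)"

lemma increment_max_greater:
  assumes ab: "a < b" and c: "continuous_on {a..b} (\<lambda>u. W u \<omega>)"
  shows "k < increment_max W a b \<omega> \<longleftrightarrow> (\<exists>u\<in>{a..b}. k < W u \<omega> - W a \<omega>)"
proof -
  have "compact ((\<lambda>u. W u \<omega> - W a \<omega>) ` {a..b})"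
    by (intro compact_continuous_image continuous_intros c) auto
  then have "bdd_above ((\<lambda>u. W u \<omega> - W a \<omega>) ` {a..b})"
    by (simp add: bounded_imp_bdd_above compact_imp_bounded)
  then show ?thesis
    unfolding increment_max_def using ab by (intro less_cSUP_iff) auto
qed

lemma increment_max_ge:
  assumes ab: "a < b" and c: "continuous_on {a..b} (\<lambda>u. W u \<omega>)"
  shows "W b \<omega> - W a \<omega> \<le> increment_max W a b \<omega> \<and> 0 \<le> increment_max W a b \<omega>"
proof -
  have "compact ((\<lambda>u. W u \<omega> - W a \<omega>) ` {a..b})"
    by (intro compact_continuous_image continuous_intros c) auto
  then have bdd: "bdd_above ((\<lambda>u. W u \<omega> - W a \<omega>) ` {a..b})"
    by (simp add: bounded_imp_bdd_above compact_imp_bounded)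
  show ?thesis
    unfolding increment_max_def using cSUP_upper[OF _ bdd, of b] cSUP_upper[OF _ bdd, of a] ab by auto
qed

text \<open>
  The event that the maximum of the increment exceeds \<open>k\<close> while the increment itself is at most
  \<open>y\<close>, with the maximum taken over the dyadic grid only.  It depends on finitely many increments
  and grows to the corresponding event on the whole interval as \<open>N\<close> increases.
\<close>

definition grid_event :: "'a measure \<Rightarrow> (real \<Rightarrow> 'a \<Rightarrow> real) \<Rightarrow> real \<Rightarrow> real \<Rightarrow> nat \<Rightarrow> real \<Rightarrow> real \<Rightarrow> 'a set" where
  "grid_event M W a b N k y = {\<omega>\<in>space M. (\<exists>j\<le>2 ^ N. k < W (dyadic_grid a b N j) \<omega> - W a \<omega>) \<and> W b \<omega> - W a \<omega> \<le> y}"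

lemma grid_event_sets:
  assumes "a < b" and W: "\<And>u. u \<in> {a..b} \<Longrightarrow> W u \<in> borel_measurable M"
  shows "grid_event M W a b N k y \<in> sets M"
proof -
  have [measurable]: "W a \<in> borel_measurable M" "W b \<in> borel_measurable M" using assms by auto
  have "{\<omega>\<in>space M. \<exists>j\<in>{..(2::nat) ^ N}. k < W (dyadic_grid a b N j) \<omega> - W a \<omega>} \<in> sets M"
  proof (rule sets.sets_Collect_finite_Ex)
    fix j assume "j \<in> {..(2::nat) ^ N}"
    then have [measurable]: "W (dyadic_grid a b N j) \<in> borel_measurable M"
      using assms by (intro W dyadic_grid_mem) auto
    show "{\<omega>\<in>space M. k < W (dyadic_grid a b N j) \<omega> - W a \<omega>} \<in> sets M" by measurable
  qed simp
  moreover have "{\<omega>\<in>space M. W b \<omega> - W a \<omega> \<le> y} \<in> sets M" by measurable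
  ultimately have "{\<omega>\<in>space M. \<exists>j\<in>{..(2::nat) ^ N}. k < W (dyadic_grid a b N j) \<omega> - W a \<omega>}
      \<inter> {\<omega>\<in>space M. W b \<omega> - W a \<omega> \<le> y} \<in> sets M" by auto
  also have "{\<omega>\<in>space M. \<exists>j\<in>{..(2::nat) ^ N}. k < W (dyadic_grid a b N j) \<omega> - W a \<omega>}
      \<inter> {\<omega>\<in>space M. W b \<omega> - W a \<omega> \<le> y} = grid_event M W a b N k y"
    unfolding grid_event_def by blast
  finally show ?thesis .
qed

lemma grid_event_incseq: "incseq (\<lambda>N. grid_event M W a b N k y)"
proof (rule incseq_SucI)
  fix N
  show "grid_event M W a b N k y \<subseteq> grid_event M W a b (Suc N) k y"
    unfolding grid_event_def
  proof safe
    fix \<omega> j assume "j \<le> (2::nat) ^ N" "k < W (dyadic_grid a b N j) \<omega> - W a \<omega>"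
    then show "\<exists>j\<le>2 ^ Suc N. k < W (dyadic_grid a b (Suc N) j) \<omega> - W a \<omega>"
      by (intro exI[of _ "2 * j"]) (auto simp: dyadic_grid_refine)
  qed
qed

lemma grid_event_UN:
  assumes ab: "a < b" and c: "\<And>\<omega>. \<omega> \<in> space M \<Longrightarrow> continuous_on {a..b} (\<lambda>u. W u \<omega>)"
  shows "(\<Union>N. grid_event M W a b N k y) = {\<omega>\<in>space M. k < increment_max W a b \<omega> \<and> W b \<omega> - W a \<omega> \<le> y}"
proof -
  have "k < increment_max W a b \<omega> \<longleftrightarrow> (\<exists>N. \<exists>j\<le>2 ^ N. k < W (dyadic_grid a b N j) \<omega> - W a \<omega>)"
    if "\<omega> \<in> space M" for \<omega>
    unfolding increment_max_greater[where W=W, OF ab c[OF that]]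
    by (intro dyadic_grid_exceed[OF ab] continuous_intros c that)
  then show ?thesis unfolding grid_event_def by blast
qed

text \<open>
  Apply \<open>discrete_reflection\<close> on dyadic grids and let the mesh tend to \<open>0\<close>.  For the lower bound,
  every path is uniformly continuous, so from some level on all its steps are at most \<open>e\<close>.
  Letting \<open>e\<close> tend to \<open>0\<close> afterwards leaves a strict inequality in the second bound.
\<close>

lemma (in prob_space) reflection_principle:
  fixes X :: "real \<Rightarrow> 'a \<Rightarrow> real"
  assumes ab: "a < b" and X: "\<And>u. u \<in> {a..b} \<Longrightarrow> X u \<in> borel_measurable M"
    and c: "\<And>\<omega>. \<omega> \<in> space M \<Longrightarrow> continuous_on {a..b} (\<lambda>u. X u \<omega>)"
    and ind: "\<And>N. indep_vars (\<lambda>_. borel)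
        (\<lambda>i \<omega>. X (dyadic_grid a b N (Suc i)) \<omega> - X (dyadic_grid a b N i) \<omega>) {..<2 ^ N}"
    and sym: "\<And>u v. a \<le> u \<Longrightarrow> u < v \<Longrightarrow> v \<le> b \<Longrightarrow>
        distr M borel (\<lambda>\<omega>. - (X v \<omega> - X u \<omega>)) = distr M borel (\<lambda>\<omega>. X v \<omega> - X u \<omega>)"
    and k: "0 \<le> k" "y \<le> k"
  shows "prob {\<omega>\<in>space M. k < increment_max X a b \<omega> \<and> X b \<omega> - X a \<omega> \<le> y}
      \<le> prob {\<omega>\<in>space M. 2 * k - y \<le> X b \<omega> - X a \<omega>}" (is "prob ?A \<le> _")
    and "prob {\<omega>\<in>space M. 2 * k - y < X b \<omega> - X a \<omega>}
      \<le> prob {\<omega>\<in>space M. k < increment_max X a b \<omega> \<and> X b \<omega> - X a \<omega> \<le> y}"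
proof -
  define \<xi> where "\<xi> N i \<omega> = X (dyadic_grid a b N (Suc i)) \<omega> - X (dyadic_grid a b N i) \<omega>" for N i \<omega>
  have S: "(\<Sum>i<j. \<xi> N i \<omega>) = X (dyadic_grid a b N j) \<omega> - X a \<omega>" for N j \<omega>
    unfolding \<xi>_def by (subst sum_lessThan_telescope) simp
  have [measurable]: "X a \<in> borel_measurable M" "X b \<in> borel_measurable M" using X ab by auto
  have gm: "X (dyadic_grid a b N j) \<in> borel_measurable M" if "j \<le> 2 ^ N" for N j
    using X[OF dyadic_grid_mem] ab that by auto
  have step: "dyadic_grid a b N i < dyadic_grid a b N (Suc i)" for N i
    using ab by (simp add: dyadic_grid_def field_simps)
  have sym': "distr M borel (\<lambda>\<omega>. - \<xi> N i \<omega>) = distr M borel (\<xi> N i)" if "i < 2 ^ N" for N i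
  proof -
    have "a \<le> dyadic_grid a b N i" "dyadic_grid a b N (Suc i) \<le> b"
      using dyadic_grid_mem[of a b i N] dyadic_grid_mem[of a b "Suc i" N] that ab by auto
    then show ?thesis unfolding \<xi>_def using step by (intro sym) auto
  qed
  define A where "A N = grid_event M X a b N k y" for N
  have A_meas: "A N \<in> sets M" for N unfolding A_def by (rule grid_event_sets[OF ab X])
  have A_inc: "incseq A" unfolding A_def by (rule grid_event_incseq)
  have A_UN: "(\<Union>N. A N) = ?A" unfolding A_def by (rule grid_event_UN[OF ab c])
  have lim: "(\<lambda>N. prob (A N)) \<longlonglongrightarrow> prob ?A"
    using finite_Lim_measure_incseq[OF _ A_inc] A_meas A_UN by auto
  have A_S: "A N = {\<omega>\<in>space M. (\<exists>j\<le>2 ^ N. k < (\<Sum>i<j. \<xi> N i \<omega>)) \<and> (\<Sum>i<2 ^ N. \<xi> N i \<omega>) \<le> y}" for N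
    unfolding S A_def grid_event_def by simp
  have ind': "indep_vars (\<lambda>_. borel) (\<xi> N) {..<2 ^ N}" for N
    using ind[of N] by (simp add: \<xi>_def[abs_def])
  note refl = discrete_reflection[OF ind' _ sym' k, folded A_S]
  have up: "prob (A N) \<le> prob {\<omega>\<in>space M. 2 * k - y \<le> X b \<omega> - X a \<omega>}" for N
    using refl(1)[of N] by (simp add: S)
  show "prob ?A \<le> prob {\<omega>\<in>space M. 2 * k - y \<le> X b \<omega> - X a \<omega>}"
    by (rule LIMSEQ_le_const2[OF lim]) (use up in auto)
  have A_le: "prob (A N) \<le> prob ?A" for N
    using A_inc lim by (intro incseq_le[OF _ lim]) (auto simp: incseq_def intro!: finite_measure_mono A_meas)
  have low: "prob {\<omega>\<in>space M. 2 * k - y + 2 * e \<le> X b \<omega> - X a \<omega>} \<le> prob ?A" if e: "0 < e" for e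
  proof -
    define G where "G N = {\<omega>\<in>space M. \<forall>i<2 ^ N. \<bar>\<xi> N i \<omega>\<bar> \<le> e}" for N
    define C where "C = {\<omega>\<in>space M. 2 * k - y + 2 * e \<le> X b \<omega> - X a \<omega>}"
    have [measurable]: "C \<in> sets M" unfolding C_def by measurable
    have Gm: "G N \<in> sets M" for N
    proof -
      have "{\<omega>\<in>space M. \<forall>i\<in>{..<(2::nat) ^ N}. \<bar>\<xi> N i \<omega>\<bar> \<le> e} \<in> sets M"
      proof (rule sets.sets_Collect_finite_All)
        fix i assume "i \<in> {..<(2::nat) ^ N}"
        then have [measurable]: "\<xi> N i \<in> borel_measurable M"
          unfolding \<xi>_def using gm by (intro borel_measurable_diff) auto
        show "{\<omega>\<in>space M. \<bar>\<xi> N i \<omega>\<bar> \<le> e} \<in> sets M" by measurable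
      qed simp
      also have "{\<omega>\<in>space M. \<forall>i\<in>{..<(2::nat) ^ N}. \<bar>\<xi> N i \<omega>\<bar> \<le> e} = G N"
        unfolding G_def by blast
      finally show ?thesis .
    qed
    \<comment> \<open>The paths in \<open>C\<close> all of whose steps are at most \<open>e\<close> from level \<open>N\<close> on.\<close>
    define H where "H N = C \<inter> (\<Inter>n\<in>{N..}. G n)" for N
    have Hm: "H N \<in> sets M" for N
      unfolding H_def using Gm by (intro sets.Int sets.countable_INT') auto
    have H_UN: "(\<Union>N. H N) = C"
    proof
      show "C \<subseteq> (\<Union>N. H N)"
      proof
        fix \<omega> assume w: "\<omega> \<in> C"
        then have sp: "\<omega> \<in> space M" by (simp add: C_def)
        obtain N0 where "\<forall>N\<ge>N0. \<forall>i<2 ^ N. \<bar>\<xi> N i \<omega>\<bar> \<le> e"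
          using dyadic_grid_small_steps[OF ab c[OF sp] e] unfolding \<xi>_def by blast
        then have "\<omega> \<in> H N0" using w sp by (auto simp: H_def G_def)
        then show "\<omega> \<in> (\<Union>N. H N)" by blast
      qed
    qed (auto simp: H_def)
    have "incseq H" unfolding incseq_def H_def by fastforce
    then have limH: "(\<lambda>N. prob (H N)) \<longlonglongrightarrow> prob C"
      using finite_Lim_measure_incseq[of H] Hm H_UN by auto
    have "prob (H N) \<le> prob ?A" for N
    proof -
      have "prob (H N) \<le> prob (C \<inter> G N)" using Gm by (intro finite_measure_mono) (auto simp: H_def)
      also have "C \<inter> G N = {\<omega>\<in>space M. 2 * k - y + 2 * e \<le> (\<Sum>i<2 ^ N. \<xi> N i \<omega>) \<and> (\<forall>i<2 ^ N. \<bar>\<xi> N i \<omega>\<bar> \<le> e)}"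
        unfolding S by (auto simp: C_def G_def)
      also have "prob \<dots> \<le> prob (A N)" using e by (intro refl(2)) auto
      also have "\<dots> \<le> prob ?A" by (rule A_le)
      finally show ?thesis .
    qed
    then show ?thesis unfolding C_def[symmetric] by (intro LIMSEQ_le_const2[OF limH]) auto
  qed
  define L where "L n = {\<omega>\<in>space M. 2 * k - y + 2 * (1 / real (Suc n)) \<le> X b \<omega> - X a \<omega>}" for n
  have Lm: "L n \<in> sets M" for n unfolding L_def by measurable
  have "incseq L"
  proof (rule incseq_SucI)
    fix n
    have "1 / real (Suc (Suc n)) \<le> 1 / real (Suc n)" by (simp add: field_simps)
    then show "L n \<subseteq> L (Suc n)" unfolding L_def by auto
  qed
  moreover have "(\<Union>n. L n) = {\<omega>\<in>space M. 2 * k - y < X b \<omega> - X a \<omega>}"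
  proof (intro equalityI subsetI)
    fix \<omega> assume "\<omega> \<in> {\<omega>\<in>space M. 2 * k - y < X b \<omega> - X a \<omega>}"
    then have w: "\<omega> \<in> space M" "0 < (X b \<omega> - X a \<omega> - (2 * k - y)) / 2" by auto
    obtain n where "1 / real (Suc n) < (X b \<omega> - X a \<omega> - (2 * k - y)) / 2"
      using reals_Archimedean[OF w(2)] by (auto simp: inverse_eq_divide)
    then have "\<omega> \<in> L n" using w(1) by (simp add: L_def)
    then show "\<omega> \<in> (\<Union>n. L n)" by blast
  next
    fix \<omega> assume "\<omega> \<in> (\<Union>n. L n)"
    then obtain n where n: "\<omega> \<in> L n" by blast
    have "0 < 1 / real (Suc n)" by simp
    moreover have "2 * k - y + 2 * (1 / real (Suc n)) \<le> X b \<omega> - X a \<omega>" "\<omega> \<in> space M"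
      using n by (simp_all only: L_def mem_Collect_eq)
    ultimately show "\<omega> \<in> {\<omega>\<in>space M. 2 * k - y < X b \<omega> - X a \<omega>}"
      unfolding mem_Collect_eq by linarith
  qed
  ultimately have "(\<lambda>n. prob (L n)) \<longlonglongrightarrow> prob {\<omega>\<in>space M. 2 * k - y < X b \<omega> - X a \<omega>}"
    using finite_Lim_measure_incseq[of L] Lm by auto
  then show "prob {\<omega>\<in>space M. 2 * k - y < X b \<omega> - X a \<omega>} \<le> prob ?A"
    by (rule LIMSEQ_le_const2) (intro exI[of _ 0] allI impI, unfold L_def, rule low, simp)
qed

section \<open>One step of the Pitman transform\<close>

lemma measurable_indicator_ray [measurable (raw)]:
  fixes f g :: "'a \<Rightarrow> real"
  assumes [measurable]: "f \<in> borel_measurable M" "g \<in> borel_measurable M"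
  shows "(\<lambda>x. indicator {f x<..} (g x) :: ennreal) \<in> borel_measurable M"
    and "(\<lambda>x. indicator {..f x} (g x) :: ennreal) \<in> borel_measurable M"
proof -
  have "(\<lambda>x. if f x < g x then 1 else 0 :: ennreal) \<in> borel_measurable M"
    "(\<lambda>x. if g x \<le> f x then 1 else 0 :: ennreal) \<in> borel_measurable M" by measurable
  then show "(\<lambda>x. indicator {f x<..} (g x) :: ennreal) \<in> borel_measurable M"
    "(\<lambda>x. indicator {..f x} (g x) :: ennreal) \<in> borel_measurable M"
    by (simp_all add: indicator_def of_bool_def)
qed

lemma measurable_indicator_interval [measurable (raw)]:
  fixes f g h :: "'a \<Rightarrow> real"
  assumes [measurable]: "f \<in> borel_measurable M" "g \<in> borel_measurable M" "h \<in> borel_measurable M"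
  shows "(\<lambda>x. indicator {f x<..<g x} (h x) :: ennreal) \<in> borel_measurable M"
proof -
  have "(\<lambda>x. if f x < h x \<and> h x < g x then 1 else 0 :: ennreal) \<in> borel_measurable M" by measurable
  then show ?thesis by (simp add: indicator_def of_bool_def)
qed

abbreviation gauss :: "real \<Rightarrow> real \<Rightarrow> real" where
  "gauss v \<equiv> normal_density 0 (sqrt v)"

text \<open>
  The negative derivative of \<open>gauss v\<close>.
\<close>

definition rayleigh :: "real \<Rightarrow> real \<Rightarrow> real" where
  "rayleigh v z = z / v * gauss v z"

lemma gauss_eq: "0 < v \<Longrightarrow> gauss v z = exp (- z\<^sup>2 / (2 * v)) / sqrt (2 * pi * v)"
  by (simp add: normal_density_def)

lemma gauss_even [simp]: "gauss v (- z) = gauss v z"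
  by (simp add: normal_density_def)

lemma gauss_antimono:
  assumes "0 < v" "\<bar>a\<bar> \<le> \<bar>b\<bar>"
  shows "gauss v b \<le> gauss v a"
proof -
  have "a\<^sup>2 \<le> b\<^sup>2" using assms(2) by (simp add: abs_le_square_iff)
  then show ?thesis using assms(1) by (simp add: gauss_eq divide_right_mono)
qed

lemma gauss_abs [simp]: "gauss v \<bar>z\<bar> = gauss v z"
  by (simp add: normal_density_def)

lemma gauss_deriv:
  assumes "0 < v"
  shows "((\<lambda>z. - gauss v z) has_real_derivative rayleigh v z) (at z)"
proof -
  have "((\<lambda>z. - (exp (- z\<^sup>2 / (2 * v)) * c)) has_real_derivative
    z / v * (exp (- z\<^sup>2 / (2 * v)) * c)) (at z)" for c
    using assms by (auto intro!: derivative_eq_intros simp: field_simps)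
  from this[of "1 / sqrt (2 * pi * v)"] show ?thesis using assms by (simp add: gauss_eq rayleigh_def)
qed

lemma borel_measurable_rayleigh [measurable]: "rayleigh v \<in> borel_measurable borel"
  unfolding rayleigh_def by measurable

lemma rayleigh_nonneg: "0 < v \<Longrightarrow> 0 \<le> z \<Longrightarrow> 0 \<le> rayleigh v z"
  by (simp add: rayleigh_def)

lemma gauss_at_top: "0 < v \<Longrightarrow> ((\<lambda>z. - gauss v z) \<longlongrightarrow> 0) at_top"
proof -
  assume v: "0 < v"
  have "filterlim (\<lambda>z::real. z\<^sup>2) at_top at_top" by (intro filterlim_pow_at_top filterlim_ident) auto
  then have "filterlim (\<lambda>z::real. z\<^sup>2 * (1 / (2 * v))) at_top at_top"
    using v by (intro filterlim_at_top_mult_tendsto_pos[of "\<lambda>_. 1 / (2 * v)" "1 / (2 * v)"]) auto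
  then have "filterlim (\<lambda>z::real. - (z\<^sup>2 * (1 / (2 * v)))) at_bot at_top"
    by (simp add: filterlim_uminus_at_bot)
  then have "((\<lambda>z. exp (- (z\<^sup>2 * (1 / (2 * v))))) \<longlongrightarrow> (0::real)) at_top"
    by (rule filterlim_compose[OF exp_at_bot])
  then have "((\<lambda>z. - (exp (- (z\<^sup>2 * (1 / (2 * v)))) / sqrt (2 * pi * v))) \<longlongrightarrow> - (0 / sqrt (2 * pi * v))) at_top"
    using v by (intro tendsto_intros) auto
  then show ?thesis using v by (simp add: gauss_eq)
qed

lemma nn_integral_rayleigh_tail:
  assumes v: "0 < v" and c: "0 \<le> c"
  shows "(\<integral>\<^sup>+z. ennreal (rayleigh v z) * indicator {c<..} z \<partial>lborel) = ennreal (gauss v c)"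
proof -
  have "(\<integral>\<^sup>+z. ennreal (rayleigh v z) * indicator {c<..} z \<partial>lborel)
      = (\<integral>\<^sup>+z. ennreal (rayleigh v z) * indicator {c..} z \<partial>lborel)"
    using AE_lborel_singleton[of c] by (intro nn_integral_cong_AE) (auto simp: indicator_def)
  also have "\<dots> = ennreal (0 - - gauss v c)"
    by (rule nn_integral_FTC_atLeast[OF _ gauss_deriv[OF v] _ gauss_at_top[OF v]])
       (use c v in \<open>auto intro!: rayleigh_nonneg\<close>)
  finally show ?thesis by simp
qed

lemma nn_integral_rayleigh_interval:
  assumes v: "0 < v" and c: "0 \<le> a" "a \<le> b"
  shows "(\<integral>\<^sup>+z. ennreal (rayleigh v z) * indicator {a<..<b} z \<partial>lborel) = ennreal (gauss v a - gauss v b)"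
proof -
  have "(\<integral>\<^sup>+z. ennreal (rayleigh v z) * indicator {a<..<b} z \<partial>lborel)
      = (\<integral>\<^sup>+z. ennreal (rayleigh v z) * indicator {a..b} z \<partial>lborel)"
    using AE_lborel_singleton[of a] AE_lborel_singleton[of b]
    by (intro nn_integral_cong_AE) (auto simp: indicator_def)
  also have "\<dots> = ennreal (- gauss v b - - gauss v a)"
    by (rule nn_integral_FTC_Icc[OF _ has_field_derivative_at_within[OF gauss_deriv[OF v]]])
       (use c v in \<open>auto intro!: rayleigh_nonneg\<close>)
  finally show ?thesis by simp
qed

lemma nn_integral_reflect:
  fixes f :: "real \<Rightarrow> ennreal"
  assumes "f \<in> borel_measurable lborel"
  shows "(\<integral>\<^sup>+x. f (c - x) \<partial>lborel) = (\<integral>\<^sup>+x. f x \<partial>lborel)"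
  using nn_integral_real_affine[OF assms[simplified], of "-1" c] by simp

lemma nn_integral_shift:
  fixes f :: "real \<Rightarrow> ennreal"
  assumes "f \<in> borel_measurable lborel"
  shows "(\<integral>\<^sup>+x. f (c + x) \<partial>lborel) = (\<integral>\<^sup>+x. f x \<partial>lborel)"
  using nn_integral_real_affine[OF assms[simplified], of 1 c] by simp

text \<open>
  The law of \<open>(2 * N - D, D)\<close> for the increment \<open>D\<close> of a Brownian motion over a time \<open>v\<close> and the
  maximum \<open>N\<close> of the increments along the way; see \<open>increment_max_law\<close>.
\<close>

definition step_law :: "real \<Rightarrow> (real \<times> real) measure" where
  "step_law v = density lborel (\<lambda>(z, d). indicator {\<bar>d\<bar><..} z * ennreal (rayleigh v z))"

lemma nn_integral_step_law:
  assumes [measurable]: "f \<in> borel_measurable borel"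
  shows "(\<integral>\<^sup>+p. f p \<partial>step_law v)
    = (\<integral>\<^sup>+d. \<integral>\<^sup>+z. indicator {\<bar>d\<bar><..} z * ennreal (rayleigh v z) * f (z, d) \<partial>lborel \<partial>lborel)"
proof -
  have "(\<lambda>(z, d). indicator {\<bar>d\<bar><..} z * ennreal (rayleigh v z)) \<in> borel_measurable (borel \<Otimes>\<^sub>M borel)"
    unfolding case_prod_unfold by measurable
  then have [measurable]: "(\<lambda>(z, d). indicator {\<bar>d\<bar><..} z * ennreal (rayleigh v z)) \<in> borel_measurable (borel :: (real \<times> real) measure)"
    by (simp add: borel_prod)
  have m2[measurable]: "(\<lambda>p. (case p of (z, d) \<Rightarrow> indicator {\<bar>d\<bar><..} z * ennreal (rayleigh v z)) * f p)
    \<in> borel_measurable (lborel \<Otimes>\<^sub>M lborel)"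
    unfolding lborel_prod by measurable
  have "(\<integral>\<^sup>+p. f p \<partial>step_law v)
    = (\<integral>\<^sup>+p. (case p of (z, d) \<Rightarrow> indicator {\<bar>d\<bar><..} z * ennreal (rayleigh v z)) * f p \<partial>lborel)"
    unfolding step_law_def by (rule nn_integral_density) simp_all
  also have "\<dots> = (\<integral>\<^sup>+p. (case p of (z, d) \<Rightarrow> indicator {\<bar>d\<bar><..} z * ennreal (rayleigh v z)) * f p \<partial>(lborel \<Otimes>\<^sub>M lborel))"
    by (simp add: lborel_prod)
  also have "\<dots> = (\<integral>\<^sup>+d. \<integral>\<^sup>+z. indicator {\<bar>d\<bar><..} z * ennreal (rayleigh v z) * f (z, d) \<partial>lborel \<partial>lborel)"
    by (subst lborel_pair.nn_integral_snd[symmetric]) auto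
  finally show ?thesis .
qed

text \<open>
  The density at \<open>\<rho>\<close> of Brownian motion started in \<open>r\<close> and killed at \<open>0\<close>, after a time
  \<open>v\<close>.  Multiplied by \<open>\<rho> / r\<close> it becomes the transition density of the radius of
  Brownian motion in space.
\<close>

abbreviation (input) radial_kernel :: "real \<Rightarrow> real \<Rightarrow> real \<Rightarrow> real" where
  "radial_kernel v r \<rho> \<equiv> gauss v (\<rho> - r) - gauss v (\<rho> + r)"

text \<open>
  One step of the Pitman chain for a fixed arrival point \<open>y'\<close>.  If \<open>z > r - y'\<close>, the running
  maximum is renewed and the new radius is \<open>z + y\<close>; otherwise it is \<open>r + y - y'\<close>.  In both cases
  the variables are changed so that the radius becomes \<open>\<rho>\<close>, and the remaining integral of the
  derivative \<open>rayleigh\<close> over an interval is a difference of two values of \<open>gauss\<close>.  The boundary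
  terms at \<open>r - y'\<close> cancel in the sum, which leaves a kernel that depends on \<open>y'\<close> only through
  the condition \<open>\<bar>y'\<bar> < \<rho>\<close>.
\<close>

lemma step_fixed_endpoint:
  assumes v: "0 < v" and r: "0 < r" and h[measurable]: "h \<in> borel_measurable borel"
  shows "(\<integral>\<^sup>+y. indicator {-r<..<r} y * (\<integral>\<^sup>+z. indicator {\<bar>y' - y\<bar><..} z * ennreal (rayleigh v z)
            * h (max (r + y - y') (z + y)) \<partial>lborel) \<partial>lborel)
    = (\<integral>\<^sup>+\<rho>. indicator {\<bar>y'\<bar><..} \<rho> * ennreal (radial_kernel v r \<rho>) * h \<rho> \<partial>lborel)"
    (is "?L = ?R")
proof -
  \<comment> \<open>The part \<open>a\<close> is the one where the maximum is renewed, \<open>b\<close> the one where it is not.\<close>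
  define a where "a y z = indicator {-r<..<r} y * indicator {\<bar>y' - y\<bar><..} z * indicator {r - y'<..} z * ennreal (rayleigh v z)" for y z
  define b where "b y z = indicator {-r<..<r} y * indicator {\<bar>y' - y\<bar><..} z * indicator {..r - y'} z * ennreal (rayleigh v z)" for y z
  have am[measurable]: "(\<lambda>p. a (fst p) (snd p)) \<in> borel_measurable (borel \<Otimes>\<^sub>M borel)"
    unfolding a_def by measurable
  have bm[measurable]: "(\<lambda>p. b (fst p) (snd p)) \<in> borel_measurable (borel \<Otimes>\<^sub>M borel)"
    unfolding b_def by measurable
  have bm2[measurable]: "(\<lambda>z. a y z) \<in> borel_measurable borel" "(\<lambda>z. b y z) \<in> borel_measurable borel" for y
    unfolding a_def b_def by measurable
  have "?L = (\<integral>\<^sup>+y. \<integral>\<^sup>+z. a y z * h (z + y) + b y z * h (r + y - y') \<partial>lborel \<partial>lborel)"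
    by (subst nn_integral_cmult[symmetric]; (measurable; fail)?)
       (intro nn_integral_cong; auto simp: a_def b_def indicator_def max_def algebra_simps)
  also have "\<dots> = (\<integral>\<^sup>+y. (\<integral>\<^sup>+z. a y z * h (z + y) \<partial>lborel) + (\<integral>\<^sup>+z. b y z * h (r + y - y') \<partial>lborel) \<partial>lborel)"
    by (intro nn_integral_cong nn_integral_add) measurable
  also have "\<dots> = (\<integral>\<^sup>+y. \<integral>\<^sup>+z. a y z * h (z + y) \<partial>lborel \<partial>lborel) + (\<integral>\<^sup>+y. \<integral>\<^sup>+z. b y z * h (r + y - y') \<partial>lborel \<partial>lborel)"
    by (intro nn_integral_add) measurable
  also have "(\<integral>\<^sup>+y. \<integral>\<^sup>+z. a y z * h (z + y) \<partial>lborel \<partial>lborel)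
     = (\<integral>\<^sup>+\<rho>. indicator {\<bar>y'\<bar><..} \<rho> * ennreal (gauss v (\<rho> - min r (\<rho> + y' - r)) - gauss v (\<rho> + r)) * h \<rho> \<partial>lborel)"
  proof -
    have "(\<integral>\<^sup>+y. \<integral>\<^sup>+z. a y z * h (z + y) \<partial>lborel \<partial>lborel) = (\<integral>\<^sup>+y. \<integral>\<^sup>+\<rho>. a y (\<rho> - y) * h \<rho> \<partial>lborel \<partial>lborel)"
    proof (rule nn_integral_cong)
      fix y
      show "(\<integral>\<^sup>+z. a y z * h (z + y) \<partial>lborel) = (\<integral>\<^sup>+\<rho>. a y (\<rho> - y) * h \<rho> \<partial>lborel)"
      proof -
        have m: "(\<lambda>z. a y z * h (z + y)) \<in> borel_measurable lborel" by measurable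
        show ?thesis by (subst nn_integral_shift[OF m, of "-y", symmetric]) simp
      qed
    qed
    also have "\<dots> = (\<integral>\<^sup>+\<rho>. \<integral>\<^sup>+y. a y (\<rho> - y) * h \<rho> \<partial>lborel \<partial>lborel)"
      by (rule lborel_pair.Fubini') (unfold a_def, measurable)
    also have "\<dots> = (\<integral>\<^sup>+\<rho>. indicator {\<bar>y'\<bar><..} \<rho> * ennreal (gauss v (\<rho> - min r (\<rho> + y' - r)) - gauss v (\<rho> + r)) * h \<rho> \<partial>lborel)"
    proof (intro nn_integral_cong)
      fix \<rho>
      have "(\<integral>\<^sup>+y. a y (\<rho> - y) \<partial>lborel) = (\<integral>\<^sup>+z. a (\<rho> - z) z \<partial>lborel)"
      proof -
        have m: "(\<lambda>y. a y (\<rho> - y)) \<in> borel_measurable lborel" unfolding a_def by measurable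
        show ?thesis by (subst nn_integral_reflect[OF m, of \<rho>, symmetric]) simp
      qed
      also have "\<dots> = indicator {\<bar>y'\<bar><..} \<rho> * ennreal (gauss v (\<rho> - min r (\<rho> + y' - r)) - gauss v (\<rho> + r))"
      proof (cases "\<bar>y'\<bar> < \<rho>")
        case True
        have "a (\<rho> - z) z = ennreal (rayleigh v z) * indicator {\<rho> - min r (\<rho> + y' - r)<..<\<rho> + r} z" for z
          using True by (auto simp: a_def indicator_def)
        then have "(\<integral>\<^sup>+z. a (\<rho> - z) z \<partial>lborel)
          = (\<integral>\<^sup>+z. ennreal (rayleigh v z) * indicator {\<rho> - min r (\<rho> + y' - r)<..<\<rho> + r} z \<partial>lborel)" by simp
        also have "\<dots> = ennreal (gauss v (\<rho> - min r (\<rho> + y' - r)) - gauss v (\<rho> + r))"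
          using True r by (intro nn_integral_rayleigh_interval[OF v]) auto
        finally show ?thesis using True by simp
      next
        case False
        have "a (\<rho> - z) z = 0" for z
          using False by (auto simp: a_def indicator_def)
        then show ?thesis using False by simp
      qed
      finally have I: "(\<integral>\<^sup>+y. a y (\<rho> - y) \<partial>lborel)
        = indicator {\<bar>y'\<bar><..} \<rho> * ennreal (gauss v (\<rho> - min r (\<rho> + y' - r)) - gauss v (\<rho> + r))" .
      have m: "(\<lambda>y. a y (\<rho> - y)) \<in> borel_measurable lborel" unfolding a_def by measurable
      show "(\<integral>\<^sup>+y. a y (\<rho> - y) * h \<rho> \<partial>lborel)
        = indicator {\<bar>y'\<bar><..} \<rho> * ennreal (gauss v (\<rho> - min r (\<rho> + y' - r)) - gauss v (\<rho> + r)) * h \<rho>"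
        by (subst nn_integral_multc[OF m]) (simp only: I)
    qed
    finally show ?thesis .
  qed
  also have "(\<integral>\<^sup>+y. \<integral>\<^sup>+z. b y z * h (r + y - y') \<partial>lborel \<partial>lborel)
     = (\<integral>\<^sup>+\<rho>. indicator {\<bar>y'\<bar><..<2 * r - y'} \<rho> * ennreal (gauss v (\<rho> - r) - gauss v (r - y')) * h \<rho> \<partial>lborel)"
  proof -
    have "(\<integral>\<^sup>+y. \<integral>\<^sup>+z. b y z * h (r + y - y') \<partial>lborel \<partial>lborel) = (\<integral>\<^sup>+\<rho>. \<integral>\<^sup>+z. b ((y' - r) + \<rho>) z * h (r + ((y' - r) + \<rho>) - y') \<partial>lborel \<partial>lborel)"
      by (rule nn_integral_shift[symmetric, of "\<lambda>y. \<integral>\<^sup>+z. b y z * h (r + y - y') \<partial>lborel"]) measurable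
    also have "\<dots> = (\<integral>\<^sup>+\<rho>. (\<integral>\<^sup>+z. b ((y' - r) + \<rho>) z \<partial>lborel) * h \<rho> \<partial>lborel)"
      by (rule nn_integral_cong, subst nn_integral_multc) (simp_all add: bm2)
    also have "\<dots> = (\<integral>\<^sup>+\<rho>. indicator {\<bar>y'\<bar><..<2 * r - y'} \<rho> * ennreal (gauss v (\<rho> - r) - gauss v (r - y')) * h \<rho> \<partial>lborel)"
    proof (intro nn_integral_cong arg_cong2[where f = "(*)"] refl)
      fix \<rho>
      show "(\<integral>\<^sup>+z. b ((y' - r) + \<rho>) z \<partial>lborel) = indicator {\<bar>y'\<bar><..<2 * r - y'} \<rho> * ennreal (gauss v (\<rho> - r) - gauss v (r - y'))"
      proof (cases "\<bar>y'\<bar> < \<rho> \<and> \<rho> < 2 * r - y'")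
        case True
        have "(\<integral>\<^sup>+z. b ((y' - r) + \<rho>) z \<partial>lborel) = (\<integral>\<^sup>+z. ennreal (rayleigh v z) * indicator {\<bar>\<rho> - r\<bar><..<r - y'} z \<partial>lborel)"
          using True AE_lborel_singleton[of "r - y'"]
          by (intro nn_integral_cong_AE) (auto simp: b_def indicator_def abs_if split: if_splits)
        also have "\<dots> = ennreal (gauss v \<bar>\<rho> - r\<bar> - gauss v (r - y'))"
          using True by (intro nn_integral_rayleigh_interval[OF v]) auto
        finally show ?thesis using True by simp
      next
        case False
        have "b ((y' - r) + \<rho>) z = 0" for z
          using False by (auto simp: b_def indicator_def)
        then show ?thesis using False by simp
      qed
    qed
    finally show ?thesis .
  qed
  also have "(\<integral>\<^sup>+\<rho>. indicator {\<bar>y'\<bar><..} \<rho> * ennreal (gauss v (\<rho> - min r (\<rho> + y' - r)) - gauss v (\<rho> + r)) * h \<rho> \<partial>lborel)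
    + (\<integral>\<^sup>+\<rho>. indicator {\<bar>y'\<bar><..<2 * r - y'} \<rho> * ennreal (gauss v (\<rho> - r) - gauss v (r - y')) * h \<rho> \<partial>lborel)
    = (\<integral>\<^sup>+\<rho>. (indicator {\<bar>y'\<bar><..} \<rho> * ennreal (gauss v (\<rho> - min r (\<rho> + y' - r)) - gauss v (\<rho> + r))
       + indicator {\<bar>y'\<bar><..<2 * r - y'} \<rho> * ennreal (gauss v (\<rho> - r) - gauss v (r - y'))) * h \<rho> \<partial>lborel)"
    by (subst nn_integral_add[symmetric]) (measurable, simp add: distrib_right)
  also have "\<dots> = ?R"
  proof (intro nn_integral_cong arg_cong2[where f = "(*)"] refl)
    fix \<rho>
    show "indicator {\<bar>y'\<bar><..} \<rho> * ennreal (gauss v (\<rho> - min r (\<rho> + y' - r)) - gauss v (\<rho> + r))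
       + indicator {\<bar>y'\<bar><..<2 * r - y'} \<rho> * ennreal (gauss v (\<rho> - r) - gauss v (r - y'))
       = indicator {\<bar>y'\<bar><..} \<rho> * ennreal (radial_kernel v r \<rho>)"
    proof (cases "\<bar>y'\<bar> < \<rho> \<and> \<rho> < 2 * r - y'")
      case True
      then have m: "\<rho> - min r (\<rho> + y' - r) = r - y'" by auto
      have "gauss v (\<rho> + r) \<le> gauss v (r - y')" using True r by (intro gauss_antimono[OF v]) auto
      moreover have "gauss v (r - y') \<le> gauss v (\<rho> - r)" using True by (intro gauss_antimono[OF v]) auto
      ultimately show ?thesis using True unfolding m by (simp add: ennreal_plus[symmetric] del: ennreal_plus)
    next
      case False
      then show ?thesis by (cases "\<bar>y'\<bar> < \<rho>") (auto simp: min_def)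
    qed
  qed
  finally show ?thesis .
qed

text \<open>
  The uniform distribution of the position over \<open>(-r, r)\<close> reproduces itself: after one step the
  position is uniform over \<open>(-\<rho>, \<rho>)\<close>, where \<open>\<rho>\<close> is the new radius.  This makes the radius
  a Markov chain of its own.  By Fubini the claim is \<open>step_fixed_endpoint\<close>, integrated over the
  arrival point.
\<close>

lemma pitman_one_step:
  assumes v: "0 < v" and r: "0 < r" and H[measurable]: "H \<in> borel_measurable (borel :: (real \<times> real) measure)"
  shows "(\<integral>\<^sup>+y. indicator {-r<..<r} y * (\<integral>\<^sup>+p. H (max (r - snd p) (fst p + y), y + snd p) \<partial>step_law v) \<partial>lborel)
    = (\<integral>\<^sup>+\<rho>. ennreal (radial_kernel v r \<rho>) * (\<integral>\<^sup>+y. indicator {-\<rho><..<\<rho>} y * H (\<rho>, y) \<partial>lborel) \<partial>lborel)"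
    (is "?L = ?R")
proof -
  have H'[measurable]: "H \<in> borel_measurable (borel \<Otimes>\<^sub>M borel)" by (simp add: borel_prod)
  have "?L = (\<integral>\<^sup>+y. indicator {-r<..<r} y * (\<integral>\<^sup>+d. \<integral>\<^sup>+z. indicator {\<bar>d\<bar><..} z * ennreal (rayleigh v z)
      * H (max (r - d) (z + y), y + d) \<partial>lborel \<partial>lborel) \<partial>lborel)"
    by (subst nn_integral_step_law) (simp_all add: borel_prod[symmetric])
  also have "\<dots> = (\<integral>\<^sup>+y. indicator {-r<..<r} y * (\<integral>\<^sup>+y'. \<integral>\<^sup>+z. indicator {\<bar>y' - y\<bar><..} z * ennreal (rayleigh v z)
      * H (max (r + y - y') (z + y), y') \<partial>lborel \<partial>lborel) \<partial>lborel)"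
  proof (rule nn_integral_cong, rule arg_cong2[where f = "(*)", OF refl])
    fix y
    show "(\<integral>\<^sup>+d. \<integral>\<^sup>+z. indicator {\<bar>d\<bar><..} z * ennreal (rayleigh v z) * H (max (r - d) (z + y), y + d) \<partial>lborel \<partial>lborel)
      = (\<integral>\<^sup>+y'. \<integral>\<^sup>+z. indicator {\<bar>y' - y\<bar><..} z * ennreal (rayleigh v z) * H (max (r + y - y') (z + y), y') \<partial>lborel \<partial>lborel)"
    proof -
      have m: "(\<lambda>y'. \<integral>\<^sup>+z. indicator {\<bar>y' - y\<bar><..} z * ennreal (rayleigh v z) * H (max (r + y - y') (z + y), y') \<partial>lborel)
        \<in> borel_measurable lborel" by measurable
      show ?thesis
        by (subst nn_integral_shift[OF m, of y, symmetric]) (simp add: algebra_simps)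
    qed
  qed
  also have "\<dots> = (\<integral>\<^sup>+y. \<integral>\<^sup>+y'. indicator {-r<..<r} y * (\<integral>\<^sup>+z. indicator {\<bar>y' - y\<bar><..} z * ennreal (rayleigh v z)
      * H (max (r + y - y') (z + y), y') \<partial>lborel) \<partial>lborel \<partial>lborel)"
    by (intro nn_integral_cong nn_integral_cmult[symmetric]) measurable
  also have "\<dots> = (\<integral>\<^sup>+y'. \<integral>\<^sup>+y. indicator {-r<..<r} y * (\<integral>\<^sup>+z. indicator {\<bar>y' - y\<bar><..} z * ennreal (rayleigh v z)
      * H (max (r + y - y') (z + y), y') \<partial>lborel) \<partial>lborel \<partial>lborel)"
    by (rule lborel_pair.Fubini') measurable
  also have "\<dots> = (\<integral>\<^sup>+y'. \<integral>\<^sup>+\<rho>. indicator {\<bar>y'\<bar><..} \<rho> * ennreal (radial_kernel v r \<rho>) * H (\<rho>, y') \<partial>lborel \<partial>lborel)"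
    by (intro nn_integral_cong step_fixed_endpoint[OF v r]) measurable
  also have "\<dots> = (\<integral>\<^sup>+\<rho>. \<integral>\<^sup>+y'. indicator {\<bar>y'\<bar><..} \<rho> * ennreal (radial_kernel v r \<rho>) * H (\<rho>, y') \<partial>lborel \<partial>lborel)"
    by (rule lborel_pair.Fubini') measurable
  also have "\<dots> = ?R"
  proof (intro nn_integral_cong)
    fix \<rho>
    have "(\<integral>\<^sup>+y'. indicator {\<bar>y'\<bar><..} \<rho> * ennreal (radial_kernel v r \<rho>) * H (\<rho>, y') \<partial>lborel)
      = (\<integral>\<^sup>+y. ennreal (radial_kernel v r \<rho>) * (indicator {-\<rho><..<\<rho>} y * H (\<rho>, y)) \<partial>lborel)"
      by (intro nn_integral_cong) (auto simp: indicator_def abs_if split: if_splits)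
    also have "\<dots> = ennreal (radial_kernel v r \<rho>) * (\<integral>\<^sup>+y. indicator {-\<rho><..<\<rho>} y * H (\<rho>, y) \<partial>lborel)"
      by (rule nn_integral_cmult) measurable
    finally show "(\<integral>\<^sup>+y'. indicator {\<bar>y'\<bar><..} \<rho> * ennreal (radial_kernel v r \<rho>) * H (\<rho>, y') \<partial>lborel) = \<dots>" .
  qed
  finally show ?thesis .
qed

section \<open>The joint law of an increment and its maximum\<close>

lemma sets_step_law [simp, measurable_cong]: "sets (step_law v) = sets borel"
  by (simp add: step_law_def)

abbreviation quadrants :: "(real \<times> real) set set" where
  "quadrants \<equiv> {{k<..} \<times> {..y} | k y. True}"

lemma borel_plane_generator:
  "sets (borel \<Otimes>\<^sub>M borel :: (real \<times> real) measure) = sigma_sets UNIV quadrants"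
proof -
  have cover: "\<exists>A\<subseteq>range greaterThan. countable A \<and> (UNIV :: real set) = \<Union>A"
    "\<exists>B\<subseteq>range atMost. countable B \<and> (UNIV :: real set) = \<Union>B"
  proof -
    have "x \<in> \<Union> (range (\<lambda>n::nat. {- real n<..}))" "x \<in> \<Union> (range (\<lambda>n::nat. {..real n}))" for x :: real
    proof -
      obtain n where "- x < real n" using reals_Archimedean2 by blast
      then show "x \<in> \<Union> (range (\<lambda>n::nat. {- real n<..}))" by (auto intro!: exI[of _ n])
      obtain n where "x < real n" using reals_Archimedean2 by blast
      then show "x \<in> \<Union> (range (\<lambda>n::nat. {..real n}))" by (auto intro!: exI[of _ n])
    qed
    then have "UNIV = \<Union> (range (\<lambda>n::nat. {- real n<..}))" "UNIV = \<Union> (range (\<lambda>n::nat. {..real n}))"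
      by blast+
    then show "\<exists>A\<subseteq>range greaterThan. countable A \<and> (UNIV :: real set) = \<Union>A"
      "\<exists>B\<subseteq>range atMost. countable B \<and> (UNIV :: real set) = \<Union>B"
      by (intro exI[of _ "range (\<lambda>n::nat. {- real n<..})"] exI[of _ "range (\<lambda>n::nat. {..real n})"] conjI;
          auto)+
  qed
  have "sets (borel \<Otimes>\<^sub>M borel :: (real \<times> real) measure)
    = sets (sigma UNIV (range greaterThan) \<Otimes>\<^sub>M sigma UNIV (range atMost))"
    by (rule sets_pair_measure_cong) (simp_all only: borel_Ioi[symmetric] borel_eq_atMost[symmetric])
  also have "\<dots> = sets (sigma (UNIV \<times> UNIV) {a \<times> b | a b. a \<in> range greaterThan \<and> b \<in> range atMost})"
    by (subst sigma_prod) (use cover in auto)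
  also have "\<dots> = sigma_sets UNIV quadrants"
    by (subst sets_measure_of) (auto intro!: arg_cong2[where f = sigma_sets])
  finally show ?thesis .
qed

lemma Int_stable_quadrants: "Int_stable quadrants"
proof (rule Int_stableI)
  fix A B assume "A \<in> quadrants" "B \<in> quadrants"
  then obtain k y k' y' :: real where "A = {k<..} \<times> {..y}" "B = {k'<..} \<times> {..y'}" by blast
  then have "A \<inter> B = {max k k'<..} \<times> {..min y y'}" by auto
  then show "A \<inter> B \<in> quadrants" by blast
qed

text \<open>
  Quadrants determine the joint law of maximum and increment.  The reflection identity gives their
  mass for \<open>0 \<le> k\<close> and \<open>y \<le> k\<close>.  For \<open>k < 0\<close> the condition on the maximum is void, and for
  \<open>y > k\<close> the additional event \<open>k < D \<le> y\<close> forces the maximum above \<open>k\<close>.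
\<close>

lemma (in prob_space) law_of_increment_and_max:
  fixes Mx D :: "'a \<Rightarrow> real"
  assumes v: "0 < v" and [measurable]: "Mx \<in> borel_measurable M" "D \<in> borel_measurable M"
    and le: "\<And>\<omega>. \<omega> \<in> space M \<Longrightarrow> D \<omega> \<le> Mx \<omega> \<and> 0 \<le> Mx \<omega>"
    and D: "distr M lborel D = density lborel (\<lambda>z. ennreal (gauss v z))"
    and refl: "\<And>k y. 0 \<le> k \<Longrightarrow> y \<le> k \<Longrightarrow>
      prob {\<omega>\<in>space M. k < Mx \<omega> \<and> D \<omega> \<le> y} = prob {\<omega>\<in>space M. 2 * k - y \<le> D \<omega>}"
  shows "distr M borel (\<lambda>\<omega>. (2 * Mx \<omega> - D \<omega>, D \<omega>)) = step_law v"
proof -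
  let ?B = "borel \<Otimes>\<^sub>M borel :: (real \<times> real) measure"
  \<comment> \<open>Maximum and increment are recovered from the pair in \<open>step_law\<close> by a linear map, and quadrants
      are tested in these coordinates.\<close>
  define N1 where "N1 = distr M ?B (\<lambda>\<omega>. (Mx \<omega>, D \<omega>))"
  define N2 where "N2 = distr (step_law v) ?B (\<lambda>p. ((fst p + snd p) / 2, snd p))"
  have T'm: "(\<lambda>p. ((fst p + snd p) / 2, snd p)) \<in> measurable (step_law v) ?B"
  proof -
    have "(\<lambda>p. ((fst p + snd p) / 2, snd p)) \<in> measurable ?B ?B" by measurable
    then show ?thesis by (simp add: borel_prod)
  qed
  have law: "emeasure M {\<omega>\<in>space M. D \<omega> \<in> A} = (\<integral>\<^sup>+z. ennreal (gauss v z) * indicator A z \<partial>lborel)"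
    if [measurable]: "A \<in> sets borel" for A
  proof -
    have "emeasure M {\<omega>\<in>space M. D \<omega> \<in> A} = emeasure (distr M lborel D) A"
      by (subst emeasure_distr) (auto intro!: arg_cong[where f = "emeasure M"])
    also have "\<dots> = (\<integral>\<^sup>+z. ennreal (gauss v z) * indicator A z \<partial>lborel)"
      unfolding D by (subst emeasure_density) auto
    finally show ?thesis .
  qed
  have eq: "emeasure N1 ({k<..} \<times> {..y}) = emeasure N2 ({k<..} \<times> {..y})" for k y
  proof -
    have S[measurable]: "{k<..} \<times> {..y} \<in> sets ?B" by measurable
    have "emeasure N2 ({k<..} \<times> {..y}) = (\<integral>\<^sup>+p. indicator ({k<..} \<times> {..y}) ((fst p + snd p) / 2, snd p) \<partial>step_law v)"
    proof -
      have "emeasure N2 ({k<..} \<times> {..y}) = (\<integral>\<^sup>+p. indicator ({k<..} \<times> {..y}) p \<partial>N2)"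
        by (subst nn_integral_indicator) (auto simp: N2_def)
      also have "\<dots> = (\<integral>\<^sup>+p. indicator ({k<..} \<times> {..y}) ((fst p + snd p) / 2, snd p) \<partial>step_law v)"
        unfolding N2_def by (rule nn_integral_distr[OF T'm]) simp
      finally show ?thesis .
    qed
    also have "\<dots> = (\<integral>\<^sup>+d. \<integral>\<^sup>+z. indicator {\<bar>d\<bar><..} z * ennreal (rayleigh v z)
        * indicator ({k<..} \<times> {..y}) ((z + d) / 2, d) \<partial>lborel \<partial>lborel)"
    proof -
      have "(\<lambda>p. indicator ({k<..} \<times> {..y}) ((fst p + snd p) / 2, snd p) :: ennreal) \<in> borel_measurable ?B"
        by measurable
      then have m: "(\<lambda>p. indicator ({k<..} \<times> {..y}) ((fst p + snd p) / 2, snd p) :: ennreal) \<in> borel_measurable borel"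
        by (simp add: borel_prod)
      show ?thesis using nn_integral_step_law[OF m, of v] by simp
    qed
    also have "\<dots> = (\<integral>\<^sup>+d. ennreal (gauss v (max \<bar>d\<bar> (2 * k - d))) * indicator {..y} d \<partial>lborel)"
    proof (rule nn_integral_cong)
      fix d
      have "(\<integral>\<^sup>+z. indicator {\<bar>d\<bar><..} z * ennreal (rayleigh v z) * indicator ({k<..} \<times> {..y}) ((z + d) / 2, d) \<partial>lborel)
        = (\<integral>\<^sup>+z. ennreal (rayleigh v z) * indicator {max \<bar>d\<bar> (2 * k - d)<..} z * indicator {..y} d \<partial>lborel)"
        by (intro nn_integral_cong) (auto simp: indicator_def)
      also have "\<dots> = (\<integral>\<^sup>+z. ennreal (rayleigh v z) * indicator {max \<bar>d\<bar> (2 * k - d)<..} z \<partial>lborel) * indicator {..y} d"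
        by (rule nn_integral_multc) measurable
      also have "\<dots> = ennreal (gauss v (max \<bar>d\<bar> (2 * k - d))) * indicator {..y} d"
        by (subst nn_integral_rayleigh_tail[OF v]) auto
      finally show "(\<integral>\<^sup>+z. indicator {\<bar>d\<bar><..} z * ennreal (rayleigh v z) * indicator ({k<..} \<times> {..y}) ((z + d) / 2, d) \<partial>lborel)
        = ennreal (gauss v (max \<bar>d\<bar> (2 * k - d))) * indicator {..y} d" .
    qed
    finally have N2: "emeasure N2 ({k<..} \<times> {..y})
      = (\<integral>\<^sup>+d. ennreal (gauss v (max \<bar>d\<bar> (2 * k - d))) * indicator {..y} d \<partial>lborel)" .
    have N1: "emeasure N1 ({k<..} \<times> {..y}) = emeasure M {\<omega>\<in>space M. k < Mx \<omega> \<and> D \<omega> \<le> y}"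
      unfolding N1_def by (subst emeasure_distr) (auto intro!: arg_cong[where f = "emeasure M"])
    have low: "emeasure M {\<omega>\<in>space M. k < Mx \<omega> \<and> D \<omega> \<le> y}
        = (\<integral>\<^sup>+d. ennreal (gauss v (max \<bar>d\<bar> (2 * k - d))) * indicator {..y} d \<partial>lborel)"
      if ky: "0 \<le> k" "y \<le> k" for y
    proof -
      have "emeasure M {\<omega>\<in>space M. k < Mx \<omega> \<and> D \<omega> \<le> y} = emeasure M {\<omega>\<in>space M. D \<omega> \<in> {2 * k - y..}}"
        using refl[OF ky] by (simp add: emeasure_eq_measure)
      also have "\<dots> = (\<integral>\<^sup>+z. ennreal (gauss v z) * indicator {2 * k - y..} z \<partial>lborel)"
        by (rule law) simp
      also have "\<dots> = (\<integral>\<^sup>+d. ennreal (gauss v (2 * k - d)) * indicator {2 * k - y..} (2 * k - d) \<partial>lborel)"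
        by (rule nn_integral_reflect[symmetric]) measurable
      also have "\<dots> = (\<integral>\<^sup>+d. ennreal (gauss v (max \<bar>d\<bar> (2 * k - d))) * indicator {..y} d \<partial>lborel)"
        using ky by (intro nn_integral_cong) (auto simp: indicator_def max_def)
      finally show ?thesis .
    qed
    consider "k < 0" | "0 \<le> k" "y \<le> k" | "0 \<le> k" "k < y" by linarith
    then show ?thesis
    proof cases
      case 1
      have "{\<omega>\<in>space M. k < Mx \<omega> \<and> D \<omega> \<le> y} = {\<omega>\<in>space M. D \<omega> \<in> {..y}}"
        using le 1 by force
      then have "emeasure N1 ({k<..} \<times> {..y}) = (\<integral>\<^sup>+z. ennreal (gauss v z) * indicator {..y} z \<partial>lborel)"
        unfolding N1 using law[of "{..y}"] by simp
      moreover have "max \<bar>d\<bar> (2 * k - d) = \<bar>d\<bar>" for d using 1 by auto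
      ultimately show ?thesis unfolding N2 by simp
    next
      case 2
      then show ?thesis unfolding N1 N2 by (rule low)
    next
      case 3
      have "{\<omega>\<in>space M. k < Mx \<omega> \<and> D \<omega> \<le> y}
        = {\<omega>\<in>space M. k < Mx \<omega> \<and> D \<omega> \<le> k} \<union> {\<omega>\<in>space M. D \<omega> \<in> {k<..y}}"
        using le 3 by force
      moreover have "emeasure M ({\<omega>\<in>space M. k < Mx \<omega> \<and> D \<omega> \<le> k} \<union> {\<omega>\<in>space M. D \<omega> \<in> {k<..y}})
        = emeasure M {\<omega>\<in>space M. k < Mx \<omega> \<and> D \<omega> \<le> k} + emeasure M {\<omega>\<in>space M. D \<omega> \<in> {k<..y}}"
        by (rule plus_emeasure[symmetric]) auto
      ultimately have "emeasure N1 ({k<..} \<times> {..y})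
        = emeasure M {\<omega>\<in>space M. k < Mx \<omega> \<and> D \<omega> \<le> k} + emeasure M {\<omega>\<in>space M. D \<omega> \<in> {k<..y}}"
        unfolding N1 by (simp only:)
      also have "\<dots> = (\<integral>\<^sup>+d. ennreal (gauss v (max \<bar>d\<bar> (2 * k - d))) * indicator {..k} d \<partial>lborel)
          + (\<integral>\<^sup>+z. ennreal (gauss v z) * indicator {k<..y} z \<partial>lborel)"
        using low[of k] law[of "{k<..y}"] 3 by simp
      also have "\<dots> = (\<integral>\<^sup>+d. ennreal (gauss v (max \<bar>d\<bar> (2 * k - d))) * indicator {..k} d
          + ennreal (gauss v d) * indicator {k<..y} d \<partial>lborel)"
        by (rule nn_integral_add[symmetric]) measurable
      also have "\<dots> = (\<integral>\<^sup>+d. ennreal (gauss v (max \<bar>d\<bar> (2 * k - d))) * indicator {..y} d \<partial>lborel)"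
        using 3 by (intro nn_integral_cong) (auto simp: indicator_def max_def)
      finally show ?thesis unfolding N2 .
    qed
  qed
  have pN1: "prob_space N1" unfolding N1_def by (rule prob_space_distr) measurable
  have N12: "N1 = N2"
  proof (rule measure_eqI_generator_eq[OF Int_stable_quadrants _ _ _ _, where \<Omega> = UNIV
        and A = "\<lambda>n. {- real n<..} \<times> {..real n}"])
    show "emeasure N1 X = emeasure N2 X" if "X \<in> quadrants" for X
      using that eq by auto
    show "sets N1 = sigma_sets UNIV quadrants"
      "sets N2 = sigma_sets UNIV quadrants"
      using borel_plane_generator by (simp_all add: N1_def N2_def)
    show "(\<Union>n::nat. {- real n<..} \<times> {..real n}) = UNIV"
    proof (intro equalityI subsetI)
      fix x :: "real \<times> real"
      obtain n where "max (- fst x) (snd x) < real n" using reals_Archimedean2 by blast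
      then show "x \<in> (\<Union>n::nat. {- real n<..} \<times> {..real n})" by (auto intro!: exI[of _ n] simp: mem_Times_iff)
    qed simp
    show "emeasure N1 ({- real n<..} \<times> {..real n}) \<noteq> \<infinity>" for n
      using finite_measure.emeasure_finite[OF prob_space.finite_measure[OF pN1]] by simp
  qed auto
  have Tm: "(\<lambda>p. (2 * fst p - snd p, snd p)) \<in> measurable ?B ?B" by measurable
  have "distr M borel (\<lambda>\<omega>. (2 * Mx \<omega> - D \<omega>, D \<omega>)) = distr N1 ?B (\<lambda>p. (2 * fst p - snd p, snd p))"
    unfolding N1_def by (subst distr_distr[OF Tm]) (auto simp: comp_def borel_prod)
  also have "\<dots> = distr (step_law v) ?B (\<lambda>p. p)"
    unfolding N12 N2_def by (subst distr_distr[OF Tm T'm]) (auto simp: comp_def field_simps)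
  also have "\<dots> = step_law v" by (rule distr_id2) (simp only: borel_prod sets_step_law)
  finally show ?thesis .
qed

text \<open>
  Pulled back along the variables, the generators are families of events that are stable under
  intersection, to which the criterion for independent families applies.
\<close>

lemma (in prob_space) indep_vars_generator:
  assumes rv: "\<And>i. i \<in> I \<Longrightarrow> X i \<in> measurable M (M' i)"
    and gen: "\<And>i. i \<in> I \<Longrightarrow> sets (M' i) = sigma_sets (space (M' i)) (E i)"
    and st: "\<And>i. i \<in> I \<Longrightarrow> Int_stable (E i)"
    and sub: "\<And>i. i \<in> I \<Longrightarrow> E i \<subseteq> Pow (space (M' i))"
    and ind: "\<And>J A. J \<subseteq> I \<Longrightarrow> J \<noteq> {} \<Longrightarrow> finite J \<Longrightarrow> (\<And>i. i \<in> J \<Longrightarrow> A i \<in> E i) \<Longrightarrow>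
      prob (\<Inter>i\<in>J. X i -` A i \<inter> space M) = (\<Prod>i\<in>J. prob (X i -` A i \<inter> space M))"
  shows "indep_vars M' X I"
proof -
  define G where "G i = {X i -` A \<inter> space M | A. A \<in> E i}" for i
  have Gev: "G i \<subseteq> events" if "i \<in> I" for i
  proof
    fix S assume "S \<in> G i"
    then obtain A where A: "A \<in> E i" "S = X i -` A \<inter> space M" by (auto simp: G_def)
    have "A \<in> sets (M' i)" unfolding gen[OF that] using A(1) by (rule sigma_sets.Basic)
    then show "S \<in> events" unfolding A(2) using rv[OF that] by (rule measurable_sets[rotated])
  qed
  have "indep_sets G I"
  proof (rule indep_setsI)
    fix i assume "i \<in> I" then show "G i \<subseteq> events" by (rule Gev)
  next
    fix B J assume J: "J \<noteq> {}" "J \<subseteq> I" "finite J" and B: "\<forall>j\<in>J. B j \<in> G j"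
    have "\<forall>j\<in>J. \<exists>A. A \<in> E j \<and> B j = X j -` A \<inter> space M" using B by (auto simp: G_def)
    then obtain A where A: "\<And>j. j \<in> J \<Longrightarrow> A j \<in> E j" "\<And>j. j \<in> J \<Longrightarrow> B j = X j -` A j \<inter> space M"
      by metis
    show "prob (\<Inter>j\<in>J. B j) = (\<Prod>j\<in>J. prob (B j))"
      using ind[OF J(2,1,3) A(1)] A(2) by simp
  qed
  then have "indep_sets (\<lambda>i. sigma_sets (space M) (G i)) I"
  proof (rule indep_sets_sigma)
    fix i assume i: "i \<in> I"
    show "Int_stable (G i)"
    proof (rule Int_stableI)
      fix a b assume "a \<in> G i" "b \<in> G i"
      then obtain A B where AB: "A \<in> E i" "a = X i -` A \<inter> space M" "B \<in> E i" "b = X i -` B \<inter> space M"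
        by (auto simp: G_def)
      have "A \<inter> B \<in> E i" using st[OF i] AB by (auto simp: Int_stable_def)
      moreover have "a \<inter> b = X i -` (A \<inter> B) \<inter> space M" using AB by auto
      ultimately show "a \<inter> b \<in> G i" unfolding G_def by blast
    qed
  qed
  moreover have "sigma_sets (space M) (G i) = sigma_sets (space M) {X i -` A \<inter> space M | A. A \<in> sets (M' i)}"
    if i: "i \<in> I" for i
  proof -
    have "X i \<in> space M \<rightarrow> space (M' i)" using rv[OF i] by (rule measurable_space[THEN funcsetI])
    then have "{X i -` A \<inter> space M | A. A \<in> sets (M' i)} = sigma_sets (space M) (G i)"
      unfolding gen[OF i] G_def by (rule sigma_sets_vimage_commute)
    moreover have "G i \<subseteq> Pow (space M)" by (auto simp: G_def)
    ultimately show ?thesis by (simp add: sigma_sets_sigma_sets_eq)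
  qed
  ultimately show ?thesis
    unfolding indep_vars_def using rv by (auto cong: indep_sets_cong)
qed

lemma measurable_increment_max:
  assumes ab: "a < b" and W: "\<And>u. u \<in> {a..b} \<Longrightarrow> W u \<in> borel_measurable M"
    and c: "\<And>\<omega>. \<omega> \<in> space M \<Longrightarrow> continuous_on {a..b} (\<lambda>u. W u \<omega>)"
  shows "increment_max W a b \<in> borel_measurable M"
proof (rule borel_measurableI_greater)
  fix k
  have "{\<omega> \<in> space M. k < increment_max W a b \<omega>}
    = (\<Union>n. {\<omega>\<in>space M. k < increment_max W a b \<omega> \<and> W b \<omega> - W a \<omega> \<le> real n})"
    using real_arch_simple by auto
  also have "\<dots> = (\<Union>n. \<Union>N. grid_event M W a b N k (real n))"
    by (simp only: grid_event_UN[OF ab c])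
  also have "\<dots> \<in> sets M"
    by (intro sets.countable_UN' countableI_type image_subsetI grid_event_sets ab W) auto
  finally show "{\<omega> \<in> space M. k < increment_max W a b \<omega>} \<in> sets M" .
qed

abbreviation (input) increment :: "(real \<Rightarrow> 'a \<Rightarrow> real) \<Rightarrow> (nat \<Rightarrow> real) \<Rightarrow> nat \<Rightarrow> 'a \<Rightarrow> real" where
  "increment X \<tau> i \<omega> \<equiv> X (\<tau> (Suc i)) \<omega> - X (\<tau> i) \<omega>"

lemma strict_chain_mono:
  fixes \<tau> :: "nat \<Rightarrow> real"
  assumes "\<And>i. i < n \<Longrightarrow> \<tau> i < \<tau> (Suc i)" "i \<le> j" "j \<le> n"
  shows "\<tau> i \<le> \<tau> j"
  using assms(2,3)
proof (induction j)
  case (Suc j)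
  then show ?case using assms(1)[of j] by (cases "i = Suc j") force+
qed simp

context prob_space begin

text \<open>
  Subdivide all intervals of the partition dyadically.  The increments along the finer partition are
  independent, and the event that belongs to the interval \<open>i\<close> depends on the \<open>i\<close>-th block of
  \<open>2 ^ N\<close> of them.
\<close>

lemma indep_grid_events:
  assumes bm: "standard_brownian_motion t M (W :: real \<Rightarrow> 'a \<Rightarrow> real)"
    and \<tau>: "0 \<le> \<tau> 0" "\<And>i. i < n \<Longrightarrow> \<tau> i < \<tau> (Suc i)" "\<tau> n \<le> t"
    and J: "J \<subseteq> {..<n}" "J \<noteq> {}"
  shows "prob (\<Inter>i\<in>J. grid_event M W (\<tau> i) (\<tau> (Suc i)) N (k i) (y i))
    = (\<Prod>i\<in>J. prob (grid_event M W (\<tau> i) (\<tau> (Suc i)) N (k i) (y i)))"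
proof -
  define m where "m = (2::nat) ^ N"
  have m: "0 < m" by (simp add: m_def)
  \<comment> \<open>The refined partition, with \<open>m\<close> steps in each interval; at the ends of blocks the grids match.\<close>
  define \<sigma> where "\<sigma> l = dyadic_grid (\<tau> (l div m)) (\<tau> (Suc (l div m))) N (l mod m)" for l
  have \<sigma>_block: "\<sigma> (i * m + j) = dyadic_grid (\<tau> i) (\<tau> (Suc i)) N j" if "j \<le> m" for i j
  proof (cases "j = m")
    case True
    then have "i * m + j = Suc i * m + 0" by simp
    then have "(i * m + j) div m = Suc i" "(i * m + j) mod m = 0" using m by (simp_all del: mult_Suc)
    then show ?thesis unfolding \<sigma>_def True m_def by simp
  next
    case False
    then show ?thesis using that m by (simp add: \<sigma>_def)
  qed
  have \<sigma>_inc: "\<sigma> l < \<sigma> (Suc l)" if "l < n * m" for l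
  proof -
    define i j where "i = l div m" and "j = l mod m"
    have l: "l = i * m + j" "j < m" using m by (auto simp: i_def j_def)
    have i: "i < n" unfolding i_def using that m by (simp add: less_mult_imp_div_less)
    have "\<sigma> l = dyadic_grid (\<tau> i) (\<tau> (Suc i)) N j" "\<sigma> (Suc l) = dyadic_grid (\<tau> i) (\<tau> (Suc i)) N (Suc j)"
      using \<sigma>_block[of j i] \<sigma>_block[of "Suc j" i] l by auto
    moreover have "dyadic_grid (\<tau> i) (\<tau> (Suc i)) N j < dyadic_grid (\<tau> i) (\<tau> (Suc i)) N (Suc j)"
      using \<tau>(2)[OF i] by (simp add: dyadic_grid_def field_simps)
    ultimately show ?thesis by simp
  qed
  have \<sigma>0: "\<sigma> 0 = \<tau> 0" using \<sigma>_block[of 0 0] by simp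
  have \<sigma>n: "\<sigma> (n * m) = \<tau> n" using \<sigma>_block[of 0 n] by simp
  define \<xi> where "\<xi> l \<omega> = W (\<sigma> (Suc l)) \<omega> - W (\<sigma> l) \<omega>" for l \<omega>
  have "\<forall>(n::nat) \<tau>. 0 \<le> \<tau> 0 \<and> (\<forall>i<n. \<tau> i < \<tau> (Suc i)) \<and> \<tau> n \<le> t \<longrightarrow>
        indep_vars (\<lambda>_. borel) (\<lambda>i \<omega>. increment W \<tau> i \<omega>) {..<n}"
    using bm unfolding standard_brownian_motion_def by blast
  from this[rule_format, of \<sigma> "n * m"] have ind: "indep_vars (\<lambda>_. borel) \<xi> {..<n * m}"
    using \<sigma>_inc \<sigma>0 \<sigma>n \<tau> unfolding \<xi>_def by auto
  define K where "K i = {i * m..<Suc i * m}" for i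
  have "indep_vars (\<lambda>i. PiM (K i) (\<lambda>_. borel)) (\<lambda>i \<omega>. restrict (\<lambda>l. \<xi> l \<omega>) (K i)) {..<n}"
  proof (rule indep_vars_restrict[OF ind])
    fix i assume "i \<in> {..<n}"
    then have "Suc i * m \<le> n * m" by (intro mult_le_mono1) auto
    then show "K i \<subseteq> {..<n * m}"
      unfolding K_def by (meson atLeastLessThan_iff lessThan_iff order_less_le_trans subsetI)
  next
    show "disjoint_family_on K {..<n}"
      unfolding disjoint_family_on_def
    proof (intro ballI impI)
      fix i j :: nat assume "i \<noteq> j"
      have "l div m = i" if "l \<in> K i" for l i
        using that m unfolding K_def by (intro div_nat_eqI) (auto simp: mult.commute)
      then show "K i \<inter> K j = {}" using \<open>i \<noteq> j\<close> by blast
    qed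
  qed
  note D = indep_varsD[OF this]
  define B where "B i = {x \<in> space (PiM (K i) (\<lambda>_. borel)). (\<exists>j\<in>{..m}. k i < (\<Sum>l\<in>{i * m..<i * m + j}. x l))
      \<and> (\<Sum>l\<in>{i * m..<i * m + m}. x l) \<le> y i}" for i
  have Bm: "B i \<in> sets (PiM (K i) (\<lambda>_. borel))" for i
  proof -
    have s: "(\<lambda>x. \<Sum>l\<in>{i * m..<i * m + j}. x l :: real) \<in> borel_measurable (PiM (K i) (\<lambda>_. borel))" if "j \<le> m" for j
      using that by (intro borel_measurable_sum measurable_component_singleton) (auto simp: K_def)
    show ?thesis unfolding B_def
    proof (intro sets.sets_Collect_conj sets.sets_Collect_finite_Ex)
      have [measurable]: "(\<lambda>x. \<Sum>l\<in>{i * m..<i * m + m}. x l :: real) \<in> borel_measurable (PiM (K i) (\<lambda>_. borel))"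
        by (rule s) simp
      show "{x \<in> space (PiM (K i) (\<lambda>_. borel)). (\<Sum>l\<in>{i * m..<i * m + m}. x l) \<le> y i} \<in> sets (PiM (K i) (\<lambda>_. borel))"
        by measurable
      fix j assume "j \<in> {..m}"
      then have [measurable]: "(\<lambda>x. \<Sum>l\<in>{i * m..<i * m + j}. x l :: real) \<in> borel_measurable (PiM (K i) (\<lambda>_. borel))"
        by (intro s) simp
      show "{x \<in> space (PiM (K i) (\<lambda>_. borel)). k i < (\<Sum>l\<in>{i * m..<i * m + j}. x l)} \<in> sets (PiM (K i) (\<lambda>_. borel))"
        by measurable
    qed simp
  qed
  have ev: "(\<lambda>\<omega>. restrict (\<lambda>l. \<xi> l \<omega>) (K i)) -` B i \<inter> space M = grid_event M W (\<tau> i) (\<tau> (Suc i)) N (k i) (y i)" for i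
  proof -
    have sum: "(\<Sum>l\<in>{i * m..<i * m + j}. restrict (\<lambda>l. \<xi> l \<omega>) (K i) l) = W (dyadic_grid (\<tau> i) (\<tau> (Suc i)) N j) \<omega> - W (\<tau> i) \<omega>"
      if "j \<le> m" for j \<omega>
    proof -
      have "(\<Sum>l\<in>{i * m..<i * m + j}. restrict (\<lambda>l. \<xi> l \<omega>) (K i) l) = (\<Sum>l\<in>{i * m..<i * m + j}. \<xi> l \<omega>)"
        using that by (intro sum.cong) (auto simp: K_def)
      also have "\<dots> = W (\<sigma> (i * m + j)) \<omega> - W (\<sigma> (i * m + 0)) \<omega>"
        unfolding \<xi>_def by (subst sum_Suc_diff') auto
      also have "\<dots> = W (dyadic_grid (\<tau> i) (\<tau> (Suc i)) N j) \<omega> - W (\<tau> i) \<omega>"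
        using \<sigma>_block[OF that, of i] \<sigma>_block[of 0 i] by simp
      finally show ?thesis .
    qed
    have "(\<lambda>\<omega>. restrict (\<lambda>l. \<xi> l \<omega>) (K i)) -` B i \<inter> space M
      = {\<omega>\<in>space M. (\<exists>j\<in>{..m}. k i < W (dyadic_grid (\<tau> i) (\<tau> (Suc i)) N j) \<omega> - W (\<tau> i) \<omega>)
         \<and> W (dyadic_grid (\<tau> i) (\<tau> (Suc i)) N m) \<omega> - W (\<tau> i) \<omega> \<le> y i}"
      unfolding B_def by (auto simp: space_PiM sum simp del: restrict_apply)
    also have "\<dots> = grid_event M W (\<tau> i) (\<tau> (Suc i)) N (k i) (y i)"
      unfolding grid_event_def m_def by auto
    finally show ?thesis .
  qed
  have "finite J" using J(1) finite_subset by blast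
  then show ?thesis using D[of J B] J Bm by (simp add: ev)
qed

lemma standard_brownian_motion_real:
  assumes bm: "standard_brownian_motion t M (W :: real \<Rightarrow> 'a \<Rightarrow> real)"
  shows "\<And>s. s \<in> {0..t} \<Longrightarrow> W s \<in> borel_measurable M"
    and "\<And>\<omega>. \<omega> \<in> space M \<Longrightarrow> continuous_on {0..t} (\<lambda>s. W s \<omega>)"
    and "AE \<omega> in M. W 0 \<omega> = 0"
    and "\<And>n \<tau>. 0 \<le> \<tau> 0 \<Longrightarrow> (\<And>i. i < n \<Longrightarrow> \<tau> i < \<tau> (Suc i)) \<Longrightarrow> \<tau> n \<le> t \<Longrightarrow>
        indep_vars (\<lambda>_. borel) (\<lambda>i \<omega>. increment W \<tau> i \<omega>) {..<n::nat}"
    and "\<And>r s. 0 \<le> r \<Longrightarrow> r < s \<Longrightarrow> s \<le> t \<Longrightarrow>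
        distr M lborel (\<lambda>\<omega>. W s \<omega> - W r \<omega>) = density lborel (\<lambda>z. ennreal (gauss (s - r) z))"
  using bm unfolding standard_brownian_motion_def continuous_process_def distributed_def by auto

text \<open>
  The two bounds of \<open>reflection_principle\<close> coincide since the increment has no atoms.
\<close>

lemma increment_max_law:
  assumes bm: "standard_brownian_motion t M (W :: real \<Rightarrow> 'a \<Rightarrow> real)"
    and ab: "0 \<le> a" "a < b" "b \<le> t"
  shows "distr M borel (\<lambda>\<omega>. (2 * increment_max W a b \<omega> - (W b \<omega> - W a \<omega>), W b \<omega> - W a \<omega>)) = step_law (b - a)"
proof (rule law_of_increment_and_max)
  note W = standard_brownian_motion_real[OF bm]
  have Wm: "W u \<in> borel_measurable M" if "u \<in> {a..b}" for u using W(1) that ab by auto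
  have Wc: "continuous_on {a..b} (\<lambda>u. W u \<omega>)" if "\<omega> \<in> space M" for \<omega>
    using W(2)[OF that] by (rule continuous_on_subset) (use ab in auto)
  show "increment_max W a b \<in> borel_measurable M" using measurable_increment_max[OF ab(2) Wm Wc] .
  show Dm[measurable]: "(\<lambda>\<omega>. W b \<omega> - W a \<omega>) \<in> borel_measurable M" using Wm ab by auto
  show "W b \<omega> - W a \<omega> \<le> increment_max W a b \<omega> \<and> 0 \<le> increment_max W a b \<omega>" if "\<omega> \<in> space M" for \<omega>
    by (rule increment_max_ge[where W = W, OF ab(2) Wc[OF that]])
  show D: "distr M lborel (\<lambda>\<omega>. W b \<omega> - W a \<omega>) = density lborel (\<lambda>z. ennreal (gauss (b - a) z))"
    by (rule W(5)) (use ab in auto)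
  show "0 < b - a" using ab by simp
  fix k y :: real assume k: "0 \<le> k" "y \<le> k"
  have sym: "distr M borel (\<lambda>\<omega>. - (W v \<omega> - W u \<omega>)) = distr M borel (\<lambda>\<omega>. W v \<omega> - W u \<omega>)"
    if uv: "a \<le> u" "u < v" "v \<le> b" for u v
  proof -
    have law: "distr M lborel (\<lambda>\<omega>. W v \<omega> - W u \<omega>) = density lborel (\<lambda>z. ennreal (gauss (v - u) z))"
      using uv ab by (intro W(5)) auto
    have [measurable]: "W u \<in> borel_measurable M" "W v \<in> borel_measurable M" using Wm uv by auto
    have "distr M borel (\<lambda>\<omega>. - (W v \<omega> - W u \<omega>)) = distr (distr M lborel (\<lambda>\<omega>. W v \<omega> - W u \<omega>)) borel uminus"
      by (subst distr_distr) (auto simp: comp_def)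
    also have "\<dots> = distr M borel (\<lambda>\<omega>. W v \<omega> - W u \<omega>)"
      unfolding law
    proof (rule measure_eqI)
      fix A assume "A \<in> sets (distr (density lborel (\<lambda>z. ennreal (gauss (v - u) z))) borel uminus)"
      then have [measurable]: "A \<in> sets borel" by simp
      have "uminus -` A \<inter> space borel \<in> sets (borel :: real measure)" by measurable
      then have [measurable]: "uminus -` A \<in> sets borel" by simp
      have "emeasure (distr (density lborel (\<lambda>z. ennreal (gauss (v - u) z))) borel uminus) A
        = (\<integral>\<^sup>+z. ennreal (gauss (v - u) z) * indicator (uminus -` A) z \<partial>lborel)"
        by (subst emeasure_distr) (auto simp: emeasure_density)
      also have "\<dots> = (\<integral>\<^sup>+z. ennreal (gauss (v - u) (0 - z)) * indicator (uminus -` A) (0 - z) \<partial>lborel)"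
        by (rule nn_integral_reflect[symmetric]) measurable
      also have "\<dots> = (\<integral>\<^sup>+z. ennreal (gauss (v - u) z) * indicator A z \<partial>lborel)"
        by (intro nn_integral_cong) (auto simp: indicator_def)
      also have "\<dots> = emeasure (distr M lborel (\<lambda>\<omega>. W v \<omega> - W u \<omega>)) A"
        unfolding law by (simp add: emeasure_density)
      also have "\<dots> = emeasure (distr M borel (\<lambda>\<omega>. W v \<omega> - W u \<omega>)) A"
        by (simp add: emeasure_distr)
      finally show "emeasure (distr (density lborel (\<lambda>z. ennreal (gauss (v - u) z))) borel uminus) A
        = emeasure (distr M borel (\<lambda>\<omega>. W v \<omega> - W u \<omega>)) A" .
    qed simp
    finally show ?thesis .
  qed
  have ind: "indep_vars (\<lambda>_. borel) (\<lambda>i \<omega>. W (dyadic_grid a b N (Suc i)) \<omega> - W (dyadic_grid a b N i) \<omega>) {..<2 ^ N}" for N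
    using ab by (intro W(4)) (auto simp: dyadic_grid_def field_simps)
  \<comment> \<open>The upper bound of the reflection principle has \<open>2 * k - y \<le> W b - W a\<close>, the lower bound the
      strict inequality; they differ by a null set.\<close>
  have "emeasure M {\<omega>\<in>space M. W b \<omega> - W a \<omega> = 2 * k - y} = emeasure (distr M lborel (\<lambda>\<omega>. W b \<omega> - W a \<omega>)) {2 * k - y}"
    by (subst emeasure_distr) (auto intro!: arg_cong[where f = "emeasure M"])
  also have "\<dots> = (\<integral>\<^sup>+z. ennreal (gauss (b - a) z) * indicator {2 * k - y} z \<partial>lborel)"
    unfolding D by (subst emeasure_density) auto
  also have "\<dots> = (\<integral>\<^sup>+z. 0 \<partial>(lborel :: real measure))"
    using AE_lborel_singleton[of "2 * k - y"] by (intro nn_integral_cong_AE) auto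
  finally have z: "prob {\<omega>\<in>space M. W b \<omega> - W a \<omega> = 2 * k - y} = 0" by (simp add: measure_def)
  have "prob {\<omega>\<in>space M. 2 * k - y \<le> W b \<omega> - W a \<omega>}
    \<le> prob ({\<omega>\<in>space M. 2 * k - y < W b \<omega> - W a \<omega>} \<union> {\<omega>\<in>space M. W b \<omega> - W a \<omega> = 2 * k - y})"
    by (intro finite_measure_mono) auto
  also have "\<dots> \<le> prob {\<omega>\<in>space M. 2 * k - y < W b \<omega> - W a \<omega>} + prob {\<omega>\<in>space M. W b \<omega> - W a \<omega> = 2 * k - y}"
    by (rule measure_Un_le) measurable
  finally have "prob {\<omega>\<in>space M. 2 * k - y \<le> W b \<omega> - W a \<omega>} \<le> prob {\<omega>\<in>space M. 2 * k - y < W b \<omega> - W a \<omega>}"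
    using z by simp
  then show "prob {\<omega>\<in>space M. k < increment_max W a b \<omega> \<and> W b \<omega> - W a \<omega> \<le> y}
     = prob {\<omega>\<in>space M. 2 * k - y \<le> W b \<omega> - W a \<omega>}"
    using reflection_principle[OF ab(2) Wm Wc ind sym k] by simp
qed

text \<open>
  The maxima depend on the whole path, so independence is first obtained on grids, by
  \<open>indep_grid_events\<close>, and then carried over to quadrants by monotone limits.
\<close>

lemma indep_increment_max:
  assumes bm: "standard_brownian_motion t M (W :: real \<Rightarrow> 'a \<Rightarrow> real)"
    and \<tau>: "0 \<le> \<tau> 0" "\<And>i. i < n \<Longrightarrow> \<tau> i < \<tau> (Suc i)" "\<tau> n \<le> t"
  shows "indep_vars (\<lambda>_. borel) (\<lambda>i \<omega>. (2 * increment_max W (\<tau> i) (\<tau> (Suc i)) \<omega>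
      - (increment W \<tau> i \<omega>), increment W \<tau> i \<omega>)) {..<n}"
proof -
  note W = standard_brownian_motion_real[OF bm]
  have mem: "{\<tau> i..\<tau> (Suc i)} \<subseteq> {0..t}" if "i < n" for i
    using strict_chain_mono[of n \<tau> 0 i] strict_chain_mono[of n \<tau> "Suc i" n] \<tau> that by auto
  have Wm: "W u \<in> borel_measurable M" if "i < n" "u \<in> {\<tau> i..\<tau> (Suc i)}" for i u
    using W(1) mem[OF that(1)] that(2) by blast
  have Wc: "continuous_on {\<tau> i..\<tau> (Suc i)} (\<lambda>u. W u \<omega>)" if "i < n" "\<omega> \<in> space M" for i \<omega>
    using W(2)[OF that(2)] mem[OF that(1)] by (rule continuous_on_subset)
  let ?M = "\<lambda>i. increment_max W (\<tau> i) (\<tau> (Suc i))" and ?D = "\<lambda>i \<omega>. increment W \<tau> i \<omega>"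
  have Mm: "?M i \<in> borel_measurable M" if "i < n" for i
    using that by (intro measurable_increment_max \<tau>(2) Wm Wc) auto
  have Dm: "?D i \<in> borel_measurable M" if "i < n" for i
    using that \<tau>(2)[OF that] by (intro borel_measurable_diff Wm[OF that]) auto
  have "indep_vars (\<lambda>_. borel \<Otimes>\<^sub>M borel) (\<lambda>i \<omega>. (?M i \<omega>, ?D i \<omega>)) {..<n}"
  proof (rule indep_vars_generator[where E = "\<lambda>_. quadrants"])
    fix i assume "i \<in> {..<n}"
    then show "(\<lambda>\<omega>. (?M i \<omega>, ?D i \<omega>)) \<in> measurable M (borel \<Otimes>\<^sub>M borel)"
      using Mm Dm by (intro measurable_Pair) auto
  next
    fix J A assume J: "J \<subseteq> {..<n}" "J \<noteq> {}" "finite J" and A: "\<And>i. i \<in> J \<Longrightarrow> A i \<in> quadrants"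
    have "\<forall>i\<in>J. \<exists>k y. A i = {k<..} \<times> {..y}" using A by blast
    then obtain k y where ky: "\<And>i. i \<in> J \<Longrightarrow> A i = {k i<..} \<times> {..y i}" by metis
    let ?G = "\<lambda>N i. grid_event M W (\<tau> i) (\<tau> (Suc i)) N (k i) (y i)"
    have ev: "(\<lambda>\<omega>. (?M i \<omega>, ?D i \<omega>)) -` A i \<inter> space M = (\<Union>N. ?G N i)" if "i \<in> J" for i
      using that J(1) by (subst grid_event_UN) (auto simp: ky intro!: \<tau>(2) Wc)
    have Gm: "?G N i \<in> sets M" if "i \<in> J" for N i
      using that J(1) by (intro grid_event_sets \<tau>(2) Wm) auto
    have lim1: "(\<lambda>N. prob (?G N i)) \<longlonglongrightarrow> prob ((\<lambda>\<omega>. (?M i \<omega>, ?D i \<omega>)) -` A i \<inter> space M)" if "i \<in> J" for i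
      unfolding ev[OF that] using Gm[OF that]
      by (intro finite_Lim_measure_incseq grid_event_incseq) auto
    have UN: "(\<Union>N. \<Inter>i\<in>J. ?G N i) = (\<Inter>i\<in>J. \<Union>N. ?G N i)"
    proof (intro equalityI subsetI)
      fix \<omega> assume "\<omega> \<in> (\<Inter>i\<in>J. \<Union>N. ?G N i)"
      then have "\<forall>i\<in>J. \<exists>N. \<omega> \<in> ?G N i" by blast
      then obtain f where f: "\<And>i. i \<in> J \<Longrightarrow> \<omega> \<in> ?G (f i) i" by metis
      have "\<omega> \<in> ?G (Max (f ` J)) i" if "i \<in> J" for i
      proof -
        have "f i \<le> Max (f ` J)" using J(3) that by simp
        then have "?G (f i) i \<subseteq> ?G (Max (f ` J)) i" using grid_event_incseq by (rule incseqD[rotated])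
        then show ?thesis using f[OF that] by blast
      qed
      then show "\<omega> \<in> (\<Union>N. \<Inter>i\<in>J. ?G N i)" by blast
    qed blast
    have "(\<lambda>N. prob (\<Inter>i\<in>J. ?G N i)) \<longlonglongrightarrow> prob (\<Union>N. \<Inter>i\<in>J. ?G N i)"
    proof (rule finite_Lim_measure_incseq)
      show "range (\<lambda>N. \<Inter>i\<in>J. ?G N i) \<subseteq> events"
        using Gm J by (intro image_subsetI sets.finite_INT) auto
      show "incseq (\<lambda>N. \<Inter>i\<in>J. ?G N i)"
      proof (rule incseq_SucI)
        fix N
        have "?G N i \<subseteq> ?G (Suc N) i" for i using grid_event_incseq by (rule incseq_SucD)
        then show "(\<Inter>i\<in>J. ?G N i) \<subseteq> (\<Inter>i\<in>J. ?G (Suc N) i)" by blast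
      qed
    qed
    moreover have "(\<Union>N. \<Inter>i\<in>J. ?G N i) = (\<Inter>i\<in>J. (\<lambda>\<omega>. (?M i \<omega>, ?D i \<omega>)) -` A i \<inter> space M)"
      unfolding UN using ev by simp
    moreover have "prob (\<Inter>i\<in>J. ?G N i) = (\<Prod>i\<in>J. prob (?G N i))" for N
      by (rule indep_grid_events[where n = n, OF bm \<tau> J(1,2)])
    ultimately have "(\<lambda>N. \<Prod>i\<in>J. prob (?G N i)) \<longlonglongrightarrow> prob (\<Inter>i\<in>J. (\<lambda>\<omega>. (?M i \<omega>, ?D i \<omega>)) -` A i \<inter> space M)"
      by simp
    moreover have "(\<lambda>N. \<Prod>i\<in>J. prob (?G N i)) \<longlonglongrightarrow> (\<Prod>i\<in>J. prob ((\<lambda>\<omega>. (?M i \<omega>, ?D i \<omega>)) -` A i \<inter> space M))"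
      by (intro tendsto_prod lim1)
    ultimately show "prob (\<Inter>i\<in>J. (\<lambda>\<omega>. (?M i \<omega>, ?D i \<omega>)) -` A i \<inter> space M)
       = (\<Prod>i\<in>J. prob ((\<lambda>\<omega>. (?M i \<omega>, ?D i \<omega>)) -` A i \<inter> space M))"
      by (rule LIMSEQ_unique)
  next
    show "Int_stable quadrants" by (rule Int_stable_quadrants)
  qed (simp_all add: borel_plane_generator space_pair_measure)
  then have "indep_vars (\<lambda>_. borel \<Otimes>\<^sub>M borel) (\<lambda>i \<omega>. (\<lambda>p. (2 * fst p - snd p, snd p)) (?M i \<omega>, ?D i \<omega>)) {..<n}"
    by (rule indep_vars_compose2) measurable
  then show ?thesis by (simp add: borel_prod)
qed

end

section \<open>Markov chains driven by independent noise\<close>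

primrec chain :: "('s \<Rightarrow> 'x \<Rightarrow> 's) \<Rightarrow> 's \<Rightarrow> (nat \<Rightarrow> 'x) \<Rightarrow> nat \<Rightarrow> 's" where
  "chain step s x 0 = s"
| "chain step s x (Suc n) = step (chain step s x n) (x n)"

text \<open>
  The expectation of \<open>(\<Prod>i<n. f i s\<^sub>i) * G s\<^sub>n\<close> for the chain with independent noise of laws
  \<open>\<nu> i\<close>, where \<open>s\<^sub>i\<close> is the state after \<open>i + 1\<close> steps, computed by integrating out the last
  noise variable first; see \<open>nn_integral_chain\<close>.  The last function is kept apart because
  it may depend on more of the state than the weights \<open>f i\<close> do in the applications.
\<close>

primrec chain_expectation ::
  "('s \<Rightarrow> 'x \<Rightarrow> 's) \<Rightarrow> 's \<Rightarrow> (nat \<Rightarrow> 'x measure) \<Rightarrow> (nat \<Rightarrow> 's \<Rightarrow> ennreal) \<Rightarrow> nat \<Rightarrow> ('s \<Rightarrow> ennreal) \<Rightarrow> ennreal" where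
  "chain_expectation step s \<nu> f 0 G = (\<integral>\<^sup>+x. G (step s x) \<partial>\<nu> 0)"
| "chain_expectation step s \<nu> f (Suc n) G
    = chain_expectation step s \<nu> f n (\<lambda>s'. f n s' * (\<integral>\<^sup>+x. G (step s' x) \<partial>\<nu> (Suc n)))"

lemma chain_cong: "(\<And>i. i < n \<Longrightarrow> x i = y i) \<Longrightarrow> chain step s x n = chain step s y n"
  by (induction n) auto

text \<open>
  Only the last factor involves the last noise variable, so Fubini replaces \<open>G\<close> by its average over
  one step.
\<close>

lemma nn_integral_chain:
  fixes step :: "'s::topological_space \<Rightarrow> 'x::topological_space \<Rightarrow> 's"
  assumes step: "(\<lambda>p. step (fst p) (snd p)) \<in> measurable (borel \<Otimes>\<^sub>M borel) borel"
    and \<nu>: "\<And>i. prob_space (\<nu> i)" "\<And>i. sets (\<nu> i) = sets borel"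
    and f[measurable]: "\<And>i. f i \<in> borel_measurable borel"
    and "G \<in> borel_measurable borel"
  shows "(\<integral>\<^sup>+x. (\<Prod>i<n. f i (chain step s x (Suc i))) * G (chain step s x (Suc n)) \<partial>PiM {..<Suc n} \<nu>)
    = chain_expectation step s \<nu> f n G"
  using assms(5)
proof (induction n arbitrary: G)
  case 0
  note [measurable] = 0
  have [measurable_cong]: "sets (\<nu> i) = sets borel" for i by (rule \<nu>(2))
  interpret product_sigma_finite \<nu>
    by (simp add: \<nu>(1) product_sigma_finite.intro prob_space_imp_sigma_finite)
  have "(\<lambda>x. step s x) \<in> measurable borel borel"
    using measurable_compose[OF measurable_Pair1' step, of s] by simp
  then have [measurable]: "(\<lambda>x. G (step s x)) \<in> borel_measurable (\<nu> 0)" by measurable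
  have "{..<Suc 0} = {0}" by auto
  then show ?case
    using product_nn_integral_singleton[of "\<lambda>x. G (step s x)" 0] by simp
next
  case (Suc n)
  note [measurable] = Suc.prems
  have [measurable_cong]: "sets (\<nu> i) = sets borel" for i by (rule \<nu>(2))
  interpret product_sigma_finite \<nu>
    by (simp add: \<nu>(1) product_sigma_finite.intro prob_space_imp_sigma_finite)
  have st: "(\<lambda>x. step (g x) (h x)) \<in> measurable N borel"
    if "g \<in> measurable N borel" "h \<in> measurable N borel" for g h and N :: "'z measure"
    using measurable_compose[OF measurable_Pair[OF that] step] by simp
  have ch: "(\<lambda>x. chain step s x k) \<in> measurable (PiM {..<m} \<nu>) borel" if "k \<le> m" for k m
    using that
  proof (induction k)
    case (Suc k)
    have "(\<lambda>x. x k) \<in> measurable (PiM {..<m} \<nu>) (\<nu> k)" using Suc.prems by (intro measurable_component_singleton) auto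
    then have "(\<lambda>x. x k) \<in> measurable (PiM {..<m} \<nu>) borel"
      by (simp only: measurable_cong_sets[OF refl \<nu>(2)])
    then show ?case unfolding chain.simps using Suc by (intro measurable_compose[OF measurable_Pair step, simplified]) auto
  qed simp
  let ?F = "\<lambda>x. (\<Prod>i<Suc n. f i (chain step s x (Suc i))) * G (chain step s x (Suc (Suc n)))"
  have Fm: "?F \<in> borel_measurable (PiM {..<Suc (Suc n)} \<nu>)"
    by (intro borel_measurable_times_ennreal borel_measurable_prod_ennreal
        measurable_compose[OF ch f] measurable_compose[OF ch Suc.prems]) auto
  have ins: "{..<Suc (Suc n)} = insert (Suc n) {..<Suc n}" by auto
  define G' where "G' s' = f n s' * (\<integral>\<^sup>+x. G (step s' x) \<partial>\<nu> (Suc n))" for s'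
  have stm: "(\<lambda>p. step (fst p) (snd p)) \<in> measurable (borel \<Otimes>\<^sub>M \<nu> (Suc n)) borel"
    using step by (simp cong: measurable_cong_sets)
  have "(\<lambda>s'. \<integral>\<^sup>+x. G (step s' x) \<partial>\<nu> (Suc n)) \<in> borel_measurable borel"
    using sigma_finite_measure.borel_measurable_nn_integral[OF prob_space_imp_sigma_finite[OF \<nu>(1)[of "Suc n"]],
        of "\<lambda>s' x. G (step s' x)" borel] measurable_compose[OF stm Suc.prems]
    by (simp add: case_prod_unfold)
  then have G'm: "G' \<in> borel_measurable borel" unfolding G'_def by measurable
  have "(\<integral>\<^sup>+x. ?F x \<partial>PiM {..<Suc (Suc n)} \<nu>) = (\<integral>\<^sup>+x. \<integral>\<^sup>+y. ?F (x(Suc n := y)) \<partial>\<nu> (Suc n) \<partial>PiM {..<Suc n} \<nu>)"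
    unfolding ins by (rule product_nn_integral_insert) (use Fm in \<open>auto simp: ins\<close>)
  also have "\<dots> = (\<integral>\<^sup>+x. (\<Prod>i<n. f i (chain step s x (Suc i))) * G' (chain step s x (Suc n)) \<partial>PiM {..<Suc n} \<nu>)"
  proof (rule nn_integral_cong)
    fix x assume "x \<in> space (PiM {..<Suc n} \<nu>)"
    have c: "chain step s (x(Suc n := y)) (Suc i) = chain step s x (Suc i)" if "i \<le> n" for i y
      using that by (intro chain_cong) auto
    have F: "?F (x(Suc n := y)) = (\<Prod>i<n. f i (chain step s x (Suc i))) * f n (chain step s x (Suc n))
       * G (step (chain step s x (Suc n)) y)" for y
    proof -
      have "(\<Prod>i<Suc n. f i (chain step s (x(Suc n := y)) (Suc i))) = (\<Prod>i<Suc n. f i (chain step s x (Suc i)))"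
        by (intro prod.cong refl arg_cong[where f = "f _"] c) auto
      moreover have "chain step s (x(Suc n := y)) (Suc (Suc n)) = step (chain step s x (Suc n)) y"
        using c[of n y] by (simp only: chain.simps(2)[of _ _ _ "Suc n"]) simp
      ultimately show ?thesis by (simp only: prod.lessThan_Suc)
    qed
    have "(\<lambda>y. step (chain step s x (Suc n)) y) \<in> measurable borel borel"
      using measurable_compose[OF measurable_Pair1' step] by simp
    then have m: "(\<lambda>y. G (step (chain step s x (Suc n)) y)) \<in> borel_measurable (\<nu> (Suc n))" by measurable
    show "(\<integral>\<^sup>+y. ?F (x(Suc n := y)) \<partial>\<nu> (Suc n))
      = (\<Prod>i<n. f i (chain step s x (Suc i))) * G' (chain step s x (Suc n))"
      unfolding F G'_def by (subst nn_integral_cmult[OF m]) (simp add: mult.assoc)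
  qed
  also have "\<dots> = chain_expectation step s \<nu> f n G'" by (rule Suc.IH[OF G'm])
  finally show ?case by (simp add: G'_def[abs_def])
qed

lemma (in prob_space) nn_integral_indep_chain:
  fixes step :: "'s::topological_space \<Rightarrow> 'x::topological_space \<Rightarrow> 's" and X :: "nat \<Rightarrow> 'a \<Rightarrow> 'x"
  assumes step: "(\<lambda>p. step (fst p) (snd p)) \<in> measurable (borel \<Otimes>\<^sub>M borel) borel"
    and \<nu>: "\<And>i. prob_space (\<nu> i)" "\<And>i. sets (\<nu> i) = sets borel"
    and f: "\<And>i. f i \<in> borel_measurable borel" and G: "G \<in> borel_measurable borel"
    and ind: "indep_vars (\<lambda>_. borel) X {..<Suc n}" and law: "\<And>i. i \<le> n \<Longrightarrow> distr M borel (X i) = \<nu> i"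
  shows "(\<integral>\<^sup>+\<omega>. (\<Prod>i<n. f i (chain step s (\<lambda>i. X i \<omega>) (Suc i))) * G (chain step s (\<lambda>i. X i \<omega>) (Suc n)) \<partial>M)
    = chain_expectation step s \<nu> f n G"
proof -
  have rv: "X i \<in> measurable M borel" if "i \<in> {..<Suc n}" for i
    using ind that by (auto simp: indep_vars_def)
  have ne: "{..<Suc n} \<noteq> {}" by auto
  have eq: "distr M (PiM {..<Suc n} (\<lambda>_. borel)) (\<lambda>\<omega>. \<lambda>i\<in>{..<Suc n}. X i \<omega>) = PiM {..<Suc n} \<nu>"
  proof -
    have "distr M (PiM {..<Suc n} (\<lambda>_. borel)) (\<lambda>\<omega>. \<lambda>i\<in>{..<Suc n}. X i \<omega>) = PiM {..<Suc n} (\<lambda>i. distr M borel (X i))"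
      using indep_vars_iff_distr_eq_PiM'[where I = "{..<Suc n}" and M' = "\<lambda>_. borel" and X = X, OF ne rv] ind by auto
    also have "\<dots> = PiM {..<Suc n} \<nu>" by (intro PiM_cong) (auto simp: law)
    finally show ?thesis .
  qed
  let ?F = "\<lambda>x. (\<Prod>i<n. f i (chain step s x (Suc i))) * G (chain step s x (Suc n))"
  have ch: "(\<lambda>x. chain step s x k) \<in> measurable (PiM {..<m} (\<lambda>_. borel)) borel" if "k \<le> m" for k m
    using that
  proof (induction k)
    case (Suc k)
    have "(\<lambda>x. x k) \<in> measurable (PiM {..<m} (\<lambda>_. borel)) borel" using Suc.prems by (intro measurable_component_singleton) auto
    then show ?case unfolding chain.simps using Suc by (intro measurable_compose[OF measurable_Pair step, simplified]) auto
  qed simp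
  have Fm: "?F \<in> borel_measurable (PiM {..<Suc n} (\<lambda>_. borel))"
    by (intro borel_measurable_times_ennreal borel_measurable_prod_ennreal
        measurable_compose[OF ch f] measurable_compose[OF ch G]) auto
  have Xm: "(\<lambda>\<omega>. \<lambda>i\<in>{..<Suc n}. X i \<omega>) \<in> measurable M (PiM {..<Suc n} (\<lambda>_. borel))"
    by (intro measurable_restrict rv)
  have "(\<integral>\<^sup>+\<omega>. ?F (\<lambda>i. X i \<omega>) \<partial>M) = (\<integral>\<^sup>+\<omega>. ?F (\<lambda>i\<in>{..<Suc n}. X i \<omega>) \<partial>M)"
  proof (rule nn_integral_cong)
    fix \<omega>
    have "chain step s (\<lambda>i. X i \<omega>) (Suc j) = chain step s (\<lambda>i\<in>{..<Suc n}. X i \<omega>) (Suc j)" if "j \<le> n" for j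
      using that by (intro chain_cong) auto
    then show "?F (\<lambda>i. X i \<omega>) = ?F (\<lambda>i\<in>{..<Suc n}. X i \<omega>)"
      by (intro arg_cong2[where f = "(*)"] prod.cong refl arg_cong[where f = "f _"] arg_cong[where f = G]) auto
  qed
  also have "\<dots> = (\<integral>\<^sup>+x. ?F x \<partial>distr M (PiM {..<Suc n} (\<lambda>_. borel)) (\<lambda>\<omega>. \<lambda>i\<in>{..<Suc n}. X i \<omega>))"
    using Fm by (intro nn_integral_distr[OF Xm, symmetric]) (simp only: measurable_distr_eq1)
  also have "\<dots> = chain_expectation step s \<nu> f n G"
    unfolding eq by (rule nn_integral_chain[OF step \<nu> f G])
  finally show ?thesis .
qed

text \<open>
  Up to the factor \<open>2 * \<rho>\<close>, the density of the radius after \<open>n + 1\<close> steps, reweighted by the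
  functions \<open>\<phi>\<close> of the earlier radii.  Both chains to be compared lead to this recursion.  The
  factor is the length of \<open>(-\<rho>, \<rho>)\<close>, over which the position is spread.
\<close>

primrec radial_density :: "(nat \<Rightarrow> real) \<Rightarrow> (nat \<Rightarrow> real \<Rightarrow> ennreal) \<Rightarrow> nat \<Rightarrow> real \<Rightarrow> ennreal" where
  "radial_density v \<phi> 0 \<rho> = indicator {0<..} \<rho> * ennreal (rayleigh (v 0) \<rho>)"
| "radial_density v \<phi> (Suc n) \<rho> = (\<integral>\<^sup>+r. radial_density v \<phi> n r * \<phi> n r
      * ennreal (radial_kernel (v (Suc n)) r \<rho>) \<partial>lborel)"

lemma measurable_radial_density [measurable]:
  assumes [measurable]: "\<And>i. \<phi> i \<in> borel_measurable borel"
  shows "radial_density v \<phi> n \<in> borel_measurable borel"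
proof (induction n)
  case 0
  have "(\<lambda>\<rho>. indicator {0<..} \<rho> * ennreal (rayleigh (v 0) \<rho>)) \<in> borel_measurable borel" by measurable
  then show ?case by (simp add: fun_eq_iff cong: measurable_cong)
next
  case (Suc n)
  note [measurable] = Suc
  have "(\<lambda>\<rho>. \<integral>\<^sup>+r. radial_density v \<phi> n r * \<phi> n r
      * ennreal (radial_kernel (v (Suc n)) r \<rho>) \<partial>lborel) \<in> borel_measurable borel"
    by measurable
  then show ?case by (simp cong: measurable_cong)
qed

text \<open>
  For \<open>\<rho> \<le> 0 < r\<close> the kernel is not positive, and \<open>ennreal\<close> truncates it to \<open>0\<close>.
\<close>

lemma radial_density_nonpos:
  assumes v: "\<And>i. 0 < v i" and "\<rho> \<le> 0"
  shows "radial_density v \<phi> n \<rho> = 0"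
  using assms(2)
proof (induction n arbitrary: \<rho>)
  case (Suc n)
  have "radial_density v \<phi> n r * \<phi> n r * ennreal (radial_kernel (v (Suc n)) r \<rho>) = 0" for r
  proof (cases "r \<le> 0")
    case True
    then show ?thesis using Suc.IH by simp
  next
    case False
    then have "gauss (v (Suc n)) (\<rho> - r) \<le> gauss (v (Suc n)) (\<rho> + r)"
      using Suc.prems by (intro gauss_antimono[OF v]) auto
    then show ?thesis by (simp add: ennreal_neg)
  qed
  then have "radial_density v \<phi> (Suc n) \<rho> = (\<integral>\<^sup>+r. 0 \<partial>(lborel :: real measure))"
    unfolding radial_density.simps by (intro nn_integral_cong) blast
  then show ?case by simp
qed simp

lemma prob_space_gauss: "0 < v \<Longrightarrow> prob_space (density lborel (\<lambda>z. ennreal (gauss v z)))"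
  by (intro prob_space_normal_density) auto

lemma nn_integral_gauss: "0 < v \<Longrightarrow> (\<integral>\<^sup>+z. ennreal (gauss v z) \<partial>lborel) = 1"
  using prob_space.emeasure_space_1[OF prob_space_gauss, of v] by (simp add: emeasure_density)

lemma prob_space_step_law: "0 < v \<Longrightarrow> prob_space (step_law v)"
proof (rule prob_spaceI)
  assume v: "0 < v"
  have "emeasure (step_law v) (space (step_law v)) = (\<integral>\<^sup>+p. 1 \<partial>step_law v)" by simp
  also have "\<dots> = (\<integral>\<^sup>+d. \<integral>\<^sup>+z. indicator {\<bar>d\<bar><..} z * ennreal (rayleigh v z) * 1 \<partial>lborel \<partial>lborel)"
    by (rule nn_integral_step_law) simp
  also have "\<dots> = (\<integral>\<^sup>+d. \<integral>\<^sup>+z. ennreal (rayleigh v z) * indicator {\<bar>d\<bar><..} z \<partial>lborel \<partial>lborel)"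
    by (simp add: mult.commute)
  also have "\<dots> = (\<integral>\<^sup>+d. ennreal (gauss v d) \<partial>lborel)"
    using nn_integral_rayleigh_tail[OF v, of "\<bar>_\<bar>"] by simp
  also have "\<dots> = 1" by (rule nn_integral_gauss[OF v])
  finally show "emeasure (step_law v) (space (step_law v)) = 1" .
qed

text \<open>
  The state is \<open>(2 * S - w, w)\<close> for a path at \<open>w\<close> with running maximum \<open>S\<close>, and the noise is
  \<open>(2 * N - d, d)\<close> with the increment \<open>d\<close> and its maximum \<open>N\<close>.  The new running maximum is
  \<open>max S (w + N)\<close>.
\<close>

definition pitman_step :: "real \<times> real \<Rightarrow> real \<times> real \<Rightarrow> real \<times> real" where
  "pitman_step s x = (max (fst s - snd x) (fst x + snd s), snd s + snd x)"

text \<open>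
  Given the radii, the current position is uniform on \<open>(-\<rho>, \<rho>)\<close>; this is preserved by
  \<open>pitman_one_step\<close>.
\<close>

lemma pitman_chain_expectation:
  assumes v: "\<And>i. 0 < v i" and \<phi>[measurable]: "\<And>i. \<phi> i \<in> borel_measurable borel"
    and "G \<in> borel_measurable borel"
  shows "chain_expectation pitman_step (0, 0) (\<lambda>i. step_law (v i)) (\<lambda>i s. \<phi> i (fst s)) n G
    = (\<integral>\<^sup>+\<rho>. radial_density v \<phi> n \<rho> * (\<integral>\<^sup>+y. indicator {-\<rho><..<\<rho>} y * G (\<rho>, y) \<partial>lborel) \<partial>lborel)"
  using assms(3)
proof (induction n arbitrary: G)
  case 0
  then have G[measurable]: "G \<in> borel_measurable (borel \<Otimes>\<^sub>M borel)" by (simp add: borel_prod)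
  have m: "(\<lambda>x. G (pitman_step (0, 0) x)) \<in> borel_measurable borel"
  proof -
    have "(\<lambda>x. G (pitman_step (0, 0) x)) \<in> borel_measurable (borel \<Otimes>\<^sub>M borel)"
      unfolding pitman_step_def by measurable
    then show ?thesis by (simp add: borel_prod)
  qed
  have "chain_expectation pitman_step (0, 0) (\<lambda>i. step_law (v i)) (\<lambda>i s. \<phi> i (fst s)) 0 G
    = (\<integral>\<^sup>+d. \<integral>\<^sup>+z. indicator {\<bar>d\<bar><..} z * ennreal (rayleigh (v 0) z) * G (pitman_step (0, 0) (z, d)) \<partial>lborel \<partial>lborel)"
    by (simp add: nn_integral_step_law[OF m])
  also have "\<dots> = (\<integral>\<^sup>+d. \<integral>\<^sup>+z. indicator {\<bar>d\<bar><..} z * ennreal (rayleigh (v 0) z) * G (z, d) \<partial>lborel \<partial>lborel)"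
    by (intro nn_integral_cong) (auto simp: pitman_step_def indicator_def max_def)
  also have "\<dots> = (\<integral>\<^sup>+z. \<integral>\<^sup>+d. indicator {\<bar>d\<bar><..} z * ennreal (rayleigh (v 0) z) * G (z, d) \<partial>lborel \<partial>lborel)"
    by (rule lborel_pair.Fubini') measurable
  also have "\<dots> = (\<integral>\<^sup>+\<rho>. radial_density v \<phi> 0 \<rho> * (\<integral>\<^sup>+y. indicator {-\<rho><..<\<rho>} y * G (\<rho>, y) \<partial>lborel) \<partial>lborel)"
  proof (rule nn_integral_cong)
    fix \<rho>
    have "(\<integral>\<^sup>+d. indicator {\<bar>d\<bar><..} \<rho> * ennreal (rayleigh (v 0) \<rho>) * G (\<rho>, d) \<partial>lborel)
      = (\<integral>\<^sup>+y. radial_density v \<phi> 0 \<rho> * (indicator {-\<rho><..<\<rho>} y * G (\<rho>, y)) \<partial>lborel)"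
      by (intro nn_integral_cong) (auto simp: indicator_def abs_if split: if_splits)
    also have "\<dots> = radial_density v \<phi> 0 \<rho> * (\<integral>\<^sup>+y. indicator {-\<rho><..<\<rho>} y * G (\<rho>, y) \<partial>lborel)"
      by (rule nn_integral_cmult) measurable
    finally show "(\<integral>\<^sup>+d. indicator {\<bar>d\<bar><..} \<rho> * ennreal (rayleigh (v 0) \<rho>) * G (\<rho>, d) \<partial>lborel) = \<dots>" .
  qed
  finally show ?case .
next
  case (Suc n)
  then have G[measurable]: "G \<in> borel_measurable (borel \<Otimes>\<^sub>M borel)" by (simp add: borel_prod)
  interpret S: prob_space "step_law (v (Suc n))" by (rule prob_space_step_law[OF v])
  have [measurable_cong]: "sets (step_law (v (Suc n))) = sets (borel \<Otimes>\<^sub>M borel)"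
    by (simp only: step_law_def borel_prod sets_density sets_lborel)
  let ?K = "\<lambda>s. \<phi> n (fst s) * (\<integral>\<^sup>+x. G (pitman_step s x) \<partial>step_law (v (Suc n)))"
  have K[measurable]: "?K \<in> borel_measurable (borel \<Otimes>\<^sub>M borel)" unfolding pitman_step_def by measurable
  then have "?K \<in> borel_measurable borel" by (simp add: borel_prod)
  then have "chain_expectation pitman_step (0, 0) (\<lambda>i. step_law (v i)) (\<lambda>i s. \<phi> i (fst s)) (Suc n) G
    = (\<integral>\<^sup>+r. radial_density v \<phi> n r * (\<integral>\<^sup>+y. indicator {-r<..<r} y * ?K (r, y) \<partial>lborel) \<partial>lborel)"
    by (simp only: chain_expectation.simps Suc.IH)
  also have "\<dots> = (\<integral>\<^sup>+r. \<integral>\<^sup>+\<rho>. radial_density v \<phi> n r * \<phi> n r * ennreal (radial_kernel (v (Suc n)) r \<rho>)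
      * (\<integral>\<^sup>+y. indicator {-\<rho><..<\<rho>} y * G (\<rho>, y) \<partial>lborel) \<partial>lborel \<partial>lborel)"
  proof (rule nn_integral_cong)
    fix r
    show "radial_density v \<phi> n r * (\<integral>\<^sup>+y. indicator {-r<..<r} y * ?K (r, y) \<partial>lborel)
      = (\<integral>\<^sup>+\<rho>. radial_density v \<phi> n r * \<phi> n r * ennreal (radial_kernel (v (Suc n)) r \<rho>)
      * (\<integral>\<^sup>+y. indicator {-\<rho><..<\<rho>} y * G (\<rho>, y) \<partial>lborel) \<partial>lborel)"
    proof (cases "r \<le> 0")
      case True
      then show ?thesis using radial_density_nonpos[OF v True] by simp
    next
      case False
      then have r: "0 < r" by simp
      have "(\<integral>\<^sup>+y. indicator {-r<..<r} y * ?K (r, y) \<partial>lborel)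
        = (\<integral>\<^sup>+y. \<phi> n r * (indicator {-r<..<r} y * (\<integral>\<^sup>+x. G (max (r - snd x) (fst x + y), y + snd x) \<partial>step_law (v (Suc n)))) \<partial>lborel)"
        by (intro nn_integral_cong) (simp add: pitman_step_def mult_ac)
      also have "\<dots> = \<phi> n r * (\<integral>\<^sup>+y. indicator {-r<..<r} y * (\<integral>\<^sup>+x. G (max (r - snd x) (fst x + y), y + snd x) \<partial>step_law (v (Suc n))) \<partial>lborel)"
        by (rule nn_integral_cmult) measurable
      also have "\<dots> = \<phi> n r * (\<integral>\<^sup>+\<rho>. ennreal (radial_kernel (v (Suc n)) r \<rho>)
          * (\<integral>\<^sup>+y. indicator {-\<rho><..<\<rho>} y * G (\<rho>, y) \<partial>lborel) \<partial>lborel)"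
        by (subst pitman_one_step[OF v r Suc.prems]) simp
      finally have "radial_density v \<phi> n r * (\<integral>\<^sup>+y. indicator {-r<..<r} y * ?K (r, y) \<partial>lborel)
        = (radial_density v \<phi> n r * \<phi> n r) * (\<integral>\<^sup>+\<rho>. ennreal (radial_kernel (v (Suc n)) r \<rho>)
          * (\<integral>\<^sup>+y. indicator {-\<rho><..<\<rho>} y * G (\<rho>, y) \<partial>lborel) \<partial>lborel)" by (simp only: mult.assoc)
      also have "\<dots> = (\<integral>\<^sup>+\<rho>. (radial_density v \<phi> n r * \<phi> n r) * (ennreal (radial_kernel (v (Suc n)) r \<rho>)
          * (\<integral>\<^sup>+y. indicator {-\<rho><..<\<rho>} y * G (\<rho>, y) \<partial>lborel)) \<partial>lborel)"
        by (rule nn_integral_cmult[symmetric]) measurable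
      finally show ?thesis by (simp only: mult.assoc)
    qed
  qed
  also have "\<dots> = (\<integral>\<^sup>+\<rho>. \<integral>\<^sup>+r. radial_density v \<phi> n r * \<phi> n r * ennreal (radial_kernel (v (Suc n)) r \<rho>)
      * (\<integral>\<^sup>+y. indicator {-\<rho><..<\<rho>} y * G (\<rho>, y) \<partial>lborel) \<partial>lborel \<partial>lborel)"
    by (rule lborel_pair.Fubini') measurable
  also have "\<dots> = (\<integral>\<^sup>+\<rho>. radial_density v \<phi> (Suc n) \<rho> * (\<integral>\<^sup>+y. indicator {-\<rho><..<\<rho>} y * G (\<rho>, y) \<partial>lborel) \<partial>lborel)"
    unfolding radial_density.simps by (rule nn_integral_cong, rule nn_integral_multc) measurable
  finally show ?case .
qed

section \<open>Radial densities in space\<close>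

text \<open>
  A rotation is a product of three shears, each of which preserves Lebesgue measure by Fubini and
  translation invariance.
\<close>

lemma nn_integral_plane_rotation:
  fixes f :: "real \<times> real \<Rightarrow> ennreal"
  assumes f[measurable]: "f \<in> borel_measurable (borel \<Otimes>\<^sub>M borel)" and cs: "c\<^sup>2 + s\<^sup>2 = 1"
  shows "(\<integral>\<^sup>+x. \<integral>\<^sup>+y. f (c * x - s * y, s * x + c * y) \<partial>lborel \<partial>lborel) = (\<integral>\<^sup>+x. \<integral>\<^sup>+y. f (x, y) \<partial>lborel \<partial>lborel)"
proof -
  have shear_x: "(\<integral>\<^sup>+x. \<integral>\<^sup>+y. g (x + a * y, y) \<partial>lborel \<partial>lborel) = (\<integral>\<^sup>+x. \<integral>\<^sup>+y. g (x, y) \<partial>lborel \<partial>lborel)"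
    if [measurable]: "g \<in> borel_measurable (borel \<Otimes>\<^sub>M borel)" for g :: "real \<times> real \<Rightarrow> ennreal" and a
  proof -
    have "(\<integral>\<^sup>+x. \<integral>\<^sup>+y. g (x + a * y, y) \<partial>lborel \<partial>lborel) = (\<integral>\<^sup>+y. \<integral>\<^sup>+x. g (x + a * y, y) \<partial>lborel \<partial>lborel)"
      by (rule lborel_pair.Fubini') measurable
    also have "\<dots> = (\<integral>\<^sup>+y. \<integral>\<^sup>+x. g (x, y) \<partial>lborel \<partial>lborel)"
    proof (rule nn_integral_cong)
      fix y
      have m: "(\<lambda>x. g (x, y)) \<in> borel_measurable lborel" by measurable
      show "(\<integral>\<^sup>+x. g (x + a * y, y) \<partial>lborel) = (\<integral>\<^sup>+x. g (x, y) \<partial>lborel)"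
        using nn_integral_shift[OF m, of "a * y"] by (simp add: add.commute)
    qed
    also have "\<dots> = (\<integral>\<^sup>+x. \<integral>\<^sup>+y. g (x, y) \<partial>lborel \<partial>lborel)"
      by (rule lborel_pair.Fubini') measurable
    finally show ?thesis .
  qed
  have shear_y: "(\<integral>\<^sup>+x. \<integral>\<^sup>+y. g (x, y + a * x) \<partial>lborel \<partial>lborel) = (\<integral>\<^sup>+x. \<integral>\<^sup>+y. g (x, y) \<partial>lborel \<partial>lborel)"
    if [measurable]: "g \<in> borel_measurable (borel \<Otimes>\<^sub>M borel)" for g :: "real \<times> real \<Rightarrow> ennreal" and a
  proof (rule nn_integral_cong)
    fix x
    have m: "(\<lambda>y. g (x, y)) \<in> borel_measurable lborel" by measurable
    show "(\<integral>\<^sup>+y. g (x, y + a * x) \<partial>lborel) = (\<integral>\<^sup>+y. g (x, y) \<partial>lborel)"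
      using nn_integral_shift[OF m, of "a * x"] by (simp add: add.commute)
  qed
  show ?thesis
  proof (cases "s = 0")
    case True
    then have "c = 1 \<or> c = -1" using cs by (simp add: power2_eq_1_iff)
    then show ?thesis
    proof
      assume c: "c = -1"
      have "(\<integral>\<^sup>+x. \<integral>\<^sup>+y. f (c * x - s * y, s * x + c * y) \<partial>lborel \<partial>lborel) = (\<integral>\<^sup>+x. \<integral>\<^sup>+y. f (0 - x, 0 - y) \<partial>lborel \<partial>lborel)"
        by (simp add: c True)
      also have "\<dots> = (\<integral>\<^sup>+x. \<integral>\<^sup>+y. f (0 - x, y) \<partial>lborel \<partial>lborel)"
        by (rule nn_integral_cong, rule nn_integral_reflect) measurable
      also have "\<dots> = (\<integral>\<^sup>+x. \<integral>\<^sup>+y. f (x, y) \<partial>lborel \<partial>lborel)"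
        by (rule nn_integral_reflect[of "\<lambda>x. \<integral>\<^sup>+y. f (x, y) \<partial>lborel"]) measurable
      finally show ?thesis .
    qed (simp add: True)
  next
    case False
    \<comment> \<open>For the angle \<open>\<theta>\<close> with cosine \<open>c\<close> and sine \<open>s\<close> this is \<open>- tan (\<theta> / 2)\<close>.\<close>
    define a where "a = (c - 1) / s"
    have a: "1 + a * s = c" "2 * a + a\<^sup>2 * s = - s"
    proof -
      show 1: "1 + a * s = c" using False by (simp add: a_def)
      have "2 * a + a\<^sup>2 * s = a * (1 + (1 + a * s))" by (simp add: power2_eq_square algebra_simps)
      also have "\<dots> = (c\<^sup>2 - 1) / s" unfolding 1 by (simp add: a_def power2_eq_square algebra_simps)
      also have "\<dots> = - s"
      proof -
        have "c\<^sup>2 - 1 = - s * s" using cs by (simp add: power2_eq_square)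
        then show ?thesis using False by simp
      qed
      finally show "2 * a + a\<^sup>2 * s = - s" .
    qed
    define f1 where "f1 p = f (fst p + a * snd p, snd p)" for p
    define f2 where "f2 p = f1 (fst p, snd p + s * fst p)" for p
    have [measurable]: "f1 \<in> borel_measurable (borel \<Otimes>\<^sub>M borel)" unfolding f1_def by measurable
    have [measurable]: "f2 \<in> borel_measurable (borel \<Otimes>\<^sub>M borel)" unfolding f2_def by measurable
    have "f (c * x - s * y, s * x + c * y) = f2 (x + a * y, y)" for x y
    proof -
      have "c * x - s * y = (1 + a * s) * x + (2 * a + a\<^sup>2 * s) * y" unfolding a by simp
      also have "\<dots> = x + a * y + a * (y + s * (x + a * y))" by (simp add: power2_eq_square algebra_simps)
      finally have 1: "c * x - s * y = x + a * y + a * (y + s * (x + a * y))" .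
      have "s * x + c * y = s * x + (1 + a * s) * y" unfolding a by simp
      also have "\<dots> = y + s * (x + a * y)" by (simp add: algebra_simps)
      finally show ?thesis unfolding f2_def f1_def fst_conv snd_conv 1 by simp
    qed
    then have "(\<integral>\<^sup>+x. \<integral>\<^sup>+y. f (c * x - s * y, s * x + c * y) \<partial>lborel \<partial>lborel)
      = (\<integral>\<^sup>+x. \<integral>\<^sup>+y. f2 (x + a * y, y) \<partial>lborel \<partial>lborel)" by simp
    also have "\<dots> = (\<integral>\<^sup>+x. \<integral>\<^sup>+y. f2 (x, y) \<partial>lborel \<partial>lborel)" by (rule shear_x) measurable
    also have "\<dots> = (\<integral>\<^sup>+x. \<integral>\<^sup>+y. f1 (x, y + s * x) \<partial>lborel \<partial>lborel)" by (simp add: f2_def)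
    also have "\<dots> = (\<integral>\<^sup>+x. \<integral>\<^sup>+y. f1 (x, y) \<partial>lborel \<partial>lborel)" by (rule shear_y) measurable
    also have "\<dots> = (\<integral>\<^sup>+x. \<integral>\<^sup>+y. f (x + a * y, y) \<partial>lborel \<partial>lborel)" by (simp add: f1_def)
    also have "\<dots> = (\<integral>\<^sup>+x. \<integral>\<^sup>+y. f (x, y) \<partial>lborel \<partial>lborel)" by (rule shear_x) measurable
    finally show ?thesis .
  qed
qed

lemma gauss_product:
  assumes "0 < v"
  shows "gauss v x * gauss v y = exp (- (x\<^sup>2 + y\<^sup>2) / (2 * v)) / (2 * pi * v)"
proof -
  have "- (x\<^sup>2 + y\<^sup>2) / (2 * v) = - x\<^sup>2 / (2 * v) + - y\<^sup>2 / (2 * v)"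
    by (metis add_divide_distrib minus_add_distrib)
  then have "exp (- (x\<^sup>2 + y\<^sup>2) / (2 * v)) = exp (- x\<^sup>2 / (2 * v)) * exp (- y\<^sup>2 / (2 * v))"
    by (simp only: exp_add)
  then show ?thesis using assms by (simp add: gauss_eq)
qed

text \<open>
  A rotation takes the centre to the first axis and changes neither distances nor Lebesgue
  measure.
\<close>

lemma gauss_plane_rotate_centre:
  fixes F :: "real \<Rightarrow> ennreal"
  assumes v: "0 < v" and [measurable]: "F \<in> borel_measurable borel"
  shows "(\<integral>\<^sup>+x. \<integral>\<^sup>+y. F (x\<^sup>2 + y\<^sup>2) * ennreal (gauss v (x0 - x) * gauss v (y0 - y)) \<partial>lborel \<partial>lborel)
    = (\<integral>\<^sup>+x. \<integral>\<^sup>+y. F (x\<^sup>2 + y\<^sup>2) * ennreal (gauss v (sqrt (x0\<^sup>2 + y0\<^sup>2) - x) * gauss v (0 - y)) \<partial>lborel \<partial>lborel)"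
proof (cases "x0 = 0 \<and> y0 = 0")
  case False
  define n where "n = sqrt (x0\<^sup>2 + y0\<^sup>2)"
  have n2: "n\<^sup>2 = x0\<^sup>2 + y0\<^sup>2" by (simp add: n_def)
  have n: "n \<noteq> 0" using False by (simp add: n_def)
  define c s where "c = x0 / n" and "s = y0 / n"
  have cs: "c\<^sup>2 + s\<^sup>2 = 1"
    using n by (simp add: c_def s_def power_divide add_divide_distrib[symmetric] n2[symmetric])
  have x0: "x0 = n * c" and y0: "y0 = n * s" using n by (simp_all add: c_def s_def)
  define f where "f p = F ((fst p)\<^sup>2 + (snd p)\<^sup>2) * ennreal (gauss v (x0 - fst p) * gauss v (y0 - snd p))" for p
  have [measurable]: "f \<in> borel_measurable (borel \<Otimes>\<^sub>M borel)" unfolding f_def by measurable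
  have "f (c * x - s * y, s * x + c * y) = F (x\<^sup>2 + y\<^sup>2) * ennreal (gauss v (n - x) * gauss v (0 - y))" for x y
  proof -
    have 1: "(c * x - s * y)\<^sup>2 + (s * x + c * y)\<^sup>2 = x\<^sup>2 + y\<^sup>2"
    proof -
      have "(c * x - s * y)\<^sup>2 + (s * x + c * y)\<^sup>2 = (c\<^sup>2 + s\<^sup>2) * (x\<^sup>2 + y\<^sup>2)" by algebra
      then show ?thesis by (simp add: cs)
    qed
    have "(x0 - (c * x - s * y))\<^sup>2 + (y0 - (s * x + c * y))\<^sup>2 = (c\<^sup>2 + s\<^sup>2) * ((n - x)\<^sup>2 + (0 - y)\<^sup>2)"
      unfolding x0 y0 by algebra
    then have 2: "(x0 - (c * x - s * y))\<^sup>2 + (y0 - (s * x + c * y))\<^sup>2 = (n - x)\<^sup>2 + (0 - y)\<^sup>2" by (simp add: cs)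
    show ?thesis unfolding f_def fst_conv snd_conv 1 gauss_product[OF v] 2 ..
  qed
  then show ?thesis
    using nn_integral_plane_rotation[of f c s, OF _ cs] unfolding n_def[symmetric] by (simp add: f_def)
qed simp

lemma disc_emeasure:
  assumes "0 \<le> q"
  shows "emeasure (lborel \<Otimes>\<^sub>M lborel) {p :: real \<times> real. (fst p)\<^sup>2 + (snd p)\<^sup>2 \<le> q} = ennreal (pi * q)"
proof -
  have "{p :: real \<times> real. (fst p)\<^sup>2 + (snd p)\<^sup>2 \<le> q} = cball 0 (sqrt q)"
    using assms by (auto simp: norm_prod_def real_sqrt_le_iff)
  moreover have "emeasure lborel (cball 0 (sqrt q) :: (real \<times> real) set) = ennreal (pi * q)"
    using assms by (subst emeasure_cball) (auto simp: eval_unit_ball_vol power2_eq_square)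
  ultimately show ?thesis by (simp add: lborel_prod)
qed

text \<open>
  The image of planar Lebesgue measure is determined by its values on half-lines.  The corresponding
  sublevel sets are discs of area \<open>pi * (q\<^sup>2 - a\<^sup>2)\<close>, with derivative \<open>2 * pi * q\<close>.
\<close>

lemma nn_integral_planar_radial:
  fixes F :: "real \<Rightarrow> ennreal"
  assumes [measurable]: "F \<in> borel_measurable borel"
  shows "(\<integral>\<^sup>+x. \<integral>\<^sup>+y. F (sqrt (a\<^sup>2 + (x\<^sup>2 + y\<^sup>2))) \<partial>lborel \<partial>lborel)
    = (\<integral>\<^sup>+r. indicator {\<bar>a\<bar><..} r * ennreal (2 * pi * r) * F r \<partial>lborel)"
proof -
  let ?L = "lborel \<Otimes>\<^sub>M lborel :: (real \<times> real) measure"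
  define N where "N p = sqrt (a\<^sup>2 + ((fst p)\<^sup>2 + (snd p)\<^sup>2))" for p :: "real \<times> real"
  have [measurable]: "N \<in> borel_measurable ?L" unfolding N_def by measurable
  define D where "D = density lborel (\<lambda>r. indicator {\<bar>a\<bar><..} r * ennreal (2 * pi * r))"
  have eqL: "emeasure (distr ?L borel N) {..q} = (if \<bar>a\<bar> \<le> q then ennreal (pi * (q\<^sup>2 - a\<^sup>2)) else 0)" for q
  proof -
    have "emeasure (distr ?L borel N) {..q} = emeasure ?L (N -` {..q} \<inter> space ?L)"
      by (rule emeasure_distr) auto
    also have "\<dots> = (if \<bar>a\<bar> \<le> q then ennreal (pi * (q\<^sup>2 - a\<^sup>2)) else 0)"
    proof (cases "\<bar>a\<bar> \<le> q")
      case True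
      have a2: "a\<^sup>2 \<le> q\<^sup>2" using True by (metis abs_ge_zero power2_abs power_mono)
      have "N p \<le> q \<longleftrightarrow> (fst p)\<^sup>2 + (snd p)\<^sup>2 \<le> q\<^sup>2 - a\<^sup>2" for p
      proof -
        have "N p \<le> q \<longleftrightarrow> a\<^sup>2 + ((fst p)\<^sup>2 + (snd p)\<^sup>2) \<le> q\<^sup>2"
          unfolding N_def using True by (auto intro: real_le_lsqrt dest: sqrt_le_D)
        then show ?thesis by linarith
      qed
      then have "N -` {..q} \<inter> space ?L = {p. (fst p)\<^sup>2 + (snd p)\<^sup>2 \<le> q\<^sup>2 - a\<^sup>2}"
        by (auto simp: space_pair_measure)
      then show ?thesis using disc_emeasure[of "q\<^sup>2 - a\<^sup>2"] a2 True by simp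
    next
      case False
      have "\<bar>a\<bar> \<le> N p" for p
      proof -
        have "sqrt (a\<^sup>2) \<le> N p" unfolding N_def by (intro real_sqrt_le_mono) simp
        then show ?thesis by simp
      qed
      then have "N p \<notin> {..q}" for p using False by (meson atMost_iff order_trans)
      then have "N -` {..q} \<inter> space ?L = {}" by auto
      then show ?thesis using False by simp
    qed
    finally show ?thesis .
  qed
  have eqD: "emeasure D {..q} = (if \<bar>a\<bar> \<le> q then ennreal (pi * (q\<^sup>2 - a\<^sup>2)) else 0)" for q
  proof -
    have "emeasure D {..q} = (\<integral>\<^sup>+r. indicator {\<bar>a\<bar><..} r * ennreal (2 * pi * r) * indicator {..q} r \<partial>lborel)"
      unfolding D_def by (rule emeasure_density) auto
    also have "\<dots> = (\<integral>\<^sup>+r. ennreal (2 * pi * r) * indicator {\<bar>a\<bar>..q} r \<partial>lborel)"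
      using AE_lborel_singleton[of "\<bar>a\<bar>"] by (intro nn_integral_cong_AE) (auto simp: indicator_def)
    also have "\<dots> = (if \<bar>a\<bar> \<le> q then ennreal (pi * (q\<^sup>2 - a\<^sup>2)) else 0)"
    proof (cases "\<bar>a\<bar> \<le> q")
      case True
      have "(\<integral>\<^sup>+r. ennreal (2 * pi * r) * indicator {\<bar>a\<bar>..q} r \<partial>lborel) = ennreal (pi * q\<^sup>2 - pi * \<bar>a\<bar>\<^sup>2)"
      proof (rule nn_integral_FTC_Icc[where F = "\<lambda>r. pi * r\<^sup>2" and f = "\<lambda>r. 2 * pi * r"])
        show "((\<lambda>r. pi * r\<^sup>2) has_real_derivative 2 * pi * r) (at r)" for r
          by (auto intro!: derivative_eq_intros)
      qed (use True in \<open>auto intro: order_trans[OF abs_ge_zero]\<close>)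
      then show ?thesis using True by (simp add: algebra_simps)
    qed simp
    finally show ?thesis .
  qed
  have "distr ?L borel N = D"
  proof (rule measure_eqI_generator_eq[where E = "range atMost" and \<Omega> = UNIV and A = "\<lambda>n. {..real n}"])
    show "Int_stable (range (atMost :: real \<Rightarrow> _))"
      by (auto simp: Int_stable_def)
    show "emeasure (distr ?L borel N) X = emeasure D X" if "X \<in> range atMost" for X
      using that by (auto simp: eqL eqD)
    show "sets (distr ?L borel N) = sigma_sets UNIV (range atMost)" "sets D = sigma_sets UNIV (range atMost)"
      by (simp_all add: D_def borel_eq_atMost)
    show "(\<Union>n::nat. {..real n}) = UNIV"
      using real_arch_simple by auto
    show "emeasure (distr ?L borel N) {..real n} \<noteq> \<infinity>" for n by (simp add: eqL)
  qed auto
  then have "(\<integral>\<^sup>+r. F r \<partial>distr ?L borel N) = (\<integral>\<^sup>+r. F r \<partial>D)" by simp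
  moreover have "(\<integral>\<^sup>+r. F r \<partial>D) = (\<integral>\<^sup>+r. indicator {\<bar>a\<bar><..} r * ennreal (2 * pi * r) * F r \<partial>lborel)"
    unfolding D_def by (rule nn_integral_density) auto
  moreover have "(\<integral>\<^sup>+r. F r \<partial>distr ?L borel N) = (\<integral>\<^sup>+p. F (N p) \<partial>?L)"
    by (rule nn_integral_distr) auto
  moreover have "(\<integral>\<^sup>+p. F (N p) \<partial>?L) = (\<integral>\<^sup>+x. \<integral>\<^sup>+y. F (N (x, y)) \<partial>lborel \<partial>lborel)"
    by (rule lborel.nn_integral_fst[symmetric]) measurable
  ultimately show ?thesis by (simp add: N_def)
qed

text \<open>
  The squares of \<open>a\<close> in the exponents cancel, and the exponential of a linear function remains.
\<close>

lemma gauss_exp_interval: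
  assumes v: "0 < v" and \<rho>: "0 < \<rho>" and r: "0 \<le> r"
  shows "(\<integral>\<^sup>+a. ennreal (gauss v (\<rho> - a) * exp (- (r\<^sup>2 - a\<^sup>2) / (2 * v))) * indicator {-r<..<r} a \<partial>lborel)
    = ennreal (v / \<rho> * (radial_kernel v r \<rho>))"
proof -
  define A where "A = 1 / sqrt (2 * pi * v)"
  have A: "0 \<le> A" using v by (simp add: A_def)
  define g where "g a = A * exp (- (\<rho>\<^sup>2 - 2 * \<rho> * a + r\<^sup>2) / (2 * v))" for a
  have g: "gauss v (\<rho> - a) * exp (- (r\<^sup>2 - a\<^sup>2) / (2 * v)) = g a" for a
  proof -
    have "- (\<rho>\<^sup>2 - 2 * \<rho> * a + r\<^sup>2) / (2 * v) = - (\<rho> - a)\<^sup>2 / (2 * v) + (- (r\<^sup>2 - a\<^sup>2) / (2 * v))"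
      unfolding add_divide_distrib[symmetric] by (rule arg_cong[where f = "\<lambda>z. z / (2 * v)"]) (simp add: power2_eq_square algebra_simps)
    then have "exp (- (\<rho>\<^sup>2 - 2 * \<rho> * a + r\<^sup>2) / (2 * v))
        = exp (- (\<rho> - a)\<^sup>2 / (2 * v)) * exp (- (r\<^sup>2 - a\<^sup>2) / (2 * v))"
      by (simp only: exp_add)
    then show ?thesis using v by (simp add: g_def gauss_eq A_def)
  qed
  have "(\<integral>\<^sup>+a. ennreal (gauss v (\<rho> - a) * exp (- (r\<^sup>2 - a\<^sup>2) / (2 * v))) * indicator {-r<..<r} a \<partial>lborel)
    = (\<integral>\<^sup>+a. ennreal (g a) * indicator {-r..r} a \<partial>lborel)"
    unfolding g using AE_lborel_singleton[of r] AE_lborel_singleton[of "-r"]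
    by (intro nn_integral_cong_AE) (auto simp: indicator_def)
  also have "\<dots> = ennreal (v / \<rho> * g r - v / \<rho> * g (- r))"
  proof (rule nn_integral_FTC_Icc)
    show "g \<in> borel_measurable borel" unfolding g_def by measurable
    show "((\<lambda>a. v / \<rho> * g a) has_real_derivative g a) (at a)" for a
      unfolding g_def using v \<rho> by (auto intro!: derivative_eq_intros simp: field_simps)
    show "0 \<le> g a" for a using A by (simp add: g_def)
  qed (use r in auto)
  also have "g r = gauss v (\<rho> - r)" using g[of r] by simp
  also have "g (- r) = gauss v (\<rho> + r)" using g[of "-r"] by simp
  finally show ?thesis by (simp add: right_diff_distrib)
qed

text \<open>
  For fixed \<open>a\<close> the other two coordinates are integrated in polar form.  The product of the planar
  Gaussians depends on the radius \<open>r\<close> only through \<open>r\<^sup>2 - a\<^sup>2\<close>, so \<open>gauss_exp_interval\<close> gives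
  the integral over \<open>a\<close> in \<open>(-r, r)\<close>.
\<close>

lemma gauss_smoothing_radial_centred:
  fixes u :: "real \<Rightarrow> ennreal"
  assumes v: "0 < v" and \<rho>: "0 < \<rho>" and [measurable]: "u \<in> borel_measurable borel"
  shows "(\<integral>\<^sup>+a. \<integral>\<^sup>+b. \<integral>\<^sup>+c. u (sqrt (a\<^sup>2 + (b\<^sup>2 + c\<^sup>2))) * ennreal (gauss v (\<rho> - a) * (gauss v (0 - b) * gauss v (0 - c)))
      \<partial>lborel \<partial>lborel \<partial>lborel)
    = (\<integral>\<^sup>+r. indicator {0<..} r * u r * ennreal (r / \<rho> * (radial_kernel v r \<rho>)) \<partial>lborel)"
proof -
  have "(\<integral>\<^sup>+a. \<integral>\<^sup>+b. \<integral>\<^sup>+c. u (sqrt (a\<^sup>2 + (b\<^sup>2 + c\<^sup>2))) * ennreal (gauss v (\<rho> - a) * (gauss v (0 - b) * gauss v (0 - c)))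
      \<partial>lborel \<partial>lborel \<partial>lborel)
    = (\<integral>\<^sup>+a. \<integral>\<^sup>+r. indicator {\<bar>a\<bar><..} r * ennreal (2 * pi * r)
        * (u r * ennreal (gauss v (\<rho> - a) * (exp (- (r\<^sup>2 - a\<^sup>2) / (2 * v)) / (2 * pi * v)))) \<partial>lborel \<partial>lborel)"
  proof (rule nn_integral_cong)
    fix a
    define F where "F r = u r * ennreal (gauss v (\<rho> - a) * (exp (- (r\<^sup>2 - a\<^sup>2) / (2 * v)) / (2 * pi * v)))" for r
    have [measurable]: "F \<in> borel_measurable borel" unfolding F_def by measurable
    have "u (sqrt (a\<^sup>2 + (b\<^sup>2 + c\<^sup>2))) * ennreal (gauss v (\<rho> - a) * (gauss v (0 - b) * gauss v (0 - c)))
      = F (sqrt (a\<^sup>2 + (b\<^sup>2 + c\<^sup>2)))" for b c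
      unfolding F_def gauss_product[OF v] by simp
    then show "(\<integral>\<^sup>+b. \<integral>\<^sup>+c. u (sqrt (a\<^sup>2 + (b\<^sup>2 + c\<^sup>2))) * ennreal (gauss v (\<rho> - a) * (gauss v (0 - b) * gauss v (0 - c)))
      \<partial>lborel \<partial>lborel) = (\<integral>\<^sup>+r. indicator {\<bar>a\<bar><..} r * ennreal (2 * pi * r)
        * (u r * ennreal (gauss v (\<rho> - a) * (exp (- (r\<^sup>2 - a\<^sup>2) / (2 * v)) / (2 * pi * v)))) \<partial>lborel)"
      using nn_integral_planar_radial[of F a] by (simp add: F_def)
  qed
  also have "\<dots> = (\<integral>\<^sup>+r. \<integral>\<^sup>+a. indicator {\<bar>a\<bar><..} r * ennreal (2 * pi * r)
        * (u r * ennreal (gauss v (\<rho> - a) * (exp (- (r\<^sup>2 - a\<^sup>2) / (2 * v)) / (2 * pi * v)))) \<partial>lborel \<partial>lborel)"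
    by (rule lborel_pair.Fubini') measurable
  also have "\<dots> = (\<integral>\<^sup>+r. indicator {0<..} r * u r * ennreal (r / \<rho> * (radial_kernel v r \<rho>)) \<partial>lborel)"
  proof (rule nn_integral_cong)
    fix r :: real
    show "(\<integral>\<^sup>+a. indicator {\<bar>a\<bar><..} r * ennreal (2 * pi * r)
        * (u r * ennreal (gauss v (\<rho> - a) * (exp (- (r\<^sup>2 - a\<^sup>2) / (2 * v)) / (2 * pi * v)))) \<partial>lborel)
      = indicator {0<..} r * u r * ennreal (r / \<rho> * (radial_kernel v r \<rho>))"
    proof (cases "0 < r")
      case False
      then have "indicator {\<bar>a\<bar><..} r = (0 :: ennreal)" for a by (auto simp: indicator_def)
      then show ?thesis using False by simp
    next
      case True
      have "indicator {\<bar>a\<bar><..} r * ennreal (2 * pi * r)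
        * (u r * ennreal (gauss v (\<rho> - a) * (exp (- (r\<^sup>2 - a\<^sup>2) / (2 * v)) / (2 * pi * v))))
        = (u r * ennreal (r / v)) * (ennreal (gauss v (\<rho> - a) * exp (- (r\<^sup>2 - a\<^sup>2) / (2 * v))) * indicator {-r<..<r} a)" for a
      proof (cases "\<bar>a\<bar> < r")
        case in_r: True
        have "ennreal (2 * pi * r) * ennreal (gauss v (\<rho> - a) * (exp (- (r\<^sup>2 - a\<^sup>2) / (2 * v)) / (2 * pi * v)))
          = ennreal (r / v) * ennreal (gauss v (\<rho> - a) * exp (- (r\<^sup>2 - a\<^sup>2) / (2 * v)))"
          using True v by (simp add: ennreal_mult[symmetric])
        moreover have "indicator {\<bar>a\<bar><..} r = (1 :: ennreal)" "indicator {-r<..<r} a = (1 :: ennreal)"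
          using in_r by (auto simp: indicator_def)
        ultimately show ?thesis by (simp only: mult_1_left mult_1_right mult.assoc mult.left_commute)
      next
        case False
        then have "a \<notin> {-r<..<r}" by auto
        then show ?thesis using False by simp
      qed
      then have "(\<integral>\<^sup>+a. indicator {\<bar>a\<bar><..} r * ennreal (2 * pi * r)
        * (u r * ennreal (gauss v (\<rho> - a) * (exp (- (r\<^sup>2 - a\<^sup>2) / (2 * v)) / (2 * pi * v)))) \<partial>lborel)
        = (\<integral>\<^sup>+a. (u r * ennreal (r / v)) * (ennreal (gauss v (\<rho> - a) * exp (- (r\<^sup>2 - a\<^sup>2) / (2 * v))) * indicator {-r<..<r} a) \<partial>lborel)"
        by simp
      also have "\<dots> = (u r * ennreal (r / v)) * (\<integral>\<^sup>+a. ennreal (gauss v (\<rho> - a) * exp (- (r\<^sup>2 - a\<^sup>2) / (2 * v))) * indicator {-r<..<r} a \<partial>lborel)"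
        by (rule nn_integral_cmult) measurable
      also have "\<dots> = (u r * ennreal (r / v)) * ennreal (v / \<rho> * (radial_kernel v r \<rho>))"
        using True by (subst gauss_exp_interval[OF v \<rho>]) auto
      also have "\<dots> = u r * ennreal (r / \<rho> * (radial_kernel v r \<rho>))"
      proof -
        have "gauss v (\<rho> + r) \<le> gauss v (\<rho> - r)" using True \<rho> by (intro gauss_antimono[OF v]) auto
        then have "ennreal (r / v) * ennreal (v / \<rho> * (radial_kernel v r \<rho>))
          = ennreal (r / \<rho> * (radial_kernel v r \<rho>))"
          using True v \<rho> by (simp add: ennreal_mult[symmetric])
        then show ?thesis by (simp add: mult.assoc)
      qed
      finally show ?thesis using True by simp
    qed
  qed
  finally show ?thesis .
qed

text \<open>
  The Gaussian smoothing of a radial function is radial, so the centre may be moved to \<open>(\<rho>, 0, 0)\<close>.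
  Two planar rotations do this, first in the last two coordinates and then in the first two;
  Fubini brings the coordinates to be rotated to the inside.
\<close>

lemma gauss_smoothing_radial:
  fixes u :: "real \<Rightarrow> ennreal"
  assumes v: "0 < v" and w: "(a0, b0, c0) \<noteq> (0, 0, 0)" and [measurable]: "u \<in> borel_measurable borel"
  defines "\<rho> \<equiv> sqrt (a0\<^sup>2 + (b0\<^sup>2 + c0\<^sup>2))"
  shows "(\<integral>\<^sup>+a. \<integral>\<^sup>+b. \<integral>\<^sup>+c. u (sqrt (a\<^sup>2 + (b\<^sup>2 + c\<^sup>2))) * ennreal (gauss v (a0 - a) * (gauss v (b0 - b) * gauss v (c0 - c)))
      \<partial>lborel \<partial>lborel \<partial>lborel)
    = (\<integral>\<^sup>+r. indicator {0<..} r * u r * ennreal (r / \<rho> * (radial_kernel v r \<rho>)) \<partial>lborel)"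
proof -
  let ?I = "\<lambda>x y z a b c. u (sqrt (a\<^sup>2 + (b\<^sup>2 + c\<^sup>2))) * ennreal (gauss v (x - a) * (gauss v (y - b) * gauss v (z - c)))"
  have \<rho>: "0 < \<rho>" unfolding \<rho>_def using w
    by (auto simp: add_nonneg_pos add_pos_nonneg sum_power2_gt_zero_iff add_nonneg_eq_0_iff less_le)
  define n where "n = sqrt (b0\<^sup>2 + c0\<^sup>2)"
  have n2: "n\<^sup>2 = b0\<^sup>2 + c0\<^sup>2" by (simp add: n_def)
  have "(\<integral>\<^sup>+a. \<integral>\<^sup>+b. \<integral>\<^sup>+c. ?I a0 b0 c0 a b c \<partial>lborel \<partial>lborel \<partial>lborel)
    = (\<integral>\<^sup>+a. \<integral>\<^sup>+b. \<integral>\<^sup>+c. ?I a0 n 0 a b c \<partial>lborel \<partial>lborel \<partial>lborel)"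
  proof (rule nn_integral_cong)
    fix a
    define F where "F q = u (sqrt (a\<^sup>2 + q)) * ennreal (gauss v (a0 - a))" for q
    have Fm: "F \<in> borel_measurable borel" unfolding F_def by measurable
    have "?I a0 b1 c1 a b c
      = F (b\<^sup>2 + c\<^sup>2) * ennreal (gauss v (b1 - b) * gauss v (c1 - c))" for b c b1 c1
      unfolding F_def by (simp add: ennreal_mult mult.assoc)
    then show "(\<integral>\<^sup>+b. \<integral>\<^sup>+c. ?I a0 b0 c0 a b c \<partial>lborel \<partial>lborel)
      = (\<integral>\<^sup>+b. \<integral>\<^sup>+c. ?I a0 n 0 a b c \<partial>lborel \<partial>lborel)"
      using gauss_plane_rotate_centre[OF v Fm, of b0 c0] by (simp only: n_def)
  qed
  also have "\<dots> = (\<integral>\<^sup>+c. \<integral>\<^sup>+a. \<integral>\<^sup>+b. ?I a0 n 0 a b c \<partial>lborel \<partial>lborel \<partial>lborel)"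
  proof -
    have "(\<integral>\<^sup>+a. \<integral>\<^sup>+b. \<integral>\<^sup>+c. ?I a0 n 0 a b c \<partial>lborel \<partial>lborel \<partial>lborel)
      = (\<integral>\<^sup>+a. \<integral>\<^sup>+c. \<integral>\<^sup>+b. ?I a0 n 0 a b c \<partial>lborel \<partial>lborel \<partial>lborel)"
      by (rule nn_integral_cong, rule lborel_pair.Fubini') measurable
    also have "\<dots> = (\<integral>\<^sup>+c. \<integral>\<^sup>+a. \<integral>\<^sup>+b. ?I a0 n 0 a b c \<partial>lborel \<partial>lborel \<partial>lborel)"
      by (rule lborel_pair.Fubini') measurable
    finally show ?thesis .
  qed
  also have "\<dots> = (\<integral>\<^sup>+c. \<integral>\<^sup>+a. \<integral>\<^sup>+b. ?I \<rho> 0 0 a b c \<partial>lborel \<partial>lborel \<partial>lborel)"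
  proof (rule nn_integral_cong)
    fix c
    define F where "F q = u (sqrt (q + c\<^sup>2)) * ennreal (gauss v (0 - c))" for q
    have Fm: "F \<in> borel_measurable borel" unfolding F_def by measurable
    have "?I a1 b1 0 a b c
      = F (a\<^sup>2 + b\<^sup>2) * ennreal (gauss v (a1 - a) * gauss v (b1 - b))" for a b a1 b1
      unfolding F_def by (simp add: ennreal_mult mult_ac add.assoc)
    moreover have "sqrt (a0\<^sup>2 + n\<^sup>2) = \<rho>" unfolding n2 \<rho>_def ..
    ultimately show "(\<integral>\<^sup>+a. \<integral>\<^sup>+b. ?I a0 n 0 a b c \<partial>lborel \<partial>lborel)
      = (\<integral>\<^sup>+a. \<integral>\<^sup>+b. ?I \<rho> 0 0 a b c \<partial>lborel \<partial>lborel)"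
      using gauss_plane_rotate_centre[OF v Fm, of a0 n] by (simp only:)
  qed
  also have "\<dots> = (\<integral>\<^sup>+a. \<integral>\<^sup>+b. \<integral>\<^sup>+c. ?I \<rho> 0 0 a b c \<partial>lborel \<partial>lborel \<partial>lborel)"
  proof -
    have "(\<integral>\<^sup>+c. \<integral>\<^sup>+a. \<integral>\<^sup>+b. ?I \<rho> 0 0 a b c \<partial>lborel \<partial>lborel \<partial>lborel)
      = (\<integral>\<^sup>+a. \<integral>\<^sup>+c. \<integral>\<^sup>+b. ?I \<rho> 0 0 a b c \<partial>lborel \<partial>lborel \<partial>lborel)"
      by (rule lborel_pair.Fubini') measurable
    also have "\<dots> = (\<integral>\<^sup>+a. \<integral>\<^sup>+b. \<integral>\<^sup>+c. ?I \<rho> 0 0 a b c \<partial>lborel \<partial>lborel \<partial>lborel)"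
      by (rule nn_integral_cong, rule lborel_pair.Fubini') measurable
    finally show ?thesis .
  qed
  also have "\<dots> = (\<integral>\<^sup>+r. indicator {0<..} r * u r * ennreal (r / \<rho> * (radial_kernel v r \<rho>)) \<partial>lborel)"
    by (rule gauss_smoothing_radial_centred[OF v \<rho>]) measurable
  finally show ?thesis .
qed

lemma nn_integral_lborel_space:
  fixes f :: "real \<times> real \<times> real \<Rightarrow> ennreal"
  assumes "f \<in> borel_measurable borel"
  shows "(\<integral>\<^sup>+w. f w \<partial>lborel) = (\<integral>\<^sup>+a. \<integral>\<^sup>+b. \<integral>\<^sup>+c. f (a, b, c) \<partial>lborel \<partial>lborel \<partial>lborel)"
proof -
  have f[measurable]: "f \<in> borel_measurable (borel \<Otimes>\<^sub>M (borel \<Otimes>\<^sub>M borel))"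
    using assms by (simp add: borel_prod)
  have "(\<integral>\<^sup>+w. f w \<partial>lborel) = (\<integral>\<^sup>+w. f w \<partial>(lborel \<Otimes>\<^sub>M lborel))" by (simp add: lborel_prod)
  also have "\<dots> = (\<integral>\<^sup>+a. \<integral>\<^sup>+p. f (a, p) \<partial>lborel \<partial>lborel)"
    using assms by (intro lborel.nn_integral_fst[symmetric]) (simp add: lborel_prod)
  also have "\<dots> = (\<integral>\<^sup>+a. \<integral>\<^sup>+p. f (a, p) \<partial>(lborel \<Otimes>\<^sub>M lborel) \<partial>lborel)" by (simp add: lborel_prod)
  also have "\<dots> = (\<integral>\<^sup>+a. \<integral>\<^sup>+b. \<integral>\<^sup>+c. f (a, b, c) \<partial>lborel \<partial>lborel \<partial>lborel)"
    by (rule nn_integral_cong, rule lborel.nn_integral_fst[of "\<lambda>p. f (_, p)", symmetric]) measurable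
  finally show ?thesis .
qed

definition gauss3 :: "real \<Rightarrow> real \<times> real \<times> real \<Rightarrow> real" where
  "gauss3 v w = gauss v (fst w) * (gauss v (fst (snd w)) * gauss v (snd (snd w)))"

lemma borel_measurable_gauss3 [measurable]: "gauss3 v \<in> borel_measurable borel"
proof -
  have "gauss3 v \<in> borel_measurable (borel \<Otimes>\<^sub>M (borel \<Otimes>\<^sub>M borel))"
    unfolding gauss3_def by measurable
  then show ?thesis by (simp add: borel_prod)
qed

lemma norm_triple: "norm (a, b, c) = sqrt (a\<^sup>2 + (b\<^sup>2 + c\<^sup>2))" for a b c :: real
  by (simp add: norm_prod_def)

lemma gauss3_eq:
  assumes v: "0 < v"
  shows "gauss3 v w = gauss v (norm w) / (2 * pi * v)"
proof -
  obtain a b c where w: "w = (a, b, c)" by (cases w)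
  have "- (a\<^sup>2 + (b\<^sup>2 + c\<^sup>2)) / (2 * v) = - a\<^sup>2 / (2 * v) + - (b\<^sup>2 + c\<^sup>2) / (2 * v)"
    by (metis add_divide_distrib minus_add_distrib)
  then have e: "exp (- (a\<^sup>2 + (b\<^sup>2 + c\<^sup>2)) / (2 * v)) = exp (- a\<^sup>2 / (2 * v)) * exp (- (b\<^sup>2 + c\<^sup>2) / (2 * v))"
    by (simp only: exp_add)
  have "gauss3 v w = gauss v a * (exp (- (b\<^sup>2 + c\<^sup>2) / (2 * v)) / (2 * pi * v))"
    unfolding gauss3_def w fst_conv snd_conv gauss_product[OF v] ..
  also have "\<dots> = exp (- (norm w)\<^sup>2 / (2 * v)) / sqrt (2 * pi * v) / (2 * pi * v)"
    unfolding w norm_triple gauss_eq[OF v] by (simp only: real_sqrt_pow2 sum_power2_ge_zero add_nonneg_nonneg zero_le_power2 e) simp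
  finally show ?thesis by (simp add: gauss_eq[OF v])
qed

definition gauss3_law :: "real \<Rightarrow> (real \<times> real \<times> real) measure" where
  "gauss3_law v = density lborel (\<lambda>w. ennreal (gauss3 v w))"

lemma sets_gauss3_law [simp, measurable_cong]: "sets (gauss3_law v) = sets borel"
  by (simp add: gauss3_law_def)

lemma nn_integral_gauss3_law:
  assumes "f \<in> borel_measurable borel"
  shows "(\<integral>\<^sup>+x. f x \<partial>gauss3_law v) = (\<integral>\<^sup>+x. ennreal (gauss3 v x) * f x \<partial>lborel)"
  unfolding gauss3_law_def using assms by (intro nn_integral_density) auto

lemma prob_space_gauss3_law:
  assumes v: "0 < v"
  shows "prob_space (gauss3_law v)"
proof (rule prob_spaceI)
  have "emeasure (gauss3_law v) (space (gauss3_law v)) = (\<integral>\<^sup>+x. 1 \<partial>gauss3_law v)" by simp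
  also have "\<dots> = (\<integral>\<^sup>+a. \<integral>\<^sup>+b. \<integral>\<^sup>+c. ennreal (gauss v a) * (ennreal (gauss v b) * ennreal (gauss v c)) \<partial>lborel \<partial>lborel \<partial>lborel)"
  proof -
    have "(\<integral>\<^sup>+x. 1 \<partial>gauss3_law v) = (\<integral>\<^sup>+x. ennreal (gauss3 v x) * 1 \<partial>lborel)"
      by (rule nn_integral_gauss3_law) simp
    also have "\<dots> = (\<integral>\<^sup>+x. ennreal (gauss3 v x) \<partial>lborel)" by simp
    also have "\<dots> = (\<integral>\<^sup>+a. \<integral>\<^sup>+b. \<integral>\<^sup>+c. ennreal (gauss3 v (a, b, c)) \<partial>lborel \<partial>lborel \<partial>lborel)"
      by (rule nn_integral_lborel_space) measurable
    finally show ?thesis by (simp add: gauss3_def ennreal_mult)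
  qed
  also have "\<dots> = 1"
    by (simp add: nn_integral_cmult nn_integral_gauss[OF v])
  finally show "emeasure (gauss3_law v) (space (gauss3_law v)) = 1" .
qed

lemma gauss3_smoothing_radial:
  fixes u :: "real \<Rightarrow> ennreal"
  assumes v: "0 < v" and w: "w' \<noteq> 0" and [measurable]: "u \<in> borel_measurable borel"
  shows "(\<integral>\<^sup>+w. u (norm w) * ennreal (gauss3 v (w' - w)) \<partial>lborel)
    = (\<integral>\<^sup>+r. indicator {0<..} r * u r * ennreal (r / norm w' * (radial_kernel v r (norm w'))) \<partial>lborel)"
proof -
  obtain a0 b0 c0 where w': "w' = (a0, b0, c0)" by (cases w')
  have "(\<integral>\<^sup>+w. u (norm w) * ennreal (gauss3 v (w' - w)) \<partial>lborel)
    = (\<integral>\<^sup>+a. \<integral>\<^sup>+b. \<integral>\<^sup>+c. u (sqrt (a\<^sup>2 + (b\<^sup>2 + c\<^sup>2))) * ennreal (gauss v (a0 - a) * (gauss v (b0 - b) * gauss v (c0 - c)))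
      \<partial>lborel \<partial>lborel \<partial>lborel)"
  proof -
    have m: "(\<lambda>w. u (norm w) * ennreal (gauss3 v (w' - w))) \<in> borel_measurable borel" by measurable
    show ?thesis by (subst nn_integral_lborel_space[OF m]) (simp add: norm_triple gauss3_def w')
  qed
  also have "\<dots> = (\<integral>\<^sup>+r. indicator {0<..} r * u r * ennreal (r / norm w' * (radial_kernel v r (norm w'))) \<partial>lborel)"
    unfolding w' norm_triple using w by (intro gauss_smoothing_radial[OF v]) (auto simp: w' zero_prod_def)
  finally show ?thesis .
qed

lemma nn_integral_translate_space:
  fixes f :: "'c::euclidean_space \<Rightarrow> ennreal"
  assumes "f \<in> borel_measurable borel"
  shows "(\<integral>\<^sup>+x. f (c + x) \<partial>lborel) = (\<integral>\<^sup>+x. f x \<partial>lborel)"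
proof -
  have "(\<integral>\<^sup>+x. f x \<partial>lborel) = (\<integral>\<^sup>+x. f x \<partial>distr lborel borel ((+) c))" by (simp add: lborel_distr_plus)
  also have "\<dots> = (\<integral>\<^sup>+x. f (c + x) \<partial>lborel)" using assms by (subst nn_integral_distr) auto
  finally show ?thesis ..
qed

text \<open>
  The position of the reweighted chain remains rotation invariant.  Its density is the density
  \<open>2 * r * radial_density v \<phi> n r\<close> of the radius divided by the area \<open>4 * pi * r\<^sup>2\<close> of the sphere.
  The factor \<open>r / norm w'\<close> in \<open>gauss3_smoothing_radial\<close> turns the factor \<open>1 / (2 * pi * r)\<close> for
  the old radius into the one for the new radius.
\<close>

lemma brownian_chain_expectation:
  assumes v: "\<And>i. 0 < v i" and \<phi>[measurable]: "\<And>i. \<phi> i \<in> borel_measurable borel"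
    and "K \<in> borel_measurable (borel :: (real \<times> real \<times> real) measure)"
  shows "chain_expectation (+) 0 (\<lambda>i. gauss3_law (v i)) (\<lambda>i w. \<phi> i (norm w)) n K
    = (\<integral>\<^sup>+w. radial_density v \<phi> n (norm w) * ennreal (1 / (2 * pi * norm w)) * K w \<partial>lborel)"
  using assms(3)
proof (induction n arbitrary: K)
  case 0
  note [measurable] = 0
  have "chain_expectation (+) 0 (\<lambda>i. gauss3_law (v i)) (\<lambda>i w. \<phi> i (norm w)) 0 K
    = (\<integral>\<^sup>+w. ennreal (gauss3 (v 0) w) * K w \<partial>lborel)"
    by (simp add: nn_integral_gauss3_law)
  also have "\<dots> = (\<integral>\<^sup>+w. radial_density v \<phi> 0 (norm w) * ennreal (1 / (2 * pi * norm w)) * K w \<partial>lborel)"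
  proof (rule nn_integral_cong_AE)
    show "AE w in lborel. ennreal (gauss3 (v 0) w) * K w
      = radial_density v \<phi> 0 (norm w) * ennreal (1 / (2 * pi * norm w)) * K w"
      using AE_lborel_singleton[of 0]
    proof eventually_elim
      case (elim w)
      have "rayleigh (v 0) (norm w) * (1 / (2 * pi * norm w)) = gauss3 (v 0) w"
        using elim v[of 0] by (simp add: gauss3_eq[OF v] rayleigh_def)
      moreover have "0 \<le> rayleigh (v 0) (norm w)" by (rule rayleigh_nonneg[OF v]) simp
      ultimately have "ennreal (rayleigh (v 0) (norm w)) * ennreal (1 / (2 * pi * norm w)) = ennreal (gauss3 (v 0) w)"
        by (metis ennreal_mult zero_le_divide_1_iff norm_ge_zero mult_nonneg_nonneg pi_ge_zero zero_le_numeral)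
      then show ?case using elim by simp
    qed
  qed
  finally show ?case .
next
  case (Suc n)
  note [measurable] = Suc.prems
  interpret S: prob_space "gauss3_law (v (Suc n))" by (rule prob_space_gauss3_law[OF v])
  let ?V = "v (Suc n)"
  define U where "U r = radial_density v \<phi> n r * ennreal (1 / (2 * pi * r)) * \<phi> n r" for r
  have [measurable]: "U \<in> borel_measurable borel" unfolding U_def by measurable
  have K'[measurable]: "(\<lambda>w. \<integral>\<^sup>+x. K (w + x) \<partial>gauss3_law ?V) \<in> borel_measurable borel" by measurable
  have "chain_expectation (+) 0 (\<lambda>i. gauss3_law (v i)) (\<lambda>i w. \<phi> i (norm w)) (Suc n) K
    = (\<integral>\<^sup>+w. radial_density v \<phi> n (norm w) * ennreal (1 / (2 * pi * norm w)) * (\<phi> n (norm w) * (\<integral>\<^sup>+x. K (w + x) \<partial>gauss3_law ?V)) \<partial>lborel)"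
    unfolding chain_expectation.simps by (rule Suc.IH) measurable
  also have "\<dots> = (\<integral>\<^sup>+w. \<integral>\<^sup>+w'. U (norm w) * (ennreal (gauss3 ?V (w' - w)) * K w') \<partial>lborel \<partial>lborel)"
  proof (rule nn_integral_cong)
    fix w :: "real \<times> real \<times> real"
    have "(\<integral>\<^sup>+x. K (w + x) \<partial>gauss3_law ?V) = (\<integral>\<^sup>+x. ennreal (gauss3 ?V ((w + x) - w)) * K (w + x) \<partial>lborel)"
      by (simp add: nn_integral_gauss3_law)
    also have "\<dots> = (\<integral>\<^sup>+w'. ennreal (gauss3 ?V (w' - w)) * K w' \<partial>lborel)"
      by (rule nn_integral_translate_space[of "\<lambda>w'. ennreal (gauss3 ?V (w' - w)) * K w'"]) measurable
    finally have 1: "(\<integral>\<^sup>+x. K (w + x) \<partial>gauss3_law ?V) = (\<integral>\<^sup>+w'. ennreal (gauss3 ?V (w' - w)) * K w' \<partial>lborel)" .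
    have "(\<integral>\<^sup>+w'. U (norm w) * (ennreal (gauss3 ?V (w' - w)) * K w') \<partial>lborel)
      = U (norm w) * (\<integral>\<^sup>+w'. ennreal (gauss3 ?V (w' - w)) * K w' \<partial>lborel)"
      by (rule nn_integral_cmult) measurable
    then show "radial_density v \<phi> n (norm w) * ennreal (1 / (2 * pi * norm w)) * (\<phi> n (norm w) * (\<integral>\<^sup>+x. K (w + x) \<partial>gauss3_law ?V))
      = (\<integral>\<^sup>+w'. U (norm w) * (ennreal (gauss3 ?V (w' - w)) * K w') \<partial>lborel)"
      unfolding 1 by (simp add: U_def mult.assoc)
  qed
  also have "\<dots> = (\<integral>\<^sup>+w'. \<integral>\<^sup>+w. U (norm w) * (ennreal (gauss3 ?V (w' - w)) * K w') \<partial>lborel \<partial>lborel)"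
    by (rule lborel_pair.Fubini') measurable
  also have "\<dots> = (\<integral>\<^sup>+w'. radial_density v \<phi> (Suc n) (norm w') * ennreal (1 / (2 * pi * norm w')) * K w' \<partial>lborel)"
  proof (rule nn_integral_cong_AE)
    show "AE w' in lborel. (\<integral>\<^sup>+w. U (norm w) * (ennreal (gauss3 ?V (w' - w)) * K w') \<partial>lborel)
      = radial_density v \<phi> (Suc n) (norm w') * ennreal (1 / (2 * pi * norm w')) * K w'"
      using AE_lborel_singleton[of 0]
    proof eventually_elim
      case (elim w')
      have "(\<integral>\<^sup>+w. U (norm w) * (ennreal (gauss3 ?V (w' - w)) * K w') \<partial>lborel)
        = (\<integral>\<^sup>+w. U (norm w) * ennreal (gauss3 ?V (w' - w)) \<partial>lborel) * K w'"
        unfolding mult.assoc[symmetric] by (rule nn_integral_multc) measurable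
      also have "(\<integral>\<^sup>+w. U (norm w) * ennreal (gauss3 ?V (w' - w)) \<partial>lborel)
        = (\<integral>\<^sup>+r. indicator {0<..} r * U r * ennreal (r / norm w' * (radial_kernel ?V r (norm w'))) \<partial>lborel)"
        by (rule gauss3_smoothing_radial[OF v elim]) measurable
      also have "\<dots> = (\<integral>\<^sup>+r. radial_density v \<phi> n r * \<phi> n r
          * ennreal (radial_kernel ?V r (norm w')) * ennreal (1 / (2 * pi * norm w')) \<partial>lborel)"
      proof (rule nn_integral_cong)
        fix r :: real
        show "indicator {0<..} r * U r * ennreal (r / norm w' * (radial_kernel ?V r (norm w')))
          = radial_density v \<phi> n r * \<phi> n r * ennreal (radial_kernel ?V r (norm w')) * ennreal (1 / (2 * pi * norm w'))"
        proof (cases "0 < r")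
          case False
          then show ?thesis using radial_density_nonpos[of v r, OF v] by simp
        next
          case True
          have "0 \<le> norm w'" by simp
          then have "\<bar>norm w' - r\<bar> \<le> \<bar>norm w' + r\<bar>" using True by linarith
          then have d: "0 \<le> radial_kernel ?V r (norm w')"
            using gauss_antimono[OF v[of "Suc n"], of "norm w' - r" "norm w' + r"] by simp
          have "1 / (2 * pi * r) * (r / norm w' * (radial_kernel ?V r (norm w')))
            = (radial_kernel ?V r (norm w')) * (1 / (2 * pi * norm w'))"
            using True by simp
          then have "ennreal (1 / (2 * pi * r)) * ennreal (r / norm w' * (radial_kernel ?V r (norm w')))
            = ennreal (radial_kernel ?V r (norm w')) * ennreal (1 / (2 * pi * norm w'))"
            using True d by (simp only: ennreal_mult[symmetric] divide_nonneg_nonneg mult_nonneg_nonneg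
                norm_ge_zero pi_ge_zero zero_le_numeral zero_le_one less_imp_le)
          then show ?thesis using True by (simp add: U_def mult.assoc mult.left_commute)
        qed
      qed
      also have "\<dots> = radial_density v \<phi> (Suc n) (norm w') * ennreal (1 / (2 * pi * norm w'))"
        unfolding radial_density.simps by (rule nn_integral_multc) measurable
      finally show ?case .
    qed
  qed
  finally show ?case .
qed

text \<open>
  By Archimedes the first coordinate of a uniform point on the sphere of radius \<open>r\<close> is uniform on
  \<open>(-r, r)\<close>.  Hence the norm and the first coordinate of the chain in space are distributed as
  \<open>pitman_chain_expectation\<close> says of the radius and position of the Pitman chain.
\<close>

lemma pitman_brownian_chain_expectation:
  assumes v: "\<And>i. 0 < v i" and \<phi>[measurable]: "\<And>i. \<phi> i \<in> borel_measurable borel"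
    and G: "G \<in> borel_measurable borel"
  shows "chain_expectation pitman_step (0, 0) (\<lambda>i. step_law (v i)) (\<lambda>i s. \<phi> i (fst s)) n G
    = chain_expectation (+) 0 (\<lambda>i. gauss3_law (v i)) (\<lambda>i w. \<phi> i (norm w)) n (\<lambda>w. G (norm w, fst w))"
proof -
  have G'[measurable]: "G \<in> borel_measurable (borel \<Otimes>\<^sub>M borel)" using G by (simp add: borel_prod)
  have "(\<lambda>w. (norm w, fst w)) \<in> measurable (borel :: (real \<times> real \<times> real) measure) borel"
    by (intro borel_measurable_continuous_onI continuous_intros)
  then have K[measurable]: "(\<lambda>w :: real \<times> real \<times> real. G (norm w, fst w)) \<in> borel_measurable borel"
    using G by (rule measurable_compose)
  have "chain_expectation (+) 0 (\<lambda>i. gauss3_law (v i)) (\<lambda>i w. \<phi> i (norm w)) n (\<lambda>w. G (norm w, fst w))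
    = (\<integral>\<^sup>+w. radial_density v \<phi> n (norm w) * ennreal (1 / (2 * pi * norm w)) * G (norm w, fst w)
        \<partial>(lborel :: (real \<times> real \<times> real) measure))"
    by (rule brownian_chain_expectation[OF v \<phi> K])
  also have "\<dots> = (\<integral>\<^sup>+a. \<integral>\<^sup>+b. \<integral>\<^sup>+c. (\<lambda>r. radial_density v \<phi> n r * ennreal (1 / (2 * pi * r)) * G (r, a)) (sqrt (a\<^sup>2 + (b\<^sup>2 + c\<^sup>2)))
      \<partial>lborel \<partial>lborel \<partial>lborel)"
    by (subst nn_integral_lborel_space) (simp_all add: norm_triple)
  also have "\<dots> = (\<integral>\<^sup>+a. \<integral>\<^sup>+r. indicator {\<bar>a\<bar><..} r * ennreal (2 * pi * r) * (radial_density v \<phi> n r * ennreal (1 / (2 * pi * r)) * G (r, a)) \<partial>lborel \<partial>lborel)"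
    by (rule nn_integral_cong, rule nn_integral_planar_radial) measurable
  also have "\<dots> = (\<integral>\<^sup>+a. \<integral>\<^sup>+r. radial_density v \<phi> n r * (indicator {-r<..<r} a * G (r, a)) \<partial>lborel \<partial>lborel)"
  proof (intro nn_integral_cong)
    fix a r :: real
    show "indicator {\<bar>a\<bar><..} r * ennreal (2 * pi * r) * (radial_density v \<phi> n r * ennreal (1 / (2 * pi * r)) * G (r, a))
      = radial_density v \<phi> n r * (indicator {-r<..<r} a * G (r, a))"
    proof (cases "\<bar>a\<bar> < r")
      case True
      then have "ennreal (2 * pi * r) * ennreal (1 / (2 * pi * r)) = 1"
        by (subst ennreal_mult[symmetric]) auto
      moreover have "indicator {\<bar>a\<bar><..} r = (1 :: ennreal)" "indicator {-r<..<r} a = (1 :: ennreal)"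
        using True by (auto simp: indicator_def)
      ultimately show ?thesis by (simp add: mult.assoc mult.left_commute[of "ennreal (2 * pi * r)"])
         (metis mult.assoc mult.left_commute mult_1)
    next
      case False
      then show ?thesis by (auto simp: indicator_def)
    qed
  qed
  also have "\<dots> = (\<integral>\<^sup>+r. \<integral>\<^sup>+a. radial_density v \<phi> n r * (indicator {-r<..<r} a * G (r, a)) \<partial>lborel \<partial>lborel)"
    by (rule lborel_pair.Fubini') measurable
  also have "\<dots> = (\<integral>\<^sup>+r. radial_density v \<phi> n r * (\<integral>\<^sup>+a. indicator {-r<..<r} a * G (r, a) \<partial>lborel) \<partial>lborel)"
    by (rule nn_integral_cong, rule nn_integral_cmult) measurable
  also have "\<dots> = chain_expectation pitman_step (0, 0) (\<lambda>i. step_law (v i)) (\<lambda>i s. \<phi> i (fst s)) n G"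
    by (rule pitman_chain_expectation[OF v \<phi> G, symmetric])
  finally show ?thesis ..
qed

section \<open>From the bridge to Brownian motion\<close>

lemma integrable_mult_of_squares:
  fixes X Y :: "'a \<Rightarrow> real"
  assumes [measurable]: "X \<in> borel_measurable M" "Y \<in> borel_measurable M"
    and "integrable M (\<lambda>\<omega>. (X \<omega>)\<^sup>2)" "integrable M (\<lambda>\<omega>. (Y \<omega>)\<^sup>2)"
  shows "integrable M (\<lambda>\<omega>. X \<omega> * Y \<omega>)"
proof (rule Bochner_Integration.integrable_bound)
  show "integrable M (\<lambda>\<omega>. (X \<omega>)\<^sup>2 + (Y \<omega>)\<^sup>2)" using assms by auto
  show "AE \<omega> in M. norm (X \<omega> * Y \<omega>) \<le> norm ((X \<omega>)\<^sup>2 + (Y \<omega>)\<^sup>2)"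
  proof (rule AE_I2)
    fix \<omega>
    have "2 * \<bar>X \<omega> * Y \<omega>\<bar> \<le> (X \<omega>)\<^sup>2 + (Y \<omega>)\<^sup>2"
      using sum_squares_bound[of "\<bar>X \<omega>\<bar>" "\<bar>Y \<omega>\<bar>"] by (simp add: abs_mult)
    then show "norm (X \<omega> * Y \<omega>) \<le> norm ((X \<omega>)\<^sup>2 + (Y \<omega>)\<^sup>2)" by simp
  qed
qed measurable

context
  fixes P :: "'a measure" and \<beta> :: "real \<Rightarrow> 'a \<Rightarrow> real" and t x :: real
  assumes t: "0 < t" and P: "prob_space P" and bridge: "brownian_bridge t x P \<beta>"
begin

interpretation prob_space P by (rule P)

lemma bridge_continuous_process: "continuous_process t P \<beta>"
  using bridge by (simp add: brownian_bridge_def)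

lemma bridge_measurable: "s \<in> {0..t} \<Longrightarrow> \<beta> s \<in> borel_measurable P"
  using bridge_continuous_process by (simp add: continuous_process_def)

lemma bridge_gaussian: "finite F \<Longrightarrow> F \<subseteq> {0..t} \<Longrightarrow> gaussian_rv P (\<lambda>\<omega>. \<Sum>s\<in>F. c s * \<beta> s \<omega>)"
  using bridge unfolding brownian_bridge_def gaussian_process_def by blast

lemma bridge_integrable:
  assumes "s \<in> {0..t}"
  shows "integrable P (\<beta> s)" "integrable P (\<lambda>\<omega>. (\<beta> s \<omega>)\<^sup>2)"
proof -
  have "gaussian_rv P (\<lambda>\<omega>. \<Sum>s\<in>{s}. (\<lambda>_. 1) s * \<beta> s \<omega>)"
    using assms by (intro bridge_gaussian) auto
  then have "gaussian_rv P (\<beta> s)" by simp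
  then show "integrable P (\<beta> s)" "integrable P (\<lambda>\<omega>. (\<beta> s \<omega>)\<^sup>2)"
    using gaussian_rv_moments[OF P] by auto
qed

lemma bridge_mean: "s \<in> {0..t} \<Longrightarrow> (LINT \<omega>|P. \<beta> s \<omega>) = x / t * s"
  using bridge unfolding brownian_bridge_def by blast

lemma bridge_covariance:
  assumes r: "r \<in> {0..t}" and s: "s \<in> {0..t}"
  shows "(LINT \<omega>|P. (\<beta> r \<omega> - x / t * r) * (\<beta> s \<omega> - x / t * s)) = min r s - r * s / t"
proof -
  have cov: "(LINT \<omega>|P. (\<beta> r \<omega> - x / t * r) * (\<beta> s \<omega> - x / t * s)) = r * (t - s) / t"
    if "0 \<le> r" "r \<le> s" "s \<le> t" for r s
  proof -
    have "(LINT \<omega>|P. (\<beta> r \<omega> - (LINT \<omega>|P. \<beta> r \<omega>)) * (\<beta> s \<omega> - (LINT \<omega>|P. \<beta> s \<omega>))) = r * (t - s) / t"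
      using bridge that unfolding brownian_bridge_def by blast
    then show ?thesis using that by (simp add: bridge_mean)
  qed
  show ?thesis
  proof (cases "r \<le> s")
    case True
    then show ?thesis using cov[of r s] r s t by (simp add: field_simps)
  next
    case False
    then have "(LINT \<omega>|P. (\<beta> s \<omega> - x / t * s) * (\<beta> r \<omega> - x / t * r)) = s * (t - r) / t"
      using r s by (intro cov) auto
    then show ?thesis using False t by (simp add: mult.commute[of "\<beta> s _ - _"] field_simps)
  qed
qed

text \<open>
  The variance \<open>s - s\<^sup>2 / t\<close> vanishes at both ends.
\<close>

lemma bridge_endpoints: "AE \<omega> in P. \<beta> 0 \<omega> = 0" "AE \<omega> in P. \<beta> t \<omega> = x"
proof -
  have z: "AE \<omega> in P. \<beta> s \<omega> = x / t * s" if s: "s \<in> {0..t}" and k: "s - s * s / t = 0" for s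
  proof -
    have [measurable]: "\<beta> s \<in> borel_measurable P" by (rule bridge_measurable[OF s])
    have "integrable P (\<lambda>\<omega>. (\<beta> s \<omega>)\<^sup>2 - 2 * (x / t * s) * \<beta> s \<omega> + (x / t * s)\<^sup>2)"
      using bridge_integrable[OF s] by auto
    then have i: "integrable P (\<lambda>\<omega>. (\<beta> s \<omega> - x / t * s) * (\<beta> s \<omega> - x / t * s))"
      by (rule Bochner_Integration.integrable_cong[THEN iffD1, rotated -1]) (auto simp: power2_eq_square algebra_simps)
    have "(LINT \<omega>|P. (\<beta> s \<omega> - x / t * s) * (\<beta> s \<omega> - x / t * s)) = 0"
      using bridge_covariance[OF s s] k by simp
    then have "AE \<omega> in P. (\<beta> s \<omega> - x / t * s) * (\<beta> s \<omega> - x / t * s) = 0"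
      using integral_nonneg_eq_0_iff_AE[OF i] by auto
    then show ?thesis by eventually_elim simp
  qed
  show "AE \<omega> in P. \<beta> 0 \<omega> = 0" using z[of 0] t by simp
  show "AE \<omega> in P. \<beta> t \<omega> = x" using z[of t] t by simp
qed

text \<open>
  The increments are jointly Gaussian, and the covariance of the \<open>i\<close>-th and the \<open>j\<close>-th is
  \<open>- \<delta> i * \<delta> j / t\<close>, plus \<open>\<delta> i\<close> if \<open>i = j\<close>.
\<close>

lemma bridge_increment_char:
  assumes \<tau>: "0 \<le> \<tau> 0" "\<And>i. i < n \<Longrightarrow> \<tau> i < \<tau> (Suc i)" "\<tau> n \<le> t"
  defines "\<delta> \<equiv> \<lambda>i. \<tau> (Suc i) - \<tau> i"
  shows "(CLINT \<omega>|P. iexp (\<Sum>i<n. l i * (increment \<beta> \<tau> i \<omega>)))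
    = iexp (x / t * (\<Sum>i<n. l i * \<delta> i)) * exp (- ((\<Sum>i<n. (l i)\<^sup>2 * \<delta> i) - (\<Sum>i<n. l i * \<delta> i)\<^sup>2 / t) / 2)"
proof -
  have mono: "\<tau> i \<le> \<tau> j" if "i \<le> j" "j \<le> n" for i j
    using strict_chain_mono[of n \<tau> i j] \<tau>(2) that by auto
  have mem: "\<tau> i \<in> {0..t}" if "i \<le> n" for i
    using mono[of 0 i] mono[of i n] \<tau> that by auto
  define D where "D i \<omega> = increment \<beta> \<tau> i \<omega>" for i \<omega>
  have Dint: "integrable P (D i)" if "i < n" for i
    unfolding D_def using that mem by (intro Bochner_Integration.integrable_diff bridge_integrable) auto
  define Z where "Z \<omega> = (\<Sum>i<n. l i * D i \<omega>)" for \<omega>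
  have g: "gaussian_rv P Z"
  proof -
    define F where "F = \<tau> ` {..n}"
    define c where "c s = (\<Sum>i<n. l i * (of_bool (s = \<tau> (Suc i)) - of_bool (s = \<tau> i)))" for s
    have "(\<Sum>s\<in>F. c s * \<beta> s \<omega>) = Z \<omega>" for \<omega>
    proof -
      have "(\<Sum>s\<in>F. c s * \<beta> s \<omega>) = (\<Sum>s\<in>F. \<Sum>i<n. l i * (of_bool (s = \<tau> (Suc i)) - of_bool (s = \<tau> i)) * \<beta> s \<omega>)"
        by (simp add: c_def sum_distrib_right)
      also have "\<dots> = (\<Sum>i<n. \<Sum>s\<in>F. l i * (of_bool (s = \<tau> (Suc i)) - of_bool (s = \<tau> i)) * \<beta> s \<omega>)"
        by (rule sum.swap)
      also have "\<dots> = Z \<omega>"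
        unfolding Z_def
      proof (rule sum.cong[OF refl])
        fix i assume "i \<in> {..<n}"
        then have F: "\<tau> (Suc i) \<in> F" "\<tau> i \<in> F" "finite F" by (auto simp: F_def)
        have "(\<Sum>s\<in>F. l i * (of_bool (s = \<tau> (Suc i)) - of_bool (s = \<tau> i)) * \<beta> s \<omega>)
          = (\<Sum>s\<in>F. (if s = \<tau> (Suc i) then l i * \<beta> s \<omega> else 0) - (if s = \<tau> i then l i * \<beta> s \<omega> else 0))"
          by (intro sum.cong) (auto simp: of_bool_def)
        also have "\<dots> = l i * \<beta> (\<tau> (Suc i)) \<omega> - l i * \<beta> (\<tau> i) \<omega>"
          using F by (simp add: sum_subtractf)
        finally show "(\<Sum>s\<in>F. l i * (of_bool (s = \<tau> (Suc i)) - of_bool (s = \<tau> i)) * \<beta> s \<omega>) = l i * D i \<omega>"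
          by (simp add: D_def right_diff_distrib)
      qed
      finally show ?thesis .
    qed
    moreover have "gaussian_rv P (\<lambda>\<omega>. \<Sum>s\<in>F. c s * \<beta> s \<omega>)"
      using mem by (intro bridge_gaussian) (auto simp: F_def)
    ultimately show ?thesis by simp
  qed
  have EZ: "(LINT \<omega>|P. Z \<omega>) = x / t * (\<Sum>i<n. l i * \<delta> i)"
  proof -
    have "(LINT \<omega>|P. Z \<omega>) = (\<Sum>i<n. l i * (LINT \<omega>|P. D i \<omega>))"
      unfolding Z_def using Dint by (subst Bochner_Integration.integral_sum) auto
    also have "\<dots> = (\<Sum>i<n. l i * (x / t * \<delta> i))"
    proof (rule sum.cong[OF refl])
      fix i assume "i \<in> {..<n}"
      then have m: "\<tau> (Suc i) \<in> {0..t}" "\<tau> i \<in> {0..t}" using mem by auto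
      have "(LINT \<omega>|P. D i \<omega>) = x / t * \<tau> (Suc i) - x / t * \<tau> i"
        unfolding D_def using m by (subst Bochner_Integration.integral_diff) (simp_all add: bridge_integrable bridge_mean del: atLeastAtMost_iff)
      then show "l i * (LINT \<omega>|P. D i \<omega>) = l i * (x / t * \<delta> i)" by (simp add: \<delta>_def right_diff_distrib)
    qed
    finally show ?thesis by (simp add: sum_distrib_left mult.left_commute)
  qed
  define Y where "Y s \<omega> = \<beta> s \<omega> - x / t * s" for s \<omega>
  have Ym: "Y s \<in> borel_measurable P" and Y2: "integrable P (\<lambda>\<omega>. (Y s \<omega>)\<^sup>2)" if s: "s \<in> {0..t}" for s
  proof -
    have [measurable]: "\<beta> s \<in> borel_measurable P" by (rule bridge_measurable[OF s])
    show "Y s \<in> borel_measurable P" unfolding Y_def by measurable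
    have "integrable P (\<lambda>\<omega>. (\<beta> s \<omega>)\<^sup>2 - 2 * (x / t * s) * \<beta> s \<omega> + (x / t * s)\<^sup>2)"
      using bridge_integrable[OF s] by auto
    then show "integrable P (\<lambda>\<omega>. (Y s \<omega>)\<^sup>2)"
      by (rule Bochner_Integration.integrable_cong[THEN iffD1, rotated -1]) (auto simp: Y_def power2_eq_square algebra_simps)
  qed
  have YY: "integrable P (\<lambda>\<omega>. Y r \<omega> * Y s \<omega>)" if "r \<in> {0..t}" "s \<in> {0..t}" for r s
    using that by (intro integrable_mult_of_squares Ym Y2)
  have cov: "(LINT \<omega>|P. Y r \<omega> * Y s \<omega>) = min r s - r * s / t" if "r \<in> {0..t}" "s \<in> {0..t}" for r s
    unfolding Y_def by (rule bridge_covariance[OF that])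
  define E where "E i \<omega> = Y (\<tau> (Suc i)) \<omega> - Y (\<tau> i) \<omega>" for i \<omega>
  have EEi: "integrable P (\<lambda>\<omega>. E i \<omega> * E j \<omega>)"
    and EE: "(LINT \<omega>|P. E i \<omega> * E j \<omega>) = (if i = j then \<delta> i else 0) - \<delta> i * \<delta> j / t" if ij: "i < n" "j < n" for i j
  proof -
    have m: "\<tau> (Suc i) \<in> {0..t}" "\<tau> i \<in> {0..t}" "\<tau> (Suc j) \<in> {0..t}" "\<tau> j \<in> {0..t}" using mem ij by auto
    have e: "E i \<omega> * E j \<omega> = Y (\<tau> (Suc i)) \<omega> * Y (\<tau> (Suc j)) \<omega> - Y (\<tau> (Suc i)) \<omega> * Y (\<tau> j) \<omega>
      - (Y (\<tau> i) \<omega> * Y (\<tau> (Suc j)) \<omega> - Y (\<tau> i) \<omega> * Y (\<tau> j) \<omega>)" for \<omega>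
      unfolding E_def by (simp add: algebra_simps)
    show "integrable P (\<lambda>\<omega>. E i \<omega> * E j \<omega>)"
      unfolding e using m by (intro Bochner_Integration.integrable_diff YY)
    have "(LINT \<omega>|P. E i \<omega> * E j \<omega>) = (min (\<tau> (Suc i)) (\<tau> (Suc j)) - \<tau> (Suc i) * \<tau> (Suc j) / t)
      - (min (\<tau> (Suc i)) (\<tau> j) - \<tau> (Suc i) * \<tau> j / t) - ((min (\<tau> i) (\<tau> (Suc j)) - \<tau> i * \<tau> (Suc j) / t)
      - (min (\<tau> i) (\<tau> j) - \<tau> i * \<tau> j / t))"
      unfolding e using m
      by (simp add: Bochner_Integration.integral_diff Bochner_Integration.integrable_diff YY cov del: atLeastAtMost_iff)
    also have "\<dots> = (min (\<tau> (Suc i)) (\<tau> (Suc j)) - min (\<tau> (Suc i)) (\<tau> j) - (min (\<tau> i) (\<tau> (Suc j)) - min (\<tau> i) (\<tau> j)))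
        - \<delta> i * \<delta> j / t"
      by (simp add: \<delta>_def diff_divide_distrib add_divide_distrib algebra_simps)
    also have "min (\<tau> (Suc i)) (\<tau> (Suc j)) - min (\<tau> (Suc i)) (\<tau> j) - (min (\<tau> i) (\<tau> (Suc j)) - min (\<tau> i) (\<tau> j))
      = (if i = j then \<delta> i else 0)"
    proof -
      consider "i = j" | "i < j" | "j < i" by linarith
      then show ?thesis
      proof cases
        case 1
        then show ?thesis using mono[of i "Suc i"] ij by (simp add: \<delta>_def)
      next
        case 2
        then show ?thesis using mono[of "Suc i" j] mono[of i "Suc i"] mono[of j "Suc j"] ij by (auto simp: min_def)
      next
        case 3
        then show ?thesis using mono[of "Suc j" i] mono[of j "Suc j"] mono[of i "Suc i"] ij by (auto simp: min_def)
      qed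
    qed
    finally show "(LINT \<omega>|P. E i \<omega> * E j \<omega>) = (if i = j then \<delta> i else 0) - \<delta> i * \<delta> j / t" .
  qed
  have VZ: "(LINT \<omega>|P. (Z \<omega> - (LINT \<omega>|P. Z \<omega>))\<^sup>2) = (\<Sum>i<n. (l i)\<^sup>2 * \<delta> i) - (\<Sum>i<n. l i * \<delta> i)\<^sup>2 / t"
  proof -
    have "Z \<omega> - (LINT \<omega>|P. Z \<omega>) = (\<Sum>i<n. l i * E i \<omega>)" for \<omega>
      unfolding EZ unfolding Z_def sum_distrib_left sum_subtractf[symmetric]
      by (intro sum.cong refl) (simp add: E_def Y_def D_def \<delta>_def algebra_simps)
    then have "(Z \<omega> - (LINT \<omega>|P. Z \<omega>))\<^sup>2 = (\<Sum>i<n. \<Sum>j<n. (l i * l j) * (E i \<omega> * E j \<omega>))" for \<omega>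
      by (simp only: power2_eq_square sum_product) (intro sum.cong refl, simp only: mult_ac)
    then have "(LINT \<omega>|P. (Z \<omega> - (LINT \<omega>|P. Z \<omega>))\<^sup>2) = (LINT \<omega>|P. (\<Sum>i<n. \<Sum>j<n. (l i * l j) * (E i \<omega> * E j \<omega>)))" by simp
    also have "\<dots> = (\<Sum>i<n. \<Sum>j<n. (l i * l j) * (LINT \<omega>|P. E i \<omega> * E j \<omega>))"
    proof (subst Bochner_Integration.integral_sum)
      show "integrable P (\<lambda>\<omega>. \<Sum>j<n. (l i * l j) * (E i \<omega> * E j \<omega>))" if "i \<in> {..<n}" for i
        using that by (intro Bochner_Integration.integrable_sum integrable_mult_right EEi) auto
      show "(\<Sum>i<n. LINT \<omega>|P. (\<Sum>j<n. (l i * l j) * (E i \<omega> * E j \<omega>)))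
        = (\<Sum>i<n. \<Sum>j<n. (l i * l j) * (LINT \<omega>|P. E i \<omega> * E j \<omega>))"
      proof (rule sum.cong[OF refl])
        fix i assume i: "i \<in> {..<n}"
        have "(LINT \<omega>|P. (\<Sum>j<n. (l i * l j) * (E i \<omega> * E j \<omega>)))
          = (\<Sum>j<n. LINT \<omega>|P. (l i * l j) * (E i \<omega> * E j \<omega>))"
          using i by (intro Bochner_Integration.integral_sum integrable_mult_right EEi) auto
        then show "(LINT \<omega>|P. (\<Sum>j<n. (l i * l j) * (E i \<omega> * E j \<omega>)))
          = (\<Sum>j<n. (l i * l j) * (LINT \<omega>|P. E i \<omega> * E j \<omega>))" by simp
      qed
    qed
    also have "\<dots> = (\<Sum>i<n. \<Sum>j<n. (if i = j then (l i * l j) * \<delta> i else 0) - (l i * \<delta> i) * (l j * \<delta> j) / t)"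
      by (intro sum.cong refl) (simp add: EE right_diff_distrib)
    also have "\<dots> = (\<Sum>i<n. (l i)\<^sup>2 * \<delta> i) - (\<Sum>i<n. l i * \<delta> i)\<^sup>2 / t"
      by (simp add: sum_subtractf power2_eq_square sum_product sum_divide_distrib)
    finally show ?thesis .
  qed
  show ?thesis
    using gaussian_rv_moments(3)[OF P g] unfolding VZ unfolding EZ unfolding Z_def D_def .
qed

end

definition gauss_law :: "real \<Rightarrow> real measure" where
  "gauss_law t = density lborel (\<lambda>z. ennreal (gauss t z))"

text \<open>
  The bridge with its endpoint \<open>x\<close> replaced by the second component of \<open>p\<close>.
\<close>

definition shifted_bridge :: "real \<Rightarrow> real \<Rightarrow> (real \<Rightarrow> 'a \<Rightarrow> real) \<Rightarrow> real \<Rightarrow> 'a \<times> real \<Rightarrow> real" where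
  "shifted_bridge t x \<beta> s p = \<beta> s (fst p) + (snd p - x) * s / t"

lemma prob_space_gauss_law: "0 < t \<Longrightarrow> prob_space (gauss_law t)"
  unfolding gauss_law_def by (intro prob_space_normal_density) auto

lemma sets_gauss_law [simp, measurable_cong]: "sets (gauss_law t) = sets borel"
  by (simp add: gauss_law_def)

lemma space_gauss_law [simp]: "space (gauss_law t) = UNIV"
  by (simp add: gauss_law_def)

context
  fixes P :: "'a measure" and \<beta> :: "real \<Rightarrow> 'a \<Rightarrow> real" and t x :: real
  assumes t: "0 < t" and P: "prob_space P" and bridge: "brownian_bridge t x P \<beta>"
begin

interpretation P: prob_space P by (rule P)
interpretation N: prob_space "gauss_law t" by (rule prob_space_gauss_law[OF t])
interpretation PN: pair_prob_space P "gauss_law t" ..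

lemma shifted_bridge_continuous_process: "continuous_process t (P \<Otimes>\<^sub>M gauss_law t) (shifted_bridge t x \<beta>)"
  unfolding continuous_process_def
proof (intro conjI ballI)
  fix s assume s: "s \<in> {0..t}"
  have [measurable]: "\<beta> s \<in> borel_measurable P" by (rule bridge_measurable[OF t P bridge s])
  show "shifted_bridge t x \<beta> s \<in> borel_measurable (P \<Otimes>\<^sub>M gauss_law t)"
    unfolding shifted_bridge_def by measurable
next
  fix p assume "p \<in> space (P \<Otimes>\<^sub>M gauss_law t)"
  then have "continuous_on {0..t} (\<lambda>s. \<beta> s (fst p))"
    using bridge_continuous_process[OF t P bridge] by (auto simp: continuous_process_def space_pair_measure)
  then show "continuous_on {0..t} (\<lambda>s. shifted_bridge t x \<beta> s p)"
    unfolding shifted_bridge_def using t by (intro continuous_intros) auto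
qed

text \<open>
  With \<open>L = (\<Sum>i<n. l i * \<delta> i)\<close> the random drift contributes the factor \<open>exp (- L\<^sup>2 / (2 * t))\<close>.
  It cancels the term by which the exponent of the bridge differs from that of independent
  increments.
\<close>

lemma shifted_bridge_increment_char:
  assumes \<tau>: "0 \<le> \<tau> 0" "\<And>i. i < n \<Longrightarrow> \<tau> i < \<tau> (Suc i)" "\<tau> n \<le> t"
  shows "(CLINT p|P \<Otimes>\<^sub>M gauss_law t. iexp (\<Sum>i<n. l i * (increment (shifted_bridge t x \<beta>) \<tau> i p)))
    = (\<Prod>i<n. char (gauss_law (\<tau> (Suc i) - \<tau> i)) (l i))"
proof -
  define \<delta> where "\<delta> i = \<tau> (Suc i) - \<tau> i" for i
  define L where "L = (\<Sum>i<n. l i * \<delta> i)"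
  have mem: "\<tau> i \<in> {0..t}" if "i \<le> n" for i
    using strict_chain_mono[of n \<tau> 0 i] strict_chain_mono[of n \<tau> i n] \<tau> that by auto
  define Z where "Z \<omega> = (\<Sum>i<n. l i * (increment \<beta> \<tau> i \<omega>))" for \<omega>
  have [measurable]: "Z \<in> borel_measurable P"
    unfolding Z_def using mem by (intro borel_measurable_sum borel_measurable_times borel_measurable_diff bridge_measurable[OF t P bridge]) auto
  have eq: "iexp (\<Sum>i<n. l i * (increment (shifted_bridge t x \<beta>) \<tau> i p))
    = iexp (Z (fst p)) * (iexp (- (x / t * L)) * iexp (L / t * snd p))" for p
  proof -
    have "(\<Sum>i<n. l i * (increment (shifted_bridge t x \<beta>) \<tau> i p))
      = (\<Sum>i<n. l i * (increment \<beta> \<tau> i (fst p)) + (snd p - x) / t * (l i * \<delta> i))"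
      using t by (intro sum.cong refl) (simp add: shifted_bridge_def \<delta>_def field_simps)
    also have "\<dots> = Z (fst p) + (snd p - x) / t * L"
      unfolding sum.distrib Z_def L_def sum_distrib_left ..
    also have "\<dots> = Z (fst p) + (- (x / t * L) + L / t * snd p)"
      using t by (simp add: field_simps)
    finally show ?thesis by (simp only: exp_add distrib_left of_real_add)
  qed
  have int: "integrable (P \<Otimes>\<^sub>M gauss_law t) (\<lambda>(\<omega>, z). iexp (Z \<omega>) * (iexp (- (x / t * L)) * iexp (L / t * z)))"
    by (rule PN.integrable_const_bound[of _ 1]) (auto simp: norm_mult case_prod_unfold)
  have "(CLINT p|P \<Otimes>\<^sub>M gauss_law t. iexp (\<Sum>i<n. l i * (increment (shifted_bridge t x \<beta>) \<tau> i p)))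
    = (CLINT p|P \<Otimes>\<^sub>M gauss_law t. (case p of (\<omega>, z) \<Rightarrow> iexp (Z \<omega>) * (iexp (- (x / t * L)) * iexp (L / t * z))))"
    unfolding eq by (simp add: case_prod_unfold)
  also have "\<dots> = (CLINT \<omega>|P. CLINT z|gauss_law t. iexp (Z \<omega>) * (iexp (- (x / t * L)) * iexp (L / t * z)))"
    using PN.integral_fst'[OF int] by simp
  also have "\<dots> = (CLINT \<omega>|P. iexp (Z \<omega>)) * (iexp (- (x / t * L)) * char (gauss_law t) (L / t))"
    unfolding char_def by simp
  also have "char (gauss_law t) (L / t) = exp (- ((L / t)\<^sup>2 * t) / 2)"
    unfolding gauss_law_def by (rule char_normal(1)[OF t])
  also have "(CLINT \<omega>|P. iexp (Z \<omega>)) = iexp (x / t * L) * exp (- ((\<Sum>i<n. (l i)\<^sup>2 * \<delta> i) - L\<^sup>2 / t) / 2)"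
    unfolding Z_def L_def \<delta>_def by (rule bridge_increment_char[where n = n and \<tau> = \<tau>, OF t P bridge \<tau>])
  also have "iexp (x / t * L) * complex_of_real (exp (- ((\<Sum>i<n. (l i)\<^sup>2 * \<delta> i) - L\<^sup>2 / t) / 2))
      * (iexp (- (x / t * L)) * complex_of_real (exp (- ((L / t)\<^sup>2 * t) / 2)))
    = complex_of_real (exp (- ((\<Sum>i<n. (l i)\<^sup>2 * \<delta> i) - L\<^sup>2 / t) / 2) * exp (- ((L / t)\<^sup>2 * t) / 2))"
  proof -
    have "iexp (x / t * L) * iexp (- (x / t * L)) = iexp (x / t * L + - (x / t * L))"
      by (simp only: exp_add distrib_left of_real_add)
    also have "\<dots> = 1" by simp
    finally have "iexp (x / t * L) * iexp (- (x / t * L)) = 1" .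
    moreover have "p * q * (r * s) = (p * r) * (q * s)" for p q r s :: complex
      by (simp only: mult.assoc mult.left_commute)
    ultimately show ?thesis by (simp only: of_real_mult mult_1_left)
  qed
  also have "exp (- ((\<Sum>i<n. (l i)\<^sup>2 * \<delta> i) - L\<^sup>2 / t) / 2) * exp (- ((L / t)\<^sup>2 * t) / 2) = exp (\<Sum>i<n. - ((l i)\<^sup>2 * \<delta> i) / 2)"
  proof -
    have "(L / t)\<^sup>2 * t = L\<^sup>2 / t" using t by (simp add: power2_eq_square)
    then have "- ((\<Sum>i<n. (l i)\<^sup>2 * \<delta> i) - L\<^sup>2 / t) / 2 + - ((L / t)\<^sup>2 * t) / 2 = - (\<Sum>i<n. (l i)\<^sup>2 * \<delta> i) / 2"
      by (simp add: field_simps)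
    also have "\<dots> = (\<Sum>i<n. - ((l i)\<^sup>2 * \<delta> i) / 2)" by (simp add: sum_divide_distrib sum_negf)
    finally show ?thesis by (simp only: exp_add[symmetric])
  qed
  also have "complex_of_real (exp (\<Sum>i<n. - ((l i)\<^sup>2 * \<delta> i) / 2)) = (\<Prod>i<n. complex_of_real (exp (- ((l i)\<^sup>2 * \<delta> i) / 2)))"
    by (simp add: exp_sum)
  also have "\<dots> = (\<Prod>i<n. char (gauss_law (\<delta> i)) (l i))"
  proof (rule prod.cong[OF refl])
    fix i assume "i \<in> {..<n}"
    then have "0 < \<delta> i" using \<tau>(2) by (simp add: \<delta>_def)
    from char_normal(1)[OF this, of "l i"]
    show "complex_of_real (exp (- ((l i)\<^sup>2 * \<delta> i) / 2)) = char (gauss_law (\<delta> i)) (l i)"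
      by (simp add: gauss_law_def)
  qed
  finally show ?thesis by (simp add: \<delta>_def)
qed

lemma shifted_bridge_increments_prob:
  assumes \<tau>: "0 \<le> \<tau> 0" "\<And>i. i < n \<Longrightarrow> \<tau> i < \<tau> (Suc i)" "\<tau> n \<le> t"
    and J: "J \<subseteq> {..<n}" and A: "\<And>i. i \<in> J \<Longrightarrow> A i \<in> sets borel"
  shows "measure (P \<Otimes>\<^sub>M gauss_law t)
      {p \<in> space (P \<Otimes>\<^sub>M gauss_law t). \<forall>i\<in>J. increment (shifted_bridge t x \<beta>) \<tau> i p \<in> A i}
    = (\<Prod>i\<in>J. measure (gauss_law (\<tau> (Suc i) - \<tau> i)) (A i))"
proof -
  have mem: "\<tau> i \<in> {0..t}" if "i \<le> n" for i
    using strict_chain_mono[of n \<tau> 0 i] strict_chain_mono[of n \<tau> i n] \<tau> that by auto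
  have fJ: "finite J" using J finite_subset by blast
  have "measure (P \<Otimes>\<^sub>M gauss_law t)
      {p \<in> space (P \<Otimes>\<^sub>M gauss_law t). \<forall>i\<in>J. increment (shifted_bridge t x \<beta>) \<tau> i p \<in> A i}
    = 1 * (\<Prod>i\<in>J. measure (gauss_law (\<tau> (Suc i) - \<tau> i)) (A i))"
  proof (rule joint_fourier_factorizes[OF fJ])
    show "real_distribution (gauss_law (\<tau> (Suc i) - \<tau> i))" if "i \<in> J" for i
      unfolding gauss_law_def using that J \<tau>(2) by (intro char_normal(2)) auto
    show "finite_measure (P \<Otimes>\<^sub>M gauss_law t)" by (rule PN.finite_measure)
    show "(\<lambda>p. increment (shifted_bridge t x \<beta>) \<tau> i p) \<in> borel_measurable (P \<Otimes>\<^sub>M gauss_law t)"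
      if "i \<in> J" for i
    proof -
      have "i < n" using that J by auto
      then have "\<tau> (Suc i) \<in> {0..t}" "\<tau> i \<in> {0..t}" using mem by auto
      then show ?thesis using shifted_bridge_continuous_process
        by (intro borel_measurable_diff) (simp_all add: continuous_process_def)
    qed
    fix l :: "nat \<Rightarrow> real"
    define l' where "l' i = (if i \<in> J then l i else 0)" for i
    have s: "(\<Sum>i<n. l' i * X i) = (\<Sum>i\<in>J. l i * X i)" for X :: "nat \<Rightarrow> real"
      using J by (intro sum.mono_neutral_cong_right) (auto simp: l'_def)
    have "(\<Prod>i<n. char (gauss_law (\<tau> (Suc i) - \<tau> i)) (l' i)) = (\<Prod>i\<in>J. char (gauss_law (\<tau> (Suc i) - \<tau> i)) (l i))"
    proof (rule prod.mono_neutral_cong_right)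
      show "\<forall>i\<in>{..<n} - J. char (gauss_law (\<tau> (Suc i) - \<tau> i)) (l' i) = 1"
      proof
        fix i assume "i \<in> {..<n} - J"
        moreover have "real_distribution (gauss_law (\<tau> (Suc i) - \<tau> i))" if "i < n"
          unfolding gauss_law_def using that \<tau>(2) by (intro char_normal(2)) auto
        ultimately show "char (gauss_law (\<tau> (Suc i) - \<tau> i)) (l' i) = 1"
          using real_distribution.char_zero by (auto simp: l'_def)
      qed
    qed (use J in \<open>auto simp: l'_def\<close>)
    then show "(CLINT p|P \<Otimes>\<^sub>M gauss_law t. iexp (\<Sum>i\<in>J. l i * (increment (shifted_bridge t x \<beta>) \<tau> i p)))
      = complex_of_real 1 * (\<Prod>i\<in>J. char (gauss_law (\<tau> (Suc i) - \<tau> i)) (l i))"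
      using shifted_bridge_increment_char[where n = n and \<tau> = \<tau> and l = l', OF \<tau>] unfolding s by simp
  qed (rule A)
  then show ?thesis by simp
qed

end

lemma AE_pair_fst:
  assumes N: "prob_space N" and Q: "AE \<omega> in P. Q \<omega>"
  shows "AE p in P \<Otimes>\<^sub>M N. Q (fst p)"
proof (rule AE_distrD[OF measurable_fst])
  show "AE \<omega> in distr (P \<Otimes>\<^sub>M N) P fst. Q \<omega>"
    unfolding prob_space.distr_pair_fst[OF N] by (rule Q)
qed

text \<open>
  Independence and laws of the increments both follow from the factorised probabilities in
  \<open>shifted_bridge_increments_prob\<close>; continuity and the start at \<open>0\<close> are inherited from the bridge.
\<close>

lemma shifted_bridge_brownian_motion:
  fixes P :: "'a measure"
  assumes t: "0 < t" and P: "prob_space P" and bridge: "brownian_bridge t x P \<beta>"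
  shows "standard_brownian_motion t (P \<Otimes>\<^sub>M gauss_law t) (shifted_bridge t x \<beta>)"
proof -
  let ?M = "P \<Otimes>\<^sub>M gauss_law t" and ?W = "shifted_bridge t x \<beta>"
  interpret P: prob_space P by (rule P)
  interpret N: prob_space "gauss_law t" by (rule prob_space_gauss_law[OF t])
  interpret PN: pair_prob_space P "gauss_law t" ..
  note cp = shifted_bridge_continuous_process[OF t P bridge]
  have Wm: "?W s \<in> borel_measurable ?M" if "s \<in> {0..t}" for s
    using cp that by (simp add: continuous_process_def)
  have "AE p in ?M. \<beta> 0 (fst p) = 0"
    by (rule AE_pair_fst[OF prob_space_gauss_law[OF t] bridge_endpoints(1)[OF t P bridge]])
  then have W0: "AE p in ?M. ?W 0 p = 0" by eventually_elim (simp add: shifted_bridge_def)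
  have ind: "PN.indep_vars (\<lambda>_. borel) (\<lambda>i p. increment ?W \<tau> i p) {..<n}"
    if \<tau>: "0 \<le> \<tau> 0" "\<And>i. i < n \<Longrightarrow> \<tau> i < \<tau> (Suc i)" "\<tau> n \<le> t" for n and \<tau> :: "nat \<Rightarrow> real"
  proof (rule PN.indep_vars_generator[where E = "\<lambda>_. sets borel"])
    fix i assume "i \<in> {..<n}"
    then have "\<tau> (Suc i) \<in> {0..t}" "\<tau> i \<in> {0..t}"
      using strict_chain_mono[of n \<tau> 0 i] strict_chain_mono[of n \<tau> "Suc i" n] \<tau>(1,3) \<tau>(2) strict_chain_mono[of n \<tau> i "Suc i"]
      by (auto intro: order_trans)
    then show "(\<lambda>p. increment ?W \<tau> i p) \<in> borel_measurable ?M"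
      by (intro borel_measurable_diff Wm)
  next
    fix J A assume J: "J \<subseteq> {..<n}" "J \<noteq> {}" "finite J" and A: "\<And>i. i \<in> J \<Longrightarrow> A i \<in> sets (borel :: real measure)"
    note pr = shifted_bridge_increments_prob[where n = n and \<tau> = \<tau>, OF t P bridge \<tau>]
    have "(\<Inter>i\<in>J. (\<lambda>p. increment ?W \<tau> i p) -` A i \<inter> space ?M)
      = {p \<in> space ?M. \<forall>i\<in>J. increment ?W \<tau> i p \<in> A i}" using J(2) by blast
    moreover have "PN.prob ((\<lambda>p. increment ?W \<tau> i p) -` A i \<inter> space ?M)
      = measure (gauss_law (\<tau> (Suc i) - \<tau> i)) (A i)" if "i \<in> J" for i
    proof -
      have "(\<lambda>p. increment ?W \<tau> i p) -` A i \<inter> space ?M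
        = {p \<in> space ?M. \<forall>i\<in>{i}. increment ?W \<tau> i p \<in> A i}" by blast
      then show ?thesis using pr[of "{i}" A] J(1) A that by auto
    qed
    ultimately show "PN.prob (\<Inter>i\<in>J. (\<lambda>p. increment ?W \<tau> i p) -` A i \<inter> space ?M)
      = (\<Prod>i\<in>J. PN.prob ((\<lambda>p. increment ?W \<tau> i p) -` A i \<inter> space ?M))"
      using pr[of J A] J(1) A by simp
  qed (auto simp: sets.sigma_sets_eq[of borel, simplified] Int_stable_def)
  have law: "distributed ?M lborel (\<lambda>p. ?W s p - ?W r p) (\<lambda>z. ennreal (\<Prod>b\<in>Basis. normal_density 0 (sqrt (s - r)) (z \<bullet> b)))"
    if rs: "0 \<le> r" "r < s" "s \<le> t" for r s
  proof -
    have [measurable]: "?W s \<in> borel_measurable ?M" "?W r \<in> borel_measurable ?M" using Wm rs by auto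
    define \<tau> where "\<tau> i = (if i = 0 then r else s)" for i :: nat
    have "distr ?M lborel (\<lambda>p. ?W s p - ?W r p) = density lborel (\<lambda>z. ennreal (gauss (s - r) z))"
    proof (rule measure_eqI)
      fix A assume "A \<in> sets (distr ?M lborel (\<lambda>p. ?W s p - ?W r p))"
      then have A[measurable]: "A \<in> sets borel" by simp
      have "0 \<le> \<tau> 0" "\<And>i. i < 1 \<Longrightarrow> \<tau> i < \<tau> (Suc i)" "\<tau> 1 \<le> t" using rs by (auto simp: \<tau>_def)
      from shifted_bridge_increments_prob[where n = 1 and \<tau> = \<tau> and J = "{0}" and A = "\<lambda>_. A", OF t P bridge this]
      have "PN.prob {p \<in> space ?M. ?W s p - ?W r p \<in> A} = measure (gauss_law (s - r)) A"
        using A by (simp add: \<tau>_def)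
      moreover interpret E: prob_space "gauss_law (s - r)" using rs by (intro prob_space_gauss_law) simp
      have "emeasure (distr ?M lborel (\<lambda>p. ?W s p - ?W r p)) A = emeasure ?M {p \<in> space ?M. ?W s p - ?W r p \<in> A}"
        by (subst emeasure_distr) (auto intro!: arg_cong[where f = "emeasure ?M"])
      ultimately have "emeasure (distr ?M lborel (\<lambda>p. ?W s p - ?W r p)) A = emeasure (gauss_law (s - r)) A"
        by (simp add: PN.emeasure_eq_measure E.emeasure_eq_measure)
      then show "emeasure (distr ?M lborel (\<lambda>p. ?W s p - ?W r p)) A
        = emeasure (density lborel (\<lambda>z. ennreal (gauss (s - r) z))) A" by (simp add: gauss_law_def)
    qed simp
    then show ?thesis unfolding distributed_def by simp
  qed
  show ?thesis
    unfolding standard_brownian_motion_def using cp W0 ind law by blast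
qed

definition planar_law :: "real \<Rightarrow> (real \<times> real) measure" where
  "planar_law v = density lborel (\<lambda>z. ennreal (gauss v (fst z) * gauss v (snd z)))"

lemma measurable_planar_density [measurable]:
  "(\<lambda>z. gauss v (fst z) * gauss v (snd z)) \<in> borel_measurable (borel :: (real \<times> real) measure)"
proof -
  have "(\<lambda>z. gauss v (fst z) * gauss v (snd z)) \<in> borel_measurable (borel \<Otimes>\<^sub>M borel)" by measurable
  then show ?thesis by (simp add: borel_prod)
qed

lemma sets_planar_law [simp, measurable_cong]: "sets (planar_law v) = sets borel"
  by (simp add: planar_law_def)

lemma prob_space_planar_law:
  assumes v: "0 < v"
  shows "prob_space (planar_law v)"
proof (rule prob_spaceI)
  have "emeasure (planar_law v) (space (planar_law v)) = (\<integral>\<^sup>+z. ennreal (gauss v (fst z) * gauss v (snd z)) \<partial>(lborel \<Otimes>\<^sub>M lborel))"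
    unfolding planar_law_def lborel_prod
    by (subst emeasure_density) (simp_all add: measurable_planar_density)
  also have "\<dots> = (\<integral>\<^sup>+a. \<integral>\<^sup>+b. ennreal (gauss v (fst (a, b)) * gauss v (snd (a, b))) \<partial>lborel \<partial>lborel)"
    by (rule lborel.nn_integral_fst[symmetric]) measurable
  also have "\<dots> = 1" by (simp add: ennreal_mult nn_integral_cmult nn_integral_gauss[OF v])
  finally show "emeasure (planar_law v) (space (planar_law v)) = 1" .
qed

lemma gauss3_law_pair:
  assumes v: "0 < v"
  shows "gauss3_law v = gauss_law v \<Otimes>\<^sub>M planar_law v"
proof -
  interpret E: prob_space "gauss_law v" by (rule prob_space_gauss_law[OF v])
  interpret L: prob_space "planar_law v" by (rule prob_space_planar_law[OF v])
  have "gauss_law v \<Otimes>\<^sub>M planar_law v = density (lborel \<Otimes>\<^sub>M lborel)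
      (\<lambda>(a, p). ennreal (gauss v a) * ennreal (gauss v (fst p) * gauss v (snd p)))"
    unfolding gauss_law_def planar_law_def
  proof (rule pair_measure_density)
    show "sigma_finite_measure (density lborel (\<lambda>z :: real \<times> real. ennreal (gauss v (fst z) * gauss v (snd z))))"
      unfolding planar_law_def[symmetric] by (rule L.sigma_finite_measure_axioms)
  qed (auto intro: lborel.sigma_finite_measure_axioms)
  also have "\<dots> = gauss3_law v"
  proof -
    have "(\<lambda>(a, p). ennreal (gauss v a) * ennreal (gauss v (fst p) * gauss v (snd p))) = (\<lambda>w. ennreal (gauss3 v w))"
      by (auto simp: gauss3_def ennreal_mult fun_eq_iff)
    then show ?thesis by (simp only: gauss3_law_def lborel_prod)
  qed
  finally show ?thesis ..
qed

lemma borel_space_generator: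
  "sets (borel :: (real \<times> real \<times> real) measure) = sigma_sets UNIV {A \<times> C | A C. A \<in> sets borel \<and> C \<in> sets borel}"
  using sets_pair_measure[of "borel :: real measure" "borel :: (real \<times> real) measure"]
  by (simp only: borel_prod space_borel UNIV_Times_UNIV)

context
  fixes P :: "'a measure" and \<beta> B2 B3 :: "real \<Rightarrow> 'a \<Rightarrow> real" and t x :: real
  assumes t: "0 < t" and P: "prob_space P" and bridge: "brownian_bridge t x P \<beta>"
    and B: "standard_brownian_motion t P (\<lambda>s \<omega>. (B2 s \<omega>, B3 s \<omega>))"
    and indep: "indep_processes t P \<beta> (\<lambda>s \<omega>. (B2 s \<omega>, B3 s \<omega>))"
begin

interpretation P: prob_space P by (rule P)
interpretation N: prob_space "gauss_law t" by (rule prob_space_gauss_law[OF t])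
interpretation PN: pair_prob_space P "gauss_law t" ..

abbreviation (input) "planar_path \<equiv> \<lambda>s \<omega>. (B2 s \<omega>, B3 s \<omega>)"

lemma planar_facts:
  shows "\<And>s. s \<in> {0..t} \<Longrightarrow> planar_path s \<in> borel_measurable P"
    and "AE \<omega> in P. planar_path 0 \<omega> = 0"
    and "\<And>n \<tau>. 0 \<le> \<tau> 0 \<Longrightarrow> (\<And>i. i < n \<Longrightarrow> \<tau> i < \<tau> (Suc i)) \<Longrightarrow> \<tau> n \<le> t \<Longrightarrow>
        P.indep_vars (\<lambda>_. borel) (\<lambda>i \<omega>. planar_path (\<tau> (Suc i)) \<omega> - planar_path (\<tau> i) \<omega>) {..<n::nat}"
    and "\<And>r s. 0 \<le> r \<Longrightarrow> r < s \<Longrightarrow> s \<le> t \<Longrightarrow>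
        distr P lborel (\<lambda>\<omega>. planar_path s \<omega> - planar_path r \<omega>) = planar_law (s - r)"
proof -
  have basis: "(Basis :: (real \<times> real) set) = {(1, 0), (0, 1)}"
    by (auto simp: Basis_prod_def)
  have "(\<Prod>b\<in>(Basis :: (real \<times> real) set). normal_density 0 (sqrt v) (z \<bullet> b)) = gauss v (fst z) * gauss v (snd z)" for v z
    unfolding basis by (cases z) simp
  then show "\<And>s. s \<in> {0..t} \<Longrightarrow> planar_path s \<in> borel_measurable P"
    and "AE \<omega> in P. planar_path 0 \<omega> = 0"
    and "\<And>n \<tau>. 0 \<le> \<tau> 0 \<Longrightarrow> (\<And>i. i < n \<Longrightarrow> \<tau> i < \<tau> (Suc i)) \<Longrightarrow> \<tau> n \<le> t \<Longrightarrow>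
        P.indep_vars (\<lambda>_. borel) (\<lambda>i \<omega>. planar_path (\<tau> (Suc i)) \<omega> - planar_path (\<tau> i) \<omega>) {..<n::nat}"
    and "\<And>r s. 0 \<le> r \<Longrightarrow> r < s \<Longrightarrow> s \<le> t \<Longrightarrow>
        distr P lborel (\<lambda>\<omega>. planar_path s \<omega> - planar_path r \<omega>) = planar_law (s - r)"
    using B unfolding standard_brownian_motion_def continuous_process_def distributed_def planar_law_def
    by auto
qed

text \<open>
  For a fixed endpoint \<open>z\<close> the condition on the shifted bridge is an event of the \<open>\<sigma>\<close>-algebra of \<open>\<beta>\<close>,
  hence independent of the planar motion.  Integrating over \<open>z\<close> gives a product of the
  probabilities of the two parts, and each part has independent increments.
\<close>

lemma joint_increments_prob:
  assumes \<tau>: "0 \<le> \<tau> 0" "\<And>i. i < n \<Longrightarrow> \<tau> i < \<tau> (Suc i)" "\<tau> n \<le> t"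
    and J: "J \<subseteq> {..<n}" "J \<noteq> {}" and A: "\<And>i. i \<in> J \<Longrightarrow> A i \<in> sets borel" and C: "\<And>i. i \<in> J \<Longrightarrow> C i \<in> sets borel"
  shows "emeasure (P \<Otimes>\<^sub>M gauss_law t) {p \<in> space (P \<Otimes>\<^sub>M gauss_law t).
      \<forall>i\<in>J. increment (shifted_bridge t x \<beta>) \<tau> i p \<in> A i
        \<and> planar_path (\<tau> (Suc i)) (fst p) - planar_path (\<tau> i) (fst p) \<in> C i}
    = (\<Prod>i\<in>J. emeasure (gauss3_law (\<tau> (Suc i) - \<tau> i)) (A i \<times> C i))"
proof -
  let ?M = "P \<Otimes>\<^sub>M gauss_law t" and ?W = "shifted_bridge t x \<beta>"
  have fJ: "finite J" using J finite_subset by blast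
  have mem: "\<tau> i \<in> {0..t}" if "i \<le> n" for i
    using strict_chain_mono[of n \<tau> 0 i] strict_chain_mono[of n \<tau> i n] \<tau> that by auto
  have memJ: "\<tau> (Suc i) \<in> {0..t}" "\<tau> i \<in> {0..t}" "\<tau> i < \<tau> (Suc i)" if "i \<in> J" for i
    using that J mem[of "Suc i"] mem[of i] \<tau>(2) by auto
  have Wm: "?W s \<in> borel_measurable ?M" if "s \<in> {0..t}" for s
    using shifted_bridge_continuous_process[OF t P bridge] that by (simp add: continuous_process_def)
  define S where "S = {p \<in> space ?M. \<forall>i\<in>J. increment ?W \<tau> i p \<in> A i}"
  define T where "T = {\<omega> \<in> space P. \<forall>i\<in>J. planar_path (\<tau> (Suc i)) \<omega> - planar_path (\<tau> i) \<omega> \<in> C i}"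
  have Sm: "S \<in> sets ?M" unfolding S_def
  proof (rule sets.sets_Collect_finite_All[OF _ fJ])
    fix i assume i: "i \<in> J"
    have [measurable]: "?W (\<tau> (Suc i)) \<in> borel_measurable ?M" "?W (\<tau> i) \<in> borel_measurable ?M" "A i \<in> sets borel"
      using Wm memJ[OF i] A[OF i] by auto
    show "{p \<in> space ?M. increment ?W \<tau> i p \<in> A i} \<in> sets ?M" by measurable
  qed
  have Bd: "(\<lambda>\<omega>. planar_path (\<tau> (Suc i)) \<omega> - planar_path (\<tau> i) \<omega>) \<in> borel_measurable P" if "i \<in> J" for i
    using memJ[OF that] by (intro borel_measurable_diff planar_facts(1))
  have Tm: "T \<in> sets P" unfolding T_def
  proof (rule sets.sets_Collect_finite_All[OF _ fJ])
    fix i assume i: "i \<in> J"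
    have "(\<lambda>\<omega>. planar_path (\<tau> (Suc i)) \<omega> - planar_path (\<tau> i) \<omega>) -` C i \<inter> space P \<in> sets P"
      by (rule measurable_sets[OF Bd[OF i] C[OF i]])
    then show "{\<omega> \<in> space P. planar_path (\<tau> (Suc i)) \<omega> - planar_path (\<tau> i) \<omega> \<in> C i} \<in> sets P"
      by (simp add: vimage_def Int_def conj_commute)
  qed
  have ind: "P.indep_set (sets (vimage_algebra (space P) (sample_path t \<beta>) (path_space t)))
       (sets (vimage_algebra (space P) (sample_path t planar_path) (path_space t)))"
    and sm: "sample_path t \<beta> \<in> measurable P (path_space t)" "sample_path t planar_path \<in> measurable P (path_space t)"
    using indep by (auto simp: indep_processes_def)
  have T_alg: "T \<in> sets (vimage_algebra (space P) (sample_path t planar_path) (path_space t))"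
  proof -
    let ?Q = "path_space t :: (real \<Rightarrow> real \<times> real) measure"
    define D where "D = {f \<in> space ?Q. \<forall>i\<in>J. f (\<tau> (Suc i)) - f (\<tau> i) \<in> C i}"
    have "D \<in> sets ?Q" unfolding D_def
    proof (rule sets.sets_Collect_finite_All[OF _ fJ])
      fix i assume i: "i \<in> J"
      have "(\<lambda>f. f (\<tau> (Suc i)) - f (\<tau> i)) \<in> borel_measurable ?Q"
        using memJ[OF i] by (intro borel_measurable_diff path_evaluation_measurable[OF t])
      then have "(\<lambda>f. f (\<tau> (Suc i)) - f (\<tau> i)) -` C i \<inter> space ?Q \<in> sets ?Q"
        by (rule measurable_sets[OF _ C[OF i]])
      then show "{f \<in> space ?Q. f (\<tau> (Suc i)) - f (\<tau> i) \<in> C i} \<in> sets ?Q"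
        by (simp add: vimage_def Int_def conj_commute)
    qed
    then have "sample_path t planar_path -` D \<inter> space P \<in> sets (vimage_algebra (space P) (sample_path t planar_path) ?Q)"
      by (rule in_vimage_algebra)
    also have "sample_path t planar_path -` D \<inter> space P = T"
      using measurable_space[OF sm(2)] memJ unfolding D_def T_def by (auto simp: sample_path_def)
    finally show ?thesis .
  qed
  have slice: "emeasure P ((\<lambda>\<omega>. (\<omega>, z)) -` (S \<inter> (T \<times> UNIV))) = emeasure P ((\<lambda>\<omega>. (\<omega>, z)) -` S) * emeasure P T" for z
  proof -
    let ?Q = "path_space t :: (real \<Rightarrow> real) measure"
    define c where "c i = (z - x) * (\<tau> (Suc i) - \<tau> i) / t" for i
    define D where "D = {f \<in> space ?Q. \<forall>i\<in>J. f (\<tau> (Suc i)) - f (\<tau> i) + c i \<in> A i}"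
    have "D \<in> sets ?Q" unfolding D_def
    proof (rule sets.sets_Collect_finite_All[OF _ fJ])
      fix i assume i: "i \<in> J"
      have [measurable]: "(\<lambda>f. f (\<tau> (Suc i))) \<in> borel_measurable ?Q" "(\<lambda>f. f (\<tau> i)) \<in> borel_measurable ?Q" "A i \<in> sets borel"
        using memJ[OF i] A[OF i] by (auto intro!: path_evaluation_measurable[OF t])
      show "{f \<in> space ?Q. f (\<tau> (Suc i)) - f (\<tau> i) + c i \<in> A i} \<in> sets ?Q" by measurable
    qed
    then have "sample_path t \<beta> -` D \<inter> space P \<in> sets (vimage_algebra (space P) (sample_path t \<beta>) ?Q)"
      by (rule in_vimage_algebra)
    also have "sample_path t \<beta> -` D \<inter> space P = (\<lambda>\<omega>. (\<omega>, z)) -` S"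
    proof -
      have "?W (\<tau> (Suc i)) (\<omega>, z) - ?W (\<tau> i) (\<omega>, z) = increment \<beta> \<tau> i \<omega> + c i" for i \<omega>
        by (simp add: shifted_bridge_def c_def diff_divide_distrib right_diff_distrib)
      then show ?thesis
        using measurable_space[OF sm(1)] memJ unfolding D_def S_def
        by (auto simp: sample_path_def space_pair_measure)
    qed
    finally have Sz: "(\<lambda>\<omega>. (\<omega>, z)) -` S \<in> sets (vimage_algebra (space P) (sample_path t \<beta>) ?Q)" .
    have "(\<lambda>\<omega>. (\<omega>, z)) -` (S \<inter> (T \<times> UNIV)) = ((\<lambda>\<omega>. (\<omega>, z)) -` S) \<inter> T" by auto
    then show ?thesis
      using P.indep_setD[OF ind Sz T_alg] by (simp add: P.emeasure_eq_measure ennreal_mult)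
  qed
  have ST: "S \<inter> (T \<times> UNIV) \<in> sets ?M"
    using Sm Tm by (intro sets.Int pair_measureI) auto
  have "{p \<in> space ?M. \<forall>i\<in>J. increment ?W \<tau> i p \<in> A i \<and> planar_path (\<tau> (Suc i)) (fst p) - planar_path (\<tau> i) (fst p) \<in> C i}
    = S \<inter> (T \<times> UNIV)"
    unfolding S_def T_def by (auto simp: space_pair_measure)
  then have "emeasure ?M {p \<in> space ?M. \<forall>i\<in>J. increment ?W \<tau> i p \<in> A i \<and> planar_path (\<tau> (Suc i)) (fst p) - planar_path (\<tau> i) (fst p) \<in> C i}
    = (\<integral>\<^sup>+z. emeasure P ((\<lambda>\<omega>. (\<omega>, z)) -` (S \<inter> (T \<times> UNIV))) \<partial>gauss_law t)"
    by (simp only:) (rule PN.emeasure_pair_measure_alt2[OF ST])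
  also have "\<dots> = (\<integral>\<^sup>+z. emeasure P ((\<lambda>\<omega>. (\<omega>, z)) -` S) * emeasure P T \<partial>gauss_law t)"
    by (simp only: slice)
  also have "\<dots> = (\<integral>\<^sup>+z. emeasure P ((\<lambda>\<omega>. (\<omega>, z)) -` S) \<partial>gauss_law t) * emeasure P T"
    by (rule nn_integral_multc) (rule PN.measurable_emeasure_Pair2[OF Sm])
  also have "(\<integral>\<^sup>+z. emeasure P ((\<lambda>\<omega>. (\<omega>, z)) -` S) \<partial>gauss_law t) = emeasure ?M S"
    by (rule PN.emeasure_pair_measure_alt2[OF Sm, symmetric])
  also have "emeasure ?M S = (\<Prod>i\<in>J. emeasure (gauss_law (\<tau> (Suc i) - \<tau> i)) (A i))"
  proof -
    have "emeasure (gauss_law (\<tau> (Suc i) - \<tau> i)) (A i) = ennreal (measure (gauss_law (\<tau> (Suc i) - \<tau> i)) (A i))" if "i \<in> J" for i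
      using memJ(3)[OF that] prob_space_gauss_law[of "\<tau> (Suc i) - \<tau> i"]
      by (intro finite_measure.emeasure_eq_measure prob_space.finite_measure) simp
    moreover have "measure ?M S = (\<Prod>i\<in>J. measure (gauss_law (\<tau> (Suc i) - \<tau> i)) (A i))"
      unfolding S_def by (rule shifted_bridge_increments_prob[where n = n and \<tau> = \<tau>, OF t P bridge \<tau> J(1) A])
    ultimately show ?thesis
      by (simp add: PN.emeasure_eq_measure prod_ennreal measure_nonneg)
  qed
  also have "emeasure P T = (\<Prod>i\<in>J. emeasure (planar_law (\<tau> (Suc i) - \<tau> i)) (C i))"
  proof -
    have "T = (\<Inter>i\<in>J. (\<lambda>\<omega>. planar_path (\<tau> (Suc i)) \<omega> - planar_path (\<tau> i) \<omega>) -` C i \<inter> space P)"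
      unfolding T_def using J(2) by blast
    then have "P.prob T = (\<Prod>i\<in>J. P.prob ((\<lambda>\<omega>. planar_path (\<tau> (Suc i)) \<omega> - planar_path (\<tau> i) \<omega>) -` C i \<inter> space P))"
      using P.indep_varsD[OF planar_facts(3)[where n = n and \<tau> = \<tau>, OF \<tau>] J(2) fJ J(1), of C] C by simp
    moreover have "emeasure P ((\<lambda>\<omega>. planar_path (\<tau> (Suc i)) \<omega> - planar_path (\<tau> i) \<omega>) -` C i \<inter> space P)
      = emeasure (planar_law (\<tau> (Suc i) - \<tau> i)) (C i)" if "i \<in> J" for i
    proof -
      have "distr P lborel (\<lambda>\<omega>. planar_path (\<tau> (Suc i)) \<omega> - planar_path (\<tau> i) \<omega>) = planar_law (\<tau> (Suc i) - \<tau> i)"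
        using memJ[OF that] by (intro planar_facts(4)) auto
      then show ?thesis
        using emeasure_distr[of "\<lambda>\<omega>. planar_path (\<tau> (Suc i)) \<omega> - planar_path (\<tau> i) \<omega>" P lborel "C i"] Bd[OF that] C[OF that] by simp
    qed
    ultimately show ?thesis
      by (simp add: P.emeasure_eq_measure prod_ennreal[symmetric] measure_nonneg)
  qed
  also have "(\<Prod>i\<in>J. emeasure (gauss_law (\<tau> (Suc i) - \<tau> i)) (A i)) * (\<Prod>i\<in>J. emeasure (planar_law (\<tau> (Suc i) - \<tau> i)) (C i))
    = (\<Prod>i\<in>J. emeasure (gauss3_law (\<tau> (Suc i) - \<tau> i)) (A i \<times> C i))"
    unfolding prod.distrib[symmetric]
  proof (rule prod.cong[OF refl])
    fix i assume i: "i \<in> J"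
    have v: "0 < \<tau> (Suc i) - \<tau> i" using memJ(3)[OF i] by simp
    interpret L: prob_space "planar_law (\<tau> (Suc i) - \<tau> i)" by (rule prob_space_planar_law[OF v])
    show "emeasure (gauss_law (\<tau> (Suc i) - \<tau> i)) (A i) * emeasure (planar_law (\<tau> (Suc i) - \<tau> i)) (C i)
      = emeasure (gauss3_law (\<tau> (Suc i) - \<tau> i)) (A i \<times> C i)"
      unfolding gauss3_law_pair[OF v] using A[OF i] C[OF i] by (subst L.emeasure_pair_measure_Times) auto
  qed
  finally show ?thesis .
qed

lemma joint_increments:
  assumes \<tau>: "0 \<le> \<tau> 0" "\<And>i. i < n \<Longrightarrow> \<tau> i < \<tau> (Suc i)" "\<tau> n \<le> t"
  defines "X \<equiv> \<lambda>i p. (increment (shifted_bridge t x \<beta>) \<tau> i p,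
      planar_path (\<tau> (Suc i)) (fst p) - planar_path (\<tau> i) (fst p))"
  shows "PN.indep_vars (\<lambda>_. borel) X {..<n}"
    and "\<And>i. i < n \<Longrightarrow> distr (P \<Otimes>\<^sub>M gauss_law t) borel (X i) = gauss3_law (\<tau> (Suc i) - \<tau> i)"
proof -
  let ?M = "P \<Otimes>\<^sub>M gauss_law t" and ?E = "{A \<times> C | A C. A \<in> sets (borel :: real measure) \<and> C \<in> sets (borel :: (real \<times> real) measure)}"
  have mem: "\<tau> i \<in> {0..t}" if "i \<le> n" for i
    using strict_chain_mono[of n \<tau> 0 i] strict_chain_mono[of n \<tau> i n] \<tau> that by auto
  have Wm: "shifted_bridge t x \<beta> s \<in> borel_measurable ?M" if "s \<in> {0..t}" for s
    using shifted_bridge_continuous_process[OF t P bridge] that by (simp add: continuous_process_def)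
  have rv: "X i \<in> borel_measurable ?M" if "i < n" for i
  proof -
    have m: "\<tau> (Suc i) \<in> {0..t}" "\<tau> i \<in> {0..t}" using mem that by auto
    have "(\<lambda>p. planar_path (\<tau> (Suc i)) (fst p) - planar_path (\<tau> i) (fst p)) \<in> borel_measurable ?M"
      using m by (intro measurable_compose[OF measurable_fst] borel_measurable_diff planar_facts(1))
    moreover have "(\<lambda>p. increment (shifted_bridge t x \<beta>) \<tau> i p) \<in> borel_measurable ?M"
      using m by (intro borel_measurable_diff Wm)
    ultimately show ?thesis unfolding X_def by (intro borel_measurable_Pair)
  qed
  have stE: "Int_stable ?E"
  proof (rule Int_stableI)
    fix a b assume "a \<in> ?E" "b \<in> ?E"
    then obtain A C A' C' where *: "a = A \<times> C" "b = A' \<times> C'" "A \<in> sets borel" "C \<in> sets borel" "A' \<in> sets borel" "C' \<in> sets borel"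
      by blast
    then have "a \<inter> b = (A \<inter> A') \<times> (C \<inter> C')" "A \<inter> A' \<in> sets borel" "C \<inter> C' \<in> sets borel" by auto
    then show "a \<inter> b \<in> ?E" by blast
  qed
  have pr: "emeasure ?M (\<Inter>i\<in>J. X i -` D i \<inter> space ?M) = (\<Prod>i\<in>J. emeasure (gauss3_law (\<tau> (Suc i) - \<tau> i)) (D i))"
    if J: "J \<subseteq> {..<n}" "J \<noteq> {}" and D: "\<And>i. i \<in> J \<Longrightarrow> D i \<in> ?E" for J D
  proof -
    have "\<forall>i\<in>J. \<exists>A C. D i = A \<times> C \<and> A \<in> sets borel \<and> C \<in> sets borel" using D by blast
    then obtain A C where AC: "\<And>i. i \<in> J \<Longrightarrow> D i = A i \<times> C i" "\<And>i. i \<in> J \<Longrightarrow> A i \<in> sets borel" "\<And>i. i \<in> J \<Longrightarrow> C i \<in> sets borel"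
      by metis
    have "(\<Inter>i\<in>J. X i -` D i \<inter> space ?M) = {p \<in> space ?M.
      \<forall>i\<in>J. increment (shifted_bridge t x \<beta>) \<tau> i p \<in> A i
        \<and> planar_path (\<tau> (Suc i)) (fst p) - planar_path (\<tau> i) (fst p) \<in> C i}"
      using J(2) AC(1) unfolding X_def by auto
    then show ?thesis
      using joint_increments_prob[where n = n and \<tau> = \<tau>, OF \<tau> J AC(2,3)] AC(1) by simp
  qed
  have law1: "emeasure ?M (X i -` D \<inter> space ?M) = emeasure (gauss3_law (\<tau> (Suc i) - \<tau> i)) D" if "i < n" "D \<in> ?E" for i D
    using pr[of "{i}" "\<lambda>_. D"] that by simp
  show "distr ?M borel (X i) = gauss3_law (\<tau> (Suc i) - \<tau> i)" if i: "i < n" for i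
  proof (rule measure_eqI_generator_eq[where E = ?E and \<Omega> = UNIV and A = "\<lambda>_. UNIV"])
    show "emeasure (distr ?M borel (X i)) D = emeasure (gauss3_law (\<tau> (Suc i) - \<tau> i)) D" if "D \<in> ?E" for D
    proof -
      have "D \<in> sets borel" using that unfolding borel_space_generator by (rule sigma_sets.Basic)
      then show ?thesis using law1[OF i that] rv[OF i] by (subst emeasure_distr) auto
    qed
    show "emeasure (distr ?M borel (X i)) UNIV \<noteq> \<infinity>"
      using rv[OF i] by (subst emeasure_distr) (auto simp: PN.emeasure_eq_measure)
    show "range (\<lambda>_ :: nat. UNIV) \<subseteq> ?E" by (auto intro!: exI[of _ UNIV])
  qed (use stE borel_space_generator in auto)
  show "PN.indep_vars (\<lambda>_. borel) X {..<n}"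
  proof (rule PN.indep_vars_generator[where E = "\<lambda>_. ?E"])
    fix J D assume J: "J \<subseteq> {..<n}" "J \<noteq> {}" "finite J" and D: "\<And>i. i \<in> J \<Longrightarrow> D i \<in> ?E"
    have "emeasure ?M (\<Inter>i\<in>J. X i -` D i \<inter> space ?M) = (\<Prod>i\<in>J. emeasure ?M (X i -` D i \<inter> space ?M))"
      using pr[OF J(1,2) D] J(1) law1 D by (auto intro!: prod.cong)
    then show "PN.prob (\<Inter>i\<in>J. X i -` D i \<inter> space ?M) = (\<Prod>i\<in>J. PN.prob (X i -` D i \<inter> space ?M))"
      by (simp add: PN.emeasure_eq_measure prod_ennreal measure_nonneg prod_nonneg)
  qed (use rv stE borel_space_generator in auto)
qed

end

section \<open>Disintegration and the final identity\<close>

lemma running_sup_extend: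
  fixes w :: "real \<Rightarrow> real"
  assumes w: "continuous_on {0..b} w" and ab: "0 \<le> a" "a \<le> b"
  shows "(SUP u\<in>{0..b}. w u) = max (SUP u\<in>{0..a}. w u) (w a + (SUP u\<in>{a..b}. w u - w a))"
proof -
  have bdd: "bdd_above (f ` {c..d})" if "0 \<le> c" "d \<le> b" "continuous_on {0..b} f" for f :: "real \<Rightarrow> real" and c d
    using that by (intro bounded_imp_bdd_above compact_imp_bounded compact_continuous_image
        continuous_on_subset[OF that(3)]) auto
  have w': "continuous_on {0..b} (\<lambda>u. w u - w a)" by (intro continuous_intros w)
  have up: "w u \<le> (SUP u\<in>{0..b}. w u)" if "u \<in> {0..b}" for u
    using bdd[OF _ _ w, of 0 b] that by (intro cSUP_upper) auto
  show ?thesis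
  proof (rule antisym)
    show "(SUP u\<in>{0..b}. w u) \<le> max (SUP u\<in>{0..a}. w u) (w a + (SUP u\<in>{a..b}. w u - w a))"
    proof (rule cSUP_least)
      fix u assume u: "u \<in> {0..b}"
      show "w u \<le> max (SUP u\<in>{0..a}. w u) (w a + (SUP u\<in>{a..b}. w u - w a))"
      proof (cases "u \<le> a")
        case True
        then have "w u \<le> (SUP u\<in>{0..a}. w u)" using u bdd[OF _ _ w, of 0 a] ab by (intro cSUP_upper) auto
        then show ?thesis by simp
      next
        case False
        then have "w u - w a \<le> (SUP u\<in>{a..b}. w u - w a)"
          using u bdd[OF _ _ w', of a b] ab by (intro cSUP_upper) auto
        then show ?thesis by simp
      qed
    qed (use ab in auto)
    have "(SUP u\<in>{0..a}. w u) \<le> (SUP u\<in>{0..b}. w u)"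
      using ab up by (intro cSUP_least) auto
    moreover have "(SUP u\<in>{a..b}. w u - w a) \<le> (SUP u\<in>{0..b}. w u) - w a"
      using ab up by (intro cSUP_least) auto
    ultimately show "max (SUP u\<in>{0..a}. w u) (w a + (SUP u\<in>{a..b}. w u - w a)) \<le> (SUP u\<in>{0..b}. w u)"
      by simp
  qed
qed

text \<open>
  The running maximum at the end of an interval is the larger of the previous one and the maximum over
  the interval, which is what \<open>pitman_step\<close> computes.
\<close>

lemma pitman_chain_path:
  assumes w: "continuous_on {0..t} (\<lambda>u. W u \<omega>)" and w0: "W 0 \<omega> = (0 :: real)"
    and \<tau>: "\<tau> 0 = 0" "\<And>i. i < n \<Longrightarrow> \<tau> i < \<tau> (Suc i)" "\<tau> n \<le> t" and k: "k \<le> n"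
  shows "chain pitman_step (0, 0) (\<lambda>i. (2 * increment_max W (\<tau> i) (\<tau> (Suc i)) \<omega>
      - (increment W \<tau> i \<omega>), increment W \<tau> i \<omega>)) k
    = (pitman_P (\<lambda>u. W u \<omega>) (\<tau> k), W (\<tau> k) \<omega>)"
  using k
proof (induction k)
  case 0
  show ?case by (simp add: \<tau>(1) pitman_P_def w0)
next
  case (Suc k)
  have k: "0 \<le> \<tau> k" "\<tau> k \<le> \<tau> (Suc k)" "\<tau> (Suc k) \<le> t"
    using strict_chain_mono[of n \<tau> 0 k] strict_chain_mono[of n \<tau> "Suc k" n] less_imp_le[OF \<tau>(2)[of k]]
      \<tau>(1,3) \<tau>(2) Suc.prems by auto
  have "continuous_on {0..\<tau> (Suc k)} (\<lambda>u. W u \<omega>)"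
    using w by (rule continuous_on_subset) (use k in auto)
  from running_sup_extend[OF this k(1,2)]
  show ?case
    using Suc by (auto simp: pitman_step_def pitman_P_def increment_max_def max_def)
qed

lemma sum_chain_path:
  fixes b :: "real \<Rightarrow> 'v::ab_group_add"
  assumes "b (\<tau> 0) = 0"
  shows "chain (+) 0 (\<lambda>i. b (\<tau> (Suc i)) - b (\<tau> i)) k = b (\<tau> k)"
  using assms by (induction k) auto

context
  fixes P :: "'a measure" and \<beta> B2 B3 :: "real \<Rightarrow> 'a \<Rightarrow> real" and t x :: real
  assumes t: "0 < t" and P: "prob_space P" and bridge: "brownian_bridge t x P \<beta>"
    and B: "standard_brownian_motion t P (\<lambda>s \<omega>. (B2 s \<omega>, B3 s \<omega>))"
    and indep: "indep_processes t P \<beta> (\<lambda>s \<omega>. (B2 s \<omega>, B3 s \<omega>))"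
begin

interpretation P: prob_space P by (rule P)
interpretation N: prob_space "gauss_law t" by (rule prob_space_gauss_law[OF t])
interpretation PN: pair_prob_space P "gauss_law t" ..

abbreviation (input) "W \<equiv> shifted_bridge t x \<beta>"

abbreviation (input) "radius s p \<equiv> sqrt ((W s p)\<^sup>2 + (B2 s (fst p))\<^sup>2 + (B3 s (fst p))\<^sup>2)"

text \<open>
  Along the partition, both \<open>(pitman_P W, W)\<close> and \<open>(W, B2, B3)\<close> are chains driven by independent
  noise, and \<open>pitman_brownian_chain_expectation\<close> compares their expectations.  The endpoint
  \<open>W t = snd p\<close> is kept as a further observable in order to disintegrate with respect to it.
\<close>

lemma pitman_theorem_extended:
  assumes \<tau>: "\<tau> 0 = 0" "\<And>i. i < Suc n \<Longrightarrow> \<tau> i < \<tau> (Suc i)" "\<tau> (Suc n) = t"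
    and \<phi>: "\<And>i. \<phi> i \<in> borel_measurable borel" and A: "A \<in> sets borel"
  shows "(\<integral>\<^sup>+p. (\<Prod>i<Suc n. \<phi> i (pitman_P (\<lambda>u. W u p) (\<tau> (Suc i)))) * indicator A (snd p) \<partial>(P \<Otimes>\<^sub>M gauss_law t))
    = (\<integral>\<^sup>+p. (\<Prod>i<Suc n. \<phi> i (radius (\<tau> (Suc i)) p)) * indicator A (snd p) \<partial>(P \<Otimes>\<^sub>M gauss_law t))"
proof -
  let ?M = "P \<Otimes>\<^sub>M gauss_law t"
  have bm: "standard_brownian_motion t ?M W" by (rule shifted_bridge_brownian_motion[OF t P bridge])
  have \<tau>0: "0 \<le> \<tau> 0" and \<tau>n: "\<tau> (Suc n) \<le> t" using \<tau> by auto
  \<comment> \<open>Padded with ones so that every variance is positive.\<close>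
  define v where "v i = (if i \<le> n then \<tau> (Suc i) - \<tau> i else 1)" for i
  have v: "0 < v i" for i using \<tau>(2)[of i] by (simp add: v_def)
  \<comment> \<open>The last observable carries the condition on the endpoint as well, since \<open>W t\<close> is the second
      component of the final state of the Pitman chain and the first coordinate in space.\<close>
  define G where "G s = \<phi> n (fst s) * indicator A (snd s)" for s :: "real \<times> real"
  have G: "G \<in> borel_measurable borel"
  proof -
    have [measurable]: "\<phi> n \<in> borel_measurable borel" "A \<in> sets borel" using \<phi> A by auto
    have "G \<in> borel_measurable (borel \<Otimes>\<^sub>M borel)" unfolding G_def by measurable
    then show ?thesis by (simp add: borel_prod)
  qed
  have "AE p in ?M. \<beta> t (fst p) = x"
    by (rule AE_pair_fst[OF prob_space_gauss_law[OF t] bridge_endpoints(2)[OF t P bridge]])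
  then have WT: "AE p in ?M. W t p = snd p"
    by eventually_elim (use t in \<open>simp add: shifted_bridge_def\<close>)
  have W0: "AE p in ?M. W 0 p = 0" using bm by (simp add: standard_brownian_motion_def)
  have B0: "AE p in ?M. (B2 0 (fst p), B3 0 (fst p)) = 0"
    by (rule AE_pair_fst[OF prob_space_gauss_law[OF t] planar_facts(2)[OF t P bridge B indep]])
  define X where "X i p = (2 * increment_max W (\<tau> i) (\<tau> (Suc i)) p - (increment W \<tau> i p), increment W \<tau> i p)" for i p
  define Y where "Y i p = (increment W \<tau> i p,
      (B2 (\<tau> (Suc i)) (fst p), B3 (\<tau> (Suc i)) (fst p)) - (B2 (\<tau> i) (fst p), B3 (\<tau> i) (fst p)))" for i p
  have ps: "(\<lambda>p. pitman_step (fst p) (snd p)) \<in> measurable (borel \<Otimes>\<^sub>M borel) borel"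
  proof -
    have "(\<lambda>p. pitman_step (fst p) (snd p)) \<in> measurable ((borel \<Otimes>\<^sub>M borel) \<Otimes>\<^sub>M (borel \<Otimes>\<^sub>M borel)) (borel \<Otimes>\<^sub>M borel)"
      unfolding pitman_step_def by measurable
    then show ?thesis by (simp add: borel_prod)
  qed
  have pl: "(\<lambda>p. (fst p :: real \<times> real \<times> real) + snd p) \<in> measurable (borel \<Otimes>\<^sub>M borel) borel" by measurable
  let ?cX = "\<lambda>p. chain pitman_step (0, 0) (\<lambda>i. X i p)" and ?cY = "\<lambda>p. chain (+) 0 (\<lambda>i. Y i p)"
  have "(\<integral>\<^sup>+p. (\<Prod>i<Suc n. \<phi> i (pitman_P (\<lambda>u. W u p) (\<tau> (Suc i)))) * indicator A (snd p) \<partial>?M)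
    = (\<integral>\<^sup>+p. (\<Prod>i<n. \<phi> i (fst (?cX p (Suc i)))) * G (?cX p (Suc n)) \<partial>?M)"
  proof (rule nn_integral_cong_AE)
    show "AE p in ?M. (\<Prod>i<Suc n. \<phi> i (pitman_P (\<lambda>u. W u p) (\<tau> (Suc i)))) * indicator A (snd p)
      = (\<Prod>i<n. \<phi> i (fst (?cX p (Suc i)))) * G (?cX p (Suc n))"
      using WT W0 AE_space
    proof eventually_elim
      case (elim p)
      have "continuous_on {0..t} (\<lambda>u. W u p)"
        using shifted_bridge_continuous_process[OF t P bridge] elim by (simp add: continuous_process_def)
      then have c: "?cX p k = (pitman_P (\<lambda>u. W u p) (\<tau> k), W (\<tau> k) p)" if "k \<le> Suc n" for k
        unfolding X_def using elim that \<tau> by (intro pitman_chain_path[where n = "Suc n" and t = t]) auto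
      have "(\<Prod>i<n. \<phi> i (fst (?cX p (Suc i)))) = (\<Prod>i<n. \<phi> i (pitman_P (\<lambda>u. W u p) (\<tau> (Suc i))))"
        by (intro prod.cong refl arg_cong[where f = "\<phi> _"], subst c) auto
      moreover have "G (?cX p (Suc n)) = \<phi> n (pitman_P (\<lambda>u. W u p) (\<tau> (Suc n))) * indicator A (snd p)"
        using elim by (subst c) (auto simp: G_def \<tau>(3))
      ultimately show ?case by (simp only: prod.lessThan_Suc mult.assoc)
    qed
  qed
  also have "\<dots> = chain_expectation pitman_step (0, 0) (\<lambda>i. step_law (v i)) (\<lambda>i s. \<phi> i (fst s)) n G"
  proof (rule PN.nn_integral_indep_chain[OF ps _ _ _ G])
    show "prob_space (step_law (v i))" for i by (rule prob_space_step_law[OF v])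
    show "(\<lambda>s :: real \<times> real. \<phi> i (fst s)) \<in> borel_measurable borel" for i
    proof -
      have "(\<lambda>s :: real \<times> real. \<phi> i (fst s)) \<in> borel_measurable (borel \<Otimes>\<^sub>M borel)"
        using \<phi> by (rule measurable_compose[OF measurable_fst])
      then show ?thesis by (simp add: borel_prod)
    qed
    show "PN.indep_vars (\<lambda>_. borel) X {..<Suc n}"
      using PN.indep_increment_max[OF bm \<tau>0 \<tau>(2) \<tau>n] by (simp add: X_def[abs_def])
    show "distr ?M borel (X i) = step_law (v i)" if "i \<le> n" for i
    proof -
      have "0 \<le> \<tau> i" "\<tau> (Suc i) \<le> t"
        using strict_chain_mono[of "Suc n" \<tau> 0 i] strict_chain_mono[of "Suc n" \<tau> "Suc i" "Suc n"] \<tau> that by auto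
      then show ?thesis
        using PN.increment_max_law[OF bm _ \<tau>(2)[of i]] that by (simp add: X_def[abs_def] v_def)
    qed
  qed simp
  also have "\<dots> = chain_expectation (+) 0 (\<lambda>i. gauss3_law (v i)) (\<lambda>i w. \<phi> i (norm w)) n (\<lambda>w. G (norm w, fst w))"
    by (rule pitman_brownian_chain_expectation[OF v \<phi> G])
  also have "\<dots> = (\<integral>\<^sup>+p. (\<Prod>i<n. \<phi> i (norm (?cY p (Suc i))))
      * G (norm (?cY p (Suc n)), fst (?cY p (Suc n))) \<partial>?M)"
  proof (rule PN.nn_integral_indep_chain[OF pl, symmetric])
    show "prob_space (gauss3_law (v i))" for i by (rule prob_space_gauss3_law[OF v])
    show "(\<lambda>w. \<phi> i (norm w)) \<in> borel_measurable borel" for i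
      by (rule measurable_compose[OF _ \<phi>]) simp
    have "(\<lambda>w. (norm w, fst w)) \<in> measurable (borel :: (real \<times> real \<times> real) measure) borel"
      by (intro borel_measurable_continuous_onI continuous_intros)
    then show "(\<lambda>w :: real \<times> real \<times> real. G (norm w, fst w)) \<in> borel_measurable borel"
      using G by (rule measurable_compose)
    show "PN.indep_vars (\<lambda>_. borel) Y {..<Suc n}"
      using joint_increments(1)[OF t P bridge B indep \<tau>0 \<tau>(2) \<tau>n] by (simp add: Y_def[abs_def])
    show "distr ?M borel (Y i) = gauss3_law (v i)" if "i \<le> n" for i
      using joint_increments(2)[OF t P bridge B indep \<tau>0 \<tau>(2) \<tau>n, of i] that by (simp add: Y_def[abs_def] v_def)
  qed simp
  also have "\<dots> = (\<integral>\<^sup>+p. (\<Prod>i<Suc n. \<phi> i (radius (\<tau> (Suc i)) p)) * indicator A (snd p) \<partial>?M)"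
  proof (rule nn_integral_cong_AE)
    show "AE p in ?M. (\<Prod>i<n. \<phi> i (norm (?cY p (Suc i))))
      * G (norm (?cY p (Suc n)), fst (?cY p (Suc n)))
      = (\<Prod>i<Suc n. \<phi> i (radius (\<tau> (Suc i)) p)) * indicator A (snd p)"
      using WT W0 B0
    proof eventually_elim
      case (elim p)
      define b where "b s = (W s p, B2 s (fst p), B3 s (fst p))" for s
      have "b (\<tau> 0) = 0" using elim by (simp add: b_def \<tau>(1) zero_prod_def)
      moreover have "Y i p = b (\<tau> (Suc i)) - b (\<tau> i)" for i by (simp add: Y_def b_def)
      ultimately have c: "?cY p k = b (\<tau> k)" for k using sum_chain_path[of b \<tau> k] by simp
      have nb: "norm (b s) = radius s p" for s by (simp add: b_def norm_triple add.assoc)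
      show ?case using elim unfolding c nb by (simp add: G_def b_def \<tau>(3) mult.assoc)
    qed
  qed
  finally show ?thesis .
qed

text \<open>
  Testing against all \<open>A\<close> shows that the integrals over the sections agree for almost every \<open>z\<close>.  By
  dominated convergence they are continuous in \<open>z\<close>, so they agree everywhere.
\<close>

lemma section_equality:
  fixes F1 F2 :: "'a \<times> real \<Rightarrow> real"
  assumes m: "F1 \<in> borel_measurable (P \<Otimes>\<^sub>M gauss_law t)" "F2 \<in> borel_measurable (P \<Otimes>\<^sub>M gauss_law t)"
    and r: "\<And>p. 0 \<le> F1 p \<and> F1 p \<le> 1" "\<And>p. 0 \<le> F2 p \<and> F2 p \<le> 1"
    and c: "\<And>\<omega> z. \<omega> \<in> space P \<Longrightarrow> isCont (\<lambda>z. F1 (\<omega>, z)) z" "\<And>\<omega> z. \<omega> \<in> space P \<Longrightarrow> isCont (\<lambda>z. F2 (\<omega>, z)) z"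
    and eq: "\<And>A. A \<in> sets borel \<Longrightarrow> (\<integral>\<^sup>+p. ennreal (F1 p) * indicator A (snd p) \<partial>(P \<Otimes>\<^sub>M gauss_law t))
      = (\<integral>\<^sup>+p. ennreal (F2 p) * indicator A (snd p) \<partial>(P \<Otimes>\<^sub>M gauss_law t))"
  shows "(LINT \<omega>|P. F1 (\<omega>, z)) = (LINT \<omega>|P. F2 (\<omega>, z))"
proof -
  let ?M = "P \<Otimes>\<^sub>M gauss_law t"
  define \<psi> where "\<psi> F z = (LINT \<omega>|P. F (\<omega>, z))" for F :: "'a \<times> real \<Rightarrow> real" and z
  have sm: "(\<lambda>\<omega>. F (\<omega>, z)) \<in> borel_measurable P" if "F \<in> borel_measurable ?M" for F :: "'a \<times> real \<Rightarrow> real" and z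
    using that by (rule measurable_compose[rotated]) simp
  have cont: "isCont (\<psi> F) z" if F: "F \<in> borel_measurable ?M" "\<And>p. 0 \<le> F p \<and> F p \<le> 1"
    "\<And>\<omega> z. \<omega> \<in> space P \<Longrightarrow> isCont (\<lambda>z. F (\<omega>, z)) z" for F z
    unfolding continuous_at_sequentially
  proof (intro allI impI)
    fix s assume s: "s \<longlonglongrightarrow> z"
    show "(\<psi> F \<circ> s) \<longlonglongrightarrow> \<psi> F z"
      unfolding \<psi>_def comp_def
    proof (rule integral_dominated_convergence[where w = "\<lambda>_. 1"])
      show "AE \<omega> in P. (\<lambda>i. F (\<omega>, s i)) \<longlonglongrightarrow> F (\<omega>, z)"
      proof (rule AE_I2)
        fix \<omega> assume "\<omega> \<in> space P"
        then show "(\<lambda>i. F (\<omega>, s i)) \<longlonglongrightarrow> F (\<omega>, z)" by (rule isCont_tendsto_compose[OF F(3) s])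
      qed
      show "AE \<omega> in P. norm (F (\<omega>, s i)) \<le> 1" for i using F(2) by simp
    qed (use sm[OF F(1)] in auto)
  qed
  have \<psi>m: "(\<lambda>z. ennreal (\<psi> F z)) \<in> borel_measurable (gauss_law t)" if "\<And>z. isCont (\<psi> F) z" for F
  proof -
    have "\<psi> F \<in> borel_measurable borel"
      using that by (intro borel_measurable_continuous_onI continuous_at_imp_continuous_on) auto
    then show ?thesis by simp
  qed
  have slice: "(\<integral>\<^sup>+p. ennreal (F p) * indicator A (snd p) \<partial>?M) = (\<integral>\<^sup>+z. ennreal (\<psi> F z) * indicator A z \<partial>gauss_law t)"
    if F: "F \<in> borel_measurable ?M" "\<And>p. 0 \<le> F p \<and> F p \<le> 1" and A: "A \<in> sets borel" for F A
  proof -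
    have [measurable]: "F \<in> borel_measurable ?M" "A \<in> sets borel" using F A by auto
    have "(\<integral>\<^sup>+p. ennreal (F p) * indicator A (snd p) \<partial>?M) = (\<integral>\<^sup>+z. \<integral>\<^sup>+\<omega>. ennreal (F (\<omega>, z)) * indicator A (snd (\<omega>, z)) \<partial>P \<partial>gauss_law t)"
      by (rule PN.nn_integral_snd[symmetric]) measurable
    also have "\<dots> = (\<integral>\<^sup>+z. ennreal (\<psi> F z) * indicator A z \<partial>gauss_law t)"
    proof (rule nn_integral_cong)
      fix z
      have [measurable]: "(\<lambda>\<omega>. F (\<omega>, z)) \<in> borel_measurable P" by (rule sm[OF F(1)])
      have "integrable P (\<lambda>\<omega>. F (\<omega>, z))" by (rule P.integrable_const_bound[of _ 1]) (use F(2) in auto)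
      then have "(\<integral>\<^sup>+\<omega>. ennreal (F (\<omega>, z)) \<partial>P) = ennreal (\<psi> F z)"
        unfolding \<psi>_def using F(2) by (intro nn_integral_eq_integral) auto
      moreover have "(\<integral>\<^sup>+\<omega>. ennreal (F (\<omega>, z)) * indicator A (snd (\<omega>, z)) \<partial>P) = (\<integral>\<^sup>+\<omega>. ennreal (F (\<omega>, z)) \<partial>P) * indicator A z"
        unfolding snd_conv by (rule nn_integral_multc) measurable
      ultimately show "(\<integral>\<^sup>+\<omega>. ennreal (F (\<omega>, z)) * indicator A (snd (\<omega>, z)) \<partial>P) = ennreal (\<psi> F z) * indicator A z" by simp
    qed
    finally show ?thesis .
  qed
  note c1 = cont[OF m(1) r(1) c(1)] and c2 = cont[OF m(2) r(2) c(2)]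
  have "density (gauss_law t) (\<lambda>z. ennreal (\<psi> F1 z)) = density (gauss_law t) (\<lambda>z. ennreal (\<psi> F2 z))"
  proof (rule measure_eqI)
    fix A assume "A \<in> sets (density (gauss_law t) (\<lambda>z. ennreal (\<psi> F1 z)))"
    then have A: "A \<in> sets borel" by simp
    have "emeasure (density (gauss_law t) (\<lambda>z. ennreal (\<psi> F1 z))) A = (\<integral>\<^sup>+z. ennreal (\<psi> F1 z) * indicator A z \<partial>gauss_law t)"
      using \<psi>m[OF c1] A by (intro emeasure_density) auto
    also have "\<dots> = (\<integral>\<^sup>+z. ennreal (\<psi> F2 z) * indicator A z \<partial>gauss_law t)"
      using eq[OF A] slice[OF m(1) r(1) A] slice[OF m(2) r(2) A] by simp
    also have "\<dots> = emeasure (density (gauss_law t) (\<lambda>z. ennreal (\<psi> F2 z))) A"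
      using \<psi>m[OF c2] A by (intro emeasure_density[symmetric]) auto
    finally show "emeasure (density (gauss_law t) (\<lambda>z. ennreal (\<psi> F1 z))) A = \<dots>" .
  qed simp
  then have "AE z in gauss_law t. ennreal (\<psi> F1 z) = ennreal (\<psi> F2 z)"
    using N.density_unique[OF \<psi>m[OF c1] \<psi>m[OF c2]] by simp
  then have "AE z in lborel. 0 < ennreal (gauss t z) \<longrightarrow> ennreal (\<psi> F1 z) = ennreal (\<psi> F2 z)"
    unfolding gauss_law_def by (subst (asm) AE_density) auto
  then have ae: "AE z in lborel. \<psi> F1 z = \<psi> F2 z"
  proof eventually_elim
    case (elim z)
    have "0 \<le> \<psi> F1 z" "0 \<le> \<psi> F2 z" unfolding \<psi>_def using r by (auto intro: integral_nonneg_AE)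
    then show ?case using elim t by (simp add: normal_density_pos)
  qed
  have "\<psi> F1 z = \<psi> F2 z"
  proof (rule ccontr)
    assume ne: "\<psi> F1 z \<noteq> \<psi> F2 z"
    have "isCont (\<lambda>z. \<psi> F1 z - \<psi> F2 z) z" by (intro continuous_intros c1 c2)
    then have "((\<lambda>z. \<psi> F1 z - \<psi> F2 z) \<longlongrightarrow> \<psi> F1 z - \<psi> F2 z) (nhds z)"
      unfolding isCont_def by (rule tendsto_at_iff_tendsto_nhds[THEN iffD1])
    then have "\<forall>\<^sub>F y in nhds z. \<psi> F1 y - \<psi> F2 y \<noteq> 0"
      by (rule tendsto_imp_eventually_ne) (use ne in simp)
    then obtain e where e: "0 < e" "\<And>y. dist y z < e \<Longrightarrow> \<psi> F1 y \<noteq> \<psi> F2 y"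
      unfolding eventually_nhds_metric by auto
    have "AE y in lborel. y \<notin> {z<..<z + e}"
      using ae by eventually_elim (use e(2) in \<open>auto simp: dist_real_def\<close>)
    then have "emeasure lborel {z<..<z + e} = 0"
      by (subst (asm) AE_iff_measurable[of "{z<..<z + e}"]) auto
    then show False using e(1) by simp
  qed
  then show ?thesis by (simp add: \<psi>_def)
qed

lemma isCont_shifted_pitman_P:
  assumes \<omega>: "\<omega> \<in> space P" and s: "s \<in> {0..t}"
  shows "isCont (\<lambda>z. pitman_P (\<lambda>u. W u (\<omega>, z)) s) z0"
proof -
  have \<beta>c: "continuous_on {0..t} (\<lambda>u. \<beta> u \<omega>)"
    using bridge_continuous_process[OF t P bridge] \<omega> by (simp add: continuous_process_def)
  have mem: "s * v \<in> {0..t}" if "0 \<le> v" "v \<le> 1" for v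
    using s that by (auto intro: order_trans[OF mult_left_le])
  have "continuous_on {z0 - 1..z0 + 1} (\<lambda>z. 2 * (SUP v\<in>{0..1}. \<beta> (s * v) \<omega> + (z - x) * (s * v) / t) - (\<beta> s \<omega> + (z - x) * s / t))"
    using t mem by (intro continuous_intros continuous_on_SUP_param)
      (auto simp: case_prod_unfold intro!: continuous_intros continuous_on_compose2[OF \<beta>c])
  then have "continuous_on {z0 - 1..z0 + 1} (\<lambda>z. pitman_P (\<lambda>u. W u (\<omega>, z)) s)"
    using s by (simp add: pitman_P_SUP_unit shifted_bridge_def)
  then show ?thesis by (rule continuous_on_interior) auto
qed

text \<open>
  The section of \<open>pitman_theorem_extended\<close> at \<open>z = x\<close>, where the shifted bridge is the bridge itself.
  Continuity of the functions \<open>f i\<close> makes the sections continuous in the endpoint.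
\<close>

lemma pitman_theorem_bridge:
  assumes \<tau>: "\<tau> 0 = 0" "\<And>i. i < Suc n \<Longrightarrow> \<tau> i < \<tau> (Suc i)" "\<tau> (Suc n) = t"
    and f: "\<And>i. continuous_on UNIV (f i)" "\<And>i y. 0 \<le> f i y \<and> f i y \<le> (1 :: real)"
  shows "(LINT \<omega>|P. (\<Prod>i<Suc n. f i (pitman_P (\<lambda>u. \<beta> u \<omega>) (\<tau> (Suc i)))))
    = (LINT \<omega>|P. (\<Prod>i<Suc n. f i (sqrt ((\<beta> (\<tau> (Suc i)) \<omega>)\<^sup>2 + (B2 (\<tau> (Suc i)) \<omega>)\<^sup>2 + (B3 (\<tau> (Suc i)) \<omega>)\<^sup>2))))"
proof -
  let ?M = "P \<Otimes>\<^sub>M gauss_law t"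
  have mem: "\<tau> (Suc i) \<in> {0..t}" if "i < Suc n" for i
    using strict_chain_mono[of "Suc n" \<tau> 0 "Suc i"] strict_chain_mono[of "Suc n" \<tau> "Suc i" "Suc n"] \<tau> that by auto
  have fm: "f i \<in> borel_measurable borel" for i using f(1) by (rule borel_measurable_continuous_onI)
  have fc: "isCont (f i) y" for i y using f(1) by (simp add: continuous_on_eq_continuous_at)
  define F1 where "F1 p = (\<Prod>i<Suc n. f i (pitman_P (\<lambda>u. W u p) (\<tau> (Suc i))))" for p
  define F2 where "F2 p = (\<Prod>i<Suc n. f i (radius (\<tau> (Suc i)) p))" for p
  note cp = shifted_bridge_continuous_process[OF t P bridge]
  have Wm: "W s \<in> borel_measurable ?M" if "s \<in> {0..t}" for s using cp that by (simp add: continuous_process_def)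
  have Bm: "(\<lambda>p. B2 s (fst p)) \<in> borel_measurable ?M" "(\<lambda>p. B3 s (fst p)) \<in> borel_measurable ?M" if "s \<in> {0..t}" for s
  proof -
    have b: "(\<lambda>p. (B2 s (fst p), B3 s (fst p))) \<in> borel_measurable ?M"
      by (rule measurable_compose[OF measurable_fst planar_facts(1)[OF t P bridge B indep that]])
    have "(\<lambda>p. fst (B2 s (fst p), B3 s (fst p))) \<in> borel_measurable ?M" "(\<lambda>p. snd (B2 s (fst p), B3 s (fst p))) \<in> borel_measurable ?M"
      by (rule measurable_compose[OF b]; rule borel_measurable_continuous_onI; intro continuous_intros)+
    then show "(\<lambda>p. B2 s (fst p)) \<in> borel_measurable ?M" "(\<lambda>p. B3 s (fst p)) \<in> borel_measurable ?M" by simp_all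
  qed
  have "(LINT \<omega>|P. F1 (\<omega>, x)) = (LINT \<omega>|P. F2 (\<omega>, x))"
  proof (rule section_equality)
    show "F1 \<in> borel_measurable ?M" unfolding F1_def
      by (intro borel_measurable_prod measurable_compose[OF measurable_pitman_P[OF cp] fm] mem) auto
    show "F2 \<in> borel_measurable ?M" unfolding F2_def
    proof (intro borel_measurable_prod measurable_compose[OF _ fm])
      fix i assume "i \<in> {..<Suc n}"
      then have i: "\<tau> (Suc i) \<in> {0..t}" using mem by auto
      have [measurable]: "W (\<tau> (Suc i)) \<in> borel_measurable ?M" "(\<lambda>p. B2 (\<tau> (Suc i)) (fst p)) \<in> borel_measurable ?M"
        "(\<lambda>p. B3 (\<tau> (Suc i)) (fst p)) \<in> borel_measurable ?M" using Wm[OF i] Bm[OF i] by auto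
      show "(\<lambda>p. radius (\<tau> (Suc i)) p) \<in> borel_measurable ?M" by measurable
    qed
    show "0 \<le> F1 p \<and> F1 p \<le> 1" "0 \<le> F2 p \<and> F2 p \<le> 1" for p
      unfolding F1_def F2_def by (intro conjI prod_nonneg prod_le_1; simp add: f(2))+
    show "isCont (\<lambda>z. F1 (\<omega>, z)) z" if "\<omega> \<in> space P" for \<omega> z
      unfolding F1_def using mem
      by (intro continuous_prod isCont_o2[OF isCont_shifted_pitman_P[OF that] fc]) auto
    show "isCont (\<lambda>z. F2 (\<omega>, z)) z" if "\<omega> \<in> space P" for \<omega> z
      unfolding F2_def shifted_bridge_def fst_conv snd_conv using t
      by (intro continuous_prod isCont_o2[OF _ fc] continuous_intros) auto
    fix A :: "real set" assume A: "A \<in> sets borel"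
    have E: "ennreal (\<Prod>i<Suc n. f i (g i)) = (\<Prod>i<Suc n. ennreal (f i (g i)))" for g
      using f(2) by (intro prod_ennreal[symmetric]) auto
    show "(\<integral>\<^sup>+p. ennreal (F1 p) * indicator A (snd p) \<partial>?M) = (\<integral>\<^sup>+p. ennreal (F2 p) * indicator A (snd p) \<partial>?M)"
      unfolding F1_def F2_def E
      by (rule pitman_theorem_extended[where \<phi> = "\<lambda>i y. ennreal (f i y)" and \<tau> = \<tau> and n = n, OF \<tau> _ A])
         (use fm in measurable)
  qed
  then show ?thesis by (simp add: F1_def F2_def shifted_bridge_def)
qed

end

text \<open>
  Continuous functions that decrease to the indicator of \<open>y \<le> a\<close> as \<open>m\<close> increases.
\<close>

definition ramp :: "nat \<Rightarrow> real \<Rightarrow> real \<Rightarrow> real" where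
  "ramp m a y = max 0 (min 1 (1 - real m * (y - a)))"

lemma ramp_range: "0 \<le> ramp m a y \<and> ramp m a y \<le> 1"
  by (auto simp: ramp_def)

lemma continuous_on_ramp: "continuous_on UNIV (ramp m a)"
  unfolding ramp_def by (intro continuous_intros)

lemma ramp_tendsto: "(\<lambda>m. ramp m a y) \<longlonglongrightarrow> of_bool (y \<le> a)"
proof (cases "y \<le> a")
  case True
  then have "ramp m a y = 1" for m
    by (auto simp: ramp_def min_def max_def mult_nonneg_nonpos)
  then show ?thesis using True by simp
next
  case False
  obtain m0 where m0: "1 / (y - a) < real m0" using reals_Archimedean2 by blast
  have "ramp m a y = 0" if "m0 \<le> m" for m
  proof -
    have "1 / (y - a) < real m" using m0 that by (meson less_le_trans of_nat_le_iff)
    then have "1 < real m * (y - a)" using False by (simp add: pos_divide_less_eq)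
    then show ?thesis by (simp add: ramp_def)
  qed
  then have "\<forall>\<^sub>F m in sequentially. ramp m a y = of_bool (y \<le> a)"
    using False by (auto simp: eventually_sequentially)
  then show ?thesis by (rule tendsto_eventually)
qed

text \<open>
  List the times of \<open>F\<close> together with \<open>0\<close> and \<open>t\<close> as a partition, and approximate the indicators
  at the times that belong to \<open>F\<close> by ramps, with the constant function \<open>1\<close> at the other times.
  Time \<open>0\<close> does not occur in the products; there both processes vanish almost surely.
\<close>

lemma fdd_eq_of_products:
  fixes X Y :: "real \<Rightarrow> 'a \<Rightarrow> real"
  assumes t: "0 < t" and P: "prob_space P"
    and m: "\<And>s. s \<in> {0..t} \<Longrightarrow> X s \<in> borel_measurable P" "\<And>s. s \<in> {0..t} \<Longrightarrow> Y s \<in> borel_measurable P"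
    and zero: "AE \<omega> in P. X 0 \<omega> = 0" "AE \<omega> in P. Y 0 \<omega> = 0"
    and prods: "\<And>n \<tau> f. \<tau> 0 = 0 \<Longrightarrow> (\<And>i. i < Suc n \<Longrightarrow> \<tau> i < \<tau> (Suc i)) \<Longrightarrow> \<tau> (Suc n) = t \<Longrightarrow>
      (\<And>i. continuous_on UNIV (f i)) \<Longrightarrow> (\<And>i y. 0 \<le> f i y \<and> f i y \<le> (1 :: real)) \<Longrightarrow>
      (LINT \<omega>|P. (\<Prod>i<Suc n. f i (X (\<tau> (Suc i)) \<omega>))) = (LINT \<omega>|P. (\<Prod>i<Suc n. f i (Y (\<tau> (Suc i)) \<omega>)))"
    and F: "finite F" "F \<subseteq> {0..t}"
  shows "emeasure P {\<omega> \<in> space P. \<forall>s\<in>F. X s \<omega> \<le> a s} = emeasure P {\<omega> \<in> space P. \<forall>s\<in>F. Y s \<omega> \<le> a s}"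
proof -
  interpret prob_space P by (rule P)
  define L where "L = sorted_list_of_set (F \<union> {0, t})"
  have fin: "finite (F \<union> {0, t})" using F(1) by simp
  have L_set: "set L = F \<union> {0, t}" unfolding L_def by (rule set_sorted_list_of_set[OF fin])
  have L_sorted: "sorted_wrt (<) L" unfolding L_def by (rule strict_sorted_list_of_set)
  have "card (F \<union> {0, t}) = length L" by (simp add: L_def)
  moreover have "card {0, t} \<le> card (F \<union> {0, t})" using F(1) by (intro card_mono) auto
  ultimately have "2 \<le> length L" using t by simp
  then obtain n where n: "length L = Suc (Suc n)" by (metis add_2_eq_Suc le_Suc_ex)
  define \<tau> where "\<tau> i = L ! i" for i
  have inc: "\<tau> i < \<tau> j" if "i < j" "j \<le> Suc n" for i j
    unfolding \<tau>_def using that n by (intro sorted_wrt_nth_less[OF L_sorted]) auto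
  have ran: "\<exists>i\<le>Suc n. \<tau> i = s" if "s \<in> F \<union> {0, t}" for s
    using that unfolding L_set[symmetric] in_set_conv_nth \<tau>_def n by (metis less_Suc_eq_le)
  have mem: "\<tau> i \<in> F \<union> {0, t}" if "i \<le> Suc n" for i
    unfolding L_set[symmetric] \<tau>_def using that n by (intro nth_mem) auto
  then have memt: "\<tau> i \<in> {0..t}" if "i \<le> Suc n" for i using that F(2) t by fastforce
  have \<tau>0: "\<tau> 0 = 0"
  proof -
    obtain i where "i \<le> Suc n" "\<tau> i = 0" using ran[of 0] by auto
    then show ?thesis using inc[of 0 i] memt[of 0] by (cases "i = 0") auto
  qed
  have \<tau>n: "\<tau> (Suc n) = t"
  proof -
    obtain i where "i \<le> Suc n" "\<tau> i = t" using ran[of t] by auto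
    then show ?thesis using inc[of i "Suc n"] memt[of "Suc n"] by (cases "i = Suc n") auto
  qed
  have pos: "(\<forall>s\<in>F - {0}. Q s) \<longleftrightarrow> (\<forall>i<Suc n. \<tau> (Suc i) \<in> F \<longrightarrow> Q (\<tau> (Suc i)))" for Q
  proof
    assume Q: "\<forall>s\<in>F - {0}. Q s"
    show "\<forall>i<Suc n. \<tau> (Suc i) \<in> F \<longrightarrow> Q (\<tau> (Suc i))"
      using Q inc[of 0 "Suc _"] \<tau>0 by (metis Diff_iff Suc_leI less_irrefl singletonD zero_less_Suc)
  next
    assume Q: "\<forall>i<Suc n. \<tau> (Suc i) \<in> F \<longrightarrow> Q (\<tau> (Suc i))"
    show "\<forall>s\<in>F - {0}. Q s"
    proof
      fix s assume s: "s \<in> F - {0}"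
      then obtain i where i: "i \<le> Suc n" "\<tau> i = s" using ran[of s] by auto
      then have "i \<noteq> 0" using s \<tau>0 by (metis DiffE singletonI)
      then obtain j where "i = Suc j" by (cases i) auto
      then show "Q s" using Q i s by auto
    qed
  qed
  let ?ramps = "\<lambda>k (Z :: real \<Rightarrow> 'a \<Rightarrow> real) \<omega>. \<Prod>i<Suc n. if \<tau> (Suc i) \<in> F then ramp k (a (\<tau> (Suc i))) (Z (\<tau> (Suc i)) \<omega>) else 1"
  have lim: "(\<lambda>k. LINT \<omega>|P. ?ramps k Z \<omega>)
      \<longlonglongrightarrow> prob {\<omega> \<in> space P. \<forall>s\<in>F - {0}. Z s \<omega> \<le> a s}"
    if Z: "\<And>s. s \<in> {0..t} \<Longrightarrow> Z s \<in> borel_measurable P" for Z :: "real \<Rightarrow> 'a \<Rightarrow> real"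
  proof -
    have ZE: "{\<omega> \<in> space P. \<forall>s\<in>F - {0}. Z s \<omega> \<le> a s} \<in> sets P"
    proof (rule sets.sets_Collect_finite_All)
      fix s assume "s \<in> F - {0}"
      then have [measurable]: "Z s \<in> borel_measurable P" using Z F(2) by blast
      show "{\<omega> \<in> space P. Z s \<omega> \<le> a s} \<in> sets P" by measurable
    qed (use F(1) in auto)
    have Zm: "Z (\<tau> (Suc i)) \<in> borel_measurable P" if "i < Suc n" for i
      using memt[of "Suc i"] that by (intro Z) auto
    have rm: "ramp k c \<in> borel_measurable borel" for k c
      by (rule borel_measurable_continuous_onI[OF continuous_on_ramp])
    have "(\<lambda>k. LINT \<omega>|P. ?ramps k Z \<omega>)
      \<longlonglongrightarrow> (LINT \<omega>|P. indicator {\<omega> \<in> space P. \<forall>s\<in>F - {0}. Z s \<omega> \<le> a s} \<omega>)"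
    proof (rule integral_dominated_convergence[where w = "\<lambda>_. 1"])
      show "AE \<omega> in P. (\<lambda>k. ?ramps k Z \<omega>)
        \<longlonglongrightarrow> indicator {\<omega> \<in> space P. \<forall>s\<in>F - {0}. Z s \<omega> \<le> a s} \<omega>"
      proof (rule AE_I2)
        fix \<omega> assume \<omega>: "\<omega> \<in> space P"
        have "(\<lambda>k. ?ramps k Z \<omega>)
          \<longlonglongrightarrow> (\<Prod>i<Suc n. of_bool (\<tau> (Suc i) \<in> F \<longrightarrow> Z (\<tau> (Suc i)) \<omega> \<le> a (\<tau> (Suc i))))"
        proof (rule tendsto_prod)
          fix i
          show "(\<lambda>k. if \<tau> (Suc i) \<in> F then ramp k (a (\<tau> (Suc i))) (Z (\<tau> (Suc i)) \<omega>) else 1)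
            \<longlonglongrightarrow> of_bool (\<tau> (Suc i) \<in> F \<longrightarrow> Z (\<tau> (Suc i)) \<omega> \<le> a (\<tau> (Suc i)))"
            using ramp_tendsto[of "a (\<tau> (Suc i))" "Z (\<tau> (Suc i)) \<omega>"]
            by (cases "\<tau> (Suc i) \<in> F") simp_all
        qed
        also have "(\<Prod>i<Suc n. of_bool (\<tau> (Suc i) \<in> F \<longrightarrow> Z (\<tau> (Suc i)) \<omega> \<le> a (\<tau> (Suc i))))
          = (of_bool (\<forall>i\<in>{..<Suc n}. \<tau> (Suc i) \<in> F \<longrightarrow> Z (\<tau> (Suc i)) \<omega> \<le> a (\<tau> (Suc i))) :: real)"
        proof (cases "\<forall>i\<in>{..<Suc n}. \<tau> (Suc i) \<in> F \<longrightarrow> Z (\<tau> (Suc i)) \<omega> \<le> a (\<tau> (Suc i))")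
          case False
          then show ?thesis by (subst prod_zero) auto
        qed (auto intro!: prod.neutral)
        also have "\<dots> = indicator {\<omega> \<in> space P. \<forall>s\<in>F - {0}. Z s \<omega> \<le> a s} \<omega>"
          using \<omega> pos[of "\<lambda>s. Z s \<omega> \<le> a s"] by (simp add: indicator_def Ball_def)
        finally show "(\<lambda>k. ?ramps k Z \<omega>)
          \<longlonglongrightarrow> indicator {\<omega> \<in> space P. \<forall>s\<in>F - {0}. Z s \<omega> \<le> a s} \<omega>" .
      qed
      show "(\<lambda>\<omega>. ?ramps k Z \<omega>) \<in> borel_measurable P" for k
      proof (intro borel_measurable_prod)
        fix i assume "i \<in> {..<Suc n}"
        then have "(\<lambda>\<omega>. ramp k (a (\<tau> (Suc i))) (Z (\<tau> (Suc i)) \<omega>)) \<in> borel_measurable P"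
          by (intro measurable_compose[OF Zm rm]) auto
        then show "(\<lambda>\<omega>. if \<tau> (Suc i) \<in> F then ramp k (a (\<tau> (Suc i))) (Z (\<tau> (Suc i)) \<omega>) else 1) \<in> borel_measurable P"
          by simp
      qed
      show "AE \<omega> in P. norm (?ramps k Z \<omega>) \<le> 1" for k
      proof (rule AE_I2)
        fix \<omega>
        have "0 \<le> ?ramps k Z \<omega>"
          "?ramps k Z \<omega> \<le> 1"
          by (intro prod_nonneg prod_le_1; simp add: ramp_range)+
        then show "norm (?ramps k Z \<omega>) \<le> 1" by simp
      qed
    qed (use ZE in auto)
    then show ?thesis using ZE by simp
  qed
  have "(LINT \<omega>|P. ?ramps k X \<omega>)
    = (LINT \<omega>|P. ?ramps k Y \<omega>)" for k
  proof (rule prods[of \<tau> n "\<lambda>i y. if \<tau> (Suc i) \<in> F then ramp k (a (\<tau> (Suc i))) y else 1"])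
    show "continuous_on UNIV (\<lambda>y. if \<tau> (Suc i) \<in> F then ramp k (a (\<tau> (Suc i))) y else 1)" for i
      using continuous_on_ramp by (cases "\<tau> (Suc i) \<in> F") simp_all
  qed (use inc \<tau>0 \<tau>n ramp_range in auto)
  then have pos_eq: "prob {\<omega> \<in> space P. \<forall>s\<in>F - {0}. X s \<omega> \<le> a s} = prob {\<omega> \<in> space P. \<forall>s\<in>F - {0}. Y s \<omega> \<le> a s}"
    using lim[of X, OF m(1)] lim[of Y, OF m(2)] LIMSEQ_unique by simp
  \<comment> \<open>At time \<open>0\<close> the condition is almost surely \<open>0 \<le> a 0\<close>, for both processes.\<close>
  have full: "prob {\<omega> \<in> space P. \<forall>s\<in>F. Z s \<omega> \<le> a s}
      = (if 0 \<in> F \<and> a 0 < 0 then 0 else prob {\<omega> \<in> space P. \<forall>s\<in>F - {0}. Z s \<omega> \<le> a s})"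
    if Z: "\<And>s. s \<in> {0..t} \<Longrightarrow> Z s \<in> borel_measurable P" "AE \<omega> in P. Z 0 \<omega> = 0" for Z :: "real \<Rightarrow> 'a \<Rightarrow> real"
  proof -
    have ZE: "{\<omega> \<in> space P. \<forall>s\<in>G. Z s \<omega> \<le> a s} \<in> sets P" if "G \<subseteq> F" for G
    proof (rule sets.sets_Collect_finite_All)
      fix s assume "s \<in> G"
      then have [measurable]: "Z s \<in> borel_measurable P" using Z(1) F(2) that by blast
      show "{\<omega> \<in> space P. Z s \<omega> \<le> a s} \<in> sets P" by measurable
    qed (use F(1) that finite_subset in auto)
    show ?thesis
    proof (cases "0 \<in> F \<and> a 0 < 0")
      case True
      have "prob {\<omega> \<in> space P. \<forall>s\<in>F. Z s \<omega> \<le> a s} = prob {}"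
        using Z(2) True ZE by (intro finite_measure_eq_AE) (auto elim!: eventually_mono intro!: bexI[of _ 0])
      then show ?thesis using True by simp
    next
      case False
      have "prob {\<omega> \<in> space P. \<forall>s\<in>F. Z s \<omega> \<le> a s} = prob {\<omega> \<in> space P. \<forall>s\<in>F - {0}. Z s \<omega> \<le> a s}"
      proof (rule finite_measure_eq_AE)
        show "AE \<omega> in P. (\<omega> \<in> {\<omega> \<in> space P. \<forall>s\<in>F. Z s \<omega> \<le> a s}) = (\<omega> \<in> {\<omega> \<in> space P. \<forall>s\<in>F - {0}. Z s \<omega> \<le> a s})"
          using Z(2)
        proof eventually_elim
          case (elim \<omega>)
          have "Z s \<omega> \<le> a s" if "s \<in> F" "s = 0" for s using that elim False by auto
          then show ?case by auto
        qed
      qed (use ZE in auto)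
      then show ?thesis using False by auto
    qed
  qed
  show ?thesis
    using pos_eq full[of X, OF m(1) zero(1)] full[of Y, OF m(2) zero(2)] by (simp add: emeasure_eq_measure)
qed

theorem corollary1p2:
  fixes t x :: real
    and P :: "'a measure" and Q :: "'b measure"
    and \<beta> B2 B3 :: "real \<Rightarrow> 'a \<Rightarrow> real"
    and M :: "real \<Rightarrow> 'b \<Rightarrow> real"
  assumes "t > 0"
    and "prob_space P" and "prob_space Q"
    and "brownian_bridge t x P \<beta>"
    and "standard_brownian_motion t P (\<lambda>s \<omega>. (B2 s \<omega>, B3 s \<omega>))"
    and "indep_processes t P \<beta> (\<lambda>s \<omega>. (B2 s \<omega>, B3 s \<omega>))"
    and "equal_in_law t Q M
           P (\<lambda>s \<omega>. sqrt ((\<beta> s \<omega>)\<^sup>2 + (B2 s \<omega>)\<^sup>2 + (B3 s \<omega>)\<^sup>2))"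
  shows "equal_in_law t
           P (\<lambda>s \<omega>. (pitman_P (\<lambda>u. \<beta> u \<omega>) s, \<beta> s \<omega>))
           Q (\<lambda>s \<omega>. (M s \<omega>, pitman_L t x (\<lambda>u. M u \<omega>) s))"
proof (rule equal_in_law_recovered)
  note t = assms(1) and P = assms(2) and bridge = assms(4) and B = assms(5) and indep = assms(6)
  interpret P: prob_space P by (rule P)
  let ?S = "path_space t :: (real \<Rightarrow> real) measure"
  let ?R = "\<lambda>s \<omega>. pitman_P (\<lambda>u. \<beta> u \<omega>) s"
  let ?V = "\<lambda>s \<omega>. sqrt ((\<beta> s \<omega>)\<^sup>2 + (B2 s \<omega>)\<^sup>2 + (B3 s \<omega>)\<^sup>2)"
  show "0 < t" by (rule t)
  show \<beta>: "continuous_process t P \<beta>" by (rule bridge_continuous_process[OF t P bridge])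
  show "AE \<omega> in P. \<beta> t \<omega> = x" by (rule bridge_endpoints(2)[OF t P bridge])
  show "sample_path t M \<in> measurable Q ?S" using assms(7) by (simp add: equal_in_law_def)
  have Vm: "sample_path t ?V \<in> measurable P ?S" and MV: "distr Q ?S (sample_path t M) = distr P ?S (sample_path t ?V)"
    using assms(7) by (auto simp: equal_in_law_def)
  have "continuous_process t P ?R"
    using \<beta> measurable_pitman_P[OF \<beta>] unfolding continuous_process_def by (auto intro!: continuous_on_pitman_P)
  then have Rm: "sample_path t ?R \<in> measurable P ?S" by (rule sample_path_measurable[OF t])
  have coord: "X s \<in> borel_measurable P" if "sample_path t X \<in> measurable P ?S" "s \<in> {0..t}" for X :: "real \<Rightarrow> 'a \<Rightarrow> real" and s
    using measurable_compose[OF that(1) path_evaluation_measurable[OF t that(2)]] that(2) by (simp add: sample_path_def)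
  have "distr P ?S (sample_path t ?R) = distr P ?S (sample_path t ?V)"
  proof (rule path_space_eqI[OF t])
    show "prob_space (distr P ?S (sample_path t ?R))" by (rule P.prob_space_distr[OF Rm])
    show "prob_space (distr P ?S (sample_path t ?V))" by (rule P.prob_space_distr[OF Vm])
    fix F a assume F: "finite F" "F \<subseteq> {0..t}"
    let ?E = "{f \<in> space ?S. \<forall>s\<in>F. f s \<le> a s}"
    have E: "?E \<in> sets ?S"
    proof (rule sets.sets_Collect_finite_All[OF _ F(1)])
      fix s assume "s \<in> F"
      then have [measurable]: "(\<lambda>f. f s) \<in> borel_measurable ?S" using F(2) by (intro path_evaluation_measurable[OF t]) auto
      show "{f \<in> space ?S. f s \<le> a s} \<in> sets ?S" by measurable
    qed
    have pre: "emeasure (distr P ?S (sample_path t X)) ?E = emeasure P {\<omega> \<in> space P. \<forall>s\<in>F. X s \<omega> \<le> a s}"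
      if X: "sample_path t X \<in> measurable P ?S" for X :: "real \<Rightarrow> 'a \<Rightarrow> real"
    proof -
      have "sample_path t X -` ?E \<inter> space P = {\<omega> \<in> space P. \<forall>s\<in>F. X s \<omega> \<le> a s}"
        using measurable_space[OF X] F(2) by (auto simp: sample_path_def subset_iff)
      then show ?thesis using X E by (simp add: emeasure_distr)
    qed
    have "emeasure P {\<omega> \<in> space P. \<forall>s\<in>F. ?R s \<omega> \<le> a s} = emeasure P {\<omega> \<in> space P. \<forall>s\<in>F. ?V s \<omega> \<le> a s}"
    proof (rule fdd_eq_of_products[OF t P _ _ _ _ _ F])
      show "?R s \<in> borel_measurable P" if "s \<in> {0..t}" for s by (rule coord[OF Rm that])
      show "?V s \<in> borel_measurable P" if "s \<in> {0..t}" for s by (rule coord[OF Vm that])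
      show "AE \<omega> in P. ?R 0 \<omega> = 0"
        using bridge_endpoints(1)[OF t P bridge] by eventually_elim (simp add: pitman_P_def)
      show "AE \<omega> in P. ?V 0 \<omega> = 0"
        using bridge_endpoints(1)[OF t P bridge] planar_facts(2)[OF t P bridge B indep]
        by eventually_elim (simp add: zero_prod_def)
    qed (rule pitman_theorem_bridge[OF t P bridge B indep])
    then show "emeasure (distr P ?S (sample_path t ?R)) ?E = emeasure (distr P ?S (sample_path t ?V)) ?E"
      by (simp only: pre[OF Rm] pre[OF Vm])
  qed simp_all
  then show "distr P ?S (sample_path t ?R) = distr Q ?S (sample_path t M)" by (simp only: MV)
qed

end
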